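(* Let $1\le m<n$ be integers, let $E,d>0$, let $\mathcal{E}\in\{\mathcal{E}_p^l,\mathcal{T}_p,\mathcal{T}_p^G\}$ (with $l\in\{1,\dots,m+2\}$ in the case $\mathcal{E}=\mathcal{E}_p^l$) and assume $p>p_0(\mathcal{E})$. Then there is a number $K=K(E,d,m,n,l,p)<\infty$ such that the class $\mathcal{A}^{\mathcal{E}}_{m,n}(E,d)$ contains at most $K$ different ambient isotopy types, i.e. there are $\Sigma^1,\dots,\Sigma^k\in\mathcal{A}^{\mathcal{E}}_{m,n}(E,d)$ with $k\le K$ such that every $\Sigma\in\mathcal{A}^{\mathcal{E}}_{m,n}(E,d)$ is ambient isotopic to some $\Sigma^i$.
   Context: $\mathscr{C}^{0,1}_{m,n}$ denotes the class of all compact, $m$-dimensional embedded Lipschitz submanifolds of $\mathbb{R}^n$; $\mathcal{H}^m$ is $m$-dimensional Hausdorff measure. For points $x_0,\dots,x_{m+1}\in\mathbb{R}^n$ let $\Delta(x_0,\dots,x_{m+1})$ be the $(m+1)$-simplex (convex hull) with these vertices, and define the discrete Menger curvature $\mathcal{K}(x_0,\dots,x_{m+1})=\mathcal{H}^{m+1}(\Delta(x_0,\dots,x_{m+1}))/\operatorname{diam}(\{x_0,\dots,x_{m+1}\})^{m+2}$. For $\Sigma\in\mathscr{C}^{0,1}_{m,n}$, $l\in\{1,\dots,m+2\}$, $p>0$: $\mathcal{E}_p^l(\Sigma)=\int_{\Sigma^l}\sup_{x_l,\dots,x_{m+1}\in\Sigma}\mathcal{K}(x_0,\dots,x_{m+1})^p\,d\mathcal{H}^{ml}(x_0,\dots,x_{l-1})$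 (no supremum when $l=m+2$; values on the diagonal are irrelevant). For $x,y\in\Sigma$, with $T_x\Sigma$ the tangent plane (defined for $\mathcal{H}^m$-a.e. $x$), let $R_{tp}(x,y)=|x-y|^2/(2\operatorname{dist}(y,x+T_x\Sigma))$, and set $\mathcal{T}_p(\Sigma)=\int_\Sigma\int_\Sigma R_{tp}(x,y)^{-p}\,d\mathcal{H}^m_x\,d\mathcal{H}^m_y$ and $\mathcal{T}_p^G(\Sigma)=\int_\Sigma\sup_{y\in\Sigma}R_{tp}(x,y)^{-p}\,d\mathcal{H}^m_x$. The scaling-invariant exponents are $p_0(\mathcal{E}_p^l)=ml$, $p_0(\mathcal{T}_p)=2m$, $p_0(\mathcal{T}_p^G)=m$. For $E,d>0$, $\mathcal{A}^{\mathcal{E}}_{m,n}(E,d)=\{\Sigma\in\mathscr{C}^{0,1}_{m,n}:\mathcal{E}(\Sigma)\le E,\ \operatorname{diam}\Sigma\le d\}$. Two embedded submanifolds $\Sigma_1,\Sigma_2\subset\mathbb{R}^n$ are ambient isotopic if there is a continuous $H:\mathbb{R}^n\times[0,1]\to\mathbb{R}^n$ such that each $H_t=H(\cdot,t)$ is an embedding, $H(x,1)=x$ for all $x$, and $H(\Sigma_2\times\{0\})=\Sigma_1$. *)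

theory Defs
  imports "HOL-Analysis.Analysis"
begin

text \<open>s-dimensional Hausdorff outer measure (normalised by the volume of the
  s-dimensional unit ball, so that it agrees with Lebesgue measure on s-planes).\<close>
definition hausdorff_outer :: "nat \<Rightarrow> 'a::euclidean_space set \<Rightarrow> ennreal" where
  "hausdorff_outer s A =
     (SUP \<delta>\<in>{0<..}. INF C\<in>{C :: nat \<Rightarrow> 'a set. A \<subseteq> (\<Union>i. C i) \<and>
                          (\<forall>i. bounded (C i) \<and> diameter (C i) \<le> \<delta>)}.
        (\<Sum>i. ennreal (unit_ball_vol (real s) * (diameter (C i) / 2) ^ s)))"

definition hausdorff_measure :: "nat \<Rightarrow> 'a::euclidean_space measure" where
  "hausdorff_measure s = measure_of UNIV (sets borel) (hausdorff_outer s)"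

definition lipschitz_submanifold :: "nat \<Rightarrow> 'a::euclidean_space set \<Rightarrow> bool" where
  "lipschitz_submanifold m \<Sigma> \<longleftrightarrow> compact \<Sigma> \<and>
     (\<forall>x\<in>\<Sigma>. \<exists>r>0. \<exists>P f L. subspace P \<and> dim P = m \<and> L-lipschitz_on P f \<and>
        (\<forall>u\<in>P. f u \<in> orthogonal_comp P) \<and>
        \<Sigma> \<inter> ball x r = {u + f u | u. u \<in> P} \<inter> ball x r)"

definition is_tangent_plane :: "nat \<Rightarrow> 'a::euclidean_space set \<Rightarrow> 'a \<Rightarrow> 'a set \<Rightarrow> bool" where
  "is_tangent_plane m \<Sigma> x T \<longleftrightarrow> subspace T \<and> dim T = m \<and>
     ((\<lambda>y. infdist y ((\<lambda>v. x + v) ` T) / norm (y - x)) \<longlongrightarrow> 0) (at x within \<Sigma>)"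

definition tangent_plane :: "nat \<Rightarrow> 'a::euclidean_space set \<Rightarrow> 'a \<Rightarrow> 'a set" where
  "tangent_plane m \<Sigma> x = (SOME T. is_tangent_plane m \<Sigma> x T)"

definition menger_K :: "nat \<Rightarrow> (nat \<Rightarrow> 'a::euclidean_space) \<Rightarrow> real" where
  "menger_K m x = enn2real (hausdorff_outer (m + 1) (convex hull (x ` {..m+1})))
                    / diameter (x ` {..m+1}) ^ (m + 2)"

definition inv_Rtp :: "nat \<Rightarrow> 'a::euclidean_space set \<Rightarrow> 'a \<Rightarrow> 'a \<Rightarrow> real" where
  "inv_Rtp m \<Sigma> x y = 2 * infdist y ((\<lambda>v. x + v) ` tangent_plane m \<Sigma> x) / (norm (x - y))\<^sup>2"

definition Hm_on :: "nat \<Rightarrow> 'a::euclidean_space set \<Rightarrow> 'a measure" where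
  "Hm_on m \<Sigma> = restrict_space (hausdorff_measure m) \<Sigma>"

definition menger_energy :: "nat \<Rightarrow> nat \<Rightarrow> real \<Rightarrow> 'a::euclidean_space set \<Rightarrow> ennreal" where
  "menger_energy m l p \<Sigma> =
     (\<integral>\<^sup>+ xs. (SUP y\<in>{y :: nat \<Rightarrow> 'a. \<forall>i\<in>{l..m+1}. y i \<in> \<Sigma>}.
                 ennreal (menger_K m (\<lambda>i. if i < l then xs i else y i) powr p))
        \<partial>(PiM {..<l} (\<lambda>_. Hm_on m \<Sigma>)))"

definition tp_energy :: "nat \<Rightarrow> real \<Rightarrow> 'a::euclidean_space set \<Rightarrow> ennreal" where
  "tp_energy m p \<Sigma> =
     (\<integral>\<^sup>+ y. (\<integral>\<^sup>+ x. ennreal (inv_Rtp m \<Sigma> x y powr p) \<partial>Hm_on m \<Sigma>) \<partial>Hm_on m \<Sigma>)"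

definition tpG_energy :: "nat \<Rightarrow> real \<Rightarrow> 'a::euclidean_space set \<Rightarrow> ennreal" where
  "tpG_energy m p \<Sigma> =
     (\<integral>\<^sup>+ x. (SUP y\<in>\<Sigma>. ennreal (inv_Rtp m \<Sigma> x y powr p)) \<partial>Hm_on m \<Sigma>)"

datatype energy_kind = Menger nat | TangentPoint | TangentPointG

definition energy :: "energy_kind \<Rightarrow> nat \<Rightarrow> real \<Rightarrow> 'a::euclidean_space set \<Rightarrow> ennreal" where
  "energy ek m p \<Sigma> = (case ek of
      Menger l \<Rightarrow> menger_energy m l p \<Sigma>
    | TangentPoint \<Rightarrow> tp_energy m p \<Sigma>
    | TangentPointG \<Rightarrow> tpG_energy m p \<Sigma>)"

definition valid_kind :: "nat \<Rightarrow> energy_kind \<Rightarrow> bool" where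
  "valid_kind m ek = (case ek of Menger l \<Rightarrow> 1 \<le> l \<and> l \<le> m + 2 | _ \<Rightarrow> True)"

text \<open>Scaling-invariant exponent p_0.\<close>
definition p0 :: "nat \<Rightarrow> energy_kind \<Rightarrow> real" where
  "p0 m ek = (case ek of Menger l \<Rightarrow> real (m * l) | TangentPoint \<Rightarrow> real (2 * m)
                | TangentPointG \<Rightarrow> real m)"

definition admissible_class ::
    "energy_kind \<Rightarrow> nat \<Rightarrow> real \<Rightarrow> real \<Rightarrow> real \<Rightarrow> 'a::euclidean_space set set" where
  "admissible_class ek m p E d =
     {\<Sigma>. lipschitz_submanifold m \<Sigma> \<and> energy ek m p \<Sigma> \<le> ennreal E \<and> diameter \<Sigma> \<le> d}"

definition ambient_isotopic :: "'a::euclidean_space set \<Rightarrow> 'a set \<Rightarrow> bool" where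
  "ambient_isotopic \<Sigma>1 \<Sigma>2 \<longleftrightarrow> (\<exists>H :: 'a \<Rightarrow> real \<Rightarrow> 'a.
      continuous_on (UNIV \<times> {0..1}) (\<lambda>(x, t). H x t) \<and>
      (\<forall>t\<in>{0..1}. \<exists>g. homeomorphism UNIV (range (\<lambda>x. H x t)) (\<lambda>x. H x t) g) \<and>
      (\<forall>x. H x 1 = x) \<and>
      (\<lambda>x. H x 0) ` \<Sigma>2 = \<Sigma>1)"

end

theory Submission
  imports Defs
begin

text \<open>
  Suppose \<open>S\<close> covers, around each of its points and over some \<open>m\<close>-plane, a disc of radius \<open>r\<close> with
  distortion at most \<open>L\<close>. Then \<open>\<H>\<^sup>m(S \<inter> B(y, s)) \<ge> c s\<^sup>m\<close> for \<open>s \<le> r\<close>, so by averaging the energy bound yields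
  points at which the integrand is small, and for a supercritical exponent this forces \<open>S \<inter> B(y, 20 s)\<close> to lie within
  \<open>C s\<^bsup>1 + k\<^esup>\<close> of an \<open>m\<close>-plane. Summing the tilts of these planes over dyadic scales, \<open>S \<inter> B(y, 10 r)\<close> is a Lipschitz
  graph with small constant, and it covers a disc of radius \<open>4 r\<close> with distortion \<open>2\<close>. A Lipschitz submanifold satisfies the
  hypothesis at some tiny scale, and each step improves the scale by the factor \<open>4\<close>, up to a scale \<open>a\<close> which depends on the
  energy bound only.

  Two sets that are such graphs at scale \<open>a\<close> and are sufficiently close in Hausdorff distance are ambient isotopic: one is
  pushed onto the other by \<open>id + V\<close> with \<open>V\<close> of Lipschitz constant at most \<open>1/2\<close>. After a translation all sets of
  diameter at most \<open>d\<close> lie in a fixed ball, and those meeting the same balls of a fine finite cover are close.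

  For the tangent-point energies the tangent planes must exist almost everywhere, which is Rademacher's theorem.
\<close>

section \<open>Orthogonal projections and almost orthonormal frames\<close>

text \<open>The class carries no uniform Lipschitz constant and no uniform patch size; both merely
  exist for each single set. Hence a step must return a distortion that does not depend on the one
  it started from: after one step at an uncontrolled scale, all constants depend on the energy bound
  alone. Covering of discs is carried along as an induction hypothesis, because flatness does not
  exclude holes, while the lower bound for the measure of small balls, and with it any use of the
  energy, rests on covering. A supercritical exponent enters only as k > 0, which makes the tilts
  over dyadic scales a convergent geometric series. The integrands contain suprema and chosen
  tangent planes that are not known to be measurable, so averaging is arranged to work for arbitrary
  functions; only the double tangent-point integral needs an exchange of integrals and hence
  measurability. For the isotopies \<epsilon> has to be fixed before the scale a is known. This is
  possible because the overlap number of a separated net does not depend on the scale; the total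
  number of net points influences only how close the two sets must be.\<close>

definition oproj :: "'a::euclidean_space set \<Rightarrow> 'a \<Rightarrow> 'a" where
  "oproj P x = (SOME p. p \<in> P \<and> (\<forall>v\<in>P. (x - p) \<bullet> v = 0))"

definition orej :: "'a::euclidean_space set \<Rightarrow> 'a \<Rightarrow> 'a" where
  "orej P x = x - oproj P x"

context
  fixes P :: "'a::euclidean_space set"
  assumes P: "subspace P"
begin

lemma oproj_ex: "\<exists>p. p \<in> P \<and> (\<forall>v\<in>P. (x - p) \<bullet> v = 0)"
proof -
  obtain y z where "y \<in> span P" "\<And>w. w \<in> span P \<Longrightarrow> orthogonal z w" "x = y + z"
    using orthogonal_subspace_decomp_exists by metis
  then show ?thesis
    using P span_base[of _ P] by (intro exI[of _ y]) (auto simp: orthogonal_def span_eq_iff[THEN iffD2])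
qed

lemma oproj_in [simp]: "oproj P x \<in> P"
  and orej_orth: "v \<in> P \<Longrightarrow> orej P x \<bullet> v = 0"
  using someI_ex[OF oproj_ex[of x]] unfolding oproj_def orej_def by auto

lemma oproj_unique:
  assumes "p \<in> P" "\<And>v. v \<in> P \<Longrightarrow> (x - p) \<bullet> v = 0"
  shows "oproj P x = p"
proof -
  have d: "oproj P x - p \<in> P" using assms P by (simp add: subspace_diff)
  have "(oproj P x - p) \<bullet> (oproj P x - p) = (x - p) \<bullet> (oproj P x - p) - orej P x \<bullet> (oproj P x - p)"
    by (simp add: orej_def inner_diff_left)
  also have "\<dots> = 0" using assms(2)[OF d] orej_orth[OF d] by simp
  finally show ?thesis by simp
qed

lemma oproj_id: "v \<in> P \<Longrightarrow> oproj P v = v"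
  by (rule oproj_unique) auto

lemma oproj_inner: "v \<in> P \<Longrightarrow> oproj P x \<bullet> v = x \<bullet> v"
  using orej_orth[of v x] by (simp add: orej_def inner_diff_left)

lemma linear_oproj: "linear (oproj P)"
proof (rule linearI)
  show "oproj P (x + y) = oproj P x + oproj P y" for x y
    using P by (intro oproj_unique) (auto simp: subspace_add inner_diff_left inner_add_left oproj_inner)
  show "oproj P (c *\<^sub>R x) = c *\<^sub>R oproj P x" for c x
    using P by (intro oproj_unique) (auto simp: subspace_scale inner_diff_left oproj_inner)
qed

lemma linear_orej: "linear (orej P)"
  unfolding orej_def using linear_oproj by (intro linear_compose_sub) (auto simp: linear_iff)

lemmas oproj_add = linear_add[OF linear_oproj]
lemmas oproj_diff = linear_diff[OF linear_oproj]
lemmas oproj_scale = linear_scale[OF linear_oproj]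
lemmas oproj_0 = linear_0[OF linear_oproj]
lemmas orej_add = linear_add[OF linear_orej]
lemmas orej_diff = linear_diff[OF linear_orej]
lemmas orej_scale = linear_scale[OF linear_orej]
lemmas orej_sum = linear_sum[OF linear_orej]
lemmas orej_0 = linear_0[OF linear_orej]

lemma norm_sq_oproj: "(norm x)\<^sup>2 = (norm (oproj P x))\<^sup>2 + (norm (orej P x))\<^sup>2"
proof -
  have "orej P x \<bullet> oproj P x = 0" by (simp add: orej_orth)
  moreover have "x = oproj P x + orej P x" by (simp add: orej_def)
  ultimately show ?thesis
    using norm_add_Pythagorean[of "orej P x" "oproj P x"] by (simp add: orthogonal_def add.commute)
qed

lemma norm_oproj_le: "norm (oproj P x) \<le> norm x"
proof (rule power2_le_imp_le)
  show "(norm (oproj P x))\<^sup>2 \<le> (norm x)\<^sup>2"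
    using norm_sq_oproj[of x] zero_le_power2[of "norm (orej P x)"] by linarith
qed simp

lemma norm_orej_le: "norm (orej P x) \<le> norm x"
proof (rule power2_le_imp_le)
  show "(norm (orej P x))\<^sup>2 \<le> (norm x)\<^sup>2"
    using norm_sq_oproj[of x] zero_le_power2[of "norm (oproj P x)"] by linarith
qed simp

lemma norm_le_oproj_orej: "norm x \<le> norm (oproj P x) + norm (orej P x)"
  using norm_triangle_ineq[of "oproj P x" "orej P x"] by (simp add: orej_def)

lemma orej_eq_0: "v \<in> P \<Longrightarrow> orej P v = 0"
  by (simp add: orej_def oproj_id)

lemma oproj_orej: "oproj P (orej P x) = 0"
  using oproj_id[of "oproj P x"] by (simp add: orej_def oproj_diff)

lemma norm_orej_le_dist: "v \<in> P \<Longrightarrow> norm (orej P x) \<le> norm (x - v)"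
  using norm_orej_le[of "x - v"] by (simp add: orej_diff orej_eq_0)

lemma infdist_eq_orej: "infdist x P = norm (orej P x)"
proof (rule antisym)
  show "infdist x P \<le> norm (orej P x)"
    using infdist_le[OF oproj_in] by (simp add: dist_norm orej_def)
  have "P \<noteq> {}" using P subspace_0 by blast
  then show "norm (orej P x) \<le> infdist x P"
    by (auto simp: infdist_def dist_norm intro!: cINF_greatest norm_orej_le_dist)
qed

text \<open>Connects the distances to affine planes in \<open>is_tangent_plane\<close> and
  \<open>inv_Rtp\<close> with \<open>orej\<close>, in which all later estimates are written.\<close>

lemma infdist_translate_eq_orej: "infdist y ((\<lambda>v. x + v) ` P) = norm (orej P (y - x))"
proof -
  have "P \<noteq> {}" using P subspace_0 by blast
  then have "infdist y ((\<lambda>v. x + v) ` P) = infdist (y - x) P"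
    by (simp add: infdist_def image_image dist_norm algebra_simps)
  then show ?thesis by (simp add: infdist_eq_orej)
qed

end

lemma continuous_on_oproj: "subspace P \<Longrightarrow> continuous_on A (oproj P)"
  by (simp add: linear_continuous_on linear_conv_bounded_linear[symmetric] linear_oproj)

section \<open>Orthonormal sets and nearly orthogonal frames\<close>

definition orthonormal :: "'a::euclidean_space set \<Rightarrow> bool" where
  "orthonormal B \<longleftrightarrow> finite B \<and> (\<forall>e\<in>B. \<forall>e'\<in>B. e \<bullet> e' = (if e = e' then 1 else 0))"

lemma orthonormal_basis_exists:
  assumes "subspace P" "dim P = m"
  obtains B where "orthonormal B" "B \<subseteq> P" "card B = m" "span B = P"
proof -
  obtain B where B: "B \<subseteq> P" "pairwise orthogonal B" "\<And>x. x \<in> B \<Longrightarrow> norm x = 1"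
    "independent B" "card B = dim P" "span B = P"
    using orthonormal_basis_subspace[OF assms(1)] by metis
  have "orthonormal B"
    using B independent_imp_finite[OF B(4)]
    by (auto simp: orthonormal_def pairwise_def orthogonal_def norm_eq_1)
  with B assms that show thesis by metis
qed

text \<open>Diagonal dominance: in the row of a coefficient of largest modulus M the diagonal
  contributes \<sigma> M, and all deviations together at most m \<eta> \<sigma> M, which is no more
  than \<sigma> M / 2.\<close>

lemma frame_coeff_bound:
  fixes p :: "'a::euclidean_space \<Rightarrow> 'a"
  assumes B: "finite B" "card B = m" and \<sigma>: "0 < \<sigma>" and \<eta>: "2 * real m * \<eta> \<le> 1"
    and p: "\<And>e e'. e \<in> B \<Longrightarrow> e' \<in> B \<Longrightarrow> \<bar>p e' \<bullet> e - (if e = e' then \<sigma> else 0)\<bar> \<le> \<eta> * \<sigma>"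
    and C: "\<And>e. e \<in> B \<Longrightarrow> \<bar>(\<Sum>e'\<in>B. l e' *\<^sub>R p e') \<bullet> e\<bar> \<le> C" and e: "e \<in> B"
  shows "\<bar>l e\<bar> \<le> 2 * C / \<sigma>"
proof -
  define M where "M = Max ((\<lambda>e. \<bar>l e\<bar>) ` B)"
  have "M \<in> (\<lambda>e. \<bar>l e\<bar>) ` B" unfolding M_def using B e by (intro Max_in) auto
  then obtain e0 where e0: "e0 \<in> B" "M = \<bar>l e0\<bar>" by auto
  have M: "\<bar>l e'\<bar> \<le> M" if "e' \<in> B" for e' using B that by (auto simp: M_def)
  have eq: "(\<Sum>e'\<in>B. l e' *\<^sub>R p e') \<bullet> e0 = \<sigma> * l e0 + (\<Sum>e'\<in>B. l e' * (p e' \<bullet> e0 - (if e0 = e' then \<sigma> else 0)))"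
  proof -
    have "(\<Sum>e'\<in>B. l e' * (if e0 = e' then \<sigma> else 0)) = (\<Sum>e'\<in>B. if e0 = e' then l e' * \<sigma> else 0)"
      by (rule sum.cong) auto
    also have "\<dots> = l e0 * \<sigma>" using e0 B by (simp only: sum.delta') simp
    finally show ?thesis
      by (simp only: inner_sum_left right_diff_distrib sum_subtractf inner_scaleR_left) simp
  qed
  have "\<bar>\<Sum>e'\<in>B. l e' * (p e' \<bullet> e0 - (if e0 = e' then \<sigma> else 0))\<bar> \<le> (\<Sum>e'\<in>B. M * (\<eta> * \<sigma>))"
    by (rule order_trans[OF sum_abs], rule sum_mono, unfold abs_mult, rule mult_mono) (use M p e0 in auto)
  also have "\<dots> = real m * \<eta> * \<sigma> * M" using B by simp
  also have "\<dots> \<le> \<sigma> * M / 2"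
  proof -
    have "(2 * real m * \<eta>) * (\<sigma> * M) \<le> 1 * (\<sigma> * M)"
      by (rule mult_right_mono[OF \<eta>]) (use \<sigma> e0 in auto)
    then show ?thesis by (simp add: algebra_simps)
  qed
  finally have 1: "\<bar>\<Sum>e'\<in>B. l e' * (p e' \<bullet> e0 - (if e0 = e' then \<sigma> else 0))\<bar> \<le> \<sigma> * M / 2" .
  have 2: "\<bar>\<sigma> * l e0\<bar> = \<sigma> * M" using \<sigma> e0(2) by (simp add: abs_mult)
  have "\<sigma> * M - \<sigma> * M / 2 \<le> C" using C[OF e0(1)] unfolding eq using 1 2 by linarith
  then have "M \<le> 2 * C / \<sigma>" using \<sigma> by (simp add: field_simps)
  then show ?thesis using M[OF e] by linarith
qed

text \<open>With C = 0 the coefficient bound leaves only the trivial combination; this excludes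
  coinciding vectors too, so that the image of B has m elements.\<close>

lemma frame_independent:
  fixes p :: "'a::euclidean_space \<Rightarrow> 'a"
  assumes B: "finite B" "card B = m" and \<sigma>: "0 < \<sigma>" and \<eta>: "2 * real m * \<eta> \<le> 1"
    and p: "\<And>e e'. e \<in> B \<Longrightarrow> e' \<in> B \<Longrightarrow> \<bar>p e' \<bullet> e - (if e = e' then \<sigma> else 0)\<bar> \<le> \<eta> * \<sigma>"
  shows "inj_on p B" "independent (p ` B)"
proof -
  have z: "l e = 0" if "(\<Sum>e'\<in>B. l e' *\<^sub>R p e') = 0" "e \<in> B" for l e
    using frame_coeff_bound[OF B \<sigma> \<eta> p, of l 0 e] that by simp
  show inj: "inj_on p B"
  proof (rule inj_onI, rule ccontr)
    fix a b assume ab: "a \<in> B" "b \<in> B" "p a = p b" "a \<noteq> b"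
    define l where "l e = (if e = a then 1 else if e = b then -1 else (0::real))" for e
    have "(\<Sum>e'\<in>B. l e' *\<^sub>R p e') = (\<Sum>e'\<in>{a,b}. l e' *\<^sub>R p e')"
      using ab B by (intro sum.mono_neutral_right) (auto simp: l_def)
    also have "\<dots> = 0" using ab by (simp add: l_def)
    finally show False using z[of l a] ab by (simp add: l_def)
  qed
  show "independent (p ` B)"
  proof
    assume "dependent (p ` B)"
    then obtain u v where u: "v \<in> p ` B" "u v \<noteq> 0" "(\<Sum>v\<in>p ` B. u v *\<^sub>R v) = 0"
      using dependent_finite[of "p ` B"] B by auto
    then have "(\<Sum>e\<in>B. u (p e) *\<^sub>R p e) = 0" by (simp add: sum.reindex[OF inj])
    then show False using z[of "\<lambda>e. u (p e)"] u by auto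
  qed
qed

lemma frame_coeffs:
  fixes p :: "'a::euclidean_space \<Rightarrow> 'a"
  assumes P: "subspace P" "dim P = m"
    and B: "finite B" "card B = m" and \<sigma>: "0 < \<sigma>" and \<eta>: "2 * real m * \<eta> \<le> 1"
    and p: "\<And>e e'. e \<in> B \<Longrightarrow> e' \<in> B \<Longrightarrow> \<bar>p e' \<bullet> e - (if e = e' then \<sigma> else 0)\<bar> \<le> \<eta> * \<sigma>"
    and pP: "\<And>e. e \<in> B \<Longrightarrow> p e \<in> P" and v: "v \<in> P" and C: "\<And>e. e \<in> B \<Longrightarrow> \<bar>v \<bullet> e\<bar> \<le> C"
  obtains l where "v = (\<Sum>e\<in>B. l e *\<^sub>R p e)" "\<And>e. e \<in> B \<Longrightarrow> \<bar>l e\<bar> \<le> 2 * C / \<sigma>"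
proof -
  have inj: "inj_on p B" and ind: "independent (p ` B)" using frame_independent[OF B \<sigma> \<eta> p] by auto
  have "card (p ` B) = m" using inj B by (simp add: card_image)
  then have "P \<subseteq> span (p ` B)" using card_ge_dim_independent[of "p ` B" P] ind pP P by auto
  then have "v \<in> span (p ` B)" using v by auto
  then obtain u where "v = (\<Sum>w\<in>p ` B. u w *\<^sub>R w)"
    using span_finite[of "p ` B"] B by auto
  then have l: "v = (\<Sum>e\<in>B. u (p e) *\<^sub>R p e)" by (simp add: sum.reindex[OF inj])
  show thesis
    by (rule that[OF l], rule frame_coeff_bound[OF B \<sigma> \<eta> p]) (use C l in auto)
qed

text \<open>Projecting the points \<open>w e\<close> to P changes their coordinates by at most h, so
  they still form a frame. The coefficients are bounded by \<open>oproj P0 v\<close> instead of v,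
  hence a vector of P with small projection to P0 is itself small.\<close>

lemma plane_frame:
  fixes w :: "'a::euclidean_space \<Rightarrow> 'a"
  assumes P: "subspace P" "dim P = m" and P0: "subspace P0"
    and B: "orthonormal B" "card B = m" "B \<subseteq> P0" and \<sigma>: "0 < \<sigma>" and h: "2 * real m * h \<le> \<sigma>"
    and w: "\<And>e. e \<in> B \<Longrightarrow> oproj P0 (w e) = \<sigma> *\<^sub>R e"
    and wP: "\<And>e. e \<in> B \<Longrightarrow> norm (orej P (w e)) \<le> h" and v: "v \<in> P"
  obtains l where "v = (\<Sum>e\<in>B. l e *\<^sub>R oproj P (w e))"
    "\<And>e. e \<in> B \<Longrightarrow> \<bar>l e\<bar> \<le> 2 * norm (oproj P0 v) / \<sigma>"
proof (rule frame_coeffs[of P m B \<sigma> "h / \<sigma>" "\<lambda>e. oproj P (w e)" v "norm (oproj P0 v)"])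
  have n1: "norm e = 1" if "e \<in> B" for e using B that by (auto simp: orthonormal_def norm_eq_1)
  show "2 * real m * (h / \<sigma>) \<le> 1" using h \<sigma> by (simp add: field_simps)
  show "\<bar>oproj P (w e') \<bullet> e - (if e = e' then \<sigma> else 0)\<bar> \<le> h / \<sigma> * \<sigma>" if e: "e \<in> B" "e' \<in> B" for e e'
  proof -
    have "w e' \<bullet> e = oproj P0 (w e') \<bullet> e" using B e P0 by (subst oproj_inner) auto
    also have "\<dots> = (if e = e' then \<sigma> else 0)" using B e w[of e'] by (auto simp: orthonormal_def)
    finally have "oproj P (w e') \<bullet> e - (if e = e' then \<sigma> else 0) = - (orej P (w e') \<bullet> e)"
      by (simp add: orej_def inner_diff_left)
    moreover have "\<bar>orej P (w e') \<bullet> e\<bar> \<le> norm (orej P (w e')) * norm e" by (rule Cauchy_Schwarz_ineq2)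
    ultimately show ?thesis using wP[OF e(2)] n1[OF e(1)] \<sigma> by simp
  qed
  show "\<bar>v \<bullet> e\<bar> \<le> norm (oproj P0 v)" if e: "e \<in> B" for e
  proof -
    have "v \<bullet> e = oproj P0 v \<bullet> e" using B e P0 by (subst oproj_inner) auto
    then show ?thesis using Cauchy_Schwarz_ineq2[of "oproj P0 v" e] n1[OF e] by simp
  qed
qed (use assms that in \<open>auto simp: orthonormal_def\<close>)

text \<open>P and P' both nearly contain the points \<open>w e\<close>. Each of the m frame vectors
  of P therefore deviates from P' by at most h + h', and the coefficients of v are at most 2 |v| /
  \<sigma>.\<close>

lemma plane_angle:
  fixes w :: "'a::euclidean_space \<Rightarrow> 'a"
  assumes P: "subspace P" "dim P = m" and P0: "subspace P0"
    and B: "orthonormal B" "card B = m" "B \<subseteq> P0" and \<sigma>: "0 < \<sigma>" and h: "2 * real m * h \<le> \<sigma>"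
    and w: "\<And>e. e \<in> B \<Longrightarrow> oproj P0 (w e) = \<sigma> *\<^sub>R e"
    and wP: "\<And>e. e \<in> B \<Longrightarrow> norm (orej P (w e)) \<le> h"
    and P': "subspace P'" and wP': "\<And>e. e \<in> B \<Longrightarrow> norm (orej P' (w e)) \<le> h'" and v: "v \<in> P"
  shows "norm (orej P' v) \<le> 2 * real m * (h + h') / \<sigma> * norm v"
proof -
  obtain l where l: "v = (\<Sum>e\<in>B. l e *\<^sub>R oproj P (w e))"
    "\<And>e. e \<in> B \<Longrightarrow> \<bar>l e\<bar> \<le> 2 * norm (oproj P0 v) / \<sigma>"
    using plane_frame[OF P P0 B \<sigma> h w wP v] by blast
  have "norm (orej P' v) = norm (\<Sum>e\<in>B. l e *\<^sub>R orej P' (oproj P (w e)))"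
    by (subst l(1)) (simp add: orej_sum orej_scale P')
  also have "\<dots> \<le> (\<Sum>e\<in>B. 2 * norm v / \<sigma> * (h + h'))"
  proof (rule sum_norm_le)
    fix e assume e: "e \<in> B"
    have "orej P' (oproj P (w e)) = orej P' (w e) - orej P' (orej P (w e))"
      by (simp add: orej_diff[OF P', symmetric] orej_def[of P])
    then have "norm (orej P' (oproj P (w e))) \<le> h + h'"
      using norm_triangle_ineq4[of "orej P' (w e)" "orej P' (orej P (w e))"]
        norm_orej_le[OF P', of "orej P (w e)"] wP[OF e] wP'[OF e] by simp
    moreover have "\<bar>l e\<bar> \<le> 2 * norm v / \<sigma>"
    proof -
      have "2 * norm (oproj P0 v) / \<sigma> \<le> 2 * norm v / \<sigma>"
        using \<sigma> norm_oproj_le[OF P0, of v] by (simp add: divide_right_mono)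
      then show ?thesis using l(2)[OF e] by linarith
    qed
    ultimately show "norm (l e *\<^sub>R orej P' (oproj P (w e))) \<le> 2 * norm v / \<sigma> * (h + h')"
      unfolding norm_scaleR using \<sigma> by (intro mult_mono) auto
  qed
  also have "\<dots> = 2 * real m * (h + h') / \<sigma> * norm v"
    using B by (simp add: field_simps)
  finally show ?thesis .
qed

section \<open>Decay of flatness implies small Lipschitz graphs\<close>

text \<open>\<open>mflat\<close> bounds the Jones beta numbers of \<open>S\<close> by a multiple of \<open>s\<^sup>k\<close>; the factor \<open>20\<close> is
  there because two points of a ball of radius \<open>10 r\<close> have distance at most \<open>20 r\<close>.\<close>

definition mgood :: "nat \<Rightarrow> real \<Rightarrow> real \<Rightarrow> 'a::euclidean_space set \<Rightarrow> bool" where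
  "mgood m L r S \<longleftrightarrow> (\<forall>y\<in>S. \<exists>P. subspace P \<and> dim P = m \<and>
     (\<forall>u\<in>P. norm u \<le> r \<longrightarrow> (\<exists>z\<in>S. oproj P (z - y) = u \<and> norm (z - y) \<le> L * norm u)))"

definition mflat :: "nat \<Rightarrow> real \<Rightarrow> real \<Rightarrow> real \<Rightarrow> 'a::euclidean_space set \<Rightarrow> bool" where
  "mflat m C k r S \<longleftrightarrow> (\<forall>y\<in>S. \<forall>s. 0 < s \<and> s \<le> r \<longrightarrow> (\<exists>P. subspace P \<and> dim P = m \<and>
     (\<forall>z\<in>S. norm (z - y) \<le> 20 * s \<longrightarrow> norm (orej P (z - y)) \<le> C * s powr (1 + k))))"

lemma mgood_mono: "mgood m L r S \<Longrightarrow> r' \<le> r \<Longrightarrow> mgood m L r' S"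
  unfolding mgood_def by (meson order_trans)

text \<open>A basis vector of length s / L is covered by a point at distance at most s, so frames
  over one and the same plane exist at every scale up to r.\<close>

lemma mgood_frame:
  assumes good: "mgood m L r S" and L: "1 \<le> L" and y: "y \<in> S"
  obtains P0 B w where "subspace P0" "orthonormal B" "card B = m" "B \<subseteq> P0"
    "\<And>s e. 0 < s \<Longrightarrow> s \<le> r \<Longrightarrow> e \<in> B \<Longrightarrow> y + w s e \<in> S"
    "\<And>s e. 0 < s \<Longrightarrow> s \<le> r \<Longrightarrow> e \<in> B \<Longrightarrow> oproj P0 (w s e) = (s / L) *\<^sub>R e"
    "\<And>s e. 0 < s \<Longrightarrow> s \<le> r \<Longrightarrow> e \<in> B \<Longrightarrow> norm (w s e) \<le> s"
    "\<And>u. u \<in> P0 \<Longrightarrow> norm u \<le> r \<Longrightarrow> \<exists>z\<in>S. oproj P0 (z - y) = u \<and> norm (z - y) \<le> L * norm u"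
proof -
  obtain P0 where P0: "subspace P0" "dim P0 = m"
    and g: "\<And>u. u \<in> P0 \<Longrightarrow> norm u \<le> r \<Longrightarrow> \<exists>z\<in>S. oproj P0 (z - y) = u \<and> norm (z - y) \<le> L * norm u"
    using good y unfolding mgood_def by blast
  obtain B where B: "orthonormal B" "B \<subseteq> P0" "card B = m" "span B = P0"
    using orthonormal_basis_exists[OF P0] .
  have "\<exists>w. y + w \<in> S \<and> oproj P0 w = (s / L) *\<^sub>R e \<and> norm w \<le> s" if "0 < s" "s \<le> r" "e \<in> B" for s e
  proof -
    have n: "norm e = 1" using B that by (auto simp: orthonormal_def norm_eq_1)
    have "s / L \<le> s / 1" using that L by (intro divide_left_mono) auto
    then have "norm ((s / L) *\<^sub>R e) \<le> r" using that L n by simp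
    moreover have "(s / L) *\<^sub>R e \<in> P0" using that B P0 by (auto intro: subspace_scale)
    ultimately obtain z where "z \<in> S" "oproj P0 (z - y) = (s / L) *\<^sub>R e" "norm (z - y) \<le> L * norm ((s / L) *\<^sub>R e)"
      using g by blast
    then show ?thesis using that L n by (intro exI[of _ "z - y"]) auto
  qed
  then obtain w where w: "\<And>s e. 0 < s \<and> s \<le> r \<and> e \<in> B \<Longrightarrow> y + w s e \<in> S \<and> oproj P0 (w s e) = (s / L) *\<^sub>R e \<and> norm (w s e) \<le> s"
    by metis
  show thesis by (rule that[OF P0(1) B(1,3,2), of w]) (use w g in auto)
qed

text \<open>The conclusion is \<open>mgood m 2 (4 * r) S\<close> together with flatness, where the constant \<open>2\<close> does not depend on \<open>L\<close>;
  therefore the step can be iterated. Coverage of a disc is obtained by minimising the distance of the projection of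
  \<open>S\<close> to a given point of the plane: if the minimum were positive, the coverage
  at scale \<open>r\<close> around the minimiser would yield a better point.\<close>

lemma graph_step:
  fixes S :: "'a::euclidean_space set"
  assumes S: "compact S" and L: "1 \<le> L" and k: "0 < k" and C: "0 \<le> C" and r: "0 < r"
    and good: "mgood m L r S" and flat: "mflat m C k r S"
    and eps: "(1 + 6 * m * L + 6 * m * L / (1 - 2 powr (-k))) * (C * r powr k) \<le> \<epsilon>"
      "\<epsilon> \<le> 1/10" "2 * m * L\<^sup>2 * \<epsilon> < 1" and x: "x \<in> S"
  obtains P where "subspace P" "dim P = m"
    "\<And>y z. y \<in> S \<Longrightarrow> z \<in> S \<Longrightarrow> norm (y - x) \<le> 10 * r \<Longrightarrow> norm (z - x) \<le> 10 * r \<Longrightarrow>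
       norm (orej P (z - y)) \<le> \<epsilon> * norm (z - y)"
    "\<And>u. u \<in> P \<Longrightarrow> norm u \<le> 4 * r \<Longrightarrow> \<exists>z\<in>S. oproj P (z - x) = u \<and> norm (z - x) \<le> 2 * norm u"
proof -
  define q where "q = 2 powr (-k)"
  have q: "0 < q" "q < 1" using k by (auto simp: q_def powr_less_one)
  \<comment> \<open>The flatness at scale s relative to s; along dyadic scales it decays
    geometrically with ratio q.\<close>
  define \<theta> where "\<theta> s = C * s powr k" for s
  have \<theta>0: "0 \<le> \<theta> s" for s using C by (simp add: \<theta>_def)
  have \<theta>m: "\<theta> s \<le> \<theta> t" if "0 < s" "s \<le> t" for s t
    unfolding \<theta>_def using that k C by (intro mult_left_mono powr_mono2) auto
  have A: "\<theta> r + 6 * m * L * \<theta> r + 6 * m * L * \<theta> r / (1 - q) \<le> \<epsilon>"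
    using eps(1) by (simp add: \<theta>_def q_def algebra_simps)
  have t1: "0 \<le> 6 * m * L * \<theta> r" "0 \<le> 6 * m * L * \<theta> r / (1 - q)"
    using L q \<theta>0[of r] by auto
  have \<theta>\<epsilon>: "\<theta> r \<le> \<epsilon>" and \<epsilon>0: "0 \<le> \<epsilon>" using A t1 \<theta>0[of r] by linarith+
  have mL: "2 * m * L * \<epsilon> \<le> 1"
  proof -
    have "2 * m * \<epsilon> * L \<le> 2 * m * \<epsilon> * L\<^sup>2" using L \<epsilon>0 by (intro mult_left_mono) (auto simp: power2_eq_square)
    then show ?thesis using eps(3) by (simp add: algebra_simps)
  qed
  have mL\<theta>: "2 * m * L * \<theta> s \<le> 1" if "0 < s" "s \<le> r" for s
  proof -
    have "2 * m * L * \<theta> s \<le> 2 * m * L * \<epsilon>" using \<theta>m[OF that] \<theta>\<epsilon> L by (intro mult_left_mono) auto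
    then show ?thesis using mL by linarith
  qed
  have "\<exists>P. subspace P \<and> dim P = m \<and>
     (\<forall>z\<in>S. norm (z - y) \<le> 20 * s \<longrightarrow> norm (orej P (z - y)) \<le> \<theta> s * s)" if "y \<in> S" "0 < s" "s \<le> r" for y s
  proof -
    have "C * s powr (1 + k) = \<theta> s * s" using that by (simp add: \<theta>_def powr_add mult_ac)
    then show ?thesis using flat that unfolding mflat_def by metis
  qed
  then obtain Pl where Pl: "\<And>y s. y \<in> S \<and> 0 < s \<and> s \<le> r \<Longrightarrow> subspace (Pl y s) \<and> dim (Pl y s) = m \<and>
     (\<forall>z\<in>S. norm (z - y) \<le> 20 * s \<longrightarrow> norm (orej (Pl y s) (z - y)) \<le> \<theta> s * s)" by metis
  \<comment> \<open>A plane that nearly contains S near y makes a small angle with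
    \<open>Pl y s\<close>, because the frame from \<open>mgood_frame\<close> consists of points of S
    and so tests both planes.\<close>
  have ang: "norm (orej P' v) \<le> 2 * m * L * (\<theta> s + h') * norm v"
    if yS: "y \<in> S" and s0: "0 < s" and sr: "s \<le> r" and P': "subspace P'" and v: "v \<in> Pl y s"
      and P'S: "\<And>z. z \<in> S \<Longrightarrow> norm (z - y) \<le> s \<Longrightarrow> norm (orej P' (z - y)) \<le> h' * s" for y s P' v h'
  proof -
    obtain P0 B w where F: "subspace P0" "orthonormal B" "card B = m" "B \<subseteq> P0"
      "\<And>e. e \<in> B \<Longrightarrow> y + w e \<in> S" "\<And>e. e \<in> B \<Longrightarrow> oproj P0 (w e) = (s / L) *\<^sub>R e"
      "\<And>e. e \<in> B \<Longrightarrow> norm (w e) \<le> s"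
      using mgood_frame[OF good L yS] s0 sr by metis
    note p = Pl[of y s]
    have "norm (orej P' v) \<le> 2 * real m * (\<theta> s * s + h' * s) / (s / L) * norm v"
    proof (rule plane_angle[of "Pl y s" m P0 B "s / L" "\<theta> s * s" w P' "h' * s" v])
      show "2 * real m * (\<theta> s * s) \<le> s / L"
      proof -
        have "2 * m * L * \<theta> s * s \<le> 1 * s" using mL\<theta> s0 sr by (intro mult_right_mono) auto
        then show ?thesis using L by (simp add: field_simps)
      qed
      show "norm (orej (Pl y s) (w e)) \<le> \<theta> s * s" if "e \<in> B" for e
      proof -
        have "norm (y + w e - y) \<le> 20 * s" using F(7)[OF that] s0 by simp
        then show ?thesis using p F(5)[OF that] yS s0 sr by (metis add_diff_cancel_left')
      qed
      show "norm (orej P' (w e)) \<le> h' * s" if "e \<in> B" for e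
        using P'S[of "y + w e"] F(5,7)[OF that] by simp
    qed (use F p yS s0 sr v P' L in auto)
    also have "2 * real m * (\<theta> s * s + h' * s) / (s / L) = 2 * m * L * (\<theta> s + h')"
      using s0 L by (simp add: field_simps)
    finally show ?thesis .
  qed

  \<comment> \<open>Tilt of the approximating planes over dyadic scales\<close>
  define s where "s j = r / 2 ^ j" for j :: nat
  have s: "0 < s j" "s j \<le> r" "s (Suc j) = s j / 2" "s (Suc j) \<le> s j" for j
    using r by (auto simp: s_def field_simps)
  have sz: "s 0 = r" by (simp add: s_def)
  have \<theta>s: "\<theta> (s j) = \<theta> r * q ^ j" for j
  proof -
    have "(2 ^ j) powr k = (2 powr k) ^ j" by (induction j) (simp_all add: powr_mult)
    then show ?thesis
      using r by (simp add: \<theta>_def s_def q_def powr_divide powr_minus_divide power_divide)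
  qed
  \<comment> \<open>Relative to the finer scale \<open>s (Suc j)\<close> the error of the coarser
    plane doubles; together with the error of the finer plane it is at most
    \<open>3 * \<theta> (s j)\<close>, whence the constant 6 m L.\<close>
  have step: "norm (orej (Pl y (s j)) v) \<le> 6 * m * L * \<theta> r * q ^ j * norm v"
    if y: "y \<in> S" and v: "v \<in> Pl y (s (Suc j))" for y j v
  proof -
    have "norm (orej (Pl y (s j)) v) \<le> 2 * m * L * (\<theta> (s (Suc j)) + 2 * \<theta> (s j)) * norm v"
    proof (rule ang[OF y s(1) s(2) _ v])
      fix z assume z: "z \<in> S" "norm (z - y) \<le> s (Suc j)"
      then have "norm (z - y) \<le> 20 * s j" using s[of j] by linarith
      then have "norm (orej (Pl y (s j)) (z - y)) \<le> \<theta> (s j) * s j"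
        using Pl[of y "s j"] y s(1,2)[of j] z by blast
      also have "\<dots> = 2 * \<theta> (s j) * s (Suc j)" unfolding s(3) by simp
      finally show "norm (orej (Pl y (s j)) (z - y)) \<le> 2 * \<theta> (s j) * s (Suc j)" .
    qed (use Pl[of y "s j"] y s[of j] in auto)
    also have "\<dots> \<le> 2 * m * L * (3 * \<theta> (s j)) * norm v"
      using \<theta>m[OF s(1) s(4), of j] L by (intro mult_right_mono mult_left_mono) auto
    finally show ?thesis by (simp add: \<theta>s algebra_simps)
  qed
  \<comment> \<open>Passing through the intermediate planes adds the tilts; projections do not
    increase norms, so no product of factors arises.\<close>
  have chain: "norm (orej (Pl y r) v) \<le> (\<Sum>i<j. 6 * m * L * \<theta> r * q ^ i) * norm v"
    if y: "y \<in> S" and v: "v \<in> Pl y (s j)" for y j v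
    using v
  proof (induction j arbitrary: v)
    case 0
    then show ?case using Pl[of y r] y r sz by (simp add: orej_eq_0)
  next
    case (Suc j)
    have sub: "subspace (Pl y (s j))" "subspace (Pl y r)" using Pl y s r by auto
    let ?c = "\<Sum>i<j. 6 * m * L * \<theta> r * q ^ i"
    have "v = oproj (Pl y (s j)) v + orej (Pl y (s j)) v" by (simp add: orej_def)
    then have "norm (orej (Pl y r) v) \<le> norm (orej (Pl y r) (oproj (Pl y (s j)) v)) + norm (orej (Pl y r) (orej (Pl y (s j)) v))"
      by (metis norm_triangle_ineq orej_add sub(2))
    also have "norm (orej (Pl y r) (oproj (Pl y (s j)) v)) \<le> ?c * norm (oproj (Pl y (s j)) v)"
      using Suc.IH sub by simp
    also have "\<dots> \<le> ?c * norm v"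
      using norm_oproj_le[OF sub(1)] L \<theta>0[of r] q by (intro mult_left_mono sum_nonneg) auto
    also have "norm (orej (Pl y r) (orej (Pl y (s j)) v)) \<le> 6 * m * L * \<theta> r * q ^ j * norm v"
      using norm_orej_le[OF sub(2)] step[OF y Suc.prems] order_trans by blast
    finally show ?case by (simp add: algebra_simps)
  qed
  have geo: "(\<Sum>i<j. 6 * m * L * \<theta> r * q ^ i) \<le> 6 * m * L * \<theta> r / (1 - q)" for j
  proof -
    have "(\<Sum>i<j. q ^ i) \<le> 1 / (1 - q)"
      using q by (simp add: sum_gp_strict divide_right_mono)
    then have "6 * m * L * \<theta> r * (\<Sum>i<j. q ^ i) \<le> 6 * m * L * \<theta> r * (1 / (1 - q))"
      using t1 by (intro mult_left_mono) auto
    then show ?thesis by (simp add: sum_distrib_left)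
  qed

  \<comment> \<open>Small Lipschitz constant in the ball of radius 10 r\<close>
  define P where "P = Pl x r"
  have P: "subspace P" "dim P = m" and Px: "\<And>z. z \<in> S \<Longrightarrow> norm (z - x) \<le> 20 * r \<Longrightarrow> norm (orej P (z - x)) \<le> \<theta> r * r"
    using Pl[of x r] x r by (auto simp: P_def)
  have main: "norm (orej P (z - y)) \<le> \<epsilon> * norm (z - y)"
    if y: "y \<in> S" and z: "z \<in> S" and yx: "norm (y - x) \<le> 10 * r" and zx: "norm (z - x) \<le> 10 * r" for y z
  proof (cases "y = z")
    case True then show ?thesis by (simp add: orej_0 P)
  next
    case False
    define D where "D = norm (z - y)"
    have D: "0 < D" "D \<le> 20 * r"
      using False norm_triangle_ineq4[of "z - x" "y - x"] yx zx by (auto simp: D_def)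
    have "\<exists>j. 20 * s (Suc j) < D"
    proof -
      obtain j where "20 * r / D < 2 ^ j" using real_arch_pow[of 2 "20 * r / D"] by auto
      then have "20 * s j < D" using D by (simp add: s_def field_simps)
      then have "20 * s (Suc j) < D" using s[of j] by linarith
      then show ?thesis ..
    qed
    \<comment> \<open>The scale adapted to D, with \<open>20 * s (Suc j) < D\<close> and
      \<open>D \<le> 20 * s j\<close>; the flatness error there is small relative to D and not only
      to r.\<close>
    define j where "j = (LEAST j. 20 * s (Suc j) < D)"
    have j1: "20 * s (Suc j) < D" unfolding j_def using \<open>\<exists>j. _\<close> by (rule LeastI_ex)
    have j2: "D \<le> 20 * s j"
    proof (cases j)
      case 0 then show ?thesis using D sz by simp
    next
      case (Suc i)
      then have "\<not> 20 * s (Suc i) < D" using not_less_Least[of i "\<lambda>j. 20 * s (Suc j) < D"] j_def by auto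
      then show ?thesis using Suc by simp
    qed
    define Q where "Q = Pl y (s j)"
    define R where "R = Pl y r"
    have Q: "subspace Q" "norm (orej Q (z - y)) \<le> \<theta> (s j) * s j"
      using Pl[of y "s j"] y z s[of j] j2 by (auto simp: Q_def D_def)
    have R: "subspace R" using Pl[of y r] y r by (auto simp: R_def)
    have "\<theta> (s j) * s j \<le> \<theta> r * D"
      using \<theta>m[OF s(1) s(2)] s[of j] j1 \<theta>0 by (intro mult_mono) auto
    with Q have e: "norm (orej Q (z - y)) \<le> \<theta> r * D" by linarith
    define v where "v = oproj Q (z - y)"
    have vQ: "v \<in> Q" and vD: "norm v \<le> D" using Q norm_oproj_le by (auto simp: v_def D_def)
    have v1: "norm (orej R v) \<le> 6 * m * L * \<theta> r / (1 - q) * D"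
    proof -
      have "norm (orej R v) \<le> (\<Sum>i<j. 6 * m * L * \<theta> r * q ^ i) * norm v"
        using chain[OF y] vQ by (simp add: Q_def R_def)
      also have "\<dots> \<le> 6 * m * L * \<theta> r / (1 - q) * D"
        using geo vD t1 by (intro mult_mono) auto
      finally show ?thesis .
    qed
    have v2: "norm (orej P (oproj R v)) \<le> 6 * m * L * \<theta> r * D"
    proof -
      have "norm (orej P (oproj R v)) \<le> 2 * m * L * (\<theta> r + 2 * \<theta> r) * norm (oproj R v)"
      proof (rule ang[OF y r order_refl P(1)])
        show "oproj R v \<in> Pl y r" using R by (simp add: R_def)
        fix z assume z: "z \<in> S" "norm (z - y) \<le> r"
        have "norm (z - x) \<le> 20 * r" using norm_triangle_ineq[of "z - y" "y - x"] z yx r by simp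
        moreover have "norm (y - x) \<le> 20 * r" using yx r by simp
        ultimately have "norm (orej P (z - x) - orej P (y - x)) \<le> \<theta> r * r + \<theta> r * r"
          using Px z y norm_triangle_ineq4 order_trans add_mono by metis
        then show "norm (orej P (z - y)) \<le> 2 * \<theta> r * r"
          by (simp add: orej_diff[OF P(1), symmetric] mult_ac)
      qed
      also have "\<dots> \<le> 2 * m * L * (\<theta> r + 2 * \<theta> r) * D"
        using norm_oproj_le[OF R, of v] vD L \<theta>0[of r] by (intro mult_left_mono) auto
      finally show ?thesis by (simp add: algebra_simps)
    qed
    \<comment> \<open>Three errors: the tilt between the planes of y and x at scale r, the tilt at y
      from scale j up to r, and the flatness of S at scale j. They are the three summands in the
      hypothesis on \<epsilon>.\<close>
    have "z - y = oproj R v + (orej R v + orej Q (z - y))" by (simp add: v_def orej_def)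
    then have "norm (orej P (z - y)) = norm (orej P (oproj R v) + (orej P (orej R v) + orej P (orej Q (z - y))))"
      by (metis orej_add P(1))
    also have "\<dots> \<le> norm (orej P (oproj R v)) + (norm (orej P (orej R v)) + norm (orej P (orej Q (z - y))))"
      by (meson norm_triangle_le norm_triangle_ineq add_left_mono order_trans)
    also have "\<dots> \<le> 6 * m * L * \<theta> r * D + (6 * m * L * \<theta> r / (1 - q) * D + \<theta> r * D)"
      using v1 v2 e norm_orej_le[OF P(1)] by (intro add_mono) (blast intro: order_trans)+
    also have "\<dots> = (\<theta> r + 6 * m * L * \<theta> r + 6 * m * L * \<theta> r / (1 - q)) * D" by (simp add: algebra_simps)
    also have "\<dots> \<le> \<epsilon> * D" using A D by (intro mult_right_mono) auto
    finally show ?thesis by (simp add: D_def)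
  qed

  \<comment> \<open>Covering of the disc of radius 4 r\<close>
  have cover: "\<exists>z\<in>S. oproj P (z - x) = u \<and> norm (z - x) \<le> 2 * norm u" if u: "u \<in> P" "norm u \<le> 4 * r" for u
  proof -
    define K where "K = S \<inter> cball x (10 * r)"
    have K: "compact K" "x \<in> K" using S x r by (auto simp: K_def compact_Int)
    have "continuous_on K (\<lambda>z. norm (oproj P (z - x) - u))"
      by (intro continuous_intros continuous_on_compose2[OF continuous_on_oproj[OF P(1), of UNIV]]) auto
    then obtain z where z: "z \<in> K" and zmin: "\<And>z'. z' \<in> K \<Longrightarrow> norm (oproj P (z - x) - u) \<le> norm (oproj P (z' - x) - u)"
      using continuous_attains_inf[OF K(1)] K(2) by blast
    define v where "v = u - oproj P (z - x)"
    have vP: "v \<in> P" using u P by (simp add: v_def subspace_diff)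
    have zS: "z \<in> S" "norm (z - x) \<le> 10 * r" using z by (auto simp: K_def dist_norm norm_minus_commute)
    have nv: "norm v \<le> 4 * r" using zmin[OF K(2)] u P by (simp add: v_def oproj_0 norm_minus_commute)
    have orz: "norm (orej P (z - x)) \<le> \<epsilon> * norm (z - x)" using main[OF x zS(1)] zS r by simp
    have "v = 0"
    proof (rule ccontr)
      assume v0: "v \<noteq> 0"
      have "norm (oproj P (z - x)) \<le> 8 * r"
        using norm_triangle_ineq4[of u v] u nv by (simp add: v_def)
      moreover have "\<epsilon> * norm (z - x) \<le> 1/10 * (10 * r)" using eps zS \<epsilon>0 by (intro mult_mono) auto
      \<comment> \<open>The minimiser keeps the distance r from the boundary of the ball, so a
        better point within r of it still belongs to K.\<close>
      ultimately have z9: "norm (z - x) \<le> 9 * r"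
        using norm_le_oproj_orej[OF P(1), of "z - x"] orz by linarith
      obtain P0 B w where F: "subspace P0" "orthonormal B" "card B = m" "B \<subseteq> P0"
        "\<And>e. e \<in> B \<Longrightarrow> z + w e \<in> S" "\<And>e. e \<in> B \<Longrightarrow> oproj P0 (w e) = (r / L) *\<^sub>R e"
        "\<And>e. e \<in> B \<Longrightarrow> norm (w e) \<le> r"
        and F2: "\<And>u. u \<in> P0 \<Longrightarrow> norm u \<le> r \<Longrightarrow> \<exists>z'\<in>S. oproj P0 (z' - z) = u \<and> norm (z' - z) \<le> L * norm u"
        using mgood_frame[OF good L zS(1)] r order_refl by metis
      \<comment> \<open>The cap makes the covering point z' lie within r of z.\<close>
      define t where "t = min 1 (r / (L * norm v))"
      have t: "0 < t" "t \<le> 1" "t * (L * norm v) \<le> r"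
      proof -
        show "0 < t" "t \<le> 1" using r L v0 by (auto simp: t_def)
        have "t * (L * norm v) \<le> r / (L * norm v) * (L * norm v)"
          using L by (intro mult_right_mono) (auto simp: t_def)
        also have "\<dots> = r" using L v0 by simp
        finally show "t * (L * norm v) \<le> r" .
      qed
      have tv: "t * norm v \<le> r" using t L v0 r
        by (smt (verit) mult_left_mono mult_le_cancel_right1 norm_ge_zero zero_less_norm_iff mult.assoc mult_nonneg_nonneg)
      have n0: "norm (t *\<^sub>R oproj P0 v) \<le> t * norm v" using t norm_oproj_le[OF F(1)] by simp
      then obtain z' where z': "z' \<in> S" "oproj P0 (z' - z) = t *\<^sub>R oproj P0 v"
        "norm (z' - z) \<le> L * norm (t *\<^sub>R oproj P0 v)"
        using F2[of "t *\<^sub>R oproj P0 v"] F(1) tv by (auto simp: subspace_scale)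
      define y where "y = z' - z"
      have "L * norm (t *\<^sub>R oproj P0 v) \<le> L * (t * norm v)" using n0 L by (intro mult_left_mono) auto
      with z' have ny: "norm y \<le> L * (t * norm v)" by (simp add: y_def)
      then have ny': "norm y \<le> r" using t by (simp add: mult_ac)
      have z'x: "norm (z' - x) \<le> 10 * r"
        using norm_triangle_ineq[of y "z - x"] ny' z9 by (simp add: y_def)
      have oy: "norm (orej P y) \<le> \<epsilon> * norm y" using main[OF zS(1) z'(1) zS(2) z'x] by (simp add: y_def)
      \<comment> \<open>As \<open>oproj P0 y = t *\<^sub>R oproj P0 v\<close>, the P0-component of d
        stems from \<open>orej P y\<close> alone and is at most \<epsilon> |y|. The frame of P then
        bounds d by \<open>2 * m * L\<^sup>2 * \<epsilon>\<close> times t |v|, which makes z' better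
        than z.\<close>
      define d where "d = oproj P y - t *\<^sub>R v"
      have dP: "d \<in> P" using P vP by (simp add: d_def subspace_diff subspace_scale)
      have "oproj P0 d = - oproj P0 (orej P y)"
        using z'(2) F(1) by (simp add: d_def oproj_diff oproj_scale orej_def y_def)
      then have "norm (oproj P0 d) \<le> norm (orej P y)" using norm_oproj_le[OF F(1)] by simp
      with oy ny \<epsilon>0 have nd0: "norm (oproj P0 d) \<le> \<epsilon> * (L * (t * norm v))"
        by (meson order_trans mult_left_mono)
      obtain l where l: "d = (\<Sum>e\<in>B. l e *\<^sub>R oproj P (w e))" "\<And>e. e \<in> B \<Longrightarrow> \<bar>l e\<bar> \<le> 2 * norm (oproj P0 d) / (r / L)"
      proof (rule plane_frame[of P m P0 B "r / L" "\<epsilon> * r" w d])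
        show "2 * real m * (\<epsilon> * r) \<le> r / L"
        proof -
          have "(2 * m * L * \<epsilon>) * r \<le> 1 * r" using mL r by (intro mult_right_mono) auto
          then show ?thesis using L by (simp add: field_simps)
        qed
        show "norm (orej P (w e)) \<le> \<epsilon> * r" if e: "e \<in> B" for e
        proof -
          have "norm (z + w e - x) \<le> 10 * r"
            using norm_triangle_ineq[of "w e" "z - x"] F(7)[OF e] z9 by (simp add: algebra_simps)
          then have "norm (orej P (w e)) \<le> \<epsilon> * norm (w e)"
            using main[OF zS(1) F(5)[OF e] zS(2)] by simp
          also have "\<dots> \<le> \<epsilon> * r" using F(7)[OF e] \<epsilon>0 by (intro mult_left_mono) auto
          finally show ?thesis .
        qed
      qed (use P F L r dP that in auto)
      have "norm d \<le> (\<Sum>e\<in>B. 2 * norm (oproj P0 d) / (r / L) * r)"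
        unfolding l(1)
      proof (subst l(1)[symmetric], rule sum_norm_le)
        fix e assume e: "e \<in> B"
        have "norm (oproj P (w e)) \<le> r" using norm_oproj_le[OF P(1), of "w e"] F(7)[OF e] by linarith
        then show "norm (l e *\<^sub>R oproj P (w e)) \<le> 2 * norm (oproj P0 d) / (r / L) * r"
          unfolding norm_scaleR using l(2)[OF e] r L by (intro mult_mono) auto
      qed
      also have "\<dots> = 2 * m * L * norm (oproj P0 d)" using F(3) r by simp
      also have "\<dots> \<le> 2 * m * L * (\<epsilon> * (L * (t * norm v)))" using nd0 L by (intro mult_left_mono) auto
      also have "\<dots> = (2 * m * L\<^sup>2 * \<epsilon>) * (t * norm v)" by (simp add: power2_eq_square algebra_simps)
      also have "\<dots> < 1 * (t * norm v)" using eps(3) t v0 by (intro mult_strict_right_mono) auto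
      finally have nd: "norm d < t * norm v" by simp
      have "oproj P (z' - x) - u = d - (1 - t) *\<^sub>R v"
        using P(1) by (simp add: d_def v_def y_def oproj_diff scaleR_diff_left)
      then have "norm (oproj P (z' - x) - u) \<le> norm d + norm ((1 - t) *\<^sub>R v)" by (metis norm_triangle_ineq4)
      also have "\<dots> < t * norm v + (1 - t) * norm v" using nd t by simp
      also have "\<dots> = norm (oproj P (z - x) - u)" by (simp add: algebra_simps v_def norm_minus_commute)
      finally have "norm (oproj P (z' - x) - u) < norm (oproj P (z - x) - u)" .
      moreover have "z' \<in> K" using z' z'x by (auto simp: K_def dist_norm norm_minus_commute)
      ultimately show False using zmin by force
    qed
    then have "oproj P (z - x) = u" by (simp add: v_def)
    moreover have "norm (z - x) \<le> 2 * norm u"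
    proof -
      have "\<epsilon> * norm (z - x) \<le> 1/10 * norm (z - x)" using eps by (intro mult_right_mono) auto
      then show ?thesis
        using norm_le_oproj_orej[OF P(1), of "z - x"] orz norm_ge_zero[of u] unfolding \<open>oproj P (z - x) = u\<close> by argo
    qed
    ultimately show ?thesis using zS by blast
  qed
  show thesis by (rule that[OF P main cover])
qed

section \<open>Isotopies between nearby graph-like sets\<close>

text \<open>The radii 32 a and 10 a leave room for the displacements in the isotopy; for a = 3 r /
  10 they fit into the radii 10 r and 4 r of \<open>graph_step\<close>.\<close>

definition graphlike :: "nat \<Rightarrow> real \<Rightarrow> real \<Rightarrow> 'a::euclidean_space set \<Rightarrow> bool" where
  "graphlike m \<epsilon> a S \<longleftrightarrow> (\<forall>x\<in>S. \<exists>P. subspace P \<and> dim P = m \<and>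
     (\<forall>y\<in>S. \<forall>z\<in>S. norm (y - x) \<le> 32 * a \<longrightarrow> norm (z - x) \<le> 32 * a \<longrightarrow> norm (orej P (z - y)) \<le> \<epsilon> * norm (z - y)) \<and>
     (\<forall>u\<in>P. norm u \<le> 10 * a \<longrightarrow> (\<exists>z\<in>S. oproj P (z - x) = u \<and> norm (z - x) \<le> 2 * norm u)))"

section \<open>Separated sets and nets\<close>

lemma separated_card_le:
  fixes T :: "'a::metric_space set"
  assumes T: "\<And>s t. s \<in> T \<Longrightarrow> t \<in> T \<Longrightarrow> s \<noteq> t \<Longrightarrow> a \<le> dist s t"
    and K: "finite K" "T \<subseteq> (\<Union>k\<in>K. ball k (a/2))"
  shows "finite T \<and> card T \<le> card K"
proof -
  have "\<forall>t\<in>T. \<exists>k. k \<in> K \<and> t \<in> ball k (a/2)" using K(2) by blast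
  then have "\<exists>f. \<forall>t\<in>T. f t \<in> K \<and> t \<in> ball (f t) (a/2)" by (rule bchoice)
  then obtain f where f: "\<forall>t\<in>T. f t \<in> K \<and> t \<in> ball (f t) (a/2)" ..
  have "inj_on f T"
  proof (rule inj_onI, rule ccontr)
    fix s t assume st: "s \<in> T" "t \<in> T" "f s = f t" "s \<noteq> t"
    have "dist s t \<le> dist (f s) s + dist (f t) t" using st(3) dist_triangle3[of s t "f s"] by simp
    moreover have "dist (f s) s < a/2" "dist (f t) t < a/2" using f st by auto
    ultimately show False using T[OF st(1,2,4)] by linarith
  qed
  moreover have "f ` T \<subseteq> K" using f by auto
  ultimately show ?thesis using K(1) card_inj_on_le[of f T K] inj_on_finite[of f T K] by blast
qed

lemma compact_ball_cover:
  fixes S :: "'a::metric_space set"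
  assumes "compact S" "0 < e"
  obtains K where "finite K" "S \<subseteq> (\<Union>k\<in>K. ball k e)"
  using compact_imp_seq_compact[OF assms(1), THEN seq_compact_imp_totally_bounded] assms(2) by blast

text \<open>Rescaling reduces to a = 1 and a ball about 0, so N depends on the dimension only. It
  later bounds, at every scale, the number of net points that move a given point.\<close>

lemma packing_bound:
  obtains N :: nat where
    "\<And>(c::'a::euclidean_space) a T. 0 < a \<Longrightarrow> T \<subseteq> cball c (4 * a) \<Longrightarrow>
       (\<And>s t. s \<in> T \<Longrightarrow> t \<in> T \<Longrightarrow> s \<noteq> t \<Longrightarrow> a \<le> dist s t) \<Longrightarrow> card T \<le> N"
proof -
  obtain K where K: "finite K" "cball (0::'a) 4 \<subseteq> (\<Union>k\<in>K. ball k (1/2))"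
    using compact_ball_cover[of "cball (0::'a) 4" "1/2"] by auto
  have "card T \<le> card K" if a: "0 < a" and T: "T \<subseteq> cball c (4 * a)"
    and sep: "\<And>s t. s \<in> T \<Longrightarrow> t \<in> T \<Longrightarrow> s \<noteq> t \<Longrightarrow> a \<le> dist s t" for c :: 'a and a T
  proof -
    define g where "g x = (x - c) /\<^sub>R a" for x
    have gd: "dist (g x) (g y) = dist x y / a" for x y
    proof -
      have "g x - g y = (x - y) /\<^sub>R a" by (simp add: g_def algebra_simps)
      then show ?thesis using a by (simp add: dist_norm divide_inverse mult.commute)
    qed
    have inj: "inj_on g T" using a by (auto simp: inj_on_def g_def)
    have "g ` T \<subseteq> cball 0 4"
    proof
      fix z assume "z \<in> g ` T"
      then obtain t where t: "t \<in> T" "z = g t" by auto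
      then have "norm (t - c) \<le> 4 * a" using T by (auto simp: dist_norm norm_minus_commute)
      then have "norm (t - c) / a \<le> 4" using a by (simp add: pos_divide_le_eq)
      then show "z \<in> cball 0 4" using a t by (simp add: g_def divide_inverse mult.commute)
    qed
    then have "g ` T \<subseteq> (\<Union>k\<in>K. ball k (1/2))" using K by blast
    moreover have "1 \<le> dist s t" if "s \<in> g ` T" "t \<in> g ` T" "s \<noteq> t" for s t
    proof -
      obtain s' t' where "s' \<in> T" "t' \<in> T" "s = g s'" "t = g t'" "s' \<noteq> t'" using \<open>s \<in> _\<close> \<open>t \<in> _\<close> \<open>s \<noteq> t\<close> by blast
      then show ?thesis using sep[of s' t'] a by (simp add: gd)
    qed
    ultimately have "card (g ` T) \<le> card K" using separated_card_le[of "g ` T" 1 K] K(1) by blast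
    then show ?thesis using card_image[OF inj] by simp
  qed
  then show thesis using that by blast
qed

text \<open>A separated subset of largest cardinality is a net, since a point farther than a from it
  could be added.\<close>

lemma separated_net:
  fixes S :: "'a::metric_space set"
  assumes K: "finite K" "S \<subseteq> (\<Union>k\<in>K. ball k (a/2))"
  obtains T where "T \<subseteq> S" "finite T" "card T \<le> card K"
    "\<And>s t. s \<in> T \<Longrightarrow> t \<in> T \<Longrightarrow> s \<noteq> t \<Longrightarrow> a \<le> dist s t" "\<And>y. y \<in> S \<Longrightarrow> \<exists>t\<in>T. dist y t \<le> a"
proof -
  define Q where "Q T \<longleftrightarrow> T \<subseteq> S \<and> (\<forall>s\<in>T. \<forall>t\<in>T. s \<noteq> t \<longrightarrow> a \<le> dist s t)" for T
  have b: "finite T \<and> card T \<le> card K" if "Q T" for T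
    by (rule separated_card_le[of T a K]) (use that K in \<open>auto simp: Q_def\<close>)
  have "Q {}" by (simp add: Q_def)
  then obtain T where T: "Q T" and mx: "\<And>T'. Q T' \<Longrightarrow> card T' \<le> card T"
    using ex_has_greatest_nat[of Q "{}" card "Suc (card K)"] b by (auto simp: less_Suc_eq_le)
  have "\<exists>t\<in>T. dist y t \<le> a" if y: "y \<in> S" for y
  proof (rule ccontr)
    assume n: "\<not> ?thesis"
    show False
    proof (cases "y \<in> T")
      case True
      \<comment> \<open>A negative a makes the covering balls empty, which contradicts the point
        y.\<close>
      then have "0 > a" using n by fastforce
      then have "S = {}" using K(2) by (auto simp: subset_iff) (smt (verit) zero_le_dist)
      then show False using y by simp
    next
      case False
      have "Q (insert y T)" using T n y by (auto simp: Q_def dist_commute not_le less_imp_le)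
      then have "card (insert y T) \<le> card T" by (rule mx)
      then show False using False b[OF T] by simp
    qed
  qed
  then show thesis using that[of T] T b[OF T] unfolding Q_def by blast
qed

text \<open>McShane's extension: the infimum of the cones \<open>g y + L * dist x y\<close> over y
  in S.\<close>

lemma lipschitz_extension_real:
  fixes g :: "'a::metric_space \<Rightarrow> real"
  assumes S: "S \<noteq> {}" and L: "0 \<le> L" and g: "\<And>x y. x \<in> S \<Longrightarrow> y \<in> S \<Longrightarrow> \<bar>g x - g y\<bar> \<le> L * dist x y"
  obtains h where "\<And>x. x \<in> S \<Longrightarrow> h x = g x" "\<And>x y. \<bar>h x - h y\<bar> \<le> L * dist x y"
proof -
  define h where "h x = (INF y\<in>S. g y + L * dist x y)" for x
  obtain y0 where y0: "y0 \<in> S" using S by auto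
  have bdd: "bdd_below ((\<lambda>y. g y + L * dist x y) ` S)" for x
  proof (rule bdd_belowI2)
    fix y assume "y \<in> S"
    then have "g y0 - g y \<le> L * dist y0 y" using g[OF y0] by fastforce
    also have "\<dots> \<le> L * (dist x y0 + dist x y)" using L dist_triangle3[of y0 y x] by (intro mult_left_mono) auto
    finally show "g y0 - L * dist x y0 \<le> g y + L * dist x y" by (simp add: algebra_simps)
  qed
  have h1: "h x = g x" if x: "x \<in> S" for x
  proof (rule antisym)
    show "h x \<le> g x" unfolding h_def using cINF_lower[OF bdd x, of x] by simp
    show "g x \<le> h x" unfolding h_def
    proof (rule cINF_greatest[OF S])
      fix y assume "y \<in> S" then show "g x \<le> g y + L * dist x y" using g[OF x, of y] by linarith
    qed
  qed
  have h2: "h x - h y \<le> L * dist x y" for x y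
  proof -
    have "h x - L * dist x y \<le> h y" unfolding h_def[of y]
    proof (rule cINF_greatest[OF S])
      fix z assume z: "z \<in> S"
      have "h x \<le> g z + L * dist x z" unfolding h_def by (rule cINF_lower[OF bdd z])
      also have "\<dots> \<le> g z + L * (dist x y + dist y z)" using L dist_triangle[of x z y] by (intro add_left_mono mult_left_mono) auto
      finally show "h x - L * dist x y \<le> g z + L * dist y z" by (simp add: algebra_simps)
    qed
    then show ?thesis by linarith
  qed
  show thesis
    using that[of h] h1 h2 by (metis abs_le_iff dist_commute minus_diff_eq)
qed

text \<open>McShane's extension in every coordinate. Summing over the coordinates costs the factor
  \<open>DIM('a)\<close>, which reappears in the smallness condition on \<epsilon> for the
  isotopy.\<close>

lemma lipschitz_extension:
  fixes W :: "'a::euclidean_space \<Rightarrow> 'a" and L :: real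
  assumes S: "S \<noteq> {}" and L: "0 \<le> L" and W: "\<And>x y. x \<in> S \<Longrightarrow> y \<in> S \<Longrightarrow> norm (W x - W y) \<le> L * norm (x - y)"
  obtains V where "\<And>x. x \<in> S \<Longrightarrow> V x = W x" "\<And>x y. norm (V x - V y) \<le> DIM('a) * L * norm (x - y)"
proof -
  have "\<exists>h. (\<forall>x\<in>S. h x = W x \<bullet> b) \<and> (\<forall>x y. \<bar>h x - h y\<bar> \<le> L * dist x y)" if b: "b \<in> Basis" for b
  proof -
    have "\<bar>W x \<bullet> b - W y \<bullet> b\<bar> \<le> L * dist x y" if "x \<in> S" "y \<in> S" for x y
      using Basis_le_norm[OF b, of "W x - W y"] W[OF that] by (simp add: inner_diff_left dist_norm)
    from lipschitz_extension_real[OF S L this] show ?thesis by metis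
  qed
  then obtain h where h: "\<And>b x. b \<in> Basis \<Longrightarrow> x \<in> S \<Longrightarrow> h b x = W x \<bullet> b"
    "\<And>b x y. b \<in> Basis \<Longrightarrow> \<bar>h b x - h b y\<bar> \<le> L * dist x y" by metis
  define V where "V x = (\<Sum>b\<in>Basis. h b x *\<^sub>R b)" for x
  show thesis
  proof (rule that[of V])
    show "V x = W x" if "x \<in> S" for x
    proof -
      have "V x = (\<Sum>b\<in>Basis. (W x \<bullet> b) *\<^sub>R b)" unfolding V_def by (rule sum.cong) (use h that in auto)
      then show ?thesis by (simp add: euclidean_representation)
    qed
    show "norm (V x - V y) \<le> DIM('a) * L * norm (x - y)" for x y
    proof -
      have "V x - V y = (\<Sum>b\<in>Basis. (h b x - h b y) *\<^sub>R b)" by (simp add: V_def scaleR_diff_left sum_subtractf)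
      also have "norm \<dots> \<le> (\<Sum>b\<in>(Basis::'a set). L * dist x y)"
        by (rule sum_norm_le) (use h(2) in auto)
      finally show ?thesis by (simp add: dist_norm)
    qed
  qed
qed

text \<open>For t in [0, 1] the map x + (1 - t) V x shrinks distances at most by the factor 1/2, so
  it is a homeomorphism onto its image. It is the identity at t = 1 and carries S2 to S1 at t =
  0.\<close>

lemma ambient_isotopic_lipschitz_perturbation:
  fixes V :: "'a::euclidean_space \<Rightarrow> 'a"
  assumes V: "\<And>x y. norm (V x - V y) \<le> 1/2 * norm (x - y)" and im: "(\<lambda>x. x + V x) ` S2 = S1"
  shows "ambient_isotopic S1 S2"
proof -
  define H where "H x t = x + (1 - t) *\<^sub>R V x" for x and t :: real
  have lip: "(1/2)-lipschitz_on UNIV V" using V by (intro lipschitz_onI) (auto simp: dist_norm)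
  have cV: "continuous_on A V" for A
    using lipschitz_on_continuous_on[OF lip] continuous_on_subset by blast
  have low: "norm (x - y) \<le> 2 * norm (H x t - H y t)" if t: "t \<in> {0..1}" for x y t
  proof -
    have "x - y = (H x t - H y t) - (1 - t) *\<^sub>R (V x - V y)" by (simp add: H_def algebra_simps)
    then have "norm (x - y) \<le> norm (H x t - H y t) + norm ((1 - t) *\<^sub>R (V x - V y))" by (metis norm_triangle_ineq4)
    moreover have "norm ((1 - t) *\<^sub>R (V x - V y)) \<le> 1 * (1/2 * norm (x - y))"
      unfolding norm_scaleR using t V by (intro mult_mono) auto
    ultimately show ?thesis by simp
  qed
  have hom: "\<exists>g. homeomorphism UNIV (range (\<lambda>x. H x t)) (\<lambda>x. H x t) g" if t: "t \<in> {0..1}" for t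
  proof -
    have inj: "inj (\<lambda>x. H x t)" using low[OF t] by (auto simp: inj_def) (metis norm_le_zero_iff right_minus_eq diff_self mult_zero_right norm_zero)
    let ?g = "inv (\<lambda>x. H x t)"
    have "2-lipschitz_on (range (\<lambda>x. H x t)) ?g"
      by (rule lipschitz_onI) (use low[OF t] in \<open>auto simp: dist_norm inv_f_f[OF inj]\<close>)
    then have "continuous_on (range (\<lambda>x. H x t)) ?g" by (rule lipschitz_on_continuous_on)
    moreover have "continuous_on UNIV (\<lambda>x. H x t)" unfolding H_def by (intro continuous_intros cV)
    ultimately show ?thesis
      by (intro exI[of _ ?g]) (auto simp: homeomorphism_def inv_f_f[OF inj] image_iff)
  qed
  have "continuous_on (UNIV \<times> {0..1}) (\<lambda>(x, t). H x t)"
    unfolding H_def case_prod_beta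
    by (intro continuous_intros continuous_on_compose2[OF cV[of UNIV]]) auto
  moreover have "\<forall>x. H x 1 = x" by (simp add: H_def)
  moreover have "(\<lambda>x. H x 0) ` S2 = S1" using im by (simp add: H_def)
  ultimately show ?thesis unfolding ambient_isotopic_def using hom by blast
qed

text \<open>Composition at each time instead of concatenation in time: at t = 1 both maps are the
  identity, and at t = 0 they carry S3 to S2 and S2 to S1.\<close>

lemma ambient_isotopic_trans:
  fixes S1 S2 S3 :: "'a::euclidean_space set"
  assumes "ambient_isotopic S1 S2" "ambient_isotopic S2 S3"
  shows "ambient_isotopic S1 S3"
proof -
  obtain H :: "'a \<Rightarrow> real \<Rightarrow> 'a" where H: "continuous_on (UNIV \<times> {0..1}) (\<lambda>(x, t). H x t)"
    "\<And>t. t \<in> {0..1} \<Longrightarrow> \<exists>g. homeomorphism UNIV (range (\<lambda>x. H x t)) (\<lambda>x. H x t) g"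
    "\<And>x. H x 1 = x" "(\<lambda>x. H x 0) ` S2 = S1" using assms(1) unfolding ambient_isotopic_def by blast
  obtain G :: "'a \<Rightarrow> real \<Rightarrow> 'a" where G: "continuous_on (UNIV \<times> {0..1}) (\<lambda>(x, t). G x t)"
    "\<And>t. t \<in> {0..1} \<Longrightarrow> \<exists>g. homeomorphism UNIV (range (\<lambda>x. G x t)) (\<lambda>x. G x t) g"
    "\<And>x. G x 1 = x" "(\<lambda>x. G x 0) ` S3 = S2" using assms(2) unfolding ambient_isotopic_def by blast
  define F where "F x t = H (G x t) t" for x t
  have "continuous_on (UNIV \<times> {0..1}) ((\<lambda>(x, t). H x t) \<circ> (\<lambda>(x, t). (G x t, t)))"
  proof (rule continuous_on_compose)
    show "continuous_on (UNIV \<times> {0..1}) (\<lambda>(x, t). (G x t, t))"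
      unfolding case_prod_beta
      by (intro continuous_intros) (use G(1) in \<open>simp add: case_prod_beta\<close>)
    show "continuous_on ((\<lambda>(x, t). (G x t, t)) ` (UNIV \<times> {0..1})) (\<lambda>(x, t). H x t)"
      by (rule continuous_on_subset[OF H(1)]) auto
  qed
  then have "continuous_on (UNIV \<times> {0..1}) (\<lambda>(x, t). F x t)"
    by (simp add: F_def comp_def case_prod_beta)
  moreover have "\<exists>g. homeomorphism UNIV (range (\<lambda>x. F x t)) (\<lambda>x. F x t) g" if t: "t \<in> {0..1}" for t
  proof -
    obtain h where h: "homeomorphism UNIV (range (\<lambda>x. H x t)) (\<lambda>x. H x t) h" using H(2)[OF t] by blast
    obtain g where g: "homeomorphism UNIV (range (\<lambda>x. G x t)) (\<lambda>x. G x t) g" using G(2)[OF t] by blast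
    have "homeomorphism (range (\<lambda>x. G x t)) ((\<lambda>x. H x t) ` range (\<lambda>x. G x t)) (\<lambda>x. H x t) h"
      by (rule homeomorphism_of_subsets[OF h]) (use h in \<open>auto simp: homeomorphism_def\<close>)
    from homeomorphism_compose[OF g this] show ?thesis
      by (intro exI[of _ "g \<circ> h"]) (simp add: F_def comp_def image_image)
  qed
  moreover have "\<forall>x. F x 1 = x" by (simp add: F_def H(3) G(3))
  moreover have "(\<lambda>x. F x 0) ` S3 = S1" unfolding H(4)[symmetric] G(4)[symmetric] by (simp add: F_def image_image)
  ultimately show ?thesis unfolding ambient_isotopic_def by blast
qed

lemma ambient_isotopic_translation: "ambient_isotopic ((\<lambda>x. x + c) ` S) (S::'a::euclidean_space set)"
  by (rule ambient_isotopic_lipschitz_perturbation[of "\<lambda>x. c"]) auto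

lemma norm_le_2_oproj:
  assumes "subspace P" "norm (orej P v) \<le> \<epsilon> * norm v" "\<epsilon> \<le> 1/2"
  shows "norm v \<le> 2 * norm (oproj P v)"
proof -
  have "\<epsilon> * norm v \<le> 1/2 * norm v" using assms(3) by (intro mult_right_mono) auto
  then show ?thesis using norm_le_oproj_orej[OF assms(1), of v] assms(2) by linarith
qed

text \<open>The Hausdorff distance \<delta> says nothing about differences of nearby points of S2.
  It is used only at the fixed scale 9 a, where a frame of S2 lies close to points of S1; this
  bounds the angle between P and the plane Q of S2, and flatness over Q covers all smaller
  scales.\<close>

lemma cross_flat:
  fixes S1 S2 :: "'a::euclidean_space set" and a \<epsilon> \<delta> :: real
  assumes a: "0 < a" and \<epsilon>: "0 < \<epsilon>" "4 * real m * \<epsilon> \<le> 1" "\<epsilon> \<le> 1" and \<delta>: "0 \<le> \<delta>" "\<delta> \<le> a * \<epsilon>"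
    and P: "subspace P"
    and flat: "\<And>y z. y \<in> S1 \<Longrightarrow> z \<in> S1 \<Longrightarrow> norm (y - x) \<le> 32 * a \<Longrightarrow> norm (z - x) \<le> 32 * a \<Longrightarrow> norm (orej P (z - y)) \<le> \<epsilon> * norm (z - y)"
    and S2: "graphlike m \<epsilon> a S2" and near: "\<And>y. y \<in> S2 \<Longrightarrow> \<exists>p\<in>S1. norm (p - y) \<le> \<delta>"
    and y: "y \<in> S2" "norm (y - x) \<le> 8 * a" and y': "y' \<in> S2" "norm (y' - x) \<le> 8 * a"
  shows "norm (orej P (y' - y)) \<le> (9 * real m + 1) * \<epsilon> * norm (y' - y)"
proof -
  obtain Q where Q: "subspace Q" "dim Q = m"
    and Qf: "\<And>y1 z. y1 \<in> S2 \<Longrightarrow> z \<in> S2 \<Longrightarrow> norm (y1 - y) \<le> 32 * a \<Longrightarrow> norm (z - y) \<le> 32 * a \<Longrightarrow> norm (orej Q (z - y1)) \<le> \<epsilon> * norm (z - y1)"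
    and Qc: "\<And>u. u \<in> Q \<Longrightarrow> norm u \<le> 10 * a \<Longrightarrow> \<exists>z\<in>S2. oproj Q (z - y) = u \<and> norm (z - y) \<le> 2 * norm u"
    using S2 y(1) unfolding graphlike_def by blast
  obtain B where B: "orthonormal B" "B \<subseteq> Q" "card B = m" "span B = Q"
    using orthonormal_basis_exists[OF Q] .
  have ex: "\<exists>w. y + w \<in> S2 \<and> oproj Q w = (9 * a) *\<^sub>R e \<and> norm w \<le> 18 * a" if e: "e \<in> B" for e
  proof -
    have n: "norm e = 1" using B e by (auto simp: orthonormal_def norm_eq_1)
    have "(9 * a) *\<^sub>R e \<in> Q" using B e Q by (auto intro: subspace_scale)
    moreover have "norm ((9 * a) *\<^sub>R e) \<le> 10 * a" using n a by simp
    ultimately obtain z where "z \<in> S2" "oproj Q (z - y) = (9 * a) *\<^sub>R e" "norm (z - y) \<le> 2 * norm ((9 * a) *\<^sub>R e)"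
      using Qc by blast
    then show ?thesis using n a by (intro exI[of _ "z - y"]) auto
  qed
  then have "\<exists>w. \<forall>e\<in>B. y + w e \<in> S2 \<and> oproj Q (w e) = (9 * a) *\<^sub>R e \<and> norm (w e) \<le> 18 * a" by (intro bchoice ballI)
  then obtain w where w: "\<And>e. e \<in> B \<Longrightarrow> y + w e \<in> S2" "\<And>e. e \<in> B \<Longrightarrow> oproj Q (w e) = (9 * a) *\<^sub>R e"
    "\<And>e. e \<in> B \<Longrightarrow> norm (w e) \<le> 18 * a" by auto
  \<comment> \<open>Frame vectors have length at most 18 a and deviate from Q by at most 18 a
    \<epsilon>. Replacing their end points by points of S1 changes differences by up to 2 \<delta>,
    which leads to 22 a \<epsilon> for P.\<close>
  have ang: "norm (orej P v) \<le> 2 * real m * (18 * a * \<epsilon> + 22 * a * \<epsilon>) / (9 * a) * norm v" if v: "v \<in> Q" for v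
  proof (rule plane_angle[OF Q Q(1) B(1,3,2) _ _ w(2) _ P _ v])
    show "0 < 9 * a" using a by simp
    have "(4 * m * \<epsilon>) * (9 * a) \<le> 1 * (9 * a)" using \<epsilon> a by (intro mult_right_mono) auto
    then show "2 * real m * (18 * a * \<epsilon>) \<le> 9 * a" by (simp add: algebra_simps)
  next
    fix e assume e: "e \<in> B"
    have "norm (orej Q (y + w e - y)) \<le> \<epsilon> * norm (y + w e - y)"
      using w[OF e] y a by (intro Qf) auto
    also have "\<dots> \<le> \<epsilon> * (18 * a)" using w(3)[OF e] \<epsilon> by (intro mult_left_mono) auto
    finally show "norm (orej Q (w e)) \<le> 18 * a * \<epsilon>" by (simp add: mult_ac)
  next
    fix e assume e: "e \<in> B"
    obtain p where p: "p \<in> S1" "norm (p - y) \<le> \<delta>" using near y by blast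
    obtain p' where p': "p' \<in> S1" "norm (p' - (y + w e)) \<le> \<delta>" using near w(1)[OF e] by blast
    have \<delta>a: "\<delta> \<le> a" using \<delta> a \<epsilon> by (smt (verit) mult_left_le)
    have n1: "norm (p - x) \<le> 32 * a" using norm_triangle_ineq[of "p - y" "y - x"] p y \<delta>a a by simp
    have n2: "norm (p' - x) \<le> 32 * a"
      using norm_triangle_ineq[of "p' - (y + w e)" "y - x + w e"] norm_triangle_ineq[of "y - x" "w e"] p' y w(3)[OF e] \<delta>a a
      by (simp add: algebra_simps)
    define q where "q = (p' - (y + w e)) - (p - y)"
    have q: "norm q \<le> 2 * \<delta>" unfolding q_def using norm_triangle_ineq4[of "p' - (y + w e)" "p - y"] p p' by linarith
    have pp: "p' - p = w e + q" by (simp add: q_def algebra_simps)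
    have "norm (orej P (w e)) = norm (orej P (p' - p) - orej P q)" unfolding pp by (simp add: orej_add[OF P])
    also have "\<dots> \<le> norm (orej P (p' - p)) + norm (orej P q)" by (rule norm_triangle_ineq4)
    also have "\<dots> \<le> \<epsilon> * norm (p' - p) + 2 * \<delta>"
      using flat[OF p(1) p'(1) n1 n2] norm_orej_le[OF P, of q] q by linarith
    also have "\<dots> \<le> \<epsilon> * (20 * a) + 2 * (a * \<epsilon>)"
    proof -
      have "norm (p' - p) \<le> 20 * a" unfolding pp using norm_triangle_ineq[of "w e" q] w(3)[OF e] q \<delta>a by linarith
      then show ?thesis using \<epsilon> \<delta> by (intro add_mono mult_left_mono) auto
    qed
    finally show "norm (orej P (w e)) \<le> 22 * a * \<epsilon>" by (simp add: algebra_simps)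
  qed
  define d where "d = y' - y"
  have d16: "norm d \<le> 32 * a" unfolding d_def using norm_triangle_ineq4[of "y' - x" "y - x"] y y' a by simp
  have "norm (orej Q d) \<le> \<epsilon> * norm d" unfolding d_def using y y' d16 a by (intro Qf) (auto simp: d_def)
  then have 1: "norm (orej P (orej Q d)) \<le> \<epsilon> * norm d" using norm_orej_le[OF P, of "orej Q d"] by linarith
  have "norm (orej P (oproj Q d)) \<le> 2 * real m * (18 * a * \<epsilon> + 22 * a * \<epsilon>) / (9 * a) * norm (oproj Q d)"
    by (rule ang) (simp add: Q)
  also have "\<dots> = (80/9 * m * \<epsilon>) * norm (oproj Q d)" using a by (simp add: field_simps)
  also have "\<dots> \<le> (9 * m * \<epsilon>) * norm d"
    using norm_oproj_le[OF Q(1), of d] \<epsilon> by (intro mult_mono mult_right_mono) auto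
  finally have 2: "norm (orej P (oproj Q d)) \<le> 9 * m * \<epsilon> * norm d" .
  have "orej P d = orej P (oproj Q d) + orej P (orej Q d)"
    by (simp add: orej_add[OF P, symmetric] orej_def[of Q])
  then have "norm (orej P d) \<le> norm (orej P (oproj Q d)) + norm (orej P (orej Q d))" by (metis norm_triangle_ineq)
  also have "\<dots> \<le> 9 * m * \<epsilon> * norm d + \<epsilon> * norm d" using 1 2 by linarith
  finally show ?thesis unfolding d_def by (simp add: algebra_simps)
qed

text \<open>The perturbation is built one net point at a time: in the \<open>j\<close>-th step the current image of \<open>S2\<close> is moved
  towards \<open>S1\<close>, along the normal space of the plane at \<open>xs j\<close>, with a cutoff supported near \<open>xs j\<close>. The
  Lipschitz constant grows by a factor in at most \<open>N0\<close> steps at each point, hence the factor \<open>9 ^ N0\<close>.\<close>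

lemma close_graphlike_ambient_isotopic_aux:
  fixes S1 S2 :: "'a::euclidean_space set" and xs :: "nat \<Rightarrow> 'a" and a \<epsilon> \<delta> :: real
  assumes a: "0 < a" and \<epsilon>: "0 < \<epsilon>" "(9 * real m + 1) * \<epsilon> \<le> 1/2"
    and \<epsilon>9: "DIM('a) * (9 ^ N0 * ((9 * real m + 5) * \<epsilon>)) \<le> 1/4"
    and \<delta>: "0 < \<delta>" "4 ^ N * \<delta> \<le> a * \<epsilon> / 2"
    and S1: "graphlike m \<epsilon> a S1" and S2: "graphlike m \<epsilon> a S2" "S2 \<noteq> {}"
    and near1: "\<And>y. y \<in> S1 \<Longrightarrow> \<exists>p\<in>S2. norm (p - y) \<le> \<delta>"
    and near2: "\<And>y. y \<in> S2 \<Longrightarrow> \<exists>p\<in>S1. norm (p - y) \<le> \<delta>"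
    and xs: "\<And>i. i < N \<Longrightarrow> xs i \<in> S1" and net: "\<And>p. p \<in> S1 \<Longrightarrow> \<exists>i<N. norm (p - xs i) \<le> a"
    and overlap: "\<And>y. card {i. i < N \<and> norm (y - xs i) \<le> 4 * a} \<le> N0"
  shows "ambient_isotopic S1 S2"
proof -
  have m0: "0 \<le> 9 * real m * \<epsilon>" using \<epsilon> by simp
  have "(9 * real m + 1) * \<epsilon> = 9 * real m * \<epsilon> + \<epsilon>" by (simp add: algebra_simps)
  then have \<epsilon>h: "\<epsilon> \<le> 1/2" and \<epsilon>1: "\<epsilon> \<le> 1" using \<epsilon> m0 by linarith+
  have \<epsilon>4: "4 * real m * \<epsilon> \<le> 1"
  proof -
    have "4 * real m * \<epsilon> \<le> 9 * real m * \<epsilon>" using \<epsilon> by (intro mult_right_mono) auto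
    then show ?thesis using \<epsilon> by (simp add: algebra_simps)
  qed
  have a\<epsilon>: "a * \<epsilon> \<le> a" using a \<epsilon>1 by (simp add: mult_left_le)
  have p4: "4 ^ j * \<delta> \<le> a * \<epsilon> / 2" if "j \<le> N" for j
  proof -
    have "(4::real) ^ j * \<delta> \<le> 4 ^ N * \<delta>" using that \<delta> by (intro mult_right_mono power_increasing) auto
    then show ?thesis using \<delta> by linarith
  qed
  have \<delta>a: "\<delta> \<le> a * \<epsilon> / 2" using p4[of 0] by simp
  have \<delta>a': "\<delta> \<le> a * \<epsilon>" using \<delta>a \<delta> by linarith
  have \<delta>1: "\<delta> \<le> a" using \<delta>a' a\<epsilon> by linarith

  \<comment> \<open>Projection onto S1 along the normal spaces of the net planes\<close>
  have "\<forall>i\<in>{..<N}. \<exists>P. subspace P \<and> dim P = m \<and>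
     (\<forall>y\<in>S1. \<forall>z\<in>S1. norm (y - xs i) \<le> 32 * a \<longrightarrow> norm (z - xs i) \<le> 32 * a \<longrightarrow> norm (orej P (z - y)) \<le> \<epsilon> * norm (z - y)) \<and>
     (\<forall>u\<in>P. norm u \<le> 10 * a \<longrightarrow> (\<exists>z\<in>S1. oproj P (z - xs i) = u \<and> norm (z - xs i) \<le> 2 * norm u))"
    using S1 xs unfolding graphlike_def by blast
  from bchoice[OF this] obtain P where Pall: "\<forall>i\<in>{..<N}. subspace (P i) \<and> dim (P i) = m \<and>
     (\<forall>y\<in>S1. \<forall>z\<in>S1. norm (y - xs i) \<le> 32 * a \<longrightarrow> norm (z - xs i) \<le> 32 * a \<longrightarrow> norm (orej (P i) (z - y)) \<le> \<epsilon> * norm (z - y)) \<and>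
     (\<forall>u\<in>P i. norm u \<le> 10 * a \<longrightarrow> (\<exists>z\<in>S1. oproj (P i) (z - xs i) = u \<and> norm (z - xs i) \<le> 2 * norm u))" ..
  then have P: "\<And>i. i < N \<Longrightarrow> subspace (P i)"
    and Pf: "\<And>i y z. i < N \<Longrightarrow> y \<in> S1 \<Longrightarrow> z \<in> S1 \<Longrightarrow> norm (y - xs i) \<le> 32 * a \<Longrightarrow> norm (z - xs i) \<le> 32 * a \<Longrightarrow> norm (orej (P i) (z - y)) \<le> \<epsilon> * norm (z - y)"
    and Pc: "\<And>i u. i < N \<Longrightarrow> u \<in> P i \<Longrightarrow> norm u \<le> 10 * a \<Longrightarrow> \<exists>z\<in>S1. oproj (P i) (z - xs i) = u \<and> norm (z - xs i) \<le> 2 * norm u"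
    by (meson lessThan_iff)+
  have exF: "\<exists>p. p \<in> S1 \<and> norm (p - xs i) \<le> 16 * a \<and> oproj (P i) (p - z) = 0" if i: "i < N" and z: "norm (z - xs i) \<le> 8 * a" for i z
  proof -
    have n: "norm (oproj (P i) (z - xs i)) \<le> 8 * a" using norm_oproj_le[OF P[OF i], of "z - xs i"] z by linarith
    then have n': "norm (oproj (P i) (z - xs i)) \<le> 10 * a" using a by linarith
    obtain p where p: "p \<in> S1" "oproj (P i) (p - xs i) = oproj (P i) (z - xs i)" "norm (p - xs i) \<le> 2 * norm (oproj (P i) (z - xs i))"
      using Pc[OF i oproj_in[OF P[OF i]] n'] by blast
    then have "oproj (P i) (p - z) = 0" by (simp add: oproj_diff[OF P[OF i]])
    then show ?thesis using p n by (intro exI[of _ p]) auto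
  qed
  \<comment> \<open>The point of S1 above z in the direction normal to \<open>P i\<close>; flatness
    makes it unique within 16 a of \<open>xs i\<close>. The radius is twice 8 a, by the distortion 2
    of the covering.\<close>
  define F where "F i z = (SOME p. p \<in> S1 \<and> norm (p - xs i) \<le> 16 * a \<and> oproj (P i) (p - z) = 0)" for i z
  have F: "F i z \<in> S1" "norm (F i z - xs i) \<le> 16 * a" "oproj (P i) (F i z - z) = 0"
    if "i < N" "norm (z - xs i) \<le> 8 * a" for i z
    using someI_ex[OF exF[OF that]] unfolding F_def by auto
  define G where "G i z = F i z - z" for i z
  \<comment> \<open>With p = z this yields \<open>G i z = 0\<close> for z in S1: a point already on
    S1 is not moved any more.\<close>
  have Gb: "norm (G i z) \<le> 3 * norm (z - p)"
    if i: "i < N" and z: "norm (z - xs i) \<le> 8 * a" and p: "p \<in> S1" "norm (p - xs i) \<le> 32 * a" for i z p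
  proof -
    have "norm (F i z - p) \<le> 2 * norm (oproj (P i) (F i z - p))"
      by (rule norm_le_2_oproj[OF P[OF i] _ \<epsilon>h], rule Pf[OF i p(1) F(1)[OF i z] p(2)]) (use F(2)[OF i z] a in linarith)
    also have "oproj (P i) (F i z - p) = oproj (P i) (z - p)"
      using F(3)[OF i z] by (simp add: oproj_diff[OF P[OF i]])
    also have "2 * norm \<dots> \<le> 2 * norm (z - p)" using norm_oproj_le[OF P[OF i], of "z - p"] by simp
    finally have "norm (F i z - p) \<le> 2 * norm (z - p)" .
    moreover have "norm (G i z) \<le> norm (F i z - p) + norm (p - z)"
      unfolding G_def using norm_triangle_ineq[of "F i z - p" "p - z"] by simp
    ultimately show ?thesis by (simp add: norm_minus_commute)
  qed
  have GL: "norm (G i z - G i z') \<le> 2 * \<epsilon> * norm (z - z') + norm (orej (P i) (z - z'))"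
    if i: "i < N" and z: "norm (z - xs i) \<le> 8 * a" "norm (z' - xs i) \<le> 8 * a" for i z z'
  proof -
    note p = P[OF i]
    have o1: "oproj (P i) (F i z - F i z') = oproj (P i) (z - z')"
      using F(3)[OF i z(1)] F(3)[OF i z(2)] by (simp add: oproj_diff[OF p])
    have fl: "norm (orej (P i) (F i z - F i z')) \<le> \<epsilon> * norm (F i z - F i z')"
      by (rule Pf[OF i F(1)[OF i z(2)] F(1)[OF i z(1)]]) (use F(2)[OF i z(1)] F(2)[OF i z(2)] a in linarith)+
    have "norm (F i z - F i z') \<le> 2 * norm (oproj (P i) (z - z'))"
      using norm_le_2_oproj[OF p fl \<epsilon>h] unfolding o1 .
    also have "\<dots> \<le> 2 * norm (z - z')" using norm_oproj_le[OF p, of "z - z'"] by simp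
    finally have f2: "\<epsilon> * norm (F i z - F i z') \<le> \<epsilon> * (2 * norm (z - z'))" using \<epsilon> by (intro mult_left_mono) auto
    have "G i z - G i z' = orej (P i) (F i z - F i z') - orej (P i) (z - z')"
      using o1 by (simp add: orej_def G_def algebra_simps)
    then have "norm (G i z - G i z') \<le> norm (orej (P i) (F i z - F i z')) + norm (orej (P i) (z - z'))" by (metis norm_triangle_ineq4)
    then show ?thesis using fl f2 by simp
  qed
  \<comment> \<open>A cutoff equal to 1 within 2 a of the net point and to 0 beyond 4 a, with
    Lipschitz constant 1 / (2 a).\<close>
  define ch where "ch i y = max 0 (min 1 (2 - norm (y - xs i) / (2 * a)))" for i y
  have ch01: "0 \<le> ch i y" "ch i y \<le> 1" for i y by (auto simp: ch_def)
  have ch1: "ch i y = 1" if "norm (y - xs i) \<le> 2 * a" for i y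
    using that a by (simp add: ch_def field_simps)
  have ch0: "ch i y = 0" if "4 * a < norm (y - xs i)" for i y
    using that a by (simp add: ch_def field_simps)
  have chL: "\<bar>ch i y - ch i y'\<bar> \<le> norm (y - y') / (2 * a)" for i y y'
  proof -
    have "\<bar>ch i y - ch i y'\<bar> \<le> \<bar>norm (y - xs i) / (2 * a) - norm (y' - xs i) / (2 * a)\<bar>" unfolding ch_def by linarith
    also have "\<dots> = \<bar>norm (y - xs i) - norm (y' - xs i)\<bar> / (2 * a)" using a by (simp add: diff_divide_distrib[symmetric])
    also have "\<dots> \<le> norm (y - y') / (2 * a)"
      using norm_triangle_ineq3[of "y - xs i" "y' - xs i"] a by (intro divide_right_mono) auto
    finally show ?thesis .
  qed

  \<comment> \<open>Iterated displacement and its size\<close>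
  define W where "W = rec_nat (\<lambda>y::'a. 0::'a) (\<lambda>j Wj y. Wj y + ch j y *\<^sub>R G j (y + Wj y))"
  have W0: "W 0 y = 0" and WS: "W (Suc j) y = W j y + ch j y *\<^sub>R G j (y + W j y)" for j y
    by (simp_all add: W_def)
  \<comment> \<open>Displacement plus \<delta> bounds the distance of the moved point to S1. A step
    moves by at most three times this amount, hence the factor 4 and the requirement on
    \<open>4 ^ N * \<delta>\<close>.\<close>
  have Wb: "norm (W j y) + \<delta> \<le> 4 ^ j * \<delta>" if "j \<le> N" "y \<in> S2" for j y
    using that(1)
  proof (induction j)
    case 0 then show ?case by (simp add: W0)
  next
    case (Suc j)
    then have j: "j < N" and IH: "norm (W j y) + \<delta> \<le> 4 ^ j * \<delta>" by auto
    show ?case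
    proof (cases "4 * a < norm (y - xs j)")
      case True
      have "4 ^ j * \<delta> \<le> 4 ^ Suc j * \<delta>" using \<delta> by (intro mult_right_mono power_increasing) auto
      moreover have "norm (W (Suc j) y) = norm (W j y)" using True by (simp add: WS ch0)
      ultimately show ?thesis using IH by linarith
    next
      case False
      obtain p where p: "p \<in> S1" "norm (p - y) \<le> \<delta>" using near2 \<open>y \<in> S2\<close> by blast
      have Wa: "norm (W j y) \<le> a" using IH p4[OF less_imp_le[OF j]] a a\<epsilon> \<delta> by linarith
      have "norm (y + W j y - xs j) \<le> 8 * a"
        using norm_triangle_ineq[of "y - xs j" "W j y"] Wa False a by (simp add: algebra_simps)
      moreover have "norm (p - xs j) \<le> 32 * a"
        using norm_triangle_ineq[of "p - y" "y - xs j"] p \<delta>1 False a by simp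
      ultimately have "norm (G j (y + W j y)) \<le> 3 * norm (y + W j y - p)" by (rule Gb[OF j _ p(1)])
      also have "\<dots> \<le> 3 * (norm (W j y) + \<delta>)"
        using norm_triangle_ineq[of "y - p" "W j y"] p by (simp add: algebra_simps norm_minus_commute)
      finally have g: "norm (G j (y + W j y)) \<le> 3 * (norm (W j y) + \<delta>)" .
      have "norm (ch j y *\<^sub>R G j (y + W j y)) \<le> 1 * norm (G j (y + W j y))"
        unfolding norm_scaleR using ch01[of j y] by (intro mult_right_mono) auto
      then have "norm (W (Suc j) y) \<le> norm (W j y) + 3 * (norm (W j y) + \<delta>)"
        unfolding WS using norm_triangle_ineq[of "W j y" "ch j y *\<^sub>R G j (y + W j y)"] g by linarith
      then show ?thesis using IH by simp
    qed
  qed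
  have Wa: "norm (W j y) \<le> a * \<epsilon> / 2" "norm (W j y) \<le> a" if "j \<le> N" "y \<in> S2" for j y
    using Wb[OF that] p4[OF that(1)] a a\<epsilon> \<delta> by linarith+

  \<comment> \<open>Lipschitz constant of the total displacement\<close>
  define \<epsilon>3 where "\<epsilon>3 = (9 * real m + 5) * \<epsilon>"
  have \<epsilon>3: "0 < \<epsilon>3" "\<epsilon> \<le> \<epsilon>3" "4 * \<epsilon> + (9 * real m + 1) * \<epsilon> = \<epsilon>3"
  proof -
    have "\<epsilon>3 = 9 * real m * \<epsilon> + 5 * \<epsilon>" by (simp add: \<epsilon>3_def algebra_simps)
    then show "0 < \<epsilon>3" "\<epsilon> \<le> \<epsilon>3" using m0 \<epsilon>(1) by linarith+
    show "4 * \<epsilon> + (9 * real m + 1) * \<epsilon> = \<epsilon>3" by (simp add: \<epsilon>3_def algebra_simps)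
  qed
  \<comment> \<open>Only these steps change W at y or y', so the exponent in the Lipschitz bound
    counts them rather than all N steps.\<close>
  define A where "A j y y' = {i. i < j \<and> (norm (y - xs i) \<le> 4 * a \<or> norm (y' - xs i) \<le> 4 * a)}" for j y y'
  have finA: "finite (A j y y')" for j y y' by (rule finite_subset[of _ "{..<j}"]) (auto simp: A_def)
  \<comment> \<open>A step turns a Lipschitz constant c into at most 3 c +
    \<open>\<epsilon>3\<close>, and (3^k - 1) \<open>\<epsilon>3\<close> is a supersolution of this
    recursion. For |y - y'| at most 2 a, both points stay within reach of a net point that is active
    at one of them.\<close>
  have WL: "norm (W j y - W j y') \<le> (3 ^ card (A j y y') - 1) * \<epsilon>3 * norm (y - y')"
    if "j \<le> N" and y: "y \<in> S2" "y' \<in> S2" "norm (y - y') \<le> 2 * a" for j y y'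
    using that(1)
  proof (induction j)
    case 0 then show ?case by (simp add: W0 A_def)
  next
    case (Suc j)
    then have j: "j < N" and IH: "norm (W j y - W j y') \<le> (3 ^ card (A j y y') - 1) * \<epsilon>3 * norm (y - y')" by auto
    show ?case
    proof (cases "norm (y - xs j) \<le> 4 * a \<or> norm (y' - xs j) \<le> 4 * a")
      case False
      then have "A (Suc j) y y' = A j y y'" by (auto simp: A_def less_Suc_eq)
      then show ?thesis using IH False by (simp add: WS ch0)
    next
      case True
      have "A (Suc j) y y' = insert j (A j y y')" using True by (auto simp: A_def less_Suc_eq)
      moreover have "j \<notin> A j y y'" by (simp add: A_def)
      ultimately have cA: "card (A (Suc j) y y') = Suc (card (A j y y'))" using finA by simp
      have n6: "norm (y - xs j) \<le> 6 * a" "norm (y' - xs j) \<le> 6 * a"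
        using True y(3) norm_triangle_ineq[of "y - y'" "y' - xs j"] norm_triangle_ineq[of "y' - y" "y - xs j"] a
        by (auto simp: norm_minus_commute)
      have Wja: "norm (W j y) \<le> a" "norm (W j y') \<le> a" using Wa(2)[of j] j y by auto
      define z where "z = y + W j y"
      define z' where "z' = y' + W j y'"
      have z8: "norm (z - xs j) \<le> 8 * a" "norm (z' - xs j) \<le> 8 * a"
        using norm_triangle_ineq[of "y - xs j" "W j y"] norm_triangle_ineq[of "y' - xs j" "W j y'"] Wja n6 a
        by (auto simp: z_def z'_def algebra_simps)
      define D where "D = norm (W j y - W j y')"
      have zz: "z - z' = (y - y') + (W j y - W j y')" by (simp add: z_def z'_def)
      have nz: "norm (z - z') \<le> norm (y - y') + D" unfolding zz D_def by (rule norm_triangle_ineq)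
      have cf: "norm (orej (P j) (y - y')) \<le> (9 * real m + 1) * \<epsilon> * norm (y - y')"
        by (rule cross_flat[OF a \<epsilon>(1) \<epsilon>4 \<epsilon>1 less_imp_le[OF \<delta>(1)] \<delta>a' P[OF j] Pf[OF j] S2(1) near2])
          (use y n6 a in auto)
      have "norm (orej (P j) (z - z')) \<le> norm (orej (P j) (y - y')) + norm (orej (P j) (W j y - W j y'))"
        unfolding zz orej_add[OF P[OF j]] by (rule norm_triangle_ineq)
      then have oz: "norm (orej (P j) (z - z')) \<le> (9 * real m + 1) * \<epsilon> * norm (y - y') + D"
        using cf norm_orej_le[OF P[OF j], of "W j y - W j y'"] unfolding D_def by linarith
      have "2 * \<epsilon> * norm (z - z') \<le> 2 * \<epsilon> * (norm (y - y') + D)" using nz \<epsilon> by (intro mult_left_mono) auto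
      also have "\<dots> \<le> 2 * \<epsilon> * norm (y - y') + D"
      proof -
        have "2 * \<epsilon> * D \<le> 1 * D" using \<epsilon>h by (intro mult_right_mono) (auto simp: D_def)
        then show ?thesis by (simp add: algebra_simps)
      qed
      finally have dG: "norm (G j z - G j z') \<le> 2 * D + 2 * \<epsilon> * norm (y - y') + (9 * real m + 1) * \<epsilon> * norm (y - y')"
        using GL[OF j z8] oz by linarith
      have g': "norm (G j z') \<le> 3 * (a * \<epsilon> / 2)"
      proof -
        obtain p where p: "p \<in> S1" "norm (p - y') \<le> \<delta>" using near2 y by blast
        have "norm (p - xs j) \<le> 32 * a"
          using norm_triangle_ineq[of "p - y'" "y' - xs j"] p \<delta>1 n6 a by simp
        then have "norm (G j z') \<le> 3 * norm (z' - p)" by (rule Gb[OF j z8(2) p(1)])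
        also have "norm (z' - p) \<le> norm (W j y') + \<delta>"
          unfolding z'_def using norm_triangle_ineq[of "y' - p" "W j y'"] p by (simp add: algebra_simps norm_minus_commute)
        also have "\<dots> \<le> a * \<epsilon> / 2" using Wb[of j y'] j y p4[of j] by simp
        finally show ?thesis by simp
      qed
      have "\<bar>ch j y - ch j y'\<bar> * norm (G j z') \<le> norm (y - y') / (2 * a) * (3 * (a * \<epsilon> / 2))"
        using chL g' a by (intro mult_mono) auto
      also have "\<dots> \<le> 2 * \<epsilon> * norm (y - y')"
      proof -
        have "norm (y - y') / (2 * a) * (3 * (a * \<epsilon> / 2)) = 3/4 * (\<epsilon> * norm (y - y'))" using a by simp
        also have "\<dots> \<le> 2 * (\<epsilon> * norm (y - y'))" using \<epsilon> by (intro mult_right_mono) auto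
        finally show ?thesis by simp
      qed
      finally have t2: "norm ((ch j y - ch j y') *\<^sub>R G j z') \<le> 2 * \<epsilon> * norm (y - y')" by simp
      have "ch j y * norm (G j z - G j z') \<le> 1 * norm (G j z - G j z')" using ch01 by (intro mult_right_mono) auto
      then have t1: "norm (ch j y *\<^sub>R (G j z - G j z')) \<le> norm (G j z - G j z')" using ch01 by simp
      have "W (Suc j) y - W (Suc j) y' = (W j y - W j y') + (ch j y *\<^sub>R (G j z - G j z') + (ch j y - ch j y') *\<^sub>R G j z')"
        by (simp add: WS z_def[symmetric] z'_def[symmetric] scaleR_diff_right scaleR_diff_left)
      note Weq = this
      have "norm (W (Suc j) y - W (Suc j) y') \<le> D + (norm (ch j y *\<^sub>R (G j z - G j z')) + norm ((ch j y - ch j y') *\<^sub>R G j z'))"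
        unfolding Weq D_def
        using norm_triangle_ineq[of "W j y - W j y'" "ch j y *\<^sub>R (G j z - G j z') + (ch j y - ch j y') *\<^sub>R G j z'"]
          norm_triangle_ineq[of "ch j y *\<^sub>R (G j z - G j z')" "(ch j y - ch j y') *\<^sub>R G j z'"] by linarith
      also have "\<dots> \<le> 3 * D + \<epsilon>3 * norm (y - y')"
        using t1 t2 dG unfolding \<epsilon>3(3)[symmetric] by (simp add: algebra_simps)
      also have "\<dots> \<le> 3 * ((3 ^ card (A j y y') - 1) * \<epsilon>3 * norm (y - y')) + 2 * (\<epsilon>3 * norm (y - y'))"
        using IH \<epsilon>3 unfolding D_def by (intro add_mono mult_left_mono) auto
      also have "\<dots> = (3 ^ card (A (Suc j) y y') - 1) * \<epsilon>3 * norm (y - y')" unfolding cA by (simp add: algebra_simps)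
      finally show ?thesis .
    qed
  qed
  define lam where "lam = 9 ^ N0 * \<epsilon>3"
  have lam0: "0 \<le> lam" "\<epsilon> \<le> lam"
  proof -
    show "0 \<le> lam" using \<epsilon>3 by (simp add: lam_def)
    have "1 * \<epsilon>3 \<le> 9 ^ N0 * \<epsilon>3" using \<epsilon>3(1) by (intro mult_right_mono) auto
    then show "\<epsilon> \<le> lam" using \<epsilon>3(2) unfolding lam_def by linarith
  qed
  \<comment> \<open>Two points together have at most 2 N0 active steps, and 3^(2 N0) = 9^N0. Beyond
    the distance 2 a the size bound on W suffices.\<close>
  have WLip: "norm (W N y - W N y') \<le> lam * norm (y - y')" if y: "y \<in> S2" "y' \<in> S2" for y y'
  proof (cases "norm (y - y') \<le> 2 * a")
    case True
    have "A N y y' = {i. i < N \<and> norm (y - xs i) \<le> 4 * a} \<union> {i. i < N \<and> norm (y' - xs i) \<le> 4 * a}" by (auto simp: A_def)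
    then have "card (A N y y') \<le> card {i. i < N \<and> norm (y - xs i) \<le> 4 * a} + card {i. i < N \<and> norm (y' - xs i) \<le> 4 * a}"
      by (simp add: card_Un_le)
    then have "card (A N y y') \<le> 2 * N0" using overlap[of y] overlap[of y'] by linarith
    then have "(3::real) ^ card (A N y y') \<le> 3 ^ (2 * N0)" by (intro power_increasing) auto
    also have "\<dots> = 9 ^ N0" by (simp add: power_mult)
    finally have "(3 ^ card (A N y y') - 1) * \<epsilon>3 * norm (y - y') \<le> 9 ^ N0 * \<epsilon>3 * norm (y - y')"
      using \<epsilon>3 by (intro mult_right_mono) auto
    then show ?thesis using WL[OF order_refl y True] by (simp add: lam_def)
  next
    case False
    have "norm (W N y - W N y') \<le> a * \<epsilon> / 2 + a * \<epsilon> / 2"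
      using norm_triangle_ineq4[of "W N y" "W N y'"] Wa(1)[OF order_refl y(1)] Wa(1)[OF order_refl y(2)] by linarith
    also have "\<dots> \<le> \<epsilon> * norm (y - y')"
    proof -
      have "\<epsilon> * a \<le> \<epsilon> * norm (y - y')" using False a \<epsilon> by (intro mult_left_mono) auto
      then show ?thesis by (simp add: mult_ac)
    qed
    also have "\<dots> \<le> lam * norm (y - y')" using lam0 by (intro mult_right_mono) auto
    finally show ?thesis .
  qed
  \<comment> \<open>A step with cutoff 1 puts the point on S1, and later steps leave it there
    because the correction vanishes on S1.\<close>
  have inS: "y + W j y \<in> S1" if "j \<le> N" "y \<in> S2" "\<exists>i<j. norm (y - xs i) \<le> 2 * a" for y j
    using that(1,3)
  proof (induction j)
    case 0 then show ?case by simp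
  next
    case (Suc j)
    then have j: "j < N" by simp
    have z8: "norm (y + W j y - xs j) \<le> 8 * a" if "norm (y - xs j) \<le> 4 * a"
      using norm_triangle_ineq[of "y - xs j" "W j y"] Wa(2)[of j y] \<open>y \<in> S2\<close> j a that by (simp add: algebra_simps)
    show ?case
    proof (cases "norm (y - xs j) \<le> 2 * a")
      case True
      then have "y + W (Suc j) y = F j (y + W j y)" by (simp add: WS ch1 G_def)
      then show ?thesis using F(1)[OF j z8] True a by simp
    next
      case False
      then have zS: "y + W j y \<in> S1" using Suc by (auto simp: less_Suc_eq)
      show ?thesis
      proof (cases "4 * a < norm (y - xs j)")
        case True then show ?thesis using zS by (simp add: WS ch0)
      next
        case False
        then have z: "norm (y + W j y - xs j) \<le> 8 * a" using z8 by simp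
        have "norm (G j (y + W j y)) \<le> 3 * norm (y + W j y - (y + W j y))"
          by (rule Gb[OF j z zS]) (use z a in linarith)
        then have "G j (y + W j y) = 0" by simp
        then show ?thesis using zS by (simp add: WS)
      qed
    qed
  qed
  have \<phi>S: "y + W N y \<in> S1" if y: "y \<in> S2" for y
  proof (rule inS[OF order_refl y])
    obtain p where p: "p \<in> S1" "norm (p - y) \<le> \<delta>" using near2 y by blast
    obtain i where i: "i < N" "norm (p - xs i) \<le> a" using net p by blast
    have "norm (y - xs i) \<le> 2 * a" using norm_triangle_ineq[of "y - p" "p - xs i"] p i \<delta>1 by (simp add: norm_minus_commute)
    then show "\<exists>i<N. norm (y - xs i) \<le> 2 * a" using i by blast
  qed
  have lamd: "DIM('a) * lam \<le> 1/4" using \<epsilon>9 by (simp add: lam_def \<epsilon>3_def)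
  have lam4: "lam \<le> 1/4"
  proof -
    have "1 * lam \<le> DIM('a) * lam" using lam0 DIM_ge_Suc0[where 'a='a] by (intro mult_right_mono) auto
    then show ?thesis using lamd by linarith
  qed
  \<comment> \<open>S2 near y0 is parametrised by its plane Q. A fixed point of T is a parameter
    whose image f has the same projection to Q as z; as f and z both lie on S1,
    \<open>cross_flat\<close> with S1 and S2 exchanged gives f = z.\<close>
  have surj: "\<exists>y\<in>S2. y + W N y = z" if z: "z \<in> S1" for z
  proof -
    obtain y0 where y0: "y0 \<in> S2" "norm (y0 - z) \<le> \<delta>" using near1 z by blast
    obtain Q where Q: "subspace Q" "dim Q = m"
      and Qf: "\<And>y z. y \<in> S2 \<Longrightarrow> z \<in> S2 \<Longrightarrow> norm (y - y0) \<le> 32 * a \<Longrightarrow> norm (z - y0) \<le> 32 * a \<Longrightarrow> norm (orej Q (z - y)) \<le> \<epsilon> * norm (z - y)"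
      and Qc: "\<And>u. u \<in> Q \<Longrightarrow> norm u \<le> 10 * a \<Longrightarrow> \<exists>z\<in>S2. oproj Q (z - y0) = u \<and> norm (z - y0) \<le> 2 * norm u"
      using S2(1) y0(1) unfolding graphlike_def by blast
    define D where "D = Q \<inter> cball 0 a"
    have "\<forall>u\<in>D. \<exists>s. s \<in> S2 \<and> oproj Q (s - y0) = u \<and> norm (s - y0) \<le> 2 * norm u"
    proof
      fix u assume "u \<in> D"
      then have "u \<in> Q" "norm u \<le> 10 * a" using a by (auto simp: D_def)
      then show "\<exists>s. s \<in> S2 \<and> oproj Q (s - y0) = u \<and> norm (s - y0) \<le> 2 * norm u" using Qc by blast
    qed
    from bchoice[OF this] obtain s where "\<forall>u\<in>D. s u \<in> S2 \<and> oproj Q (s u - y0) = u \<and> norm (s u - y0) \<le> 2 * norm u" ..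
    then have s: "\<And>u. u \<in> D \<Longrightarrow> s u \<in> S2" "\<And>u. u \<in> D \<Longrightarrow> oproj Q (s u - y0) = u"
      "\<And>u. u \<in> D \<Longrightarrow> norm (s u - y0) \<le> 2 * norm u" by blast+
    have s2: "norm (s u - y0) \<le> 2 * a" if "u \<in> D" for u using s(3)[OF that] that by (auto simp: D_def)
    have sL: "norm (s u - s u') \<le> 2 * norm (u - u')" if u: "u \<in> D" "u' \<in> D" for u u'
    proof -
      have "norm (s u - s u') \<le> 2 * norm (oproj Q (s u - s u'))"
        by (rule norm_le_2_oproj[OF Q(1) _ \<epsilon>h], rule Qf[OF s(1)[OF u(2)] s(1)[OF u(1)]])
          (use s2[OF u(1)] s2[OF u(2)] a in linarith)+
      also have "oproj Q (s u - s u') = u - u'"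
        using s(2)[OF u(1)] s(2)[OF u(2)] by (simp add: oproj_diff[OF Q(1)] algebra_simps)
      finally show ?thesis .
    qed
    define T where "T u = oproj Q (z - y0 - W N (s u))" for u
    have "\<exists>!u\<in>D. T u = u"
    proof (rule Banach_fix)
      show "complete D" unfolding D_def using closed_subspace[OF Q(1)] by (simp add: complete_eq_closed closed_Int)
      show "D \<noteq> {}" using subspace_0[OF Q(1)] a by (auto simp: D_def intro!: exI[of _ 0])
      show "0 \<le> (1/2::real)" "(1/2::real) < 1" by auto
      show "T ` D \<subseteq> D"
      proof
        fix v assume "v \<in> T ` D"
        then obtain u where u: "u \<in> D" "v = T u" by auto
        have "norm v \<le> norm (z - y0 - W N (s u))" unfolding u(2) T_def by (rule norm_oproj_le[OF Q(1)])
        also have "\<dots> \<le> \<delta> + a * \<epsilon> / 2"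
          using norm_triangle_ineq4[of "z - y0" "W N (s u)"] y0(2) Wa(1)[OF order_refl s(1)[OF u(1)]] by (simp add: norm_minus_commute)
        also have "\<dots> \<le> a" using \<delta>a a\<epsilon> by linarith
        finally show "v \<in> D" using u(2) Q(1) by (simp add: D_def T_def)
      qed
      show "dist (T u) (T u') \<le> 1/2 * dist u u'" if u: "u \<in> D" "u' \<in> D" for u u'
      proof -
        have "T u - T u' = oproj Q (W N (s u') - W N (s u))" unfolding T_def oproj_diff[OF Q(1), symmetric] by (simp add: algebra_simps)
        then have "norm (T u - T u') \<le> norm (W N (s u') - W N (s u))" by (simp add: norm_oproj_le[OF Q(1)])
        also have "\<dots> \<le> lam * norm (s u' - s u)" using WLip s(1) u by blast
        also have "\<dots> \<le> 1/4 * (2 * norm (u' - u))" using sL[OF u(2) u(1)] lam4 lam0 by (intro mult_mono) auto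
        finally show ?thesis by (simp add: dist_norm norm_minus_commute)
      qed
    qed
    then obtain u where u: "u \<in> D" "T u = u" by blast
    define f where "f = s u + W N (s u)"
    have fS: "f \<in> S1" unfolding f_def by (rule \<phi>S[OF s(1)[OF u(1)]])
    have "f - z = (s u - y0) - (z - y0 - W N (s u))" by (simp add: f_def algebra_simps)
    then have "oproj Q (f - z) = oproj Q (s u - y0) - T u" unfolding T_def by (simp only: oproj_diff[OF Q(1)])
    then have o: "oproj Q (f - z) = 0" using s(2)[OF u(1)] u(2) by simp
    have "norm (orej Q (f - z)) \<le> (9 * real m + 1) * \<epsilon> * norm (f - z)"
    proof (rule cross_flat[OF a \<epsilon>(1) \<epsilon>4 \<epsilon>1 less_imp_le[OF \<delta>(1)] \<delta>a' Q(1) Qf S1 near1 z])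
      show "norm (z - y0) \<le> 8 * a" using y0(2) \<delta>1 a by (simp add: norm_minus_commute)
      show "norm (f - y0) \<le> 8 * a" unfolding f_def
        using norm_triangle_ineq[of "s u - y0" "W N (s u)"] s2[OF u(1)] Wa(2)[OF order_refl s(1)[OF u(1)]] a by (simp add: algebra_simps)
    qed (use fS in auto)
    then have "norm (f - z) \<le> 2 * norm (oproj Q (f - z))" by (rule norm_le_2_oproj[OF Q(1) _ \<epsilon>(2)])
    then have "f = z" using o by simp
    then show ?thesis using s(1)[OF u(1)] unfolding f_def by blast
  qed
  obtain V where V: "\<And>x. x \<in> S2 \<Longrightarrow> V x = W N x" "\<And>x y. norm (V x - V y) \<le> DIM('a) * lam * norm (x - y)"
    using lipschitz_extension[OF S2(2) lam0(1) WLip] by blast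
  show ?thesis
  proof (rule ambient_isotopic_lipschitz_perturbation[of V])
    fix x y :: 'a
    have "DIM('a) * lam * norm (x - y) \<le> 1/2 * norm (x - y)" using lamd by (intro mult_right_mono) auto
    then show "norm (V x - V y) \<le> 1/2 * norm (x - y)" using V(2)[of x y] by linarith
    show "(\<lambda>x. x + V x) ` S2 = S1"
    proof (intro set_eqI iffI)
      fix p assume "p \<in> (\<lambda>x. x + V x) ` S2" then show "p \<in> S1" using V(1) \<phi>S by auto
    next
      fix p assume "p \<in> S1" then show "p \<in> (\<lambda>x. x + V x) ` S2" using surj[of p] V(1) by force
    qed
  qed
qed

text \<open>The order of the quantifiers matters: \<epsilon> depends on m and the dimension only,
  since the scale a will be found in terms of \<epsilon>. The scale and the bounding ball influence
  \<delta> alone.\<close>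

lemma close_graphlike_ambient_isotopic:
  obtains \<epsilon> :: real where "0 < \<epsilon>" "\<epsilon> \<le> 1/10"
    "\<And>a M. 0 < a \<Longrightarrow> \<exists>\<delta>>0. \<forall>S1 S2::'a::euclidean_space set.
       graphlike m \<epsilon> a S1 \<longrightarrow> graphlike m \<epsilon> a S2 \<longrightarrow> S1 \<subseteq> cball 0 M \<longrightarrow>
       (\<forall>y\<in>S1. \<exists>p\<in>S2. norm (p - y) \<le> \<delta>) \<longrightarrow> (\<forall>y\<in>S2. \<exists>p\<in>S1. norm (p - y) \<le> \<delta>) \<longrightarrow> ambient_isotopic S1 S2"
proof -
  obtain N0 :: nat where N0: "\<And>(c::'a) a T. 0 < a \<Longrightarrow> T \<subseteq> cball c (4 * a) \<Longrightarrow>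
       (\<And>s t. s \<in> T \<Longrightarrow> t \<in> T \<Longrightarrow> s \<noteq> t \<Longrightarrow> a \<le> dist s t) \<Longrightarrow> card T \<le> N0"
    using packing_bound by blast
  define c where "c = DIM('a) * (9 ^ N0 * (9 * real m + 5))"
  have c: "9 * real m + 5 \<le> c"
  proof -
    have "1 * (1 * (9 * real m + 5)) \<le> c" unfolding c_def
      using DIM_ge_Suc0[where 'a='a] by (intro mult_mono) auto
    then show ?thesis by simp
  qed
  define \<epsilon> where "\<epsilon> = 1 / (4 * c)"
  have c5: "5 \<le> c" using c by simp
  have \<epsilon>: "0 < \<epsilon>" "\<epsilon> \<le> 1/10" "c * \<epsilon> = 1/4" using c5 by (auto simp: \<epsilon>_def field_simps)
  have e1: "(9 * real m + 1) * \<epsilon> \<le> 1/2"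
  proof -
    have "(9 * real m + 1) * \<epsilon> \<le> c * \<epsilon>" using c \<epsilon> by (intro mult_right_mono) auto
    then show ?thesis using \<epsilon>(3) by linarith
  qed
  have e2: "DIM('a) * (9 ^ N0 * ((9 * real m + 5) * \<epsilon>)) \<le> 1/4" using \<epsilon>(3) by (simp add: c_def algebra_simps)
  show thesis
  proof (rule that[OF \<epsilon>(1,2)])
    fix a M :: real assume a: "0 < a"
    obtain K where K: "finite K" "cball (0::'a) M \<subseteq> (\<Union>k\<in>K. ball k (a/2))"
      using compact_ball_cover[of "cball (0::'a) M" "a/2"] a by auto
    \<comment> \<open>The net has at most \<open>card K\<close> points, which bounds the number of
      steps, each with growth factor 4.\<close>
    define \<delta> where "\<delta> = a * \<epsilon> / (2 * 4 ^ card K)"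
    have \<delta>: "0 < \<delta>" using a \<epsilon> by (simp add: \<delta>_def)
    have "ambient_isotopic S1 S2" if S1: "graphlike m \<epsilon> a S1" and S2: "graphlike m \<epsilon> a S2" and b: "S1 \<subseteq> cball 0 M"
      and n1: "\<forall>y\<in>S1. \<exists>p\<in>S2. norm (p - y) \<le> \<delta>" and n2: "\<forall>y\<in>S2. \<exists>p\<in>S1. norm (p - y) \<le> \<delta>" for S1 S2 :: "'a set"
    proof (cases "S2 = {}")
      case True
      then have "S1 = {}" using n1 by auto
      then show ?thesis using ambient_isotopic_translation[of 0 "{}"] True by simp
    next
      case False
      have "S1 \<subseteq> (\<Union>k\<in>K. ball k (a/2))" using b K(2) by blast
      from separated_net[OF K(1) this] obtain T where T: "T \<subseteq> S1" "finite T" "card T \<le> card K"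
        "\<And>s t. s \<in> T \<Longrightarrow> t \<in> T \<Longrightarrow> s \<noteq> t \<Longrightarrow> a \<le> dist s t" "\<And>y. y \<in> S1 \<Longrightarrow> \<exists>t\<in>T. dist y t \<le> a" by metis
      obtain xs where xs: "bij_betw xs {..<card T} T"
        using ex_bij_betw_nat_finite[OF T(2)] by (auto simp: atLeast0LessThan)
      show ?thesis
      proof (rule close_graphlike_ambient_isotopic_aux[OF a \<epsilon>(1) e1 e2 \<delta> _ S1 S2 False, of "card T" xs])
        have "(4::real) ^ card T * \<delta> \<le> 4 ^ card K * \<delta>" using T(3) \<delta> by (intro mult_right_mono power_increasing) auto
        then show "4 ^ card T * \<delta> \<le> a * \<epsilon> / 2" by (simp add: \<delta>_def)
        show "\<And>y. y \<in> S1 \<Longrightarrow> \<exists>p\<in>S2. norm (p - y) \<le> \<delta>" "\<And>y. y \<in> S2 \<Longrightarrow> \<exists>p\<in>S1. norm (p - y) \<le> \<delta>" using n1 n2 by auto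
        show "xs i \<in> S1" if "i < card T" for i using xs T(1) that by (auto simp: bij_betw_def)
        show "\<exists>i<card T. norm (p - xs i) \<le> a" if p: "p \<in> S1" for p
        proof -
          obtain t where "t \<in> T" "dist p t \<le> a" using T(5)[OF p] by blast
          moreover then obtain i where "i < card T" "xs i = t" using xs by (metis bij_betw_imp_surj_on imageE lessThan_iff)
          ultimately show ?thesis by (auto simp: dist_norm)
        qed
        show "card {i. i < card T \<and> norm (y - xs i) \<le> 4 * a} \<le> N0" for y
        proof -
          let ?I = "{i. i < card T \<and> norm (y - xs i) \<le> 4 * a}"
          have sub: "xs ` ?I \<subseteq> T" using xs by (auto simp: bij_betw_def)
          have "inj_on xs ?I" using xs by (auto simp: bij_betw_def inj_on_def)
          then have "card ?I = card (xs ` ?I)" by (simp add: card_image)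
          also have "\<dots> \<le> N0"
          proof (rule N0[OF a, of _ y])
            show "xs ` ?I \<subseteq> cball y (4 * a)" by (auto simp: dist_norm)
            show "a \<le> dist s t" if "s \<in> xs ` ?I" "t \<in> xs ` ?I" "s \<noteq> t" for s t
              using T(4) sub that by blast
          qed
          finally show ?thesis .
        qed
      qed
    qed
    then show "\<exists>\<delta>>0. \<forall>S1 S2::'a set. graphlike m \<epsilon> a S1 \<longrightarrow> graphlike m \<epsilon> a S2 \<longrightarrow> S1 \<subseteq> cball 0 M \<longrightarrow>
       (\<forall>y\<in>S1. \<exists>p\<in>S2. norm (p - y) \<le> \<delta>) \<longrightarrow> (\<forall>y\<in>S2. \<exists>p\<in>S1. norm (p - y) \<le> \<delta>) \<longrightarrow> ambient_isotopic S1 S2"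
      using \<delta> by blast
  qed
qed

section \<open>Hausdorff measure\<close>

definition hcover :: "real \<Rightarrow> 'a::euclidean_space set \<Rightarrow> (nat \<Rightarrow> 'a set) set" where
  "hcover \<delta> A = {C. A \<subseteq> (\<Union>i. C i) \<and> (\<forall>i. bounded (C i) \<and> diameter (C i) \<le> \<delta>)}"

definition hcost :: "nat \<Rightarrow> 'a::euclidean_space set \<Rightarrow> ennreal" where
  "hcost s X = ennreal (unit_ball_vol (real s) * (diameter X / 2) ^ s)"

definition hdelta :: "nat \<Rightarrow> real \<Rightarrow> 'a::euclidean_space set \<Rightarrow> ennreal" where
  "hdelta s \<delta> A = (INF C\<in>hcover \<delta> A. \<Sum>i. hcost s (C i))"

lemma hausdorff_outer_eq: "hausdorff_outer s A = (SUP \<delta>\<in>{0<..}. hdelta s \<delta> A)"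
  by (simp add: hausdorff_outer_def hdelta_def hcover_def hcost_def)

text \<open>For s = 0 the empty set would cost 1, as 0 ^ 0 = 1; in positive dimension covers can be
  padded with empty sets.\<close>

lemma hcost_empty [simp]: "0 < s \<Longrightarrow> hcost s {} = 0"
  by (simp add: hcost_def)

lemma hdelta_le: "C \<in> hcover \<delta> A \<Longrightarrow> hdelta s \<delta> A \<le> (\<Sum>i. hcost s (C i))"
  unfolding hdelta_def by (rule INF_lower)

lemma hdelta_antimono: "\<delta> \<le> \<delta>' \<Longrightarrow> hdelta s \<delta>' A \<le> hdelta s \<delta> A"
  unfolding hdelta_def by (rule INF_superset_mono) (auto simp: hcover_def intro: order_trans)

lemma hdelta_le_hausdorff: "0 < \<delta> \<Longrightarrow> hdelta s \<delta> A \<le> hausdorff_outer s A"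
  unfolding hausdorff_outer_eq by (rule SUP_upper) auto

lemma hausdorff_outer_leI: "(\<And>\<delta>. 0 < \<delta> \<Longrightarrow> hdelta s \<delta> A \<le> X) \<Longrightarrow> hausdorff_outer s A \<le> X"
  unfolding hausdorff_outer_eq by (rule SUP_least) auto

lemma hdelta_mono: "A \<subseteq> B \<Longrightarrow> hdelta s \<delta> A \<le> hdelta s \<delta> B"
  unfolding hdelta_def by (rule INF_superset_mono) (auto simp: hcover_def)

lemma hausdorff_outer_mono: "A \<subseteq> B \<Longrightarrow> hausdorff_outer s A \<le> hausdorff_outer s B"
  by (rule hausdorff_outer_leI) (meson hdelta_mono hdelta_le_hausdorff order_trans)

text \<open>Covers with an arbitrary countable index set are padded by empty sets. The integral over
  \<open>count_space\<close> matches the formula for the measure of a disjoint countable union in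
  the later Vitali argument.\<close>

lemma hdelta_le_countable:
  assumes s: "0 < s" and \<delta>: "0 < \<delta>" and I: "countable I" and A: "A \<subseteq> (\<Union>i\<in>I. D i)"
    and D: "\<And>i. i \<in> I \<Longrightarrow> bounded (D i)" "\<And>i. i \<in> I \<Longrightarrow> diameter (D i) \<le> \<delta>"
  shows "hdelta s \<delta> A \<le> (\<integral>\<^sup>+i. hcost s (D i) \<partial>count_space I)"
proof -
  define f where "f = to_nat_on I"
  have inj: "inj_on f I" unfolding f_def by (rule inj_on_to_nat_on[OF I])
  define C where "C n = (if n \<in> f ` I then D (inv_into I f n) else {})" for n
  have Cf: "C (f i) = D i" if "i \<in> I" for i using that inj by (simp add: C_def)
  have "C \<in> hcover \<delta> A"
  proof -
    have "A \<subseteq> (\<Union>n. C n)"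
    proof
      fix x assume "x \<in> A"
      then obtain i where "i \<in> I" "x \<in> D i" using A by blast
      then show "x \<in> (\<Union>n. C n)" using Cf by blast
    qed
    moreover have "bounded (C n) \<and> diameter (C n) \<le> \<delta>" for n
      using D \<delta> inv_into_into[of n f I] by (auto simp: C_def)
    ultimately show ?thesis by (simp add: hcover_def)
  qed
  then have "hdelta s \<delta> A \<le> (\<Sum>n. hcost s (C n))" by (rule hdelta_le)
  also have "\<dots> = (\<integral>\<^sup>+n. hcost s (C n) \<partial>count_space UNIV)" by (simp add: nn_integral_count_space_nat)
  also have "\<dots> = (\<integral>\<^sup>+n. hcost s (C n) \<partial>count_space (f ` I))"
    by (rule nn_integral_count_space_eq) (auto simp: C_def s)
  also have "\<dots> = (\<integral>\<^sup>+i. hcost s (C (f i)) \<partial>count_space I)"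
    using nn_integral_bij_count_space[OF inj_on_imp_bij_betw[OF inj], of "\<lambda>n. hcost s (C n)"] by simp
  also have "\<dots> = (\<integral>\<^sup>+i. hcost s (D i) \<partial>count_space I)"
    by (rule nn_integral_cong) (simp add: Cf)
  finally show ?thesis .
qed

lemma hdelta_empty: "0 < s \<Longrightarrow> 0 < \<delta> \<Longrightarrow> hdelta s \<delta> {} = 0"
  using hdelta_le_countable[of s \<delta> "{}" "{}" "\<lambda>_. {}"] by simp

text \<open>Near-optimal covers of the sets \<open>A i\<close>, with error e / 2^(i+1) each, are
  joined through the pairing of natural numbers.\<close>

lemma hdelta_subadditive:
  assumes s: "0 < s" and \<delta>: "0 < \<delta>"
  shows "hdelta s \<delta> (\<Union>i. A i) \<le> (\<Sum>i. hdelta s \<delta> (A i))"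
proof (rule ennreal_le_epsilon)
  fix e :: real assume e: "0 < e" and fin: "(\<Sum>i. hdelta s \<delta> (A i)) < top"
  have "\<exists>C\<in>hcover \<delta> (A i). (\<Sum>j. hcost s (C j)) \<le> hdelta s \<delta> (A i) + ennreal (e * (1/2) ^ Suc i)" for i
  proof -
    have "hdelta s \<delta> (A i) \<noteq> top"
      using ennreal_suminf_lessD[OF fin, of i] by simp
    then have "hdelta s \<delta> (A i) < hdelta s \<delta> (A i) + ennreal (e * (1/2) ^ Suc i)"
      using e by (simp add: less_top ennreal_zero_less_mult_iff)
    then show ?thesis unfolding hdelta_def[of s \<delta> "A i"] INF_less_iff by (metis less_imp_le)
  qed
  then obtain C where C: "\<And>i. C i \<in> hcover \<delta> (A i)"
    "\<And>i. (\<Sum>j. hcost s (C i j)) \<le> hdelta s \<delta> (A i) + ennreal (e * (1/2) ^ Suc i)" by metis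
  define D where "D n = case_prod C (prod_decode n)" for n
  have "D \<in> hcover \<delta> (\<Union>i. A i)"
  proof -
    have "(\<Union>i. A i) \<subseteq> (\<Union>n. D n)"
    proof
      fix x assume "x \<in> (\<Union>i. A i)"
      then obtain i where "x \<in> A i" by blast
      then obtain j where "x \<in> C i j" using C(1)[of i] by (auto simp: hcover_def)
      then have "x \<in> D (prod_encode (i, j))" by (simp add: D_def)
      then show "x \<in> (\<Union>n. D n)" by blast
    qed
    moreover have "bounded (D n) \<and> diameter (D n) \<le> \<delta>" for n
      using C(1) by (auto simp: D_def hcover_def split: prod.split)
    ultimately show ?thesis by (simp add: hcover_def)
  qed
  then have "hdelta s \<delta> (\<Union>i. A i) \<le> (\<Sum>n. hcost s (D n))" by (rule hdelta_le)
  also have "\<dots> = (\<Sum>n. (\<lambda>(i,j). hcost s (C i j)) (prod_decode n))" by (simp add: D_def case_prod_beta)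
  also have "\<dots> = (\<Sum>i. \<Sum>j. hcost s (C i j))" by (rule suminf_ennreal_2dimen) simp
  also have "\<dots> \<le> (\<Sum>i. hdelta s \<delta> (A i) + ennreal (e * (1/2) ^ Suc i))"
    using C(2) by (intro suminf_le) auto
  also have "\<dots> = (\<Sum>i. hdelta s \<delta> (A i)) + (\<Sum>i. ennreal (e * (1/2) ^ Suc i))"
    by (rule suminf_add[symmetric]) auto
  also have "(\<Sum>i. ennreal (e * (1/2) ^ Suc i)) = ennreal e"
  proof -
    have "(\<lambda>i. e * (1/2) ^ Suc i) sums (e * 1)" by (intro sums_mult power_half_series)
    then show ?thesis using e by (intro suminf_ennreal_eq) auto
  qed
  finally show "hdelta s \<delta> (\<Union>i. A i) \<le> (\<Sum>i. hdelta s \<delta> (A i)) + ennreal e" .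
qed

lemma hausdorff_outer_subadditive:
  assumes s: "0 < s"
  shows "hausdorff_outer s (\<Union>i::nat. A i) \<le> (\<Sum>i. hausdorff_outer s (A i))"
proof (rule hausdorff_outer_leI)
  fix \<delta> :: real assume \<delta>: "0 < \<delta>"
  have "hdelta s \<delta> (\<Union>i. A i) \<le> (\<Sum>i. hdelta s \<delta> (A i))" by (rule hdelta_subadditive[OF s \<delta>])
  also have "\<dots> \<le> (\<Sum>i. hausdorff_outer s (A i))" by (intro suminf_le hdelta_le_hausdorff \<delta>) auto
  finally show "hdelta s \<delta> (\<Union>i. A i) \<le> (\<Sum>i. hausdorff_outer s (A i))" .
qed

lemma hausdorff_outer_empty: "0 < s \<Longrightarrow> hausdorff_outer s {} = 0"
  using hausdorff_outer_leI[of s "{}" 0] by (simp add: hdelta_empty)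

lemma hausdorff_outer_Un_le:
  assumes s: "0 < s"
  shows "hausdorff_outer s (A \<union> B) \<le> hausdorff_outer s A + hausdorff_outer s B"
proof -
  have "hausdorff_outer s (\<Union>i. binaryset A B i) \<le> (\<Sum>i. hausdorff_outer s (binaryset A B i))"
    by (rule hausdorff_outer_subadditive[OF s])
  also have "\<dots> = hausdorff_outer s A + hausdorff_outer s B"
    by (rule suminf_binaryset_eq) (simp add: hausdorff_outer_empty[OF s])
  finally show ?thesis by (simp add: UN_binaryset_eq)
qed

text \<open>A set of diameter less than e cannot meet both A and B, so a fine cover of the union
  splits into a cover of A and one of B.\<close>

lemma hausdorff_outer_metric:
  assumes s: "0 < s" and e: "0 < e" and sep: "\<And>x y. x \<in> A \<Longrightarrow> y \<in> B \<Longrightarrow> e \<le> dist x y"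
  shows "hausdorff_outer s A + hausdorff_outer s B \<le> hausdorff_outer s (A \<union> B)"
proof -
  have key: "hdelta s \<delta> A + hdelta s \<delta> B \<le> hausdorff_outer s (A \<union> B)" if \<delta>: "0 < \<delta>" "\<delta> < e" for \<delta>
  proof -
    have "hdelta s \<delta> A + hdelta s \<delta> B \<le> hdelta s \<delta> (A \<union> B)"
      unfolding hdelta_def[of s \<delta> "A \<union> B"]
    proof (rule INF_greatest)
      fix C assume C: "C \<in> hcover \<delta> (A \<union> B)"
      define CA where "CA i = (if C i \<inter> A \<noteq> {} then C i else {})" for i
      define CB where "CB i = (if C i \<inter> A \<noteq> {} then {} else C i)" for i
      have "A \<subseteq> (\<Union>i. CA i)"
      proof
        fix x assume x: "x \<in> A"
        then obtain i where "x \<in> C i" using C by (auto simp: hcover_def)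
        then have "x \<in> CA i" using x by (auto simp: CA_def)
        then show "x \<in> (\<Union>i. CA i)" by blast
      qed
      then have 1: "CA \<in> hcover \<delta> A" using C \<delta> by (auto simp: hcover_def CA_def)
      have "B \<subseteq> (\<Union>i. CB i)"
      proof
        fix y assume y: "y \<in> B"
        then obtain i where i: "y \<in> C i" using C by (auto simp: hcover_def)
        have "C i \<inter> A = {}"
        proof (rule ccontr)
          assume "C i \<inter> A \<noteq> {}"
          then obtain x where x: "x \<in> C i" "x \<in> A" by blast
          have "dist x y \<le> diameter (C i)" using C x i by (auto simp: hcover_def intro: diameter_bounded_bound)
          also have "\<dots> \<le> \<delta>" using C by (auto simp: hcover_def)
          finally show False using sep[OF x(2) y] \<delta> by simp
        qed
        then show "y \<in> (\<Union>i. CB i)" using i by (auto simp: CB_def)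
      qed
      then have 2: "CB \<in> hcover \<delta> B" using C \<delta> by (auto simp: hcover_def CB_def)
      have "hdelta s \<delta> A + hdelta s \<delta> B \<le> (\<Sum>i. hcost s (CA i)) + (\<Sum>i. hcost s (CB i))"
        using hdelta_le[OF 1] hdelta_le[OF 2] by (rule add_mono)
      also have "\<dots> = (\<Sum>i. hcost s (CA i) + hcost s (CB i))" by (rule suminf_add) auto
      also have "\<dots> = (\<Sum>i. hcost s (C i))"
        using s by (intro suminf_cong) (simp add: CA_def CB_def)
      finally show "hdelta s \<delta> A + hdelta s \<delta> B \<le> (\<Sum>i. hcost s (C i))" .
    qed
    also have "\<dots> \<le> hausdorff_outer s (A \<union> B)" by (rule hdelta_le_hausdorff[OF \<delta>(1)])
    finally show ?thesis .
  qed
  have "hdelta s \<delta> A + hdelta s \<delta>' B \<le> hausdorff_outer s (A \<union> B)" if "0 < \<delta>" "0 < \<delta>'" for \<delta> \<delta>'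
  proof -
    define d where "d = min (min \<delta> \<delta>') (e/2)"
    have "hdelta s \<delta> A + hdelta s \<delta>' B \<le> hdelta s d A + hdelta s d B"
      by (intro add_mono hdelta_antimono) (auto simp: d_def)
    also have "\<dots> \<le> hausdorff_outer s (A \<union> B)" using that e by (intro key) (auto simp: d_def)
    finally show ?thesis .
  qed
  then have "(SUP \<delta>'\<in>{0<..}. hdelta s \<delta> A + hdelta s \<delta>' B) \<le> hausdorff_outer s (A \<union> B)" if "0 < \<delta>" for \<delta>
    using that by (intro SUP_least) auto
  then have "hdelta s \<delta> A + hausdorff_outer s B \<le> hausdorff_outer s (A \<union> B)" if "0 < \<delta>" for \<delta>
    using that by (simp add: hausdorff_outer_eq[of s B] ennreal_SUP_add_right[symmetric] del: ennreal_SUP_add_right)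
  then have "(SUP \<delta>\<in>{0<..}. hdelta s \<delta> A + hausdorff_outer s B) \<le> hausdorff_outer s (A \<union> B)"
    by (intro SUP_least) auto
  then show ?thesis by (subst (asm) ennreal_SUP_add_left) (auto simp: hausdorff_outer_eq[of s A])
qed

text \<open>The shells at distance between \<open>1/(k+2)\<close> and \<open>1/(k+1)\<close> from a closed set have summable
  measure, since shells of equal parity are positively separated.\<close>

lemma hausdorff_outer_closed_split:
  fixes F :: "'a::euclidean_space set"
  assumes s: "0 < s" and F: "closed F" "F \<noteq> {}"
  shows "hausdorff_outer s (A \<inter> F) + hausdorff_outer s (A - F) \<le> hausdorff_outer s A"
proof (cases "hausdorff_outer s A = top")
  case True then show ?thesis by simp
next
  case fin: False
  let ?H = "hausdorff_outer s"
  define U where "U n = {x \<in> A. 1 / real (Suc n) \<le> infdist x F}" for n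
  define R where "R n = U (Suc n) - U n" for n
  have Rd: "infdist x F < 1 / real (Suc n)" "1 / real (Suc (Suc n)) \<le> infdist x F" if "x \<in> R n" for x n
    using that by (auto simp: R_def U_def)
  have mono: "U n \<subseteq> U (Suc n)" for n
  proof
    fix x assume "x \<in> U n"
    then show "x \<in> U (Suc n)" using frac_le[of 1 1 "real (Suc n)" "real (Suc (Suc n))"] by (auto simp: U_def)
  qed
  have sub: "U n \<subseteq> A" for n by (auto simp: U_def)
  have RU: "A - F \<subseteq> U n \<union> (\<Union>k. R (k + n))" for n
  proof
    fix x assume x: "x \<in> A - F"
    then have "0 < infdist x F" using F by (simp add: in_closed_iff_infdist_zero infdist_pos_not_in_closed)
    then obtain N where "1 / real (Suc N) < infdist x F" using nat_approx_posE by blast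
    then have "x \<in> U N" using x by (auto simp: U_def)
    moreover have "x \<in> U n \<union> (\<Union>k. R (k + n))" if "x \<in> U (n + j)" for j
      using that
    proof (induction j)
      case (Suc j)
      then show ?case by (cases "x \<in> U (n + j)") (auto simp: R_def add.commute)
    qed simp
    moreover have "U N \<subseteq> U (n + N)" by (rule lift_Suc_mono_le[of U, OF mono]) simp
    ultimately show "x \<in> U n \<union> (\<Union>k. R (k + n))" by blast
  qed
  have sepR: "?H (\<Union>k<N. R (2 * k + j)) = (\<Sum>k<N. ?H (R (2 * k + j)))" for N j
  proof (induction N)
    case 0 then show ?case by (simp add: hausdorff_outer_empty s)
  next
    case (Suc N)
    let ?A = "\<Union>k<N. R (2 * k + j)" and ?B = "R (2 * N + j)"
    define e where "e = 1 / real (2 * N + j) - 1 / real (Suc (2 * N + j))"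
    \<comment> \<open>For N = 0 the first union is empty. The case is separate because the gap e
      involves 1 / (2 N + j), which is 0 for N = j = 0.\<close>
    have "?H ?A + ?H ?B \<le> ?H (?A \<union> ?B)"
    proof (cases "N = 0")
      case True then show ?thesis by (simp add: hausdorff_outer_empty s)
    next
      case N: False
      show ?thesis
      proof (rule hausdorff_outer_metric[OF s])
        have "1 / real (Suc (2 * N + j)) < 1 / real (2 * N + j)" using N by (intro frac_less2) auto
        then show "0 < e" by (simp add: e_def)
        fix x y assume "x \<in> ?A" and y: "y \<in> ?B"
        then obtain k where k: "k < N" "x \<in> R (2 * k + j)" by blast
        have "1 / real (2 * N + j) \<le> 1 / real (Suc (Suc (2 * k + j)))" using k by (intro frac_le) auto
        then have "1 / real (2 * N + j) \<le> infdist x F" using Rd(2)[OF k(2)] by linarith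
        moreover have "infdist y F < 1 / real (Suc (2 * N + j))" using Rd(1)[OF y] by simp
        moreover have "infdist x F \<le> infdist y F + dist x y" by (rule infdist_triangle)
        ultimately show "e \<le> dist x y" unfolding e_def by linarith
      qed
    qed
    then have "?H (?A \<union> ?B) = ?H ?A + ?H ?B" by (intro antisym hausdorff_outer_Un_le[OF s])
    moreover have "(\<Union>k<Suc N. R (2 * k + j)) = ?A \<union> ?B" by (auto simp: less_Suc_eq)
    ultimately show ?case using Suc by simp
  qed
  have sums: "(\<Sum>k. ?H (R (2 * k + j))) \<le> ?H A" for j
  proof (rule suminf_le_const)
    show "(\<Sum>k<N. ?H (R (2 * k + j))) \<le> ?H A" for N
      unfolding sepR[symmetric] by (rule hausdorff_outer_mono) (auto simp: R_def U_def)
  qed simp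
  have "(\<Sum>k. ?H (R k)) \<le> ?H A + ?H A"
  proof (rule suminf_le_const)
    fix N
    have "(\<Sum>k<N. ?H (R k)) \<le> (\<Sum>k<2 * N. ?H (R k))" by (intro sum_mono2) auto
    also have "\<dots> = (\<Sum>k<N. ?H (R (2 * k))) + (\<Sum>k<N. ?H (R (2 * k + 1)))"
      by (induction N) (simp_all add: algebra_simps)
    also have "\<dots> \<le> ?H A + ?H A"
    proof (rule add_mono)
      show "(\<Sum>k<N. ?H (R (2 * k))) \<le> ?H A"
        using sum_le_suminf[of "\<lambda>k. ?H (R (2 * k + 0))" "{..<N}"] sums[of 0] by (auto intro: order_trans)
      show "(\<Sum>k<N. ?H (R (2 * k + 1))) \<le> ?H A"
        using sum_le_suminf[of "\<lambda>k. ?H (R (2 * k + 1))" "{..<N}"] sums[of 1] by (auto intro: order_trans)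
    qed
    finally show "(\<Sum>k<N. ?H (R k)) \<le> ?H A + ?H A" .
  qed simp
  then have fs: "(\<Sum>k. ?H (R k)) \<noteq> top" using fin by (metis ennreal_add_eq_top neq_top_trans)
  \<comment> \<open>Finite total mass of the shells makes the remainders tend to 0, so the sets
    \<open>U n\<close> exhaust A - F up to a vanishing error.\<close>
  have tail: "(\<lambda>n. \<Sum>k. ?H (R (k + n))) \<longlonglongrightarrow> 0"
  proof -
    have rf: "?H (R k) \<noteq> top" for k using fs ennreal_suminf_lessD[of "\<lambda>k. ?H (R k)" top k] by (simp add: less_top)
    define r where "r k = enn2real (?H (R k))" for k
    have rr: "?H (R k) = ennreal (r k)" for k using rf by (simp add: r_def less_top)
    have r0: "0 \<le> r k" for k by (simp add: r_def)
    have sr: "summable r" using fs r0 by (intro summable_suminf_not_top) (auto simp: rr)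
    have "(\<lambda>n. \<Sum>k. r (k + n)) \<longlonglongrightarrow> 0" by (rule suminf_exist_split2[OF sr])
    then have "(\<lambda>n. ennreal (\<Sum>k. r (k + n))) \<longlonglongrightarrow> ennreal 0" by (rule tendsto_ennrealI)
    moreover have "(\<Sum>k. ?H (R (k + n))) = ennreal (\<Sum>k. r (k + n))" for n
      unfolding rr by (rule suminf_ennreal2) (use r0 sr in \<open>auto simp: summable_iff_shift\<close>)
    ultimately show ?thesis by simp
  qed
  have "?H (A \<inter> F) + ?H (A - F) \<le> ?H A + (\<Sum>k. ?H (R (k + n)))" for n
  proof -
    have "?H (A \<inter> F) + ?H (U n) \<le> ?H (A \<inter> F \<union> U n)"
    proof (rule hausdorff_outer_metric[OF s])
      show "0 < 1 / real (Suc n)" by simp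
      fix x y assume "x \<in> A \<inter> F" "y \<in> U n"
      then show "1 / real (Suc n) \<le> dist x y" using infdist_le[of x F y] by (auto simp: U_def dist_commute)
    qed
    also have "\<dots> \<le> ?H A" using sub by (intro hausdorff_outer_mono) auto
    finally have 1: "?H (A \<inter> F) + ?H (U n) \<le> ?H A" .
    have "?H (A - F) \<le> ?H (U n \<union> (\<Union>k. R (k + n)))" by (rule hausdorff_outer_mono[OF RU])
    also have "\<dots> \<le> ?H (U n) + ?H (\<Union>k. R (k + n))" by (rule hausdorff_outer_Un_le[OF s])
    also have "\<dots> \<le> ?H (U n) + (\<Sum>k. ?H (R (k + n)))" by (intro add_left_mono hausdorff_outer_subadditive[OF s])
    finally have "?H (A \<inter> F) + ?H (A - F) \<le> ?H (A \<inter> F) + (?H (U n) + (\<Sum>k. ?H (R (k + n))))" by (rule add_left_mono)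
    also have "\<dots> \<le> ?H A + (\<Sum>k. ?H (R (k + n)))" using add_right_mono[OF 1] by (simp add: add.assoc)
    finally show ?thesis .
  qed
  moreover have "(\<lambda>n. ?H A + (\<Sum>k. ?H (R (k + n)))) \<longlonglongrightarrow> ?H A + 0"
    by (intro tendsto_add tendsto_const tail)
  ultimately show ?thesis by (metis (no_types, lifting) LIMSEQ_le_const add.right_neutral)
qed

text \<open>\<open>measure_of\<close> falls back to the zero measure unless the set function is a
  measure on the generated \<sigma>-algebra. Caratheodory's theorem supplies this: closed sets split
  every set additively, hence so do all Borel sets.\<close>

lemma emeasure_hausdorff:
  assumes s: "0 < s" and A: "A \<in> sets (borel :: 'a::euclidean_space measure)"
  shows "emeasure (hausdorff_measure s) A = hausdorff_outer s A"
proof -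
  let ?H = "hausdorff_outer s :: 'a set \<Rightarrow> ennreal"
  interpret P: sigma_algebra "UNIV :: 'a set" "Pow UNIV" by (rule sigma_algebra_Pow)
  have oms: "outer_measure_space (Pow UNIV) ?H"
    unfolding outer_measure_space_def positive_def increasing_def countably_subadditive_def
    using hausdorff_outer_mono hausdorff_outer_subadditive[OF s] hausdorff_outer_empty[OF s] by auto
  let ?L = "lambda_system UNIV (Pow UNIV) ?H"
  have ms: "measure_space UNIV ?L ?H" by (rule P.caratheodory_lemma[OF oms])
  then interpret L: sigma_algebra UNIV ?L by (simp add: measure_space_def)
  have cl: "F \<in> ?L" if F: "closed F" for F
  proof (cases "F = {}")
    case True then show ?thesis using L.empty_sets by simp
  next
    case False
    have "?H (F \<inter> X) + ?H ((UNIV - F) \<inter> X) = ?H X" for X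
    proof (rule antisym)
      show "?H (F \<inter> X) + ?H ((UNIV - F) \<inter> X) \<le> ?H X"
        using hausdorff_outer_closed_split[OF s F False, of X] by (simp add: Int_commute Diff_eq)
      have "X = (F \<inter> X) \<union> ((UNIV - F) \<inter> X)" by blast
      then show "?H X \<le> ?H (F \<inter> X) + ?H ((UNIV - F) \<inter> X)" using hausdorff_outer_Un_le[OF s] by metis
    qed
    then show ?thesis by (simp add: lambda_system_def)
  qed
  have sub: "sets borel \<subseteq> ?L"
    using L.sigma_sets_subset[of "Collect closed"] cl by (auto simp: borel_eq_closed)
  have "measure_space UNIV (sets borel) ?H"
    by (rule measure_down[OF ms _ sub]) (metis sets.sigma_algebra_axioms space_borel)
  then have "positive (sets borel) ?H" "countably_additive (sets borel) ?H" by (auto simp: measure_space_def)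
  then show ?thesis
    unfolding hausdorff_measure_def using A sets.sigma_algebra_axioms[of "borel :: 'a measure"]
    by (intro emeasure_measure_of_sigma) auto
qed

lemma sets_hausdorff [simp, measurable_cong]: "sets (hausdorff_measure s :: 'a::euclidean_space measure) = sets borel"
  unfolding hausdorff_measure_def
  by (metis sets.sigma_sets_eq sets_measure_of space_borel top_greatest Pow_UNIV)

lemma space_hausdorff [simp]: "space (hausdorff_measure s) = UNIV"
  using sets_eq_imp_space_eq[OF sets_hausdorff] by simp

section \<open>Orthonormal coordinates and Lebesgue measure\<close>

lemma orthonormal_expand:
  fixes B :: "'a::euclidean_space set"
  assumes B: "orthonormal B" and sp: "span B = UNIV"
  shows "(\<Sum>b\<in>B. (y \<bullet> b) *\<^sub>R b) = y"
proof -
  define z where "z = y - (\<Sum>b\<in>B. (y \<bullet> b) *\<^sub>R b)"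
  have fin: "finite B" using B by (simp add: orthonormal_def)
  have zb: "z \<bullet> b = 0" if b: "b \<in> B" for b
  proof -
    have "(\<Sum>b'\<in>B. (y \<bullet> b') * (b' \<bullet> b)) = (\<Sum>b'\<in>B. if b = b' then y \<bullet> b' else 0)"
      using B b by (intro sum.cong) (auto simp: orthonormal_def)
    also have "\<dots> = y \<bullet> b" using fin b by simp
    finally show ?thesis by (simp add: z_def inner_diff_left inner_sum_left)
  qed
  have "orthogonal z x" if "x \<in> span B" for x
    by (rule orthogonal_to_span[OF that]) (simp add: orthogonal_def zb)
  then have "z \<bullet> z = 0" using sp by (auto simp: orthogonal_def)
  then show ?thesis by (simp add: z_def)
qed

lemma orthonormal_norm_sq:
  fixes B :: "'a::euclidean_space set"
  assumes B: "orthonormal B" and sp: "span B = UNIV"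
  shows "(norm y)\<^sup>2 = (\<Sum>b\<in>B. (y \<bullet> b)\<^sup>2)"
proof -
  have "y \<bullet> y = y \<bullet> (\<Sum>b\<in>B. (y \<bullet> b) *\<^sub>R b)" by (simp add: orthonormal_expand[OF assms])
  also have "\<dots> = (\<Sum>b\<in>B. (y \<bullet> b)\<^sup>2)" by (simp add: inner_sum_right power2_eq_square)
  finally show ?thesis by (simp add: power2_norm_eq_inner)
qed

lemma orthonormal_independent: "orthonormal (B::'a::euclidean_space set) \<Longrightarrow> independent B"
proof (rule pairwise_orthogonal_independent)
  assume B: "orthonormal B"
  then show "pairwise orthogonal B" by (auto simp: orthonormal_def pairwise_def orthogonal_def)
  show "0 \<notin> B"
  proof
    assume "0 \<in> B"
    then have "(0::'a) \<bullet> 0 = 1" using B unfolding orthonormal_def by metis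
    then show False by simp
  qed
qed

lemma orthonormal_extend:
  fixes B :: "'a::euclidean_space set"
  assumes B: "orthonormal B"
  obtains B' where "orthonormal (B \<union> B')" "B \<inter> B' = {}" "span (B \<union> B') = UNIV"
proof -
  define Q where "Q = {x. \<forall>b\<in>B. x \<bullet> b = 0}"
  have Q: "subspace Q" by (auto simp: Q_def subspace_def inner_add_left)
  obtain B' where B': "orthonormal B'" "B' \<subseteq> Q" "span B' = Q" using orthonormal_basis_exists[OF Q refl] by blast
  have o: "b \<bullet> b' = 0" "b' \<bullet> b = 0" if "b \<in> B" "b' \<in> B'" for b b'
    using B' that by (auto simp: Q_def inner_commute)
  have disj: "B \<inter> B' = {}" using o B by (fastforce simp: orthonormal_def)
  show thesis
  proof (rule that[OF _ disj])
    show "orthonormal (B \<union> B')" using B B'(1) o disj by (auto simp: orthonormal_def)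
    have "x \<in> span (B \<union> B')" for x
    proof -
      have sB: "subspace (span B)" by simp
      have "orej (span B) x \<bullet> b = 0" if "b \<in> B" for b using orej_orth[OF sB span_base[OF that]] .
      then have "orej (span B) x \<in> span B'" by (simp add: B' Q_def)
      then have "orej (span B) x \<in> span (B \<union> B')" using span_mono[of B' "B \<union> B'"] by blast
      moreover have "oproj (span B) x \<in> span (B \<union> B')" using oproj_in[OF sB, of x] span_mono[of B "B \<union> B'"] by blast
      ultimately have "oproj (span B) x + orej (span B) x \<in> span (B \<union> B')" by (rule span_add[rotated])
      then show ?thesis by (simp add: orej_def)
    qed
    then show "span (B \<union> B') = UNIV" by blast
  qed
qed

text \<open>Lebesgue measure is invariant under a linear isometry, because an open set is filled up to a null set
  by disjoint balls, whose volume depends on the radius only.\<close>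

lemma lborel_isometry_open:
  fixes S T :: "'a::euclidean_space \<Rightarrow> 'a"
  assumes iso: "\<And>x y. dist (T x) (T y) = dist x y" and TS: "\<And>x. T (S x) = x" "\<And>x. S (T x) = x" and U: "open U"
  shows "emeasure lborel (S -` U) = emeasure lborel U"
proof -
  have isoS: "dist (S x) (S y) = dist x y" for x y using iso[of "S x" "S y"] by (simp add: TS)
  have pre: "S -` X = T ` X" for X by (auto simp: TS image_iff) (metis TS)
  have Tball: "T ` ball x r = ball (T x) r" for x r
  proof (intro set_eqI iffI)
    fix z assume "z \<in> ball (T x) r"
    then have "S z \<in> ball x r" using isoS[of "T x" z] by (simp add: TS)
    then show "z \<in> T ` ball x r" by (metis TS(1) imageI)
  qed (auto simp: iso)
  define K where "K = {(x, r). 0 < r \<and> ball x r \<subseteq> U}"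
  obtain C where C: "countable C" "C \<subseteq> K" "pairwise (\<lambda>i j. disjnt (ball (fst i) (snd i)) (ball (fst j) (snd j))) C"
    "negligible (U - (\<Union>i\<in>C. ball (fst i) (snd i)))"
  proof (rule Vitali_covering_theorem_balls[of U K fst snd])
    fix x :: 'a and d :: real assume x: "x \<in> U" and d: "0 < d"
    obtain e where e: "0 < e" "ball x e \<subseteq> U" using U x openE by blast
    let ?r = "min e (d/2)"
    have "ball x ?r \<subseteq> U" using e(2) by auto
    then have "(x, ?r) \<in> K" "x \<in> ball (fst (x, ?r)) (snd (x, ?r))" "snd (x, ?r) < d" using e d by (auto simp: K_def)
    then show "\<exists>i. i \<in> K \<and> x \<in> ball (fst i) (snd i) \<and> snd i < d" by blast
  qed blast
  let ?D = "\<Union>i\<in>C. ball (fst i) (snd i)"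
  have DU: "?D \<subseteq> U" using C(2) by (fastforce simp: K_def)
  have lip: "continuous_on UNIV S" "continuous_on UNIV T"
    by (auto intro!: lipschitz_on_continuous_on[of 1] lipschitz_onI simp: isoS iso)
  have oD: "open ?D" by auto
  have oSU: "open (S -` U)" "open (S -` ?D)" using lip U oD by (auto intro!: open_vimage)
  have e1: "emeasure lborel X = emeasure lborel Y" if "Y \<subseteq> X" "open X" "open Y" "negligible (X - Y)" for X Y :: "'a set"
  proof -
    have "X - Y \<in> null_sets lborel" using that by (auto simp: negligible_iff_null_sets null_sets_def emeasure_completion)
    then have "emeasure lborel (Y \<union> (X - Y)) = emeasure lborel Y" using that by (intro emeasure_Un_null_set) auto
    moreover have "Y \<union> (X - Y) = X" using that by blast
    ultimately show ?thesis by simp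
  qed
  have "emeasure lborel U = emeasure lborel ?D" by (rule e1[OF DU U oD C(4)])
  also have "\<dots> = (\<integral>\<^sup>+i. emeasure lborel (ball (fst i) (snd i)) \<partial>count_space C)"
    using C by (intro emeasure_UN_countable) (auto simp: disjoint_family_on_def pairwise_def disjnt_def)
  also have "\<dots> = (\<integral>\<^sup>+i. emeasure lborel (ball (T (fst i)) (snd i)) \<partial>count_space C)"
    by (rule nn_integral_cong) (metis emeasure_ball emeasure_empty ball_eq_empty linear)
  also have "\<dots> = emeasure lborel (\<Union>i\<in>C. ball (T (fst i)) (snd i))"
  proof (rule emeasure_UN_countable[symmetric])
    show "disjoint_family_on (\<lambda>i. ball (T (fst i)) (snd i)) C"
      unfolding disjoint_family_on_def
    proof (intro ballI impI)
      fix i j assume "i \<in> C" "j \<in> C" "i \<noteq> j"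
      then have "ball (fst i) (snd i) \<inter> ball (fst j) (snd j) = {}" using C(3) by (auto simp: pairwise_def disjnt_def)
      moreover have "inj T" by (metis TS(2) injI)
      ultimately show "ball (T (fst i)) (snd i) \<inter> ball (T (fst j)) (snd j) = {}"
        unfolding Tball[symmetric] by (simp add: image_Int[symmetric])
    qed
  qed (use C in auto)
  also have "(\<Union>i\<in>C. ball (T (fst i)) (snd i)) = S -` ?D" unfolding pre image_UN Tball ..
  also have "emeasure lborel (S -` ?D) = emeasure lborel (S -` U)"
  proof (rule e1[symmetric])
    show "S -` ?D \<subseteq> S -` U" using DU by blast
    have "negligible (T ` (U - ?D))"
      by (rule negligible_locally_Lipschitz_image[OF _ C(4)]) (auto intro!: exI[of _ UNIV] exI[of _ 1] simp: iso[unfolded dist_norm])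
    moreover have "S -` U - S -` ?D = T ` (U - ?D)" unfolding pre[symmetric] by blast
    ultimately show "negligible (S -` U - S -` ?D)" by simp
  qed (use oSU in auto)
  finally show ?thesis by simp
qed

text \<open>The map S that turns coordinates with respect to B into standard coordinates is an
  isometry, so it preserves Lebesgue measure, and the set is the preimage of an ordinary
  box.\<close>

lemma emeasure_orthonormal_box:
  fixes B :: "'a::euclidean_space set"
  assumes B: "orthonormal B" and sp: "span B = UNIV" and lu: "\<And>b. b \<in> B \<Longrightarrow> l b \<le> u b"
  shows "{x. \<forall>b\<in>B. l b \<le> x \<bullet> b \<and> x \<bullet> b \<le> u b} \<in> sets borel"
    "emeasure lborel {x. \<forall>b\<in>B. l b \<le> x \<bullet> b \<and> x \<bullet> b \<le> u b} = ennreal (\<Prod>b\<in>B. u b - l b)"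
proof -
  have fin: "finite B" using B by (simp add: orthonormal_def)
  have "card B = DIM('a)"
    using dim_eq_card_independent[OF orthonormal_independent[OF B]] dim_span[of B] sp by simp
  then obtain g where g: "bij_betw g (Basis::'a set) B" using finite_same_card_bij[of "Basis::'a set" B] fin by auto
  define S where "S y = (\<Sum>i\<in>Basis. (y \<bullet> g i) *\<^sub>R i)" for y
  define T where "T x = (\<Sum>i\<in>Basis. (x \<bullet> i) *\<^sub>R g i)" for x
  have Si: "S y \<bullet> i = y \<bullet> g i" if "i \<in> Basis" for y i using that by (simp add: S_def)
  have gB: "g i \<in> B" if "i \<in> Basis" for i using g that by (auto simp: bij_betw_def)
  have Tg: "T x \<bullet> g i = x \<bullet> i" if i: "i \<in> Basis" for x i
  proof -
    have "T x \<bullet> g i = (\<Sum>j\<in>Basis. if i = j then x \<bullet> j else 0)"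
      unfolding T_def inner_sum_left
    proof (rule sum.cong)
      fix j :: 'a assume j: "j \<in> Basis"
      have "g j \<bullet> g i = (if i = j then 1 else 0)"
        using B gB[OF i] gB[OF j] g i j by (auto simp: orthonormal_def bij_betw_def inj_on_def)
      then show "(x \<bullet> j) *\<^sub>R g j \<bullet> g i = (if i = j then x \<bullet> j else 0)" by simp
    qed simp
    then show ?thesis using i by simp
  qed
  have TS: "T (S y) = y" for y
  proof -
    have "T (S y) = (\<Sum>i\<in>Basis. (y \<bullet> g i) *\<^sub>R g i)" unfolding T_def by (rule sum.cong) (simp_all add: Si)
    also have "\<dots> = (\<Sum>b\<in>B. (y \<bullet> b) *\<^sub>R b)" by (rule sum.reindex_bij_betw[OF g])
    finally show ?thesis by (simp add: orthonormal_expand[OF B sp])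
  qed
  have ST: "S (T x) = x" for x by (rule euclidean_eqI) (simp add: Si Tg)
  have linS: "S x - S y = S (x - y)" for x y
    by (simp add: S_def inner_diff_left scaleR_diff_left sum_subtractf)
  have nS: "norm (S y) = norm y" for y
  proof -
    have "(norm (S y))\<^sup>2 = (\<Sum>i\<in>Basis. (y \<bullet> g i)\<^sup>2)"
      unfolding power2_norm_eq_inner euclidean_inner[of "S y" "S y"] by (simp add: Si power2_eq_square)
    also have "\<dots> = (\<Sum>b\<in>B. (y \<bullet> b)\<^sup>2)" by (rule sum.reindex_bij_betw[OF g])
    finally have "(norm (S y))\<^sup>2 = (norm y)\<^sup>2" using orthonormal_norm_sq[OF B sp, of y] by simp
    then show ?thesis by (rule power2_eq_imp_eq) auto
  qed
  have isoS: "dist (S x) (S y) = dist x y" for x y by (simp add: dist_norm linS nS)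
  have iso: "dist (T x) (T y) = dist x y" for x y using isoS[of "T x" "T y"] by (simp add: ST)
  have "continuous_on UNIV S" by (auto intro!: lipschitz_on_continuous_on[of 1] lipschitz_onI simp: isoS)
  then have mS: "S \<in> borel_measurable borel" by (rule borel_measurable_continuous_onI)
  have M: "lborel = distr lborel borel S"
  proof (rule lborel_eqI)
    fix a b :: 'a assume ab: "\<And>i. i \<in> Basis \<Longrightarrow> a \<bullet> i \<le> b \<bullet> i"
    have "emeasure (distr lborel borel S) (box a b) = emeasure lborel (S -` box a b)"
      using mS by (subst emeasure_distr) auto
    also have "\<dots> = emeasure lborel (box a b)"
      by (rule lborel_isometry_open[OF iso TS ST open_box])
    finally show "emeasure (distr lborel borel S) (box a b) = ennreal (\<Prod>i\<in>Basis. (b - a) \<bullet> i)" using ab by simp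
  qed simp
  define a where "a = (\<Sum>i\<in>Basis. l (g i) *\<^sub>R i)"
  define b where "b = (\<Sum>i\<in>Basis. u (g i) *\<^sub>R i)"
  have eq: "{x. \<forall>b\<in>B. l b \<le> x \<bullet> b \<and> x \<bullet> b \<le> u b} = S -` cbox a b"
    using g by (auto simp: a_def b_def mem_box Si bij_betw_def)
  show "{x. \<forall>b\<in>B. l b \<le> x \<bullet> b \<and> x \<bullet> b \<le> u b} \<in> sets borel"
    unfolding eq using measurable_sets[OF mS, of "cbox a b"] by simp
  have "emeasure lborel (S -` cbox a b) = emeasure (distr lborel borel S) (cbox a b)"
    using mS by (subst emeasure_distr) auto
  also have "\<dots> = emeasure lborel (cbox a b)" using M by simp
  also have "\<dots> = ennreal (\<Prod>i\<in>Basis. (b - a) \<bullet> i)"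
    using lu gB by (intro emeasure_lborel_cbox) (simp add: a_def b_def)
  also have "(\<Prod>i\<in>Basis. (b - a) \<bullet> i) = (\<Prod>i\<in>Basis. u (g i) - l (g i))"
    by (rule prod.cong) (auto simp: a_def b_def inner_diff_left)
  also have "\<dots> = (\<Prod>b\<in>B. u b - l b)" by (rule prod.reindex_bij_betw[OF g])
  finally show "emeasure lborel {x. \<forall>b\<in>B. l b \<le> x \<bullet> b \<and> x \<bullet> b \<le> u b} = ennreal (\<Prod>b\<in>B. u b - l b)"
    unfolding eq .
qed

text \<open>Compares the cost (diameter / 2)^k of a set with the volume (2 diameter)^k of a box
  around it.\<close>

definition hconst :: "nat \<Rightarrow> real" where "hconst k = unit_ball_vol (real k) / 4 ^ k"

lemma hconst_pos: "0 < hconst k" by (simp add: hconst_def)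

text \<open>If A projects onto a k-dimensional box, a cover of A induces a cover of that box times a
  unit cube in the complementary directions, by boxes of the same kind. Lebesgue measure of the
  whole space then gives the bound.\<close>

lemma hausdorff_outer_ge_box:
  fixes A B :: "'a::euclidean_space set"
  assumes k: "0 < k" and B: "orthonormal B" "card B = k" and l: "\<And>b. b \<in> B \<Longrightarrow> 0 \<le> l b"
    and A: "\<And>t. (\<And>b. b \<in> B \<Longrightarrow> 0 \<le> t b \<and> t b \<le> l b) \<Longrightarrow> \<exists>x\<in>A. \<forall>b\<in>B. (x - c) \<bullet> b = t b"
  shows "ennreal (hconst k * (\<Prod>b\<in>B. l b)) \<le> hausdorff_outer k A"
proof -
  have fin: "finite B" using B by (simp add: orthonormal_def)
  obtain B' where B': "orthonormal (B \<union> B')" "B \<inter> B' = {}" "span (B \<union> B') = UNIV"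
    using orthonormal_extend[OF B(1)] .
  have fin': "finite B'" using B' by (simp add: orthonormal_def)
  \<comment> \<open>Directions outside B get the side [-1/2, 1/2] and contribute the factor 1 to
    every volume.\<close>
  define lo where "lo e p b = (if b \<in> B then p \<bullet> b - e else (-1/2::real))" for e and p :: 'a and b
  define up where "up e p b = (if b \<in> B then p \<bullet> b + e else (1/2::real))" for e and p :: 'a and b
  define D where "D e p = {x. \<forall>b\<in>B \<union> B'. lo e p b \<le> x \<bullet> b \<and> x \<bullet> b \<le> up e p b}" for e p
  have D: "D e p \<in> sets borel" "emeasure lborel (D e p) = ennreal ((2 * e) ^ k)" if "0 \<le> e" for e p
  proof -
    have lu: "lo e p b \<le> up e p b" if "b \<in> B \<union> B'" for b using \<open>0 \<le> e\<close> by (simp add: lo_def up_def)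
    show "D e p \<in> sets borel" unfolding D_def by (rule emeasure_orthonormal_box(1)[OF B'(1,3) lu])
    have "emeasure lborel (D e p) = ennreal (\<Prod>b\<in>B \<union> B'. up e p b - lo e p b)"
      unfolding D_def by (rule emeasure_orthonormal_box(2)[OF B'(1,3) lu])
    also have "(\<Prod>b\<in>B \<union> B'. up e p b - lo e p b) = (\<Prod>b\<in>B. up e p b - lo e p b) * (\<Prod>b\<in>B'. up e p b - lo e p b)"
      by (rule prod.union_disjoint[OF fin fin' B'(2)])
    also have "(\<Prod>b\<in>B. up e p b - lo e p b) = (\<Prod>b\<in>B. 2 * e)" by (rule prod.cong) (auto simp: up_def lo_def)
    also have "\<dots> = (2 * e) ^ k" using B by simp
    also have "(\<Prod>b\<in>B'. up e p b - lo e p b) = (\<Prod>b\<in>B'. 1)" using B'(2) by (intro prod.cong) (auto simp: up_def lo_def)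
    finally show "emeasure lborel (D e p) = ennreal ((2 * e) ^ k)" by simp
  qed
  define L where "L b = (if b \<in> B then c \<bullet> b else (-1/2::real))" for b
  define U where "U b = (if b \<in> B then c \<bullet> b + l b else (1/2::real))" for b
  define X where "X = {x. \<forall>b\<in>B \<union> B'. L b \<le> x \<bullet> b \<and> x \<bullet> b \<le> U b}"
  have X: "X \<in> sets borel" "emeasure lborel X = ennreal (\<Prod>b\<in>B. l b)"
  proof -
    have lu: "L b \<le> U b" if "b \<in> B \<union> B'" for b using l by (simp add: L_def U_def)
    show "X \<in> sets borel" unfolding X_def by (rule emeasure_orthonormal_box(1)[OF B'(1,3) lu])
    have "emeasure lborel X = ennreal (\<Prod>b\<in>B \<union> B'. U b - L b)"
      unfolding X_def by (rule emeasure_orthonormal_box(2)[OF B'(1,3) lu])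
    also have "(\<Prod>b\<in>B \<union> B'. U b - L b) = (\<Prod>b\<in>B. U b - L b) * (\<Prod>b\<in>B'. U b - L b)"
      by (rule prod.union_disjoint[OF fin fin' B'(2)])
    also have "(\<Prod>b\<in>B. U b - L b) = (\<Prod>b\<in>B. l b)" by (rule prod.cong) (auto simp: U_def L_def)
    also have "(\<Prod>b\<in>B'. U b - L b) = (\<Prod>b\<in>B'. 1)" using B'(2) by (intro prod.cong) (auto simp: U_def L_def)
    finally show "emeasure lborel X = ennreal (\<Prod>b\<in>B. l b)" by simp
  qed
  have "ennreal (hconst k * (\<Prod>b\<in>B. l b)) \<le> hdelta k 1 A"
    unfolding hdelta_def
  proof (rule INF_greatest)
    fix C assume C: "C \<in> hcover 1 A"
    \<comment> \<open>A base point of the covering set; for an empty one it is arbitrary, and the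
      box is degenerate.\<close>
    define p where "p i = (SOME x. x \<in> C i)" for i
    have p: "p i \<in> C i" if "x \<in> C i" for x i unfolding p_def by (rule someI[of "\<lambda>x. x \<in> C i", OF that])
    define E where "E i = D (diameter (C i)) (p i)" for i
    have bd: "bounded (C i)" for i using C by (auto simp: hcover_def)
    have "X \<subseteq> (\<Union>i. E i)"
    proof
      fix x assume x: "x \<in> X"
      have "\<exists>a\<in>A. \<forall>b\<in>B. (a - c) \<bullet> b = (x - c) \<bullet> b"
      proof (rule A)
        fix b assume b: "b \<in> B"
        then have "L b \<le> x \<bullet> b" "x \<bullet> b \<le> U b" using x by (auto simp: X_def)
        then show "0 \<le> (x - c) \<bullet> b \<and> (x - c) \<bullet> b \<le> l b" using b by (simp add: L_def U_def inner_diff_left)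
      qed
      then obtain a where a: "a \<in> A" "\<And>b. b \<in> B \<Longrightarrow> a \<bullet> b = x \<bullet> b" by (auto simp: inner_diff_left)
      then obtain i where i: "a \<in> C i" using C by (auto simp: hcover_def)
      have ab: "\<bar>(x - p i) \<bullet> b\<bar> \<le> diameter (C i)" if b: "b \<in> B" for b
      proof -
        have "\<bar>(x - p i) \<bullet> b\<bar> = \<bar>(a - p i) \<bullet> b\<bar>" using a(2)[OF b] by (simp add: inner_diff_left)
        also have "\<dots> \<le> norm (a - p i) * norm b" by (rule Cauchy_Schwarz_ineq2)
        also have "norm b = 1" using B b by (auto simp: orthonormal_def norm_eq_1)
        finally show ?thesis using diameter_bounded_bound[OF bd i p[OF i]] by (simp add: dist_norm)
      qed
      have "lo (diameter (C i)) (p i) b \<le> x \<bullet> b \<and> x \<bullet> b \<le> up (diameter (C i)) (p i) b" if b: "b \<in> B \<union> B'" for b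
      proof (cases "b \<in> B")
        case True
        have "\<bar>x \<bullet> b - p i \<bullet> b\<bar> \<le> diameter (C i)" using ab[OF True] by (simp only: inner_diff_left)
        then show ?thesis using True by (simp only: lo_def up_def if_True) linarith
      next
        case False
        moreover have "L b \<le> x \<bullet> b" "x \<bullet> b \<le> U b" using x b by (auto simp: X_def)
        ultimately show ?thesis by (simp add: lo_def up_def L_def U_def)
      qed
      then have "x \<in> E i" by (simp add: E_def D_def)
      then show "x \<in> (\<Union>i. E i)" by blast
    qed
    then have "emeasure lborel X \<le> emeasure lborel (\<Union>i. E i)"
      by (intro emeasure_mono) (auto simp: E_def D diameter_ge_0 bd)
    also have "\<dots> \<le> (\<Sum>i. emeasure lborel (E i))"
      by (rule emeasure_subadditive_countably) (auto simp: E_def D diameter_ge_0 bd)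
    also have "\<dots> = (\<Sum>i. ennreal ((2 * diameter (C i)) ^ k))" by (simp add: E_def D diameter_ge_0 bd)
    finally have "ennreal (\<Prod>b\<in>B. l b) \<le> (\<Sum>i. ennreal ((2 * diameter (C i)) ^ k))" by (simp add: X)
    then have "ennreal (hconst k) * ennreal (\<Prod>b\<in>B. l b) \<le> ennreal (hconst k) * (\<Sum>i. ennreal ((2 * diameter (C i)) ^ k))"
      by (rule mult_left_mono) simp
    also have "\<dots> = (\<Sum>i. ennreal (hconst k) * ennreal ((2 * diameter (C i)) ^ k))" by simp
    also have "\<dots> = (\<Sum>i. hcost k (C i))"
    proof (rule suminf_cong)
      fix i
      have "(2 * diameter (C i)) ^ k = 4 ^ k * (diameter (C i) / 2) ^ k"
        using power_mult_distrib[of 4 "diameter (C i) / 2" k] by simp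
      then have "hconst k * (2 * diameter (C i)) ^ k = unit_ball_vol (real k) * (diameter (C i) / 2) ^ k"
        by (simp add: hconst_def)
      then show "ennreal (hconst k) * ennreal ((2 * diameter (C i)) ^ k) = hcost k (C i)"
        unfolding hcost_def using hconst_pos[of k] diameter_ge_0[OF bd, of i] by (simp add: ennreal_mult[symmetric])
    qed
    finally show "ennreal (hconst k * (\<Prod>b\<in>B. l b)) \<le> (\<Sum>i. hcost k (C i))"
      using hconst_pos[of k] l by (simp add: ennreal_mult prod_nonneg)
  qed
  also have "\<dots> \<le> hausdorff_outer k A" by (rule hdelta_le_hausdorff) simp
  finally show ?thesis .
qed

text \<open>Vectors with m coordinates of size at most s / (L m) have norm at most s / L, so the
  points covering them lie in \<open>cball y s\<close>.\<close>

lemma mgood_measure_ge: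
  fixes S :: "'a::euclidean_space set"
  assumes m: "1 \<le> m" and good: "mgood m L r S" and L: "1 \<le> L" and y: "y \<in> S" and s: "0 < s" "s \<le> r"
  shows "ennreal (hconst m * (s / (L * m)) ^ m) \<le> hausdorff_outer m (S \<inter> cball y s)"
proof -
  obtain P0 where P0: "subspace P0" "dim P0 = m"
    and g: "\<And>u. u \<in> P0 \<Longrightarrow> norm u \<le> r \<Longrightarrow> \<exists>z\<in>S. oproj P0 (z - y) = u \<and> norm (z - y) \<le> L * norm u"
    using good y unfolding mgood_def by blast
  obtain B where B: "orthonormal B" "B \<subseteq> P0" "card B = m" "span B = P0"
    using orthonormal_basis_exists[OF P0] .
  have fin: "finite B" using B by (simp add: orthonormal_def)
  have "ennreal (hconst m * (\<Prod>b\<in>B. s / (L * m))) \<le> hausdorff_outer m (S \<inter> cball y s)"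
  proof (rule hausdorff_outer_ge_box[of m B _ _ y])
    fix t assume t: "\<And>b. b \<in> B \<Longrightarrow> 0 \<le> t b \<and> t b \<le> s / (L * m)"
    define u where "u = (\<Sum>b\<in>B. t b *\<^sub>R b)"
    have uP: "u \<in> P0" unfolding u_def using B P0 by (intro subspace_sum) (auto intro: subspace_scale)
    have "norm u \<le> (\<Sum>b\<in>B. s / (L * m))" unfolding u_def
    proof (rule sum_norm_le)
      fix b assume b: "b \<in> B"
      then have "norm b = 1" using B by (auto simp: orthonormal_def norm_eq_1)
      then show "norm (t b *\<^sub>R b) \<le> s / (L * m)" using t[OF b] by simp
    qed
    also have "\<dots> = s / L" using B m by simp
    finally have nu: "norm u \<le> s / L" .
    have "s / L \<le> s" using s L by (simp add: divide_le_eq mult_le_cancel_left1)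
    then obtain z where z: "z \<in> S" "oproj P0 (z - y) = u" "norm (z - y) \<le> L * norm u" using g[OF uP] nu s by fastforce
    have "L * norm u \<le> L * (s / L)" using nu L by (intro mult_left_mono) auto
    then have "norm (z - y) \<le> s" using z L by simp
    moreover have "(z - y) \<bullet> b = t b" if b: "b \<in> B" for b
    proof -
      have "(z - y) \<bullet> b = u \<bullet> b" using oproj_inner[OF P0(1), of b "z - y"] b B z by auto
      also have "\<dots> = (\<Sum>b'\<in>B. if b = b' then t b' else 0)" unfolding u_def inner_sum_left
        using B b by (intro sum.cong) (auto simp: orthonormal_def)
      also have "\<dots> = t b" using fin b by simp
      finally show ?thesis .
    qed
    ultimately show "\<exists>x\<in>S \<inter> cball y s. \<forall>b\<in>B. (x - y) \<bullet> b = t b"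
      using z by (intro bexI[of _ z]) (auto simp: dist_norm norm_minus_commute)
  qed (use m B L s in auto)
  then show ?thesis using B by simp
qed

text \<open>The k coordinates in B determine a point of A in a Lipschitz way. The cells of a grid of
  mesh 1 / N number (2 N M + 1)^k and have diameter at most L k / N, so the total cost is bounded
  independently of N.\<close>

lemma hausdorff_outer_finite:
  fixes A B :: "'a::euclidean_space set"
  assumes k: "0 < k" and B: "orthonormal B" "card B = k" and A: "bounded A"
    and L: "\<And>x y. x \<in> A \<Longrightarrow> y \<in> A \<Longrightarrow> norm (x - y) \<le> L * (\<Sum>b\<in>B. \<bar>(x - y) \<bullet> b\<bar>)" and L0: "0 < L"
  shows "hausdorff_outer k A < top"
proof -
  have fin: "finite B" using B by (simp add: orthonormal_def)
  obtain M0 where M0: "\<And>x. x \<in> A \<Longrightarrow> norm x \<le> M0" using A by (auto simp: bounded_iff)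
  obtain M :: nat where M: "M0 \<le> M" "1 \<le> M" using real_arch_simple[of "max M0 1"] by auto
  have "hdelta k \<delta> A \<le> ennreal (unit_ball_vol (real k) * (3 * M * L * k / 2) ^ k)" if \<delta>: "0 < \<delta>" for \<delta>
  proof -
    obtain N :: nat where N: "L * k / \<delta> \<le> N" "1 \<le> N" using real_arch_simple[of "max (L * k / \<delta>) 1"] by auto
    define I where "I = PiE B (\<lambda>_. {- int (N * M)..int (N * M)})"
    define D where "D g = {x \<in> A. \<forall>b\<in>B. \<lfloor>real N * (x \<bullet> b)\<rfloor> = g b}" for g
    have finI: "finite I" unfolding I_def using fin by (intro finite_PiE) auto
    have cardI: "card I = (2 * N * M + 1) ^ k"
    proof -
      have "int (N * M) - (- int (N * M)) + 1 = int (2 * N * M + 1)" by simp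
      then have "card {- int (N * M)..int (N * M)} = 2 * N * M + 1" by (simp only: card_atLeastAtMost_int nat_int)
      then show ?thesis unfolding I_def using fin B by (simp only: card_PiE prod_constant)
    qed
    have cov: "A \<subseteq> (\<Union>g\<in>I. D g)"
    proof
      fix x assume x: "x \<in> A"
      define g where "g = restrict (\<lambda>b. \<lfloor>real N * (x \<bullet> b)\<rfloor>) B"
      have "g \<in> I" unfolding I_def
      proof (rule PiE_I)
        fix b assume b: "b \<in> B"
        have "\<bar>x \<bullet> b\<bar> \<le> norm x * norm b" by (rule Cauchy_Schwarz_ineq2)
        also have "norm b = 1" using B b by (auto simp: orthonormal_def norm_eq_1)
        finally have "\<bar>x \<bullet> b\<bar> \<le> M" using M0[OF x] M by simp
        then have "\<bar>real N * (x \<bullet> b)\<bar> \<le> real (N * M)" by (simp add: abs_mult mult_left_mono)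
        then have "- real (N * M) \<le> real N * (x \<bullet> b)" "real N * (x \<bullet> b) \<le> real (N * M)" by (auto simp: abs_le_iff)
        then have "- int (N * M) \<le> \<lfloor>real N * (x \<bullet> b)\<rfloor>" "\<lfloor>real N * (x \<bullet> b)\<rfloor> \<le> int (N * M)" by linarith+
        then show "g b \<in> {- int (N * M)..int (N * M)}" using b by (simp add: g_def)
      qed (auto simp: g_def)
      moreover have "x \<in> D g" using x by (simp add: D_def g_def)
      ultimately show "x \<in> (\<Union>g\<in>I. D g)" by blast
    qed
    have dD: "diameter (D g) \<le> L * k / N" for g
    proof (rule diameter_le)
      show "D g \<noteq> {} \<or> 0 \<le> L * k / N" using L0 by simp
      fix x y assume xy: "x \<in> D g" "y \<in> D g"
      have "norm (x - y) \<le> L * (\<Sum>b\<in>B. \<bar>(x - y) \<bullet> b\<bar>)" using L xy by (auto simp: D_def)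
      also have "\<dots> \<le> L * (\<Sum>b\<in>B. 1 / N)"
      proof (intro mult_left_mono sum_mono)
        fix b assume b: "b \<in> B"
        have "\<lfloor>real N * (x \<bullet> b)\<rfloor> = \<lfloor>real N * (y \<bullet> b)\<rfloor>" using xy b by (auto simp: D_def)
        then have "\<bar>real N * (x \<bullet> b) - real N * (y \<bullet> b)\<bar> \<le> 1" by linarith
        then have "real N * \<bar>(x - y) \<bullet> b\<bar> \<le> 1"
          by (simp add: inner_diff_left right_diff_distrib[symmetric] abs_mult)
        then show "\<bar>(x - y) \<bullet> b\<bar> \<le> 1 / N" using N by (simp add: field_simps)
      qed (use L0 in auto)
      also have "\<dots> = L * k / N" using B by simp
      finally show "norm (x - y) \<le> L * k / N" .
    qed
    have LN: "L * k / N \<le> \<delta>" using N \<delta> by (simp add: field_simps)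
    have bD: "bounded (D g)" for g by (rule bounded_subset[OF A]) (auto simp: D_def)
    have "hdelta k \<delta> A \<le> (\<integral>\<^sup>+g. hcost k (D g) \<partial>count_space I)"
      by (rule hdelta_le_countable[OF k \<delta> countable_finite[OF finI] cov bD order_trans[OF dD LN]])
    also have "\<dots> = (\<Sum>g\<in>I. hcost k (D g))" by (rule nn_integral_count_space_finite[OF finI])
    also have "\<dots> \<le> (\<Sum>g\<in>I. ennreal (unit_ball_vol (real k) * (L * k / N / 2) ^ k))"
      unfolding hcost_def using dD diameter_ge_0[OF bD]
      by (intro sum_mono ennreal_leI mult_left_mono power_mono divide_right_mono) auto
    also have "\<dots> = ennreal (card I * (unit_ball_vol (real k) * (L * k / N / 2) ^ k))"
      using L0 by (simp add: ennreal_mult ennreal_of_nat_eq_real_of_nat)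
    also have "\<dots> \<le> ennreal (unit_ball_vol (real k) * (3 * M * L * k / 2) ^ k)"
    proof (rule ennreal_leI)
      have "1 * 1 \<le> N * M" using N M by (intro mult_mono) auto
      then have "2 * N * M + 1 \<le> 3 * N * M" by simp
      then have "real (2 * N * M + 1) \<le> real (3 * N * M)" by (rule of_nat_mono)
      then have "real (card I) \<le> real (3 * N * M) ^ k" unfolding cardI by (simp only: of_nat_power) (rule power_mono, auto)
      then have "card I * (unit_ball_vol (real k) * (L * k / N / 2) ^ k) \<le> real (3 * N * M) ^ k * (unit_ball_vol (real k) * (L * k / N / 2) ^ k)"
        using L0 by (intro mult_right_mono) auto
      also have "\<dots> = unit_ball_vol (real k) * (real (3 * N * M) * (L * k / N / 2)) ^ k" by (metis power_mult_distrib mult.left_commute)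
      also have "real (3 * N * M) * (L * k / N / 2) = 3 * M * L * k / 2" using N by simp
      finally show "card I * (unit_ball_vol (real k) * (L * k / N / 2) ^ k) \<le> unit_ball_vol (real k) * (3 * M * L * k / 2) ^ k" .
    qed
    finally show ?thesis .
  qed
  then have "hausdorff_outer k A \<le> ennreal (unit_ball_vol (real k) * (3 * M * L * k / 2) ^ k)" by (rule hausdorff_outer_leI)
  then show ?thesis by (rule order_le_less_trans) simp
qed

section \<open>Rademacher's theorem\<close>

lemma emeasure_UN_le_nn_integral:
  assumes I: "countable I" and X: "\<And>i. i \<in> I \<Longrightarrow> X i \<in> sets M"
  shows "emeasure M (\<Union>i\<in>I. X i) \<le> (\<integral>\<^sup>+i. emeasure M (X i) \<partial>count_space I)"
proof -
  have U: "(\<Union>i\<in>I. X i) \<in> sets M" using I X by (intro sets.countable_UN') auto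
  have "emeasure M (\<Union>i\<in>I. X i) = (\<integral>\<^sup>+x. indicator (\<Union>i\<in>I. X i) x \<partial>M)" using U by simp
  also have "\<dots> \<le> (\<integral>\<^sup>+x. (\<integral>\<^sup>+i. indicator (X i) x \<partial>count_space I) \<partial>M)"
  proof (rule nn_integral_mono)
    fix x
    show "indicator (\<Union>i\<in>I. X i) x \<le> (\<integral>\<^sup>+i. indicator (X i) x \<partial>count_space I)"
    proof (cases "x \<in> (\<Union>i\<in>I. X i)")
      case True
      then obtain i where "i \<in> I" "x \<in> X i" by blast
      then show ?thesis using nn_integral_ge_point[of i I "\<lambda>i. indicator (X i) x"] by (simp add: indicator_def)
    qed simp
  qed
  also have "\<dots> = (\<integral>\<^sup>+i. (\<integral>\<^sup>+x. indicator (X i) x \<partial>M) \<partial>count_space I)"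
    using X by (intro nn_integral_count_space_nn_integral[OF I]) auto
  also have "\<dots> = (\<integral>\<^sup>+i. emeasure M (X i) \<partial>count_space I)"
    using X by (intro nn_integral_cong) simp
  finally show ?thesis .
qed

text \<open>The intervals between x and x + h on which g grows by at most a |h| form a Vitali cover
  of E. Disjoint ones inside a slightly larger open set U carry E up to a null set, whose image is
  null because g is Lipschitz.\<close>

lemma emeasure_image_slope_le:
  fixes g :: "real \<Rightarrow> real"
  assumes mono: "mono g" and lip: "\<And>x y. \<bar>g x - g y\<bar> \<le> K * \<bar>x - y\<bar>" and a: "0 < a" and E: "E \<in> sets borel"
    and fin: "emeasure lborel E < top"
    and slope: "\<And>x d. x \<in> E \<Longrightarrow> 0 < d \<Longrightarrow> \<exists>h. h \<noteq> 0 \<and> \<bar>h\<bar> < d \<and> (g (x + h) - g x) / h \<le> a"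
  shows "emeasure lebesgue (g ` E) \<le> ennreal a * emeasure lborel E"
proof (rule ennreal_le_epsilon)
  fix e :: real assume e: "0 < e"
  obtain U where U: "open U" "E \<subseteq> U" "emeasure lebesgue (U - E) < ennreal (e / a)"
    using sets_lebesgue_outer_open[of E "e / a"] E e a by (metis divide_pos_pos sets_completionI_sets sets_lborel)
  \<comment> \<open>Increments h of either sign are recorded; the interval is the ball about x + h/2
    of radius |h| / 2.\<close>
  define I where "I = {(x, h). h \<noteq> 0 \<and> cball (x + h / 2) (\<bar>h\<bar> / 2) \<subseteq> U \<and> (g (x + h) - g x) / h \<le> a}"
  define ce where "ce = (\<lambda>(x, h). x + h / 2 :: real)"
  define ra where "ra = (\<lambda>(x :: real, h). \<bar>h\<bar> / 2 :: real)"
  obtain C where C: "countable C" "C \<subseteq> I" "pairwise (\<lambda>i j. disjnt (cball (ce i) (ra i)) (cball (ce j) (ra j))) C"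
    "negligible (E - (\<Union>i\<in>C. cball (ce i) (ra i)))"
  proof (rule Vitali_covering_theorem_cballs[of I ra E ce])
    show "0 < ra i" if "i \<in> I" for i using that by (auto simp: I_def ra_def)
    fix x d :: real assume x: "x \<in> E" and d: "0 < d"
    obtain r where r: "0 < r" "ball x r \<subseteq> U" using U x openE by blast
    obtain h where h: "h \<noteq> 0" "\<bar>h\<bar> < min r d" "(g (x + h) - g x) / h \<le> a" using slope[OF x, of "min r d"] r d by auto
    have "cball (x + h / 2) (\<bar>h\<bar> / 2) \<subseteq> ball x r"
    proof
      fix y assume "y \<in> cball (x + h / 2) (\<bar>h\<bar> / 2)"
      then have "\<bar>x + h / 2 - y\<bar> \<le> \<bar>h\<bar> / 2" by (simp add: dist_real_def)
      then show "y \<in> ball x r" using h(2) by (auto simp: dist_real_def abs_if split: if_splits)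
    qed
    then have "(x, h) \<in> I" using h r by (auto simp: I_def)
    moreover have "x \<in> cball (ce (x, h)) (ra (x, h))" by (simp add: ce_def ra_def dist_real_def)
    moreover have "ra (x, h) < d" using h d by (simp add: ra_def)
    ultimately show "\<exists>i. i \<in> I \<and> x \<in> cball (ce i) (ra i) \<and> ra i < d" by blast
  qed blast
  define J where "J i = {g (ce i - ra i)..g (ce i + ra i)}" for i
  have J: "emeasure lborel (J i) \<le> ennreal a * emeasure lborel (cball (ce i) (ra i))" if i: "i \<in> C" for i
  proof -
    obtain x h where xh: "i = (x, h)" by (cases i)
    have h: "h \<noteq> 0" "(g (x + h) - g x) / h \<le> a" using C(2) i xh by (auto simp: I_def)
    have "g (ce i + ra i) - g (ce i - ra i) \<le> a * \<bar>h\<bar>"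
    proof (cases "0 < h")
      case True
      then have "ce i + ra i = x + h" "ce i - ra i = x" by (auto simp: ce_def ra_def xh)
      then show ?thesis using h True by (simp add: pos_divide_le_eq)
    next
      case False
      then have "ce i + ra i = x" "ce i - ra i = x + h" using h by (auto simp: ce_def ra_def xh)
      then show ?thesis using h False by (simp add: neg_divide_le_eq)
    qed
    moreover have "g (ce i - ra i) \<le> g (ce i + ra i)" using mono by (rule monoD) (auto simp: ra_def xh)
    moreover have "emeasure lborel (cball (ce i) (ra i)) = ennreal \<bar>h\<bar>"
      by (simp add: cball_eq_atLeastAtMost ra_def xh ce_def)
    ultimately show ?thesis using a by (simp add: J_def ennreal_mult[symmetric] ennreal_leI)
  qed
  let ?N = "E - (\<Union>i\<in>C. cball (ce i) (ra i))"
  have neg: "negligible (g ` ?N)"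
    by (rule negligible_locally_Lipschitz_image[OF _ C(4)]) (use lip in \<open>auto intro!: exI[of _ UNIV] exI[of _ K]\<close>)
  then have gN: "g ` ?N \<in> null_sets lebesgue" by (simp only: negligible_iff_null_sets)
  have UJ: "(\<Union>i\<in>C. J i) \<in> sets lebesgue" by (intro sets.countable_UN'[OF C(1)]) (auto simp: J_def)
  have "g ` E \<subseteq> (\<Union>i\<in>C. J i) \<union> g ` ?N"
  proof
    fix y assume "y \<in> g ` E"
    then obtain x where x: "x \<in> E" "y = g x" by blast
    show "y \<in> (\<Union>i\<in>C. J i) \<union> g ` ?N"
    proof (cases "x \<in> (\<Union>i\<in>C. cball (ce i) (ra i))")
      case True
      then obtain i where i: "i \<in> C" "x \<in> cball (ce i) (ra i)" by blast
      then have "ce i - ra i \<le> x" "x \<le> ce i + ra i" by (auto simp: cball_eq_atLeastAtMost)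
      then have "y \<in> J i" using monoD[OF mono] x by (auto simp: J_def)
      then show ?thesis using i by blast
    qed (use x in blast)
  qed
  then have "emeasure lebesgue (g ` E) \<le> emeasure lebesgue ((\<Union>i\<in>C. J i) \<union> g ` ?N)"
    using UJ gN by (intro emeasure_mono sets.Un) auto
  also have "\<dots> = emeasure lebesgue (\<Union>i\<in>C. J i)"
    using UJ gN by (intro emeasure_Un_null_set)
  also have "\<dots> \<le> (\<integral>\<^sup>+i. emeasure lebesgue (J i) \<partial>count_space C)"
    by (rule emeasure_UN_le_nn_integral[OF C(1)]) (simp add: J_def)
  also have "\<dots> = (\<integral>\<^sup>+i. emeasure lborel (J i) \<partial>count_space C)" by (simp add: J_def)
  also have "\<dots> \<le> (\<integral>\<^sup>+i. ennreal a * emeasure lborel (cball (ce i) (ra i)) \<partial>count_space C)"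
    by (rule nn_integral_mono) (use J in auto)
  also have "\<dots> = ennreal a * (\<integral>\<^sup>+i. emeasure lborel (cball (ce i) (ra i)) \<partial>count_space C)"
    by (rule nn_integral_cmult) simp
  also have "(\<integral>\<^sup>+i. emeasure lborel (cball (ce i) (ra i)) \<partial>count_space C) = emeasure lborel (\<Union>i\<in>C. cball (ce i) (ra i))"
    using C(1,3) by (intro emeasure_UN_countable[symmetric]) (auto simp: disjoint_family_on_def pairwise_def disjnt_def)
  also have "\<dots> \<le> emeasure lborel U"
    using C(2) U(1) by (intro emeasure_mono) (auto simp: I_def ce_def ra_def split: prod.splits)
  also have "\<dots> \<le> emeasure lborel E + ennreal (e / a)"
  proof -
    have "emeasure lborel U = emeasure lborel (E \<union> (U - E))" using U(2) by (simp add: Un_absorb1)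
    also have "\<dots> \<le> emeasure lborel E + emeasure lborel (U - E)" using U(1) E by (intro emeasure_subadditive) auto
    also have "emeasure lborel (U - E) \<le> ennreal (e / a)" using U(1,3) E by (simp add: less_imp_le)
    finally show ?thesis by (simp add: add_left_mono)
  qed
  finally have "emeasure lebesgue (g ` E) \<le> ennreal a * (emeasure lborel E + ennreal (e / a))"
    by (simp add: mult_left_mono)
  also have "\<dots> = ennreal a * emeasure lborel E + ennreal e"
    using a e by (simp add: distrib_left ennreal_mult[symmetric])
  finally show "emeasure lebesgue (g ` E) \<le> ennreal a * emeasure lborel E + ennreal e" .
qed

text \<open>The points whose difference quotients in direction v fall below p and rise above q at
  arbitrarily small increments. Restricting to rational increments makes the set Borel.\<close>

definition osc_set :: "('a::euclidean_space \<Rightarrow> real) \<Rightarrow> 'a \<Rightarrow> real \<Rightarrow> real \<Rightarrow> 'a set" where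
  "osc_set f v p q = {x. (\<forall>k::nat. \<exists>r::rat. of_rat r \<noteq> (0::real) \<and> \<bar>of_rat r\<bar> < inverse (real (Suc k)) \<and> (f (x + of_rat r *\<^sub>R v) - f x) / of_rat r < p)
     \<and> (\<forall>k::nat. \<exists>r::rat. of_rat r \<noteq> (0::real) \<and> \<bar>of_rat r\<bar> < inverse (real (Suc k)) \<and> (f (x + of_rat r *\<^sub>R v) - f x) / of_rat r > q)}"

lemma osc_set_borel:
  fixes f :: "'a::euclidean_space \<Rightarrow> real"
  assumes "continuous_on UNIV f"
  shows "osc_set f v p q \<in> sets borel"
proof -
  have [measurable]: "f \<in> borel_measurable borel" using assms by (rule borel_measurable_continuous_onI)
  have "osc_set f v p q = {x \<in> space borel. (\<forall>k::nat. \<exists>r::rat. of_rat r \<noteq> (0::real) \<and> \<bar>of_rat r\<bar> < inverse (real (Suc k)) \<and> (f (x + of_rat r *\<^sub>R v) - f x) / of_rat r < p)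
     \<and> (\<forall>k::nat. \<exists>r::rat. of_rat r \<noteq> (0::real) \<and> \<bar>of_rat r\<bar> < inverse (real (Suc k)) \<and> (f (x + of_rat r *\<^sub>R v) - f x) / of_rat r > q)}"
    by (simp add: osc_set_def)
  also have "\<dots> \<in> sets borel" by measurable
  finally show ?thesis .
qed

text \<open>Adding a linear function one may assume \<open>f\<close> to be increasing with a Lipschitz inverse. On the set, small slopes
  give \<open>|f(E)| \<le> p |E|\<close>, and large slopes, applied to the inverse function, give \<open>q |E| \<le> |f(E)|\<close>.\<close>

lemma osc_set_null_real:
  fixes f :: "real \<Rightarrow> real"
  assumes lip: "\<And>x y. \<bar>f x - f y\<bar> \<le> L * \<bar>x - y\<bar>" and L: "0 \<le> L" and pq: "p < q"
  shows "emeasure lborel (osc_set f 1 p q) = 0"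
proof -
  have cf: "continuous_on UNIV f"
    by (rule lipschitz_on_continuous_on[of L]) (use lip L in \<open>auto intro!: lipschitz_onI simp: dist_real_def\<close>)
  \<comment> \<open>The slope L + 1 makes F grow at least as fast as the identity, so its inverse
    has Lipschitz constant 1; all quotients are shifted by L + 1.\<close>
  define F where "F x = f x + (L + 1) * x" for x
  have low: "y - x \<le> F y - F x" if "x \<le> y" for x y
    using lip[of y x] that by (simp add: F_def algebra_simps abs_le_iff)
  have up: "\<bar>F x - F y\<bar> \<le> (2 * L + 1) * \<bar>x - y\<bar>" for x y
  proof -
    have "F x - F y = (f x - f y) + (L + 1) * (x - y)" by (simp add: F_def algebra_simps)
    then have "\<bar>F x - F y\<bar> \<le> \<bar>f x - f y\<bar> + (L + 1) * \<bar>x - y\<bar>" using L by (simp add: abs_mult order_trans[OF abs_triangle_ineq])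
    then show ?thesis using lip[of x y] by (simp add: algebra_simps)
  qed
  have "continuous_on UNIV F" unfolding F_def by (intro continuous_intros cf)
  then have cF: "continuous_on A F" for A by (rule continuous_on_subset) simp
  have sm: "strict_mono F"
  proof (rule strict_monoI)
    fix x y :: real assume "x < y"
    then show "F x < F y" using low[of x y] by linarith
  qed
  have "surj F"
  proof -
    have "\<exists>x. F x = y" for y
    proof -
      define c where "c = \<bar>y - F 0\<bar>"
      have "F (-c) \<le> y" using low[of "-c" 0] by (simp add: c_def)
      moreover have "y \<le> F c" using low[of 0 c] by (simp add: c_def)
      ultimately show ?thesis using IVT'[of F "-c" y c] cF by (auto simp: c_def)
    qed
    then show ?thesis unfolding surj_def by metis
  qed
  define G where "G = inv F"
  have injF: "inj F" using sm by (rule strict_mono_imp_inj_on)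
  have GF: "G (F x) = x" "F (G y) = y" for x y unfolding G_def using injF \<open>surj F\<close> by (auto simp: surj_f_inv_f)
  have monoG: "mono G" by (rule monoI) (metis GF(2) sm strict_mono_less_eq)
  have lipG: "\<bar>G x - G y\<bar> \<le> 1 * \<bar>x - y\<bar>" for x y
    using low[of "G x" "G y"] low[of "G y" "G x"] GF by (cases "G x \<le> G y") auto
  have mG: "G \<in> borel_measurable borel"
    by (rule borel_measurable_continuous_onI, rule lipschitz_on_continuous_on[of 1]) (use lipG in \<open>auto intro!: lipschitz_onI simp: dist_real_def\<close>)
  let ?O = "osc_set f 1 p q"
  have O: "?O \<in> sets borel" by (rule osc_set_borel[OF cf])
  have quot: "(F (x + h) - F x) / h = (f (x + h) - f x) / h + (L + 1)" if "h \<noteq> 0" for x h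
    using that by (simp add: F_def field_simps)
  have h1: "\<exists>h. h \<noteq> 0 \<and> \<bar>h\<bar> < d \<and> (f (x + h) - f x) / h < p" if "x \<in> ?O" "0 < d" for x d
  proof -
    obtain k where "inverse (real (Suc k)) < d" using reals_Archimedean[OF \<open>0 < d\<close>] by blast
    moreover have "\<forall>k::nat. \<exists>r::rat. of_rat r \<noteq> (0::real) \<and> \<bar>of_rat r\<bar> < inverse (real (Suc k)) \<and> (f (x + of_rat r) - f x) / of_rat r < p"
      using that(1) by (simp add: osc_set_def)
    then obtain r :: rat where "of_rat r \<noteq> (0::real)" "\<bar>of_rat r\<bar> < inverse (real (Suc k))" "(f (x + of_rat r) - f x) / of_rat r < p" by blast
    ultimately show ?thesis by (intro exI[of _ "of_rat r"]) auto
  qed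
  have h2: "\<exists>h. h \<noteq> 0 \<and> \<bar>h\<bar> < d \<and> q < (f (x + h) - f x) / h" if "x \<in> ?O" "0 < d" for x d
  proof -
    obtain k where "inverse (real (Suc k)) < d" using reals_Archimedean[OF \<open>0 < d\<close>] by blast
    moreover have "\<forall>k::nat. \<exists>r::rat. of_rat r \<noteq> (0::real) \<and> \<bar>of_rat r\<bar> < inverse (real (Suc k)) \<and> q < (f (x + of_rat r) - f x) / of_rat r"
      using that(1) by (simp add: osc_set_def)
    then obtain r :: rat where "of_rat r \<noteq> (0::real)" "\<bar>of_rat r\<bar> < inverse (real (Suc k))" "q < (f (x + of_rat r) - f x) / of_rat r" by blast
    ultimately show ?thesis by (intro exI[of _ "of_rat r"]) auto
  qed
  \<comment> \<open>On a bounded interval the measure is finite, so that |E| \<le> (a/b) |E| with a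
    < b forces it to vanish.\<close>
  have "emeasure lborel (?O \<inter> {-real n..real n}) = 0" for n
  proof (rule ccontr)
    let ?E = "?O \<inter> {-real n..real n}"
    assume ne: "emeasure lborel ?E \<noteq> 0"
    have E: "?E \<in> sets borel" using O by auto
    have fin: "emeasure lborel ?E < top"
    proof -
      have "emeasure lborel ?E \<le> emeasure lborel {-real n..real n}" by (rule emeasure_mono) auto
      then show ?thesis by (rule order_le_less_trans) simp
    qed
    define a where "a = p + L + 1"
    define b where "b = q + L + 1"
    have "?E \<noteq> {}" using ne by (metis emeasure_empty)
    then obtain x where x: "x \<in> ?E" by blast
    obtain h where h: "h \<noteq> 0" "(f (x + h) - f x) / h < p" using h1[of x 1] x by auto
    have "\<bar>(f (x + h) - f x) / h\<bar> \<le> L" using lip[of "x + h" x] h by (simp add: abs_divide divide_le_eq)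
    then have a: "0 < a" using h(2) unfolding a_def by linarith
    have b: "a < b" "0 < b" using pq a by (auto simp: a_def b_def)
    have FE: "F ` ?E = G -` ?E"
    proof (intro set_eqI iffI)
      fix y assume "y \<in> F ` ?E" then show "y \<in> G -` ?E" by (auto simp: GF)
    next
      fix y assume "y \<in> G -` ?E"
      then have "F (G y) \<in> F ` ?E" by (intro imageI) simp
      then show "y \<in> F ` ?E" by (simp add: GF)
    qed
    have FEb: "F ` ?E \<in> sets borel" unfolding FE using measurable_sets[OF mG E] by simp
    have i1: "emeasure lborel (F ` ?E) \<le> ennreal a * emeasure lborel ?E"
    proof -
      have "emeasure lebesgue (F ` ?E) \<le> ennreal a * emeasure lborel ?E"
      proof (rule emeasure_image_slope_le[OF _ up a E fin])
        show "mono F" using sm by (rule strict_mono_mono)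
        fix x d :: real assume "x \<in> ?E" "0 < d"
        then obtain h where h: "h \<noteq> 0" "\<bar>h\<bar> < d" "(f (x + h) - f x) / h < p" using h1[of x d] by auto
        then have "(F (x + h) - F x) / h \<le> a" using quot[OF h(1), of x] by (simp add: a_def)
        then show "\<exists>h. h \<noteq> 0 \<and> \<bar>h\<bar> < d \<and> (F (x + h) - F x) / h \<le> a" using h by blast
      qed
      then show ?thesis using FEb by simp
    qed
    have i2: "emeasure lborel ?E \<le> ennreal (1 / b) * emeasure lborel (F ` ?E)"
    proof -
      have "emeasure lebesgue (G ` F ` ?E) \<le> ennreal (1 / b) * emeasure lborel (F ` ?E)"
      proof (rule emeasure_image_slope_le[OF monoG lipG _ FEb])
        show "0 < 1 / b" using b by simp
        show "emeasure lborel (F ` ?E) < top" using i1 fin by (meson ennreal_mult_less_top ennreal_less_top order_le_less_trans)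
        fix y d :: real assume "y \<in> F ` ?E" and d: "0 < d"
        then obtain x where x: "x \<in> ?E" "y = F x" by blast
        \<comment> \<open>The increment for the inverse function is F (x + h) - F x, at most (2 L +
          1) |h| in modulus; hence the choice of d / (2 L + 1).\<close>
        obtain h where h: "h \<noteq> 0" "\<bar>h\<bar> < d / (2 * L + 1)" "q < (f (x + h) - f x) / h"
          using h2[of x "d / (2 * L + 1)"] x d L by auto
        define k where "k = F (x + h) - F x"
        have kb: "b \<le> k / h" using quot[OF h(1), of x] h(3) by (simp add: k_def b_def)
        then have k0: "k \<noteq> 0" using b by auto
        have "\<bar>k\<bar> \<le> (2 * L + 1) * \<bar>h\<bar>" using up[of "x + h" x] by (simp add: k_def)
        also have "\<dots> < d" using h(2) L by (simp add: field_simps)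
        finally have kd: "\<bar>k\<bar> < d" .
        have "G (y + k) - G y = h" by (simp add: x k_def GF)
        moreover have "h / k \<le> 1 / b"
        proof -
          have "1 / (k / h) \<le> 1 / b" using kb b by (intro frac_le) auto
          then show ?thesis by simp
        qed
        ultimately show "\<exists>h. h \<noteq> 0 \<and> \<bar>h\<bar> < d \<and> (G (y + h) - G y) / h \<le> 1 / b" using k0 kd by (intro exI[of _ k]) simp
      qed
      moreover have "G ` F ` ?E = ?E" by (simp add: image_image GF)
      ultimately show ?thesis using E by simp
    qed
    have "ennreal (1 / b) * emeasure lborel (F ` ?E) \<le> ennreal (1 / b) * (ennreal a * emeasure lborel ?E)"
      using i1 by (rule mult_left_mono) simp
    also have "\<dots> = ennreal (1 / b) * ennreal a * emeasure lborel ?E" by (rule mult.assoc[symmetric])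
    also have "ennreal (1 / b) * ennreal a = ennreal (a / b)"
      using a b ennreal_mult[of "1 / b" a] by simp
    finally have le: "emeasure lborel ?E \<le> ennreal (a / b) * emeasure lborel ?E" using i2 by (rule order_trans[rotated])
    obtain t where t: "emeasure lborel ?E = ennreal t" "0 \<le> t"
      using fin by (cases "emeasure lborel ?E") auto
    have "t \<noteq> 0" using ne t by auto
    then have t0: "0 < t" using t by simp
    have "ennreal t \<le> ennreal (a / b * t)"
      using le a b t0 ennreal_mult[of "a / b" t] unfolding t(1) by simp
    then have "t \<le> a / b * t" using a b t0 by (subst (asm) ennreal_le_iff) auto
    then have "t * b \<le> t * a" using b by (simp add: field_simps)
    then have "b \<le> a" using t0 by simp
    then show False using b by simp
  qed
  then have "?O \<inter> {-real n..real n} \<in> null_sets lborel" for n using O by auto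
  then have "(\<Union>n. ?O \<inter> {-real n..real n}) \<in> null_sets lborel" by (intro null_sets_UN)
  moreover have "(\<Union>n. ?O \<inter> {-real n..real n}) = ?O"
  proof -
    have "x \<in> (\<Union>n. {-real n..real n})" for x :: real
    proof -
      obtain n where "\<bar>x\<bar> \<le> real n" using real_arch_simple by blast
      then have "x \<in> {-real n..real n}" by auto
      then show ?thesis by blast
    qed
    then show ?thesis by blast
  qed
  ultimately show ?thesis by auto
qed

text \<open>Tonelli for the set of pairs (x, t) with x + t v in the oscillation set: the slices at
  fixed x are null by the one-dimensional case, and the slices at fixed t are translates of the
  oscillation set. So its measure times infinity is 0.\<close>

lemma osc_set_null:
  fixes f :: "'a::euclidean_space \<Rightarrow> real"
  assumes lip: "\<And>x y. \<bar>f x - f y\<bar> \<le> L * norm (x - y)" and L: "0 \<le> L" and pq: "p < q"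
  shows "osc_set f v p q \<in> null_sets lborel"
proof -
  have cf: "continuous_on UNIV f"
    by (rule lipschitz_on_continuous_on[of L]) (use lip L in \<open>auto intro!: lipschitz_onI simp: dist_norm\<close>)
  let ?N = "osc_set f v p q"
  have N: "?N \<in> sets borel" by (rule osc_set_borel[OF cf])
  define M where "M = {z \<in> space (borel \<Otimes>\<^sub>M borel). fst z + snd z *\<^sub>R v \<in> ?N}"
  have "M \<in> sets (borel \<Otimes>\<^sub>M borel)" unfolding M_def using N by measurable
  then have M: "M \<in> sets (lborel \<Otimes>\<^sub>M lborel)" by (simp cong: sets_pair_measure_cong)
  have "emeasure (lborel \<Otimes>\<^sub>M lborel) M = (\<integral>\<^sup>+x. emeasure lborel (Pair x -` M) \<partial>lborel)"
    by (rule lborel.emeasure_pair_measure_alt[OF M])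
  also have "\<dots> = (\<integral>\<^sup>+(x::'a). 0 \<partial>lborel)"
  proof (rule nn_integral_cong)
    fix x :: 'a
    have "Pair x -` M = osc_set (\<lambda>t. f (x + t *\<^sub>R v)) 1 p q"
      by (auto simp: M_def osc_set_def scaleR_add_left space_pair_measure add.assoc)
    also have "emeasure lborel \<dots> = 0"
    proof (rule osc_set_null_real[OF _ _ pq])
      show "\<bar>f (x + s *\<^sub>R v) - f (x + t *\<^sub>R v)\<bar> \<le> (L * norm v) * \<bar>s - t\<bar>" for s t
        using lip[of "x + s *\<^sub>R v" "x + t *\<^sub>R v"] by (simp add: scaleR_diff_left[symmetric] mult_ac)
      show "0 \<le> L * norm v" using L by simp
    qed
    finally show "emeasure lborel (Pair x -` M) = 0" .
  qed
  finally have "0 = emeasure (lborel \<Otimes>\<^sub>M lborel) M" by simp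
  also have "\<dots> = (\<integral>\<^sup>+t. emeasure lborel ((\<lambda>x. (x, t)) -` M) \<partial>lborel)"
    by (rule lborel_pair.emeasure_pair_measure_alt2[OF M])
  also have "\<dots> = (\<integral>\<^sup>+(t::real). emeasure lborel ?N \<partial>lborel)"
  proof (rule nn_integral_cong)
    fix t :: real
    have "(\<lambda>x. (x, t)) -` M = (+) (t *\<^sub>R v) -` ?N" by (auto simp: M_def space_pair_measure add.commute)
    moreover have "emeasure lborel ((+) (t *\<^sub>R v) -` ?N) = emeasure (distr lborel borel ((+) (t *\<^sub>R v))) ?N"
      using N by (subst emeasure_distr) auto
    ultimately show "emeasure lborel ((\<lambda>x. (x, t)) -` M) = emeasure lborel ?N"
      by (simp add: lborel_distr_plus)
  qed
  also have "\<dots> = emeasure lborel ?N * top" by simp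
  finally have "emeasure lborel ?N * top = 0" by simp
  then have "emeasure lborel ?N = 0" by (rule contrapos_pp) (simp add: ennreal_mult_top)
  then show ?thesis using N by auto
qed

text \<open>If the lower and upper limits of the quotient differ, rationals p < q fit strictly
  between them, and continuity of the quotient away from 0 replaces the increments by rational ones.
  Boundedness makes the common limit finite.\<close>

lemma quotient_tendsto_if_not_osc:
  fixes f :: "'a::euclidean_space \<Rightarrow> real"
  assumes lip: "\<And>x y. \<bar>f x - f y\<bar> \<le> L * norm (x - y)" and L: "0 \<le> L"
    and x: "\<And>p q :: rat. p < q \<Longrightarrow> x \<notin> osc_set f v (of_rat p) (of_rat q)"
  obtains l where "((\<lambda>h. (f (x + h *\<^sub>R v) - f x) / h) \<longlongrightarrow> l) (at 0)"
proof -
  have cf: "continuous_on UNIV f"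
    by (rule lipschitz_on_continuous_on[of L]) (use lip L in \<open>auto intro!: lipschitz_onI simp: dist_norm\<close>)
  define Q where "Q h = (f (x + h *\<^sub>R v) - f x) / h" for h
  have bnd: "\<bar>Q h\<bar> \<le> L * norm v" for h
  proof (cases "h = 0")
    case False
    have "\<bar>f (x + h *\<^sub>R v) - f x\<bar> \<le> L * norm v * \<bar>h\<bar>" using lip[of "x + h *\<^sub>R v" x] by (simp add: mult_ac)
    then show ?thesis using False by (simp add: Q_def abs_divide divide_le_eq)
  qed (simp add: Q_def L)
  have cQ: "continuous_on (- {0}) Q" unfolding Q_def
    by (intro continuous_intros continuous_on_compose2[OF cf]) auto
  have near: "\<exists>r::rat. of_rat r \<noteq> (0::real) \<and> \<bar>of_rat r\<bar> < (d::real) \<and> Q (of_rat r) \<in> W" if fr: "frequently (\<lambda>h. Q h \<in> W) (at 0)" and d: "0 < d" and W: "open W" for d W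
  proof -
    have "\<exists>h. h \<noteq> 0 \<and> \<bar>h\<bar> < d \<and> Q h \<in> W"
      using fr d unfolding frequently_def eventually_at by (auto simp: dist_real_def)
    then obtain h where h: "h \<noteq> 0" "\<bar>h\<bar> < d" "Q h \<in> W" by blast
    have "open (- {0} \<inter> Q -` W)" by (rule continuous_open_preimage[OF cQ _ W]) auto
    then have "open ((- {0} \<inter> Q -` W) \<inter> {-d<..<d})" by auto
    moreover have "h \<in> (- {0} \<inter> Q -` W) \<inter> {-d<..<d}" using h by auto
    ultimately obtain e where e: "0 < e" "ball h e \<subseteq> (- {0} \<inter> Q -` W) \<inter> {-d<..<d}" using openE by blast
    obtain r where r: "h < of_rat r" "of_rat r < h + e" using of_rat_dense[of h "h + e"] e by auto
    then have "of_rat r \<in> ball h e" by (auto simp: dist_real_def)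
    then have mem: "of_rat r \<in> (- {0} \<inter> Q -` W) \<inter> {-d<..<d}" using e(2) by blast
    then have "- d < real_of_rat r" "real_of_rat r < d" by auto
    then have "\<bar>real_of_rat r\<bar> < d" by linarith
    then show ?thesis using mem by blast
  qed
  define X where "X h = ereal (Q h)" for h
  have "Liminf (at 0) X = Limsup (at 0) X"
  proof (rule ccontr)
    assume "Liminf (at 0) X \<noteq> Limsup (at 0) X"
    then have lt: "Liminf (at 0) X < Limsup (at 0) X" using Liminf_le_Limsup[of "at (0::real)" X] by (simp add: less_le)
    obtain p' where p': "Liminf (at 0) X < ereal p'" "ereal p' < Limsup (at 0) X" using ereal_dense2[OF lt] by blast
    obtain q' where q': "ereal p' < ereal q'" "ereal q' < Limsup (at 0) X" using ereal_dense2[OF p'(2)] by blast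
    obtain p where p: "p' < of_rat p" "of_rat p < q'" using of_rat_dense[of p' q'] q' by auto
    obtain q where q: "of_rat p < (of_rat q :: real)" "of_rat q < q'" using of_rat_dense[OF p(2)] by auto
    have fp: "frequently (\<lambda>h. Q h \<in> {..<of_rat p}) (at 0)"
    proof -
      have "\<not> (ereal p' \<le> Liminf (at 0) X)" using p' by simp
      then obtain y where y: "y < ereal p'" "\<not> eventually (\<lambda>h. y < X h) (at 0)" unfolding le_Liminf_iff by blast
      then have "frequently (\<lambda>h. X h \<le> y) (at 0)" by (simp add: frequently_def not_le)
      then show ?thesis
      proof (rule frequently_elim1)
        fix h :: real assume "X h \<le> y"
        then have "X h < ereal p'" using y(1) by simp
        then show "Q h \<in> {..<of_rat p}" using p by (simp add: X_def)
      qed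
    qed
    have fq: "frequently (\<lambda>h. Q h \<in> {of_rat q<..}) (at 0)"
    proof -
      have "\<not> (Limsup (at 0) X \<le> ereal q')" using q' by simp
      then obtain y where y: "ereal q' < y" "\<not> eventually (\<lambda>h. X h < y) (at 0)" unfolding Limsup_le_iff by blast
      then have "frequently (\<lambda>h. y \<le> X h) (at 0)" by (simp add: frequently_def not_le)
      then show ?thesis
      proof (rule frequently_elim1)
        fix h :: real assume "y \<le> X h"
        then have "ereal q' < X h" using y(1) by simp
        then show "Q h \<in> {of_rat q<..}" using q by (simp add: X_def)
      qed
    qed
    have "x \<in> osc_set f v (of_rat p) (of_rat q)"
      unfolding osc_set_def using near[OF fp] near[OF fq] by (auto simp: Q_def)
    moreover have "p < q" using q by (simp add: of_rat_less)
    ultimately show False using x by blast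
  qed
  then have lim: "(X \<longlongrightarrow> Limsup (at 0) X) (at 0)" by (intro tendsto_iff_Liminf_eq_Limsup[THEN iffD2]) auto
  have "Limsup (at 0) X \<le> ereal (L * norm v)" using bnd by (intro Limsup_bounded) (auto simp: X_def abs_le_iff)
  moreover have "ereal (- (L * norm v)) \<le> Limsup (at 0) X"
  proof -
    have "ereal (- (L * norm v)) \<le> Liminf (at 0) X" using bnd by (intro Liminf_bounded) (auto simp: X_def abs_le_iff minus_le_iff)
    then show ?thesis using \<open>Liminf _ _ = _\<close> by simp
  qed
  ultimately obtain l where "Limsup (at 0) X = ereal l" by (cases "Limsup (at 0) X") auto
  then have "(Q \<longlongrightarrow> l) (at 0)" using lim unfolding X_def by simp
  then show thesis using that unfolding Q_def by blast
qed

text \<open>On a compact subset of {F > 0} the vanishing integral forces measure 0; inner regularity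
  extends this to the whole set, and -F is treated alike.\<close>

lemma AE_zero_if_integral_compact_zero:
  fixes F :: "'a::euclidean_space \<Rightarrow> real"
  assumes F [measurable]: "F \<in> borel_measurable borel"
    and int: "\<And>K. compact K \<Longrightarrow> integrable lborel (\<lambda>x. indicator K x * F x) \<and> (\<integral>x. indicator K x * F x \<partial>lborel) = 0"
  shows "AE x in lborel. F x = 0"
proof -
  have pos: "{x. 0 < G x} \<in> null_sets lborel"
    if G [measurable]: "G \<in> borel_measurable borel"
      and intG: "\<And>K. compact K \<Longrightarrow> integrable lborel (\<lambda>x. indicator K x * G x) \<and> (\<integral>x. indicator K x * G x \<partial>lborel) = 0"
    for G :: "'a \<Rightarrow> real"
  proof -
    let ?A = "{x. 0 < G x}"
    have A: "?A \<in> sets borel" by measurable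
    have K0: "emeasure lborel K = 0" if K: "compact K" "K \<subseteq> ?A" for K
    proof -
      have Kb [measurable]: "K \<in> sets borel" using K(1) by (simp add: borel_compact)
      have "0 \<le> indicator K x * G x" for x using K(2) by (auto simp: indicator_def less_imp_le)
      then have "AE x in lborel. indicator K x * G x = 0"
        using integral_nonneg_eq_0_iff_AE[of lborel "\<lambda>x. indicator K x * G x"] intG[OF K(1)] by auto
      moreover have "indicator K x * G x \<noteq> 0" if "x \<in> K" for x using that K(2) by auto
      ultimately have "AE x in lborel. x \<notin> K" by (elim eventually_mono) blast
      then show ?thesis using Kb by (simp add: AE_iff_measurable[of K])
    qed
    have T0: "emeasure lborel T = 0" if T: "closed T" "T \<subseteq> ?A" for T
    proof -
      have "T \<inter> cball 0 (real n) \<in> null_sets lborel" for n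
        using K0[of "T \<inter> cball 0 (real n)"] T by (auto simp: closed_Int_compact null_sets_def)
      then have "(\<Union>n. T \<inter> cball 0 (real n)) \<in> null_sets lborel" by (intro null_sets_UN)
      moreover have "(\<Union>n. T \<inter> cball 0 (real n)) = T" using real_arch_simple by (auto simp: set_eq_iff)
      ultimately show ?thesis by auto
    qed
    have "emeasure lborel ?A \<le> 0"
    proof (rule ennreal_le_epsilon)
      fix e :: real assume e: "0 < e"
      obtain T where T: "closed T" "T \<subseteq> ?A" "emeasure lebesgue (?A - T) < ennreal e"
        using sets_lebesgue_inner_closed[of ?A e] A e by (metis sets_completionI_sets sets_lborel)
      have "emeasure lborel ?A = emeasure lborel (T \<union> (?A - T))" using T(2) by (simp add: Un_absorb1)
      also have "\<dots> \<le> emeasure lborel T + emeasure lborel (?A - T)" using T(1) A by (intro emeasure_subadditive) auto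
      also have "\<dots> \<le> 0 + ennreal e" using T0[OF T(1,2)] T A by (simp add: less_imp_le)
      finally show "emeasure lborel ?A \<le> 0 + ennreal e" .
    qed
    then show ?thesis using A by auto
  qed
  have "{x. 0 < F x} \<in> null_sets lborel" by (rule pos[OF F int])
  moreover have "{x. 0 < - F x} \<in> null_sets lborel" by (rule pos) (use int in auto)
  ultimately have "AE x in lborel. x \<notin> {x. 0 < F x}" "AE x in lborel. x \<notin> {x. 0 < - F x}"
    by (auto dest!: AE_not_in)
  then show ?thesis by eventually_elim auto
qed

text \<open>The difference quotient in direction \<open>v + w\<close> differs from the sum of those in directions \<open>v\<close> and \<open>w\<close> by a translation
  of length \<open>O(1/k)\<close>, which in an integral is shifted to the continuous test function and disappears in the limit.\<close>

lemma dir_derivative_additive: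
  fixes f :: "'a::euclidean_space \<Rightarrow> real" and D :: "'a \<Rightarrow> 'a \<Rightarrow> real"
  assumes lip: "\<And>x y. \<bar>f x - f y\<bar> \<le> L * norm (x - y)" and L: "0 \<le> L"
  defines "q \<equiv> \<lambda>u (k::nat) x. (f (x + (1 / real (Suc k)) *\<^sub>R u) - f x) * real (Suc k)"
  assumes D: "\<And>u. u \<in> {v, w, v + w} \<Longrightarrow> AE x in lborel. (\<lambda>k. q u k x) \<longlonglongrightarrow> D u x"
    and Dm: "\<And>u. D u \<in> borel_measurable borel"
  shows "AE x in lborel. D (v + w) x = D v x + D w x"
proof -
  have cf: "continuous_on UNIV f"
    by (rule lipschitz_on_continuous_on[of L]) (use lip L in \<open>auto intro!: lipschitz_onI simp: dist_norm\<close>)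
  have fm [measurable]: "f \<in> borel_measurable borel" by (rule borel_measurable_continuous_onI[OF cf])
  have qm [measurable]: "q u k \<in> borel_measurable borel" for u k unfolding q_def by measurable
  note Dm [measurable]
  have qb: "\<bar>q u k x\<bar> \<le> L * norm u" for u k x
  proof -
    have "\<bar>f (x + (1 / real (Suc k)) *\<^sub>R u) - f x\<bar> \<le> L * norm u * (1 / real (Suc k))"
      using lip[of "x + (1 / real (Suc k)) *\<^sub>R u" x] by (simp add: mult_ac)
    then have "\<bar>f (x + (1 / real (Suc k)) *\<^sub>R u) - f x\<bar> * real (Suc k) \<le> L * norm u * (1 / real (Suc k)) * real (Suc k)"
      by (rule mult_right_mono) simp
    then show ?thesis unfolding q_def by (simp add: abs_mult)
  qed
  have cb: "integrable lborel (\<lambda>x::'a. c * indicator (cball 0 R) x :: real)" for c R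
    by (intro integrable_mult_right integrable_real_indicator) (auto simp: emeasure_lborel_cball_finite[unfolded infinity_ennreal_def])
  have main: "integrable lborel (\<lambda>x. \<psi> x * D u x)" "(\<lambda>k. \<integral>x. \<psi> x * q u k x \<partial>lborel) \<longlonglongrightarrow> (\<integral>x. \<psi> x * D u x \<partial>lborel)"
    if \<psi>: "continuous_on UNIV \<psi>" "\<And>x. 0 \<le> \<psi> x \<and> \<psi> x \<le> 1" "\<And>x. R < norm x \<Longrightarrow> \<psi> x = 0" and u: "u \<in> {v, w, v + w}"
    for \<psi> :: "'a \<Rightarrow> real" and R u
  proof -
    have [measurable]: "\<psi> \<in> borel_measurable borel" by (rule borel_measurable_continuous_onI[OF \<psi>(1)])
    have b: "norm (\<psi> x * q u k x) \<le> L * norm u * indicator (cball 0 R) x" for k x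
    proof (cases "R < norm x")
      case False
      have "\<bar>\<psi> x\<bar> * \<bar>q u k x\<bar> \<le> 1 * (L * norm u)" using \<psi>(2) qb by (intro mult_mono) auto
      then show ?thesis using False by (simp add: abs_mult)
    qed (simp add: \<psi>(3))
    have lim: "AE x in lborel. (\<lambda>k. \<psi> x * q u k x) \<longlonglongrightarrow> \<psi> x * D u x"
      using D[OF u] by (elim eventually_mono) (intro tendsto_mult tendsto_const)
    have db: "AE x in lborel. norm (\<psi> x * q u k x) \<le> L * norm u * indicator (cball 0 R) x" for k
      by (rule AE_I2) (rule b)
    show "integrable lborel (\<lambda>x. \<psi> x * D u x)"
      by (rule integrable_dominated_convergence[OF _ _ cb lim db]) measurable
    show "(\<lambda>k. \<integral>x. \<psi> x * q u k x \<partial>lborel) \<longlonglongrightarrow> (\<integral>x. \<psi> x * D u x \<partial>lborel)"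
      by (rule integral_dominated_convergence[OF _ _ cb lim db]) measurable
  qed
  define F where "F x = D (v + w) x - D v x - D w x" for x
  have Fm [measurable]: "F \<in> borel_measurable borel" unfolding F_def by measurable
  have zero: "integrable lborel (\<lambda>x. \<psi> x * F x) \<and> (\<integral>x. \<psi> x * F x \<partial>lborel) = 0"
    if \<psi>: "continuous_on UNIV \<psi>" "\<And>x. 0 \<le> \<psi> x \<and> \<psi> x \<le> 1" "\<And>x. R < norm x \<Longrightarrow> \<psi> x = 0" for \<psi> :: "'a \<Rightarrow> real" and R
  proof -
    have [measurable]: "\<psi> \<in> borel_measurable borel" by (rule borel_measurable_continuous_onI[OF \<psi>(1)])
    note m = main[OF \<psi>]
    have iq: "integrable lborel (\<lambda>x. \<psi> x * q u k x)" for u k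
    proof (rule Bochner_Integration.integrable_bound[OF cb[of "L * norm u" R]])
      have "norm (\<psi> x * q u k x) \<le> L * norm u * indicator (cball 0 R) x" for x
      proof (cases "R < norm x")
        case False
        have "\<bar>\<psi> x\<bar> * \<bar>q u k x\<bar> \<le> 1 * (L * norm u)" using \<psi>(2) qb by (intro mult_mono) auto
        then show ?thesis using False by (simp add: abs_mult)
      qed (simp add: \<psi>(3))
      then show "AE x in lborel. norm (\<psi> x * q u k x) \<le> norm (L * norm u * indicator (cball 0 R) x)"
        using L by (intro AE_I2) (fastforce intro: order_trans)
    qed measurable
    define c where "c k = (1 / real (Suc k)) *\<^sub>R v" for k
    \<comment> \<open>The quotient in direction v + w minus that in direction v is the quotient in
      direction w at the point shifted by \<open>c k\<close>; translation invariance moves the shift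
      to \<psi>.\<close>
    have shift: "(\<integral>x. \<psi> x * q (v + w) k x \<partial>lborel) - (\<integral>x. \<psi> x * q v k x \<partial>lborel) = (\<integral>x. \<psi> (x - c k) * q w k x \<partial>lborel)" for k
    proof -
      have "(\<integral>x. \<psi> x * q (v + w) k x \<partial>lborel) - (\<integral>x. \<psi> x * q v k x \<partial>lborel) = (\<integral>x. \<psi> x * q (v + w) k x - \<psi> x * q v k x \<partial>lborel)"
        by (rule Bochner_Integration.integral_diff[symmetric]) (rule iq)+
      also have "\<dots> = (\<integral>x. \<psi> (c k + x - c k) * q w k (c k + x) \<partial>lborel)"
        by (rule Bochner_Integration.integral_cong) (auto simp: q_def c_def algebra_simps)
      also have "\<dots> = (\<integral>x. \<psi> (x - c k) * q w k x \<partial>distr lborel borel ((+) (c k)))"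
        by (subst integral_distr) auto
      also have "\<dots> = (\<integral>x. \<psi> (x - c k) * q w k x \<partial>lborel)" by (simp add: lborel_distr_plus)
      finally show ?thesis .
    qed
    have c0: "c \<longlonglongrightarrow> 0" unfolding c_def
      using tendsto_scaleR[OF LIMSEQ_inverse_real_of_nat tendsto_const, of v] by (simp add: inverse_eq_divide)
    have lim: "AE x in lborel. (\<lambda>k. \<psi> (x - c k) * q w k x) \<longlonglongrightarrow> \<psi> x * D w x"
    proof (rule eventually_mono[OF D[of w]])
      fix x assume "(\<lambda>k. q w k x) \<longlonglongrightarrow> D w x"
      moreover have "(\<lambda>k. \<psi> (x - c k)) \<longlonglongrightarrow> \<psi> x"
        using continuous_on_tendsto_compose[OF \<psi>(1), of "\<lambda>k. x - c k" x] tendsto_diff[OF tendsto_const c0, of x] by simp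
      ultimately show "(\<lambda>k. \<psi> (x - c k) * q w k x) \<longlonglongrightarrow> \<psi> x * D w x" by (rule tendsto_mult[rotated])
    qed simp
    have b: "norm (\<psi> (x - c k) * q w k x) \<le> L * norm w * indicator (cball 0 (R + norm v)) x" for k x
    proof (cases "R < norm (x - c k)")
      case False
      have "1 / real (Suc k) * norm v \<le> 1 * norm v" by (intro mult_right_mono) auto
      then have "norm (c k) \<le> norm v" by (simp add: c_def)
      then have "x \<in> cball 0 (R + norm v)" using False norm_triangle_ineq[of "x - c k" "c k"] by simp
      moreover have "\<bar>\<psi> (x - c k)\<bar> * \<bar>q w k x\<bar> \<le> 1 * (L * norm w)" using \<psi>(2) qb by (intro mult_mono) auto
      ultimately show ?thesis by (simp add: abs_mult)
    qed (simp add: \<psi>(3) L)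
    have db: "AE x in lborel. norm (\<psi> (x - c k) * q w k x) \<le> L * norm w * indicator (cball 0 (R + norm v)) x" for k
      by (rule AE_I2) (rule b)
    have l1: "(\<lambda>k. \<integral>x. \<psi> (x - c k) * q w k x \<partial>lborel) \<longlonglongrightarrow> (\<integral>x. \<psi> x * D w x \<partial>lborel)"
      by (rule integral_dominated_convergence[OF _ _ cb lim db]) measurable
    have l2: "(\<lambda>k. (\<integral>x. \<psi> x * q (v + w) k x \<partial>lborel) - (\<integral>x. \<psi> x * q v k x \<partial>lborel))
        \<longlonglongrightarrow> (\<integral>x. \<psi> x * D (v + w) x \<partial>lborel) - (\<integral>x. \<psi> x * D v x \<partial>lborel)"
      by (rule tendsto_diff[OF m(2) m(2)]) simp_all
    have e: "(\<integral>x. \<psi> x * D (v + w) x \<partial>lborel) - (\<integral>x. \<psi> x * D v x \<partial>lborel) = (\<integral>x. \<psi> x * D w x \<partial>lborel)"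
      by (rule LIMSEQ_unique[OF l2[unfolded shift] l1])
    have eq: "(\<lambda>x. \<psi> x * F x) = (\<lambda>x. \<psi> x * D (v + w) x - \<psi> x * D v x - \<psi> x * D w x)"
      by (simp add: F_def algebra_simps)
    have i: "integrable lborel (\<lambda>x. \<psi> x * D (v + w) x)" "integrable lborel (\<lambda>x. \<psi> x * D v x)" "integrable lborel (\<lambda>x. \<psi> x * D w x)"
      by (auto intro: m(1))
    show ?thesis unfolding eq using e i by simp
  qed
  \<comment> \<open>This bound permits dominated convergence when continuous test functions are
    replaced by the indicator of K.\<close>
  have Fb: "AE x in lborel. \<bar>F x\<bar> \<le> 4 * L * (norm v + norm w)"
  proof -
    have "AE x in lborel. \<forall>u\<in>{v, w, v + w}. (\<lambda>k. q u k x) \<longlonglongrightarrow> D u x"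
      using D by (simp add: AE_conj_iff)
    then show ?thesis
    proof (elim eventually_mono)
      fix x assume a: "\<forall>u\<in>{v, w, v + w}. (\<lambda>k. q u k x) \<longlonglongrightarrow> D u x"
      have "\<bar>D u x\<bar> \<le> L * norm u" if "u \<in> {v, w, v + w}" for u
      proof (rule LIMSEQ_le_const2)
        show "(\<lambda>k. \<bar>q u k x\<bar>) \<longlonglongrightarrow> \<bar>D u x\<bar>" using a that by (intro tendsto_rabs) blast
        show "\<exists>N. \<forall>k\<ge>N. \<bar>q u k x\<bar> \<le> L * norm u" using qb by blast
      qed
      then have "\<bar>D v x\<bar> \<le> L * norm v" "\<bar>D w x\<bar> \<le> L * norm w" "\<bar>D (v + w) x\<bar> \<le> L * norm (v + w)" by auto
      moreover have "L * norm (v + w) \<le> L * (norm v + norm w)" using L by (intro mult_left_mono norm_triangle_ineq)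
      moreover have "0 \<le> L * norm v" "0 \<le> L * norm w" using L by auto
      ultimately show "\<bar>F x\<bar> \<le> 4 * L * (norm v + norm w)" unfolding F_def by (simp add: algebra_simps)
    qed
  qed
  have "AE x in lborel. F x = 0"
  proof (rule AE_zero_if_integral_compact_zero[OF Fm])
    fix K :: "'a set" assume K: "compact K"
    show "integrable lborel (\<lambda>x. indicator K x * F x) \<and> (\<integral>x. indicator K x * F x \<partial>lborel) = 0"
    proof (cases "K = {}")
      case False
      have [measurable]: "K \<in> sets borel" using K by (simp add: borel_compact)
      obtain R where R: "\<And>x. x \<in> K \<Longrightarrow> norm x \<le> R" using compact_imp_bounded[OF K] by (auto simp: bounded_iff)
      \<comment> \<open>Continuous functions that decrease to the indicator of K and vanish at
        distance 1 and more from it.\<close>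
      define \<psi> where "\<psi> j x = max 0 (1 - real (Suc j) * infdist x K)" for j x
      have p1: "continuous_on UNIV (\<psi> j)" for j unfolding \<psi>_def by (intro continuous_intros)
      have p2: "0 \<le> \<psi> j x \<and> \<psi> j x \<le> 1" for j x by (simp add: \<psi>_def infdist_nonneg)
      have p3: "\<psi> j x = 0" if "R + 1 < norm x" for j x
      proof -
        obtain y where y: "y \<in> K" "infdist x K = dist x y" using infdist_attains_inf[OF compact_imp_closed[OF K] False] by blast
        have "1 \<le> infdist x K" unfolding y(2) using R[OF y(1)] that norm_triangle_ineq2[of x y] by (simp add: dist_norm)
        then have "1 * 1 \<le> real (Suc j) * infdist x K" by (intro mult_mono) auto
        then show ?thesis by (simp add: \<psi>_def)
      qed
      have [measurable]: "\<psi> j \<in> borel_measurable borel" for j by (rule borel_measurable_continuous_onI[OF p1])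
      have lim: "(\<lambda>j. \<psi> j x) \<longlonglongrightarrow> indicator K x" for x
      proof (cases "x \<in> K")
        case True then show ?thesis by (simp add: \<psi>_def)
      next
        case F: False
        then have "0 < infdist x K" using compact_imp_closed[OF K] False by (simp add: infdist_pos_not_in_closed)
        then obtain n where n: "1 < real n * infdist x K" using ex_less_of_nat_mult by blast
        have "\<psi> j x = 0" if "n \<le> j" for j
        proof -
          have "real n * infdist x K \<le> real (Suc j) * infdist x K" using that by (intro mult_right_mono) (auto simp: infdist_nonneg)
          then show ?thesis using n by (simp add: \<psi>_def)
        qed
        then have "eventually (\<lambda>j. \<psi> j x = 0) sequentially" unfolding eventually_sequentially by blast
        then show ?thesis using F by (simp add: tendsto_eventually)
      qed
      have dl: "AE x in lborel. (\<lambda>j. \<psi> j x * F x) \<longlonglongrightarrow> indicator K x * F x"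
        by (intro AE_I2 tendsto_mult lim tendsto_const)
      have db: "AE x in lborel. norm (\<psi> j x * F x) \<le> 4 * L * (norm v + norm w) * indicator (cball 0 (R + 1)) x" for j
        using Fb
      proof (elim eventually_mono)
        fix x assume fb: "\<bar>F x\<bar> \<le> 4 * L * (norm v + norm w)"
        show "norm (\<psi> j x * F x) \<le> 4 * L * (norm v + norm w) * indicator (cball 0 (R + 1)) x"
        proof (cases "R + 1 < norm x")
          case False
          have "\<bar>\<psi> j x\<bar> * \<bar>F x\<bar> \<le> 1 * (4 * L * (norm v + norm w))" using p2[of j x] fb by (intro mult_mono) auto
          then show ?thesis using False by (simp add: abs_mult)
        qed (simp add: p3)
      qed
      have "integrable lborel (\<lambda>x. indicator K x * F x)"
        by (rule integrable_dominated_convergence[OF _ _ cb dl db]) measurable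
      moreover have "(\<lambda>j. \<integral>x. \<psi> j x * F x \<partial>lborel) \<longlonglongrightarrow> (\<integral>x. indicator K x * F x \<partial>lborel)"
        by (rule integral_dominated_convergence[OF _ _ cb dl db]) measurable
      moreover have "(\<integral>x. \<psi> j x * F x \<partial>lborel) = 0" for j using zero[OF p1 p2 p3] by blast
      ultimately show ?thesis by (simp add: LIMSEQ_const_iff)
    qed simp
  qed
  then show ?thesis by (elim eventually_mono) (simp add: F_def)
qed

text \<open>Off a null set the derivatives along a countable dense group V of rational directions
  exist and are additive in the direction. The resulting linear map is the derivative: finitely many
  directions from V control all unit vectors at once, since f and the linear map are both
  Lipschitz.\<close>

theorem lipschitz_AE_differentiable:
  fixes f :: "'a::euclidean_space \<Rightarrow> real"
  assumes lip: "\<And>x y. \<bar>f x - f y\<bar> \<le> L * norm (x - y)" and L: "0 \<le> L"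
  obtains N where "N \<in> null_sets lborel" "\<And>x. x \<notin> N \<Longrightarrow> f differentiable (at x)"
proof -
  have cf: "continuous_on UNIV f"
    by (rule lipschitz_on_continuous_on[of L]) (use lip L in \<open>auto intro!: lipschitz_onI simp: dist_norm\<close>)
  have fm [measurable]: "f \<in> borel_measurable borel" by (rule borel_measurable_continuous_onI[OF cf])
  define comb where "comb c = (\<Sum>i\<in>Basis. of_rat (c i) *\<^sub>R i :: 'a)" for c :: "'a \<Rightarrow> rat"
  define V where "V = comb ` (Basis \<rightarrow>\<^sub>E UNIV)"
  have Vc: "countable V" unfolding V_def by (intro countable_image countable_PiE) auto
  have VI: "comb c \<in> V" for c
  proof -
    have "comb c = comb (restrict c Basis)" by (simp add: comb_def)
    then show ?thesis by (auto simp: V_def)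
  qed
  have Vadd: "u + w \<in> V" if "u \<in> V" "w \<in> V" for u w
  proof -
    obtain c d where "u = comb c" "w = comb d" using \<open>u \<in> V\<close> \<open>w \<in> V\<close> by (auto simp: V_def)
    then have "u + w = comb (\<lambda>i. c i + d i)" by (simp add: comb_def sum.distrib[symmetric] scaleR_add_left of_rat_add)
    then show ?thesis by (simp add: VI)
  qed
  have Vdense: "\<exists>u\<in>V. norm (x - u) < e" if "0 < e" for x :: 'a and e
  proof -
    have "\<exists>r::rat. \<bar>x \<bullet> i - of_rat r\<bar> < e / real DIM('a)" for i
    proof -
      have "0 < e / real DIM('a)" using \<open>0 < e\<close> by simp
      then obtain r where "x \<bullet> i < of_rat r" "of_rat r < x \<bullet> i + e / real DIM('a)"
        using of_rat_dense[of "x \<bullet> i" "x \<bullet> i + e / real DIM('a)"] by auto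
      then show ?thesis by (intro exI[of _ r]) auto
    qed
    then obtain c :: "'a \<Rightarrow> rat" where c: "\<And>i. \<bar>x \<bullet> i - of_rat (c i)\<bar> < e / real DIM('a)" by metis
    have "norm (x - comb c) \<le> (\<Sum>i\<in>Basis. \<bar>(x - comb c) \<bullet> i\<bar>)" by (rule norm_le_l1)
    also have "\<dots> < (\<Sum>i\<in>(Basis::'a set). e / real DIM('a))"
      using c by (intro sum_strict_mono) (auto simp: comb_def inner_diff_left)
    also have "\<dots> = e" by simp
    finally show ?thesis using VI by blast
  qed
  define q where "q = (\<lambda>u (k::nat) x. (f (x + (1 / real (Suc k)) *\<^sub>R u) - f x) * real (Suc k))"
  define D where "D u x = lim (\<lambda>k. q u k x)" for u x
  have qm [measurable]: "q u k \<in> borel_measurable borel" for u k unfolding q_def by measurable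
  have Dm [measurable]: "D u \<in> borel_measurable borel" for u unfolding D_def by measurable
  \<comment> \<open>Only countably many directions and pairs of rationals occur, so the union is
    null.\<close>
  define N1 where "N1 = (\<Union>u\<in>V. \<Union>(p, r)\<in>{(p :: rat, r). p < r}. osc_set f u (of_rat p) (of_rat r))"
  have N1: "N1 \<in> null_sets lborel"
    unfolding N1_def using Vc
    by (intro null_sets_UN' countableI_type) (auto intro!: osc_set_null[OF lip L] simp: of_rat_less)
  have full: "((\<lambda>h. (f (x + h *\<^sub>R u) - f x) / h) \<longlongrightarrow> D u x) (at 0)" "(\<lambda>k. q u k x) \<longlonglongrightarrow> D u x"
    if x: "x \<notin> N1" and u: "u \<in> V" for x u
  proof -
    obtain l where l: "((\<lambda>h. (f (x + h *\<^sub>R u) - f x) / h) \<longlongrightarrow> l) (at 0)"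
      by (rule quotient_tendsto_if_not_osc[OF lip L, of x u]) (use x u in \<open>auto simp: N1_def\<close>)
    have "filterlim (\<lambda>k. 1 / real (Suc k)) (at 0) sequentially"
      unfolding filterlim_at using LIMSEQ_inverse_real_of_nat by (auto simp: inverse_eq_divide)
    from filterlim_compose[OF l this] have ql: "(\<lambda>k. q u k x) \<longlonglongrightarrow> l" by (simp add: q_def)
    then have "D u x = l" by (simp add: D_def limI)
    then show "((\<lambda>h. (f (x + h *\<^sub>R u) - f x) / h) \<longlongrightarrow> D u x) (at 0)" "(\<lambda>k. q u k x) \<longlonglongrightarrow> D u x"
      using l ql by auto
  qed
  have AEq: "AE x in lborel. (\<lambda>k. q u k x) \<longlonglongrightarrow> D u x" if "u \<in> V" for u
    using AE_not_in[OF N1] by (rule eventually_mono) (use full that in auto)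
  have "AE x in lborel. \<forall>u\<in>V. \<forall>w\<in>V. D (u + w) x = D u x + D w x"
  proof -
    have "AE x in lborel. D (u + w) x = D u x + D w x" if "u \<in> V" "w \<in> V" for u w
      by (rule dir_derivative_additive[OF lip L]) (use AEq Vadd that Dm in \<open>auto simp: q_def\<close>)
    then show ?thesis using Vc by (simp add: AE_ball_countable)
  qed
  then obtain N2 where N2: "N2 \<in> null_sets lborel" "\<And>x. x \<notin> N2 \<Longrightarrow> \<forall>u\<in>V. \<forall>w\<in>V. D (u + w) x = D u x + D w x"
    by (auto elim!: AE_E3)
  show thesis
  proof (rule that[of "N1 \<union> N2"])
    show "N1 \<union> N2 \<in> null_sets lborel" using N1 N2 by auto
    fix x assume x: "x \<notin> N1 \<union> N2"
    have add: "D (u + w) x = D u x + D w x" if "u \<in> V" "w \<in> V" for u w using N2(2)[of x] x that by blast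
    \<comment> \<open>For c different from 0 this is the substitution of c h for the increment
      h.\<close>
    have hom: "D (c *\<^sub>R u) x = c * D u x" if "u \<in> V" "c *\<^sub>R u \<in> V" for c u
    proof (cases "c = 0")
      case True
      have "D 0 x = 0" by (simp add: D_def q_def)
      then show ?thesis using True by simp
    next
      case False
      have "((\<lambda>h. (f (x + (c * h) *\<^sub>R u) - f x) / (c * h)) \<longlongrightarrow> D u x) (at 0)"
      proof (rule filterlim_compose[OF full(1)])
        show "filterlim (\<lambda>h. c * h) (at 0) (at 0)"
          unfolding filterlim_at using False by (auto simp: eventually_at_filter intro!: tendsto_eq_intros)
      qed (use x that in auto)
      then have "((\<lambda>h. c * ((f (x + (c * h) *\<^sub>R u) - f x) / (c * h))) \<longlongrightarrow> c * D u x) (at 0)" by (intro tendsto_mult tendsto_const)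
      then have "((\<lambda>h. (f (x + h *\<^sub>R (c *\<^sub>R u)) - f x) / h) \<longlongrightarrow> c * D u x) (at 0)" using False by (simp add: mult.commute)
      then show ?thesis using full(1)[of x "c *\<^sub>R u"] x that by (intro tendsto_unique[OF _ full(1)]) auto
    qed
    define A where "A u = (\<Sum>i\<in>Basis. (u \<bullet> i) * D i x)" for u
    have iV: "of_rat c *\<^sub>R i \<in> V" if "i \<in> Basis" for i :: 'a and c
    proof -
      have "comb (\<lambda>j. if j = i then c else 0) = (\<Sum>j\<in>Basis. if j = i then of_rat c *\<^sub>R j else 0)"
        unfolding comb_def by (rule sum.cong) auto
      also have "\<dots> = of_rat c *\<^sub>R i" using that by simp
      finally show ?thesis using VI by metis
    qed
    have DA: "D u x = A u" if "u \<in> V" for u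
    proof -
      obtain c where c: "u = comb c" using \<open>u \<in> V\<close> by (auto simp: V_def)
      have part: "(\<Sum>i\<in>J. of_rat (c i) *\<^sub>R i) \<in> V \<and> D (\<Sum>i\<in>J. of_rat (c i) *\<^sub>R i) x = (\<Sum>i\<in>J. of_rat (c i) * D i x)"
        if "finite J" "J \<subseteq> Basis" for J :: "'a set"
        using that
      proof (induction J rule: finite_induct)
        case empty
        have "comb (\<lambda>_. 0) \<in> V" by (rule VI)
        then show ?case by (simp add: comb_def D_def q_def)
      next
        case (insert i J)
        have i: "i \<in> V" using iV[of i 1] insert by simp
        have ci: "of_rat (c i) *\<^sub>R i \<in> V" using iV insert by auto
        show ?case using insert add[OF ci] Vadd[OF ci] hom[OF i ci] by simp
      qed
      have "A u = (\<Sum>i\<in>Basis. of_rat (c i) * D i x)" unfolding A_def c comb_def by (rule sum.cong) auto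
      then show ?thesis using part[of Basis] unfolding c comb_def by simp
    qed
    have Alin: "linear A" unfolding A_def
      by (intro linearI) (auto simp: inner_add_left algebra_simps sum.distrib sum_distrib_left)
    define a where "a = (\<Sum>i\<in>Basis. \<bar>D i x\<bar>)"
    have a0: "0 \<le> a" by (simp add: a_def sum_nonneg)
    have Ab: "\<bar>A u\<bar> \<le> a * norm u" for u
    proof -
      have "\<bar>A u\<bar> \<le> (\<Sum>i\<in>Basis. \<bar>(u \<bullet> i) * D i x\<bar>)" unfolding A_def by (rule sum_abs)
      also have "\<dots> \<le> (\<Sum>i\<in>Basis. norm u * \<bar>D i x\<bar>)"
        by (intro sum_mono) (auto simp: abs_mult intro!: mult_right_mono Basis_le_norm)
      finally show ?thesis by (simp add: a_def sum_distrib_left mult.commute)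
    qed
    have "(f has_derivative A) (at x)"
      unfolding has_derivative_at_alt
    proof (intro conjI allI impI)
      show "bounded_linear A" using Alin by (simp add: linear_conv_bounded_linear)
      fix e :: real assume e: "0 < e"
      \<comment> \<open>Replacing a unit vector by a net vector within \<eta> costs at most (L + a)
        \<eta> t in f and A together, which is at most half of the admissible error.\<close>
      define \<eta> where "\<eta> = e / (2 * (L + a + 1))"
      have \<eta>: "0 < \<eta>" using e L a0 by (simp add: \<eta>_def)
      have "sphere (0::'a) 1 \<subseteq> (\<Union>u\<in>V. ball u \<eta>)" using Vdense[OF \<eta>] by (auto simp: dist_norm norm_minus_commute)
      then obtain W where W: "W \<subseteq> V" "finite W" "sphere (0::'a) 1 \<subseteq> (\<Union>u\<in>W. ball u \<eta>)"
        using compactE_image[of "sphere (0::'a) 1" V "\<lambda>u. ball u \<eta>"] by auto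
      have "\<exists>d>0. \<forall>h. h \<noteq> 0 \<and> \<bar>h\<bar> < d \<longrightarrow> \<bar>(f (x + h *\<^sub>R u) - f x) / h - A u\<bar> < e/2" if "u \<in> W" for u
      proof -
        have "((\<lambda>h. (f (x + h *\<^sub>R u) - f x) / h) \<longlongrightarrow> A u) (at 0)" using full(1)[of x u] DA[of u] W x that by auto
        from tendstoD[OF this, of "e/2"] e show ?thesis by (auto simp: eventually_at dist_real_def)
      qed
      then obtain d where d: "\<And>u. u \<in> W \<Longrightarrow> 0 < d u" "\<And>u h. u \<in> W \<Longrightarrow> h \<noteq> 0 \<Longrightarrow> \<bar>h\<bar> < d u \<Longrightarrow> \<bar>(f (x + h *\<^sub>R u) - f x) / h - A u\<bar> < e/2"
        by metis
      define d0 where "d0 = Min (insert 1 (d ` W))"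
      have d0: "0 < d0" "\<And>u. u \<in> W \<Longrightarrow> d0 \<le> d u" using W d by (auto simp: d0_def)
      have "norm (f y - f x - A (y - x)) \<le> e * norm (y - x)" if y: "norm (y - x) < d0" for y
      proof (cases "y = x")
        case True then show ?thesis by (simp add: linear_0[OF Alin])
      next
        case False
        define t where "t = norm (y - x)"
        define u where "u = (y - x) /\<^sub>R t"
        have t: "0 < t" "t < d0" using False y by (auto simp: t_def)
        have "norm u = 1" using t by (simp add: u_def t_def)
        then obtain w where w: "w \<in> W" "norm (w - u) < \<eta>" using W(3) by (force simp: dist_norm)
        have yx: "y = x + t *\<^sub>R u" using t by (simp add: u_def)
        have 1: "\<bar>f (x + t *\<^sub>R u) - f (x + t *\<^sub>R w)\<bar> \<le> L * (t * \<eta>)"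
        proof -
          have "\<bar>f (x + t *\<^sub>R u) - f (x + t *\<^sub>R w)\<bar> \<le> L * norm (t *\<^sub>R (w - u))"
            using lip[of "x + t *\<^sub>R u" "x + t *\<^sub>R w"] by (simp add: algebra_simps norm_minus_commute)
          also have "\<dots> \<le> L * (t * \<eta>)" using L t w by (intro mult_left_mono) auto
          finally show ?thesis .
        qed
        have 2: "\<bar>f (x + t *\<^sub>R w) - f x - t * A w\<bar> \<le> e/2 * t"
        proof -
          have "\<bar>(f (x + t *\<^sub>R w) - f x) / t - A w\<bar> < e/2" using d(2)[OF w(1), of t] d0(2)[OF w(1)] t by simp
          then have "\<bar>(f (x + t *\<^sub>R w) - f x) / t - A w\<bar> * t \<le> e/2 * t" using t by (intro mult_right_mono) auto
          moreover have "\<bar>(f (x + t *\<^sub>R w) - f x) / t - A w\<bar> * t = \<bar>((f (x + t *\<^sub>R w) - f x) / t - A w) * t\<bar>" using t by (simp add: abs_mult)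
          moreover have "((f (x + t *\<^sub>R w) - f x) / t - A w) * t = f (x + t *\<^sub>R w) - f x - t * A w" using t by (simp add: field_simps)
          ultimately show ?thesis by simp
        qed
        have 3: "\<bar>t * A w - A (y - x)\<bar> \<le> a * (t * \<eta>)"
        proof -
          have "t * A w - A (y - x) = A (t *\<^sub>R (w - u))"
            unfolding yx by (simp add: linear_scale[OF Alin] linear_diff[OF Alin] right_diff_distrib)
          then have "\<bar>t * A w - A (y - x)\<bar> \<le> a * norm (t *\<^sub>R (w - u))" by (simp only: Ab)
          also have "\<dots> \<le> a * (t * \<eta>)" using a0 t w by (intro mult_left_mono) auto
          finally show ?thesis .
        qed
        have "(L + a) * \<eta> \<le> e/2"
        proof -
          have "(L + a) * \<eta> \<le> (L + a + 1) * \<eta>" using \<eta> by (intro mult_right_mono) auto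
          also have "\<dots> = e/2" using L a0 by (simp add: \<eta>_def field_simps)
          finally show ?thesis .
        qed
        then have "(L + a) * \<eta> * t \<le> e/2 * t" using t by (intro mult_right_mono) auto
        moreover have "(L + a) * \<eta> * t = L * (t * \<eta>) + a * (t * \<eta>)" by (simp add: algebra_simps)
        moreover have "f (x + t *\<^sub>R u) = f y" using yx by simp
        moreover have "e/2 * t + e/2 * t = e * t" by simp
        ultimately have "\<bar>f y - f x - A (y - x)\<bar> \<le> e * t" using 1 2 3 by linarith
        then show ?thesis by (simp add: t_def)
      qed
      then show "\<exists>d>0. \<forall>y. norm (y - x) < d \<longrightarrow> norm (f y - f x - A (y - x)) \<le> e * norm (y - x)" using d0 by blast
    qed
    then show "f differentiable (at x)" by (rule differentiableI)
  qed
qed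

lemma lipschitz_AE_differentiable_vector:
  fixes f :: "'a::euclidean_space \<Rightarrow> 'b::euclidean_space"
  assumes lip: "\<And>x y. norm (f x - f y) \<le> L * norm (x - y)" and L: "0 \<le> L"
  obtains N where "N \<in> null_sets lborel" "\<And>x. x \<notin> N \<Longrightarrow> f differentiable (at x)"
proof -
  have "\<exists>N. N \<in> null_sets lborel \<and> (\<forall>x. x \<notin> N \<longrightarrow> (\<lambda>x. f x \<bullet> i) differentiable (at x))" if i: "i \<in> Basis" for i
  proof -
    have "\<bar>f x \<bullet> i - f y \<bullet> i\<bar> \<le> L * norm (x - y)" for x y
      using Basis_le_norm[OF i, of "f x - f y"] lip[of x y] by (simp add: inner_diff_left)
    from lipschitz_AE_differentiable[OF this L] show ?thesis by metis
  qed
  then obtain N where N: "\<And>i. i \<in> Basis \<Longrightarrow> N i \<in> null_sets lborel"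
    "\<And>i x. i \<in> Basis \<Longrightarrow> x \<notin> N i \<Longrightarrow> (\<lambda>x. f x \<bullet> i) differentiable (at x)" by metis
  show thesis
  proof (rule that[of "\<Union>i\<in>Basis. N i"])
    show "(\<Union>i\<in>Basis. N i) \<in> null_sets lborel" using N(1) by (intro null_sets_UN') (auto intro: countable_finite)
    show "f differentiable (at x)" if "x \<notin> (\<Union>i\<in>Basis. N i)" for x
      using N(2) that differentiable_componentwise_within[of f x UNIV] by auto
  qed
qed

section \<open>Tangent planes of Lipschitz submanifolds\<close>

text \<open>Closing the sets of a cover changes neither diameters nor cost, so an intersection of
  such covers is a Borel null set. It makes exceptional sets admissible for
  \<open>hausdorff_measure\<close>, which lives on Borel sets.\<close>

lemma hausdorff_null_borel_hull:
  fixes A :: "'a::euclidean_space set"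
  assumes s: "0 < s" and A: "hausdorff_outer s A = 0"
  obtains N where "N \<in> sets borel" "A \<subseteq> N" "hausdorff_outer s N = 0"
proof -
  have "\<exists>C\<in>hcover (1 / real (Suc n)) A. (\<Sum>i. hcost s (C i)) < ennreal (1 / real (Suc n))" for n
  proof -
    have "hdelta s (1 / real (Suc n)) A = 0" using hdelta_le_hausdorff[of "1 / real (Suc n)" s A] A by simp
    then have "hdelta s (1 / real (Suc n)) A < ennreal (1 / real (Suc n))" by simp
    then show ?thesis unfolding hdelta_def INF_less_iff .
  qed
  then obtain C where C: "\<And>n. C n \<in> hcover (1 / real (Suc n)) A" "\<And>n. (\<Sum>i. hcost s (C n i)) < ennreal (1 / real (Suc n))" by metis
  define N where "N = (\<Inter>n. \<Union>i. closure (C n i))"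
  show thesis
  proof (rule that[of N])
    show "N \<in> sets borel" unfolding N_def by auto
    show "A \<subseteq> N"
    proof
      fix x assume x: "x \<in> A"
      have "x \<in> (\<Union>i. closure (C n i))" for n
      proof -
        obtain i where "x \<in> C n i" using x C(1)[of n] by (auto simp: hcover_def)
        then have "x \<in> closure (C n i)" using closure_subset[of "C n i"] by (rule subsetD[rotated])
        then show ?thesis by blast
      qed
      then show "x \<in> N" by (simp add: N_def)
    qed
    have "hausdorff_outer s N \<le> 0"
    proof (rule hausdorff_outer_leI)
      fix \<delta> :: real assume \<delta>: "0 < \<delta>"
      have "hdelta s \<delta> N \<le> ennreal (1 / real (Suc n))" if n: "1 / real (Suc n) \<le> \<delta>" for n
      proof -
        have bd: "bounded (C n i)" "diameter (C n i) \<le> 1 / real (Suc n)" for i using C(1)[of n] by (auto simp: hcover_def)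
        have "(\<lambda>i. closure (C n i)) \<in> hcover \<delta> N"
          using bd n by (auto simp: hcover_def N_def diameter_closure intro: order_trans)
        then have "hdelta s \<delta> N \<le> (\<Sum>i. hcost s (closure (C n i)))" by (rule hdelta_le)
        also have "\<dots> = (\<Sum>i. hcost s (C n i))" by (simp add: hcost_def diameter_closure bd)
        finally show ?thesis using C(2)[of n] by simp
      qed
      note le = this
      show "hdelta s \<delta> N \<le> 0"
      proof (rule ennreal_le_epsilon)
        fix e :: real assume e: "0 < e"
        obtain n where n: "inverse (real (Suc n)) < min \<delta> e" using reals_Archimedean[of "min \<delta> e"] \<delta> e by auto
        have "hdelta s \<delta> N \<le> ennreal (1 / real (Suc n))" using n by (intro le) (simp add: inverse_eq_divide)
        also have "\<dots> \<le> ennreal e" using n by (intro ennreal_leI) (simp add: inverse_eq_divide)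
        finally show "hdelta s \<delta> N \<le> 0 + ennreal e" by simp
      qed
    qed
    then show "hausdorff_outer s N = 0" by simp
  qed
qed

text \<open>A null set of the m-plane P is encoded by the null cylinder N over it in the whole
  space. Tubes over small balls about the projection of A lie in an open set T around N of small
  measure; a Vitali selection makes them disjoint, and the Lipschitz bound over P turns their
  measure into the cost of a cover of A.\<close>

lemma hausdorff_null_of_cylinder:
  fixes N A P :: "'a::euclidean_space set"
  assumes P: "subspace P" "dim P = m" and m: "1 \<le> m" and N: "negligible N"
    and cyl: "\<And>x y. x \<in> N \<Longrightarrow> oproj P y = oproj P x \<Longrightarrow> y \<in> N"
    and A: "A \<subseteq> N" and K: "0 < K" "\<And>x y. x \<in> A \<Longrightarrow> y \<in> A \<Longrightarrow> norm (x - y) \<le> K * norm (oproj P (x - y))"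
  shows "hausdorff_outer m A = 0"
proof -
  obtain B where B: "orthonormal B" "B \<subseteq> P" "card B = m" "span B = P" using orthonormal_basis_exists[OF P] .
  obtain B' where B': "orthonormal (B \<union> B')" "B \<inter> B' = {}" "span (B \<union> B') = UNIV" using orthonormal_extend[OF B(1)] .
  have fin: "finite B" "finite B'" using B' by (auto simp: orthonormal_def)
  have n1: "norm b = 1" if "b \<in> B \<union> B'" for b using B'(1) that by (auto simp: orthonormal_def norm_eq_1)
  have oB: "b \<bullet> b' = 0" "b' \<bullet> b = 0" if "b \<in> B" "b' \<in> B'" for b b' using B'(1,2) that by (auto simp: orthonormal_def)
  have PB': "p \<bullet> b' = 0" if "p \<in> P" "b' \<in> B'" for p b'
  proof -
    have "orthogonal b' p" using that B(4) oB by (intro orthogonal_to_span[of p B b']) (auto simp: orthogonal_def)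
    then show ?thesis by (simp add: orthogonal_def inner_commute)
  qed
  have oprojB: "oproj P x \<bullet> b = x \<bullet> b" if "b \<in> B" for x b using that B P by (intro oproj_inner) auto
  have oproj_eqI: "oproj P x = u" if "u \<in> P" "\<And>b. b \<in> B \<Longrightarrow> x \<bullet> b = u \<bullet> b" for x u
  proof (rule oproj_unique[OF P(1) \<open>u \<in> P\<close>])
    fix v assume "v \<in> P"
    then have "orthogonal (x - u) v" using that B(4) by (intro orthogonal_to_span[of v B]) (auto simp: orthogonal_def inner_diff_left)
    then show "(x - u) \<bullet> v = 0" by (simp add: orthogonal_def)
  qed
  have norm_le: "norm p \<le> (\<Sum>b\<in>B. \<bar>p \<bullet> b\<bar>)" if p: "p \<in> P" for p
  proof -
    have "p = (\<Sum>b\<in>B \<union> B'. (p \<bullet> b) *\<^sub>R b)" using orthonormal_expand[OF B'(1,3)] by simp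
    also have "norm \<dots> \<le> (\<Sum>b\<in>B \<union> B'. \<bar>p \<bullet> b\<bar>)" using n1 by (intro sum_norm_le) auto
    also have "\<dots> = (\<Sum>b\<in>B. \<bar>p \<bullet> b\<bar>) + (\<Sum>b\<in>B'. \<bar>p \<bullet> b\<bar>)" using fin B'(2) by (rule sum.union_disjoint)
    also have "(\<Sum>b\<in>B'. \<bar>p \<bullet> b\<bar>) = 0" using PB'[OF p] by (intro sum.neutral) auto
    finally show ?thesis by simp
  qed
  \<comment> \<open>The part of the fibre over u with complementary coordinates at most 1/2 in
    modulus. It is compact, so a tube of some positive radius around it stays inside an open set
    containing it.\<close>
  define Fib where "Fib u = {z. (\<forall>b\<in>B. z \<bullet> b = u \<bullet> b) \<and> (\<forall>b\<in>B'. \<bar>z \<bullet> b\<bar> \<le> 1/2)}" for u :: 'a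
  have Fibc: "compact (Fib u)" for u
  proof -
    have "closed (Fib u)"
    proof -
      have "Fib u = (\<Inter>b\<in>B. {z. z \<bullet> b = u \<bullet> b}) \<inter> (\<Inter>b\<in>B'. {z. \<bar>z \<bullet> b\<bar> \<le> 1/2})" by (auto simp: Fib_def)
      also have "closed \<dots>" by (intro closed_Int closed_INT ballI closed_Collect_eq closed_Collect_le continuous_intros)
      finally show ?thesis .
    qed
    moreover have "norm z \<le> (\<Sum>b\<in>B \<union> B'. \<bar>u \<bullet> b\<bar> + 1/2)" if "z \<in> Fib u" for z
    proof -
      have "z = (\<Sum>b\<in>B \<union> B'. (z \<bullet> b) *\<^sub>R b)" using orthonormal_expand[OF B'(1,3)] by simp
      also have "norm \<dots> \<le> (\<Sum>b\<in>B \<union> B'. \<bar>u \<bullet> b\<bar> + 1/2)"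
      proof (rule sum_norm_le)
        fix b assume b: "b \<in> B \<union> B'"
        then have "\<bar>z \<bullet> b\<bar> \<le> \<bar>u \<bullet> b\<bar> + 1/2" using that by (auto simp: Fib_def intro: order_trans)
        then show "norm ((z \<bullet> b) *\<^sub>R b) \<le> \<bar>u \<bullet> b\<bar> + 1/2" using n1[OF b] by simp
      qed
      finally show ?thesis .
    qed
    ultimately show ?thesis by (auto simp: compact_eq_bounded_closed bounded_iff)
  qed
  have FibN: "Fib u \<subseteq> N" if x: "x \<in> A" "u = oproj P x" for u x
  proof
    fix z assume z: "z \<in> Fib u"
    have "oproj P z = u" using z x P by (intro oproj_eqI) (auto simp: Fib_def)
    then show "z \<in> N" using cyl[of x z] x A by auto
  qed
  have Fib_ne: "Fib u \<noteq> {}" if u: "u \<in> P" for u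
    using PB'[OF u] by (auto simp: Fib_def intro!: exI[of _ u])
  \<comment> \<open>A covering set has diameter at most 10 K \<rho>, and 5 K \<rho> is 5 K m times
    the side \<rho> / m of the associated box.\<close>
  define c where "c = unit_ball_vol (real m) * (5 * K * m) ^ m"
  have c0: "0 < c" using K m by (simp add: c_def)
  have main: "hdelta m \<delta> A \<le> ennreal (c * e)" if \<delta>: "0 < \<delta>" and e: "0 < e" for \<delta> e
  proof -
    have Nl: "N \<in> null_sets lebesgue" using N by (simp only: negligible_iff_null_sets)
    obtain T where T: "open T" "N \<subseteq> T" "emeasure lebesgue (T - N) < ennreal e"
      by (rule sets_lebesgue_outer_open[OF null_setsD2[OF Nl] e])
    have Te: "emeasure lborel T \<le> ennreal e"
    proof -
      have "emeasure lebesgue T = emeasure lebesgue ((T - N) \<union> N)" using T(2) by (simp add: Un_absorb2)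
      also have "\<dots> = emeasure lebesgue (T - N)" using T(1) Nl by (intro emeasure_Un_null_set) auto
      finally show ?thesis using T(1,3) by (simp add: less_imp_le)
    qed
    let ?S = "oproj P ` A"
    have "\<exists>\<rho>>0. \<rho> \<le> \<delta> / (10 * K) \<and> {z. infdist z (Fib u) \<le> \<rho>} \<subseteq> T" if u: "u \<in> ?S" for u
    proof -
      obtain x where x: "x \<in> A" "u = oproj P x" using u by blast
      have "u \<in> P" using x P by simp
      moreover have "Fib u \<subseteq> T" using FibN[OF x] T(2) by blast
      ultimately obtain r where r: "0 < r" "{z. infdist z (Fib u) \<le> r} \<subseteq> T"
        using compact_in_open_separated[OF Fib_ne Fibc T(1), of u] by blast
      show ?thesis using r \<delta> K by (intro exI[of _ "min r (\<delta> / (10 * K))"]) auto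
    qed
    then have "\<forall>u\<in>?S. \<exists>\<rho>. 0 < \<rho> \<and> \<rho> \<le> \<delta> / (10 * K) \<and> {z. infdist z (Fib u) \<le> \<rho>} \<subseteq> T" by blast
    from bchoice[OF this] obtain \<rho> where "\<forall>u\<in>?S. 0 < \<rho> u \<and> \<rho> u \<le> \<delta> / (10 * K) \<and> {z. infdist z (Fib u) \<le> \<rho> u} \<subseteq> T" ..
    then have \<rho>: "\<And>u. u \<in> ?S \<Longrightarrow> 0 < \<rho> u" "\<And>u. u \<in> ?S \<Longrightarrow> \<rho> u \<le> \<delta> / (10 * K)"
      "\<And>u. u \<in> ?S \<Longrightarrow> {z. infdist z (Fib u) \<le> \<rho> u} \<subseteq> T" by blast+
    have "?S \<subseteq> (\<Union>u\<in>?S. ball u (\<rho> u))"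
    proof
      fix u assume "u \<in> ?S"
      then show "u \<in> (\<Union>u\<in>?S. ball u (\<rho> u))" using \<rho>(1)[of u] by (intro UN_I[of u]) auto
    qed
    then obtain C where C: "countable C" "C \<subseteq> ?S" "pairwise (\<lambda>i j. disjnt (ball i (\<rho> i)) (ball j (\<rho> j))) C"
      "?S \<subseteq> (\<Union>u\<in>C. ball u (5 * \<rho> u))"
      by (rule Vitali_covering_lemma_balls[where B = "\<delta> / (10 * K)"]) (use \<rho>(1,2) in blast)+
    \<comment> \<open>Half-sides \<rho> / (2 m) keep the projection of the box within \<rho> / 2 of
      u; so boxes over disjoint balls are disjoint, and each lies in its tube.\<close>
    define lo where "lo u b = (if b \<in> B then u \<bullet> b - \<rho> u / (2 * m) else (-1/2::real))" for u b
    define up where "up u b = (if b \<in> B then u \<bullet> b + \<rho> u / (2 * m) else (1/2::real))" for u b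
    define E where "E u = {x. \<forall>b\<in>B \<union> B'. lo u b \<le> x \<bullet> b \<and> x \<bullet> b \<le> up u b}" for u
    have CP: "u \<in> P" "0 < \<rho> u" "u \<in> ?S" if "u \<in> C" for u using that C(2) \<rho>(1) P by auto
    have E: "E u \<in> sets borel" "emeasure lborel (E u) = ennreal ((\<rho> u / m) ^ m)" if u: "u \<in> C" for u
    proof -
      have lu: "lo u b \<le> up u b" if "b \<in> B \<union> B'" for b using CP(2)[OF u] m by (simp add: lo_def up_def)
      show "E u \<in> sets borel" unfolding E_def by (rule emeasure_orthonormal_box(1)[OF B'(1,3) lu])
      have "emeasure lborel (E u) = ennreal (\<Prod>b\<in>B \<union> B'. up u b - lo u b)"
        unfolding E_def by (rule emeasure_orthonormal_box(2)[OF B'(1,3) lu])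
      also have "(\<Prod>b\<in>B \<union> B'. up u b - lo u b) = (\<Prod>b\<in>B. up u b - lo u b) * (\<Prod>b\<in>B'. up u b - lo u b)"
        by (rule prod.union_disjoint[OF fin B'(2)])
      also have "(\<Prod>b\<in>B. up u b - lo u b) = (\<Prod>b\<in>B. \<rho> u / m)" by (rule prod.cong) (auto simp: up_def lo_def)
      also have "\<dots> = (\<rho> u / m) ^ m" using B by simp
      also have "(\<Prod>b\<in>B'. up u b - lo u b) = (\<Prod>b\<in>B'. 1)" using B'(2) by (intro prod.cong) (auto simp: up_def lo_def)
      finally show "emeasure lborel (E u) = ennreal ((\<rho> u / m) ^ m)" by simp
    qed
    have close: "norm (oproj P z - u) \<le> \<rho> u / 2" if u: "u \<in> C" and z: "z \<in> E u" for u z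
    proof -
      have "norm (oproj P z - u) \<le> (\<Sum>b\<in>B. \<bar>(oproj P z - u) \<bullet> b\<bar>)"
        using CP[OF u] P by (intro norm_le subspace_diff) auto
      also have "\<dots> \<le> (\<Sum>b\<in>B. \<rho> u / (2 * m))"
      proof (rule sum_mono)
        fix b assume b: "b \<in> B"
        then have "lo u b \<le> z \<bullet> b" "z \<bullet> b \<le> up u b" using z by (auto simp: E_def)
        then show "\<bar>(oproj P z - u) \<bullet> b\<bar> \<le> \<rho> u / (2 * m)" using b oprojB[OF b, of z] by (simp add: lo_def up_def inner_diff_left)
      qed
      also have "\<dots> = \<rho> u / 2" using B m by simp
      finally show ?thesis .
    qed
    have ET: "E u \<subseteq> T" if u: "u \<in> C" for u
    proof
      fix z assume z: "z \<in> E u"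
      define z' where "z' = z - (oproj P z - u)"
      have dP: "oproj P z - u \<in> P" using CP[OF u] P by (simp add: subspace_diff)
      have "z' \<bullet> b = u \<bullet> b" if b: "b \<in> B" for b using oprojB[OF b, of z] by (simp add: z'_def inner_diff_left)
      moreover have "\<bar>z' \<bullet> b\<bar> \<le> 1/2" if b: "b \<in> B'" for b
      proof -
        have "b \<notin> B" using b B'(2) by auto
        moreover have "lo u b \<le> z \<bullet> b" "z \<bullet> b \<le> up u b" using z b by (auto simp: E_def)
        ultimately have "- (1/2) \<le> z \<bullet> b" "z \<bullet> b \<le> 1/2" by (auto simp: lo_def up_def)
        then show ?thesis using PB'[OF dP b] by (simp add: z'_def inner_diff_left abs_le_iff)
      qed
      ultimately have "z' \<in> Fib u" by (simp add: Fib_def)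
      then have "infdist z (Fib u) \<le> dist z z'" by (rule infdist_le)
      also have "\<dots> = norm (oproj P z - u)" by (simp add: z'_def dist_norm)
      also have "\<dots> \<le> \<rho> u" using close[OF u z] CP(2)[OF u] by linarith
      finally show "z \<in> T" using \<rho>(3)[OF CP(3)[OF u]] by blast
    qed
    have disj: "disjoint_family_on E C"
      unfolding disjoint_family_on_def
    proof (intro ballI impI, rule ccontr)
      fix u v assume uv: "u \<in> C" "v \<in> C" "u \<noteq> v" and "E u \<inter> E v \<noteq> {}"
      then obtain z where z: "z \<in> E u" "z \<in> E v" by blast
      have "oproj P z \<in> ball u (\<rho> u)" "oproj P z \<in> ball v (\<rho> v)"
        using close[OF uv(1) z(1)] close[OF uv(2) z(2)] CP(2)[OF uv(1)] CP(2)[OF uv(2)] by (auto simp: dist_norm norm_minus_commute)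
      then show False using C(3) uv unfolding pairwise_def disjnt_def by blast
    qed
    define D where "D u = {x \<in> A. oproj P x \<in> ball u (5 * \<rho> u)}" for u
    have Dd: "norm (x - y) \<le> K * (10 * \<rho> u)" if "x \<in> D u" "y \<in> D u" for x y u
    proof -
      have "norm (x - y) \<le> K * norm (oproj P (x - y))" using K(2) that by (auto simp: D_def)
      also have "oproj P (x - y) = (u - oproj P y) - (u - oproj P x)" by (simp add: oproj_diff[OF P(1)])
      also have "K * norm \<dots> \<le> K * (10 * \<rho> u)"
        using that K norm_triangle_ineq4[of "u - oproj P y" "u - oproj P x"] by (intro mult_left_mono) (auto simp: D_def dist_norm)
      finally show ?thesis .
    qed
    have Db: "bounded (D u)" for u
    proof (cases "D u = {}")
      case False
      then obtain x where "x \<in> D u" by blast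
      then have "D u \<subseteq> cball x (K * (10 * \<rho> u))" using Dd[of x u] by (auto simp: dist_norm)
      then show ?thesis using bounded_cball bounded_subset by blast
    qed simp
    have Ddi: "diameter (D u) \<le> K * (10 * \<rho> u)" if "u \<in> C" for u
      using CP(2)[OF that] K Dd by (intro diameter_le) auto
    have "A \<subseteq> (\<Union>u\<in>C. D u)"
    proof
      fix x assume x: "x \<in> A"
      then have "oproj P x \<in> (\<Union>u\<in>C. ball u (5 * \<rho> u))" using C(4) by blast
      then obtain u where "u \<in> C" "oproj P x \<in> ball u (5 * \<rho> u)" by blast
      then show "x \<in> (\<Union>u\<in>C. D u)" using x unfolding D_def by blast
    qed
    moreover have "diameter (D u) \<le> \<delta>" if u: "u \<in> C" for u
    proof -
      have "K * (10 * \<rho> u) \<le> K * (10 * (\<delta> / (10 * K)))" using \<rho>(2)[OF CP(3)[OF u]] K by (intro mult_left_mono) auto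
      then show ?thesis using Ddi[OF u] K by simp
    qed
    ultimately have "hdelta m \<delta> A \<le> (\<integral>\<^sup>+u. hcost m (D u) \<partial>count_space C)"
      using m Db by (intro hdelta_le_countable[OF _ \<delta> C(1)]) auto
    also have "\<dots> \<le> (\<integral>\<^sup>+u. ennreal c * emeasure lborel (E u) \<partial>count_space C)"
    proof (rule nn_integral_mono)
      fix u assume "u \<in> space (count_space C)"
      then have u: "u \<in> C" by simp
      have "(diameter (D u) / 2) ^ m \<le> (5 * K * m * (\<rho> u / m)) ^ m"
        using Ddi[OF u] m diameter_ge_0[OF Db, of u] by (intro power_mono) auto
      also have "\<dots> = (5 * K * m) ^ m * (\<rho> u / m) ^ m" by (rule power_mult_distrib)
      finally have "unit_ball_vol (real m) * (diameter (D u) / 2) ^ m \<le> c * (\<rho> u / m) ^ m"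
        unfolding c_def mult.assoc by (intro mult_left_mono) auto
      then show "hcost m (D u) \<le> ennreal c * emeasure lborel (E u)"
        unfolding hcost_def E(2)[OF u] using c0 CP(2)[OF u] by (simp add: ennreal_mult[symmetric] ennreal_leI)
    qed
    also have "\<dots> = ennreal c * (\<integral>\<^sup>+u. emeasure lborel (E u) \<partial>count_space C)" by (rule nn_integral_cmult) simp
    also have "(\<integral>\<^sup>+u. emeasure lborel (E u) \<partial>count_space C) = emeasure lborel (\<Union>u\<in>C. E u)"
      using E C(1) disj by (intro emeasure_UN_countable[symmetric]) auto
    also have "\<dots> \<le> emeasure lborel T" using ET T(1) by (intro emeasure_mono) auto
    also have "\<dots> \<le> ennreal e" by (rule Te)
    finally show ?thesis using c0 e by (simp add: ennreal_mult mult_left_mono)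
  qed
  have "hausdorff_outer m A \<le> 0"
  proof (rule hausdorff_outer_leI)
    fix \<delta> :: real assume \<delta>: "0 < \<delta>"
    show "hdelta m \<delta> A \<le> 0"
    proof (rule ennreal_le_epsilon)
      fix e :: real assume e: "0 < e"
      show "hdelta m \<delta> A \<le> 0 + ennreal e" using main[OF \<delta>, of "e / c"] e c0 by simp
    qed
  qed
  then show ?thesis by simp
qed

text \<open>A point of S nearest to x + v / k lies within 2 |v| / k of x, where S deviates from the
  tangent plane by o(1/k); the component of v normal to T therefore survives in the
  distance.\<close>

lemma tangent_plane_infdist_lower:
  fixes S :: "'a::euclidean_space set"
  assumes S: "closed S" "x \<in> S" and T: "is_tangent_plane m S x T" and e: "0 < e"
  shows "eventually (\<lambda>k. norm (orej T v) - e \<le> real (Suc k) * infdist (x + v /\<^sub>R real (Suc k)) S) sequentially"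
proof -
  have sT: "subspace T" using T by (simp add: is_tangent_plane_def)
  define \<eta> where "\<eta> = e / (2 * norm v + 1)"
  have \<eta>: "0 < \<eta>" using e by (simp add: \<eta>_def add_nonneg_pos)
  have "eventually (\<lambda>y. dist (infdist y ((\<lambda>v. x + v) ` T) / norm (y - x)) 0 < \<eta>) (at x within S)"
    using T \<eta> unfolding is_tangent_plane_def by (auto dest: tendstoD)
  then obtain d where d: "0 < d" "\<And>y. y \<in> S \<Longrightarrow> y \<noteq> x \<Longrightarrow> dist y x < d \<Longrightarrow> dist (infdist y ((\<lambda>v. x + v) ` T) / norm (y - x)) 0 < \<eta>"
    unfolding eventually_at by blast
  have flat: "norm (orej T (y - x)) \<le> \<eta> * norm (y - x)" if y: "y \<in> S" "norm (y - x) < d" for y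
  proof (cases "y = x")
    case True then show ?thesis by (simp add: orej_0[OF sT])
  next
    case False
    then have "norm (orej T (y - x)) / norm (y - x) < \<eta>"
      using d(2)[OF y(1)] y by (simp add: infdist_translate_eq_orej[OF sT] dist_norm)
    then show ?thesis using False by (simp add: field_simps)
  qed
  obtain N :: nat where N: "2 * norm v / d < real N" using reals_Archimedean2 by blast
  have "norm (orej T v) - e \<le> real (Suc k) * infdist (x + v /\<^sub>R real (Suc k)) S" if k: "N \<le> k" for k
  proof -
    define K where "K = real (Suc k)"
    have K: "0 < K" "2 * norm v / d < K" using N k by (auto simp: K_def)
    define p where "p = x + v /\<^sub>R K"
    have "S \<noteq> {}" using S by auto
    then obtain z where z: "z \<in> S" "infdist p S = dist p z" using infdist_attains_inf[OF S(1)] by blast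
    have "dist p z \<le> dist p x" using z infdist_le[OF S(2), of p] by simp
    also have px: "dist p x = norm v / K" using K by (simp add: p_def dist_norm divide_inverse mult.commute)
    finally have zx: "norm (z - x) \<le> 2 * norm v / K"
      using px dist_triangle[of z x p] by (simp add: dist_norm norm_minus_commute)
    also have "\<dots> < d" using K d by (simp add: field_simps)
    finally have o: "norm (orej T (z - x)) \<le> \<eta> * norm (z - x)" using flat z by blast
    have "orej T (v /\<^sub>R K) = orej T (z - x) + orej T (p - z)" by (simp add: orej_add[OF sT, symmetric] p_def)
    then have "norm (orej T (v /\<^sub>R K)) \<le> norm (orej T (z - x)) + norm (orej T (p - z))" by (metis norm_triangle_ineq)
    also have "\<dots> \<le> \<eta> * (2 * norm v / K) + infdist p S"
    proof (rule add_mono)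
      show "norm (orej T (z - x)) \<le> \<eta> * (2 * norm v / K)" using o zx \<eta> by (meson mult_left_mono less_imp_le order_trans)
      show "norm (orej T (p - z)) \<le> infdist p S" using norm_orej_le[OF sT, of "p - z"] z(2) by (simp add: dist_norm)
    qed
    finally have "norm (orej T v) / K \<le> \<eta> * (2 * norm v / K) + infdist p S"
      using K by (simp add: orej_scale[OF sT] divide_inverse mult.commute)
    then have "norm (orej T v) / K * K \<le> (\<eta> * (2 * norm v / K) + infdist p S) * K" using K by (intro mult_right_mono) auto
    moreover have "(\<eta> * (2 * norm v / K) + infdist p S) * K = \<eta> * (2 * norm v) + K * infdist p S" using K by (simp add: field_simps)
    moreover have "norm (orej T v) / K * K = norm (orej T v)" using K by simp
    ultimately have "norm (orej T v) \<le> \<eta> * (2 * norm v) + K * infdist p S" by linarith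
    moreover have "\<eta> * (2 * norm v) \<le> e"
    proof -
      have "\<eta> * (2 * norm v) \<le> \<eta> * (2 * norm v + 1)" using \<eta> by (intro mult_left_mono) auto
      also have "\<dots> = e" by (simp add: \<eta>_def add_nonneg_eq_0_iff)
      finally show ?thesis .
    qed
    ultimately show ?thesis by (simp add: K_def p_def)
  qed
  then show ?thesis unfolding eventually_sequentially by blast
qed

lemma has_derivative_shift:
  assumes "(F has_derivative A) (at (a + w))"
  shows "((\<lambda>y. F (y + w)) has_derivative A) (at a)"
proof -
  have "((\<lambda>y. y + w) has_derivative (\<lambda>h. h)) (at a)" by (auto intro!: derivative_eq_intros)
  from has_derivative_compose[OF this, of F A] assms show ?thesis by simp
qed

text \<open>\<open>tangent_plane\<close> is chosen by \<open>SOME\<close>, so its identity must be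
  recovered. The graph T of the derivative over P satisfies the definition and bounds the blow-up
  distance from above, while \<open>tangent_plane_infdist_lower\<close> bounds it from below for the
  chosen plane. So T lies in the chosen plane, and dimensions give equality.\<close>

lemma graph_tangent_plane:
  fixes S :: "'a::euclidean_space set"
  assumes S: "closed S" "x \<in> S" "x \<in> ball x0 r" and P: "subspace P" "dim P = m" and f: "\<And>u. u \<in> P \<Longrightarrow> f u \<in> orthogonal_comp P"
    and graph: "S \<inter> ball x0 r = {u + f u | u. u \<in> P} \<inter> ball x0 r"
    and diff: "(\<lambda>y. f (oproj P y)) differentiable (at x)"
  shows "is_tangent_plane m S x (tangent_plane m S x)"
    "(\<lambda>k. real (Suc k) * infdist (x + v /\<^sub>R real (Suc k)) S) \<longlonglongrightarrow> norm (orej (tangent_plane m S x) v)"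
proof -
  define F where "F y = f (oproj P y)" for y
  have FP: "oproj P (F y) = 0" for y
  proof (rule oproj_unique[OF P(1) subspace_0[OF P(1)]])
    fix v assume "v \<in> P"
    then show "(F y - 0) \<bullet> v = 0" using f[of "oproj P y"] P unfolding F_def orthogonal_comp_def orthogonal_def
      by (auto simp: inner_commute)
  qed
  have rep: "y = oproj P y + F y" if y: "y \<in> S" "y \<in> ball x0 r" for y
  proof -
    obtain u where u: "u \<in> P" "y = u + f u" using y graph by blast
    have "F u = f u" using u P by (simp add: F_def oproj_id)
    then have "oproj P y = u" using u FP[of u] P by (simp add: oproj_add oproj_id)
    then show ?thesis using u by (simp add: F_def)
  qed
  obtain A0 where "(F has_derivative A0) (at x)" using diff unfolding F_def differentiable_def by blast
  then have A0: "(F has_derivative A0) (at (oproj P x + orej P x))" by (simp add: orej_def)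
  have Fw: "F (y + orej P x) = F y" for y
    using P(1) by (simp add: F_def oproj_add oproj_orej)
  have "((\<lambda>y. F (y + orej P x)) has_derivative A0) (at (oproj P x))"
    by (rule has_derivative_shift[OF A0])
  then have A1: "(F has_derivative A0) (at (oproj P x))" by (simp add: Fw)
  have blp: "bounded_linear (oproj P)" "bounded_linear (orej P)"
    using linear_oproj[OF P(1)] linear_orej[OF P(1)] by (auto simp: linear_conv_bounded_linear)
  \<comment> \<open>F depends on the P-component only and has values normal to P; accordingly its
    derivative factors through P and maps into the orthogonal complement.\<close>
  define A where "A h = orej P (A0 (oproj P h))" for h
  have "((\<lambda>y. F (oproj P y)) has_derivative (\<lambda>h. A0 (oproj P h))) (at x)"
    using has_derivative_compose[OF bounded_linear.has_derivative[OF blp(1) has_derivative_ident] A1] by simp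
  then have "((\<lambda>y. orej P (F (oproj P y))) has_derivative A) (at x)"
    unfolding A_def by (rule bounded_linear.has_derivative[OF blp(2)])
  moreover have "orej P (F (oproj P y)) = F y" for y
    using FP[of y] P by (simp add: orej_def F_def oproj_id)
  ultimately have A: "(F has_derivative A) (at x)" by simp
  have Alin: "linear A" using A has_derivative_linear by blast
  have Ap: "A (oproj P h) = A h" "oproj P (A h) = 0" for h
    using P(1) by (auto simp: A_def oproj_id oproj_orej)
  define T where "T = (\<lambda>u. u + A u) ` P"
  have Tlin: "linear (\<lambda>u. u + A u)" using Alin by (intro linear_compose_add linear_ident)
  have T: "subspace T" unfolding T_def by (rule linear_subspace_image[OF Tlin P(1)])
  have "inj_on (\<lambda>u. u + A u) P"
  proof (rule inj_onI)
    fix u u' assume u: "u \<in> P" "u' \<in> P" "u + A u = u' + A u'"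
    have "u = oproj P (u + A u)" using u(1) P by (simp add: oproj_add Ap oproj_id)
    also have "\<dots> = oproj P (u' + A u')" by (simp only: u(3))
    also have "\<dots> = u'" using u(2) P by (simp add: oproj_add Ap oproj_id)
    finally show "u = u'" .
  qed
  moreover have sp: "span P = P" using P(1) by (simp add: span_eq_iff)
  ultimately have "inj_on (\<lambda>u. u + A u) (span P)" by metis
  then have Td: "dim T = m" unfolding T_def using P(2) dim_image_eq[OF Tlin, of P] by simp
  have small: "\<exists>d>0. \<forall>y. norm (y - x) < d \<longrightarrow> norm (F y - F x - A (y - x)) \<le> e * norm (y - x)" if "0 < e" for e
    using A that unfolding has_derivative_at_alt by blast
  obtain \<rho> where \<rho>: "0 < \<rho>" "ball x \<rho> \<subseteq> ball x0 r" using S(3) openE[OF open_ball] by blast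
  have xr: "x = oproj P x + F x" using rep S by blast
  have tan: "is_tangent_plane m S x T"
    unfolding is_tangent_plane_def
  proof (intro conjI T Td tendstoI)
    fix e :: real assume e: "0 < e"
    obtain d where d: "0 < d" "\<And>y. norm (y - x) < d \<Longrightarrow> norm (F y - F x - A (y - x)) \<le> e/2 * norm (y - x)" using small[of "e/2"] e by auto
    have "dist (infdist y ((\<lambda>v. x + v) ` T) / norm (y - x)) 0 < e" if y: "y \<in> S" "y \<noteq> x" "dist y x < min d \<rho>" for y
    proof -
      have yb: "y \<in> ball x0 r" using \<rho> y by (auto simp: dist_commute)
      define u where "u = oproj P (y - x)"
      have uT: "u + A u \<in> T" using P by (auto simp: T_def u_def)
      have "norm (orej T (y - x)) \<le> norm (y - x - (u + A u))" by (rule norm_orej_le_dist[OF T uT])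
      also have "y - x - (u + A u) = F y - F x - A (y - x)"
      proof -
        have "y - x = (oproj P y + F y) - (oproj P x + F x)" by (rule arg_cong2[OF rep[OF y(1) yb] xr, of "(-)"])
        also have "\<dots> = u + (F y - F x)" by (simp add: u_def oproj_diff[OF P(1)])
        finally have "y - x - (u + A u) = F y - F x - A u" by simp
        moreover have "A u = A (y - x)" unfolding u_def by (rule Ap)
        ultimately show ?thesis by simp
      qed
      also have "norm \<dots> \<le> e/2 * norm (y - x)" using d(2) y by (simp add: dist_norm)
      finally have "norm (orej T (y - x)) / norm (y - x) \<le> e/2" using y by (simp add: divide_le_eq)
      then have "norm (orej T (y - x)) / norm (y - x) < e" using e by linarith
      then show ?thesis using e by (simp add: infdist_translate_eq_orej[OF T])
    qed
    then show "eventually (\<lambda>y. dist (infdist y ((\<lambda>v. x + v) ` T) / norm (y - x)) 0 < e) (at x within S)"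
      unfolding eventually_at using d \<rho> by (intro exI[of _ "min d \<rho>"]) auto
  qed
  have upper: "eventually (\<lambda>k. real (Suc k) * infdist (x + v /\<^sub>R real (Suc k)) S \<le> norm (orej T v) + e) sequentially"
    if e: "0 < e" for e v
  proof -
    obtain u where u: "u \<in> P" "oproj T v = u + A u" using oproj_in[OF T, of v] by (auto simp: T_def)
    define \<eta> where "\<eta> = e / (norm u + 1)"
    have \<eta>: "0 < \<eta>" using e by (simp add: \<eta>_def add_nonneg_pos)
    obtain d where d: "0 < d" "\<And>y. norm (y - x) < d \<Longrightarrow> norm (F y - F x - A (y - x)) \<le> \<eta> * norm (y - x)" using small[OF \<eta>] by auto
    \<comment> \<open>A competitor for the distance: the point of the graph over
      \<open>oproj P x + u /\<^sub>R real (Suc k)\<close>, where u is the P-coordinate of the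
      T-component of v.\<close>
    define z where "z k = oproj P x + u /\<^sub>R real (Suc k) + F (x + u /\<^sub>R real (Suc k))" for k
    have inv0: "(\<lambda>k. u /\<^sub>R real (Suc k)) \<longlonglongrightarrow> 0"
      using tendsto_scaleR[OF LIMSEQ_inverse_real_of_nat tendsto_const, of u] by simp
    have cF: "isCont F x" using A has_derivative_continuous by blast
    have "(\<lambda>k. x + u /\<^sub>R real (Suc k)) \<longlonglongrightarrow> x" using tendsto_add[OF tendsto_const inv0, of x] by simp
    then have "(\<lambda>k. F (x + u /\<^sub>R real (Suc k))) \<longlonglongrightarrow> F x" by (rule isCont_tendsto_compose[OF cF])
    then have "z \<longlonglongrightarrow> oproj P x + 0 + F x" unfolding z_def by (intro tendsto_add tendsto_const inv0)
    then have "z \<longlonglongrightarrow> x" using xr by simp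
    then have ev1: "eventually (\<lambda>k. z k \<in> ball x0 r) sequentially" using S(3) by (rule topological_tendstoD[OF _ open_ball])
    have ev2: "eventually (\<lambda>k. norm (u /\<^sub>R real (Suc k)) < d) sequentially"
      using tendstoD[OF inv0 d(1)] by (simp add: dist_norm)
    from ev1 ev2 show ?thesis
    proof eventually_elim
      fix k assume k: "z k \<in> ball x0 r" "norm (u /\<^sub>R real (Suc k)) < d"
      define K where "K = real (Suc k)"
      have K: "0 < K" by (simp add: K_def)
      have pu: "oproj P (x + u /\<^sub>R K) = oproj P x + u /\<^sub>R K" using u P by (simp add: oproj_add oproj_id subspace_scale)
      have zk: "z k = oproj P x + u /\<^sub>R K + F (x + u /\<^sub>R K)" by (simp only: z_def K_def)
      then have "z k = oproj P (x + u /\<^sub>R K) + f (oproj P (x + u /\<^sub>R K))" by (simp only: F_def pu)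
      then have zS: "z k \<in> S" using k(1) graph oproj_in[OF P(1)] by blast
      have "x + v /\<^sub>R K - z k = (v - (u + A u)) /\<^sub>R K - (F (x + u /\<^sub>R K) - F x - A (x + u /\<^sub>R K - x))"
      proof -
        have "A (x + u /\<^sub>R K - x) = A u /\<^sub>R K" by (simp add: linear_scale[OF Alin])
        moreover have "x + v /\<^sub>R K - z k = F x + v /\<^sub>R K - u /\<^sub>R K - F (x + u /\<^sub>R K)"
        proof -
          have "x + v /\<^sub>R K - z k = (oproj P x + F x) + v /\<^sub>R K - z k" by (rule arg_cong[OF xr, of "\<lambda>x. x + v /\<^sub>R K - z k"])
          then show ?thesis unfolding zk by simp
        qed
        ultimately show ?thesis by (simp add: algebra_simps)
      qed
      then have "norm (x + v /\<^sub>R K - z k) \<le> norm ((v - (u + A u)) /\<^sub>R K) + norm (F (x + u /\<^sub>R K) - F x - A (x + u /\<^sub>R K - x))"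
        by (metis norm_triangle_ineq4)
      also have "\<dots> \<le> norm (orej T v) / K + \<eta> * (norm u / K)"
      proof (rule add_mono)
        show "norm ((v - (u + A u)) /\<^sub>R K) \<le> norm (orej T v) / K" using K u(2) by (simp add: orej_def divide_inverse mult.commute)
        show "norm (F (x + u /\<^sub>R K) - F x - A (x + u /\<^sub>R K - x)) \<le> \<eta> * (norm u / K)"
        proof -
          have "norm (x + u /\<^sub>R K - x) < d" using k(2) by (simp only: K_def add_diff_cancel_left')
          then have "norm (F (x + u /\<^sub>R K) - F x - A (x + u /\<^sub>R K - x)) \<le> \<eta> * norm (x + u /\<^sub>R K - x)" by (rule d(2))
          then show ?thesis using K by (simp add: divide_inverse mult.commute)
        qed
      qed
      finally have "infdist (x + v /\<^sub>R K) S \<le> norm (orej T v) / K + \<eta> * (norm u / K)"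
        using infdist_le[OF zS, of "x + v /\<^sub>R K"] by (simp add: dist_norm)
      then have "K * infdist (x + v /\<^sub>R K) S \<le> K * (norm (orej T v) / K + \<eta> * (norm u / K))" using K by (intro mult_left_mono) auto
      also have "\<dots> = norm (orej T v) + \<eta> * norm u" using K by (simp add: field_simps)
      also have "\<dots> \<le> norm (orej T v) + e"
      proof -
        have "\<eta> * norm u \<le> \<eta> * (norm u + 1)" using \<eta> by (intro mult_left_mono) auto
        also have "\<dots> = e" by (simp add: \<eta>_def add_nonneg_eq_0_iff)
        finally show ?thesis by simp
      qed
      finally show "real (Suc k) * infdist (x + v /\<^sub>R real (Suc k)) S \<le> norm (orej T v) + e" by (simp only: K_def)
    qed
  qed
  show tp: "is_tangent_plane m S x (tangent_plane m S x)"
    unfolding tangent_plane_def by (rule someI[of "is_tangent_plane m S x", OF tan])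
  let ?T = "tangent_plane m S x"
  have sT': "subspace ?T" "dim ?T = m" using tp by (auto simp: is_tangent_plane_def)
  have "T \<subseteq> ?T"
  proof
    fix w assume w: "w \<in> T"
    have "norm (orej ?T w) \<le> 0"
    proof (rule field_le_epsilon)
      fix e :: real assume e: "0 < e"
      have e2: "0 < e/2" using e by simp
      from tangent_plane_infdist_lower[OF S(1,2) tp e2, of w] upper[OF e2, of w]
      have "eventually (\<lambda>k. norm (orej ?T w) - e/2 \<le> norm (orej T w) + e/2) sequentially"
        by eventually_elim linarith
      then have "norm (orej ?T w) - e/2 \<le> norm (orej T w) + e/2" by simp
      then show "norm (orej ?T w) \<le> 0 + e" using orej_eq_0[OF T w] by simp
    qed
    then have "oproj ?T w = w" by (simp add: orej_def)
    then show "w \<in> ?T" using oproj_in[OF sT'(1), of w] by simp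
  qed
  then have TT: "T = ?T" using subspace_dim_equal[OF T sT'(1)] Td sT'(2) by simp
  show "(\<lambda>k. real (Suc k) * infdist (x + v /\<^sub>R real (Suc k)) S) \<longlonglongrightarrow> norm (orej ?T v)"
  proof (rule tendstoI)
    fix e :: real assume e: "0 < e"
    then have e2: "0 < e/2" by simp
    from tangent_plane_infdist_lower[OF S(1,2) tp e2, of v] upper[OF e2, of v, unfolded TT]
    show "eventually (\<lambda>k. dist (real (Suc k) * infdist (x + v /\<^sub>R real (Suc k)) S) (norm (orej ?T v)) < e) sequentially"
    proof eventually_elim
      case (elim k)
      then show ?case using e unfolding dist_real_def by linarith
    qed
  qed
qed

lemma lipschitz_submanifoldE:
  fixes S :: "'a::euclidean_space set"
  assumes "lipschitz_submanifold m S" "x \<in> S"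
  obtains r P L f where "0 < r" "subspace P" "dim P = m" "L-lipschitz_on P f"
    "\<And>u. u \<in> P \<Longrightarrow> f u \<in> orthogonal_comp P" "S \<inter> ball x r = {u + f u | u. u \<in> P} \<inter> ball x r"
proof -
  from assms(1) have "\<forall>x\<in>S. \<exists>r>0. \<exists>P f L. subspace P \<and> dim P = m \<and> L-lipschitz_on P f \<and>
        (\<forall>u\<in>P. f u \<in> orthogonal_comp P) \<and> S \<inter> ball x r = {u + f u | u. u \<in> P} \<inter> ball x r"
    unfolding lipschitz_submanifold_def by (rule conjunct2)
  from bspec[OF this assms(2)] show thesis
  proof (elim exE conjE)
    fix r P f L assume a: "0 < r" "subspace P" "dim P = m" "L-lipschitz_on P f"
      "\<forall>u\<in>P. f u \<in> orthogonal_comp P" "S \<inter> ball x r = {u + f u | u. u \<in> P} \<inter> ball x r"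
    show thesis by (rule that[OF a(1-4) bspec[OF a(5)] a(6)])
  qed
qed

text \<open>The graph map is extended to the whole space as \<open>f (oproj P y)\<close>, to which
  Rademacher's theorem applies. The blow-up limit is recorded as well, because it expresses the
  distance to the tangent plane through continuous functions.\<close>

lemma lipschitz_submanifold_tangent_AE:
  fixes S :: "'a::euclidean_space set"
  assumes S: "lipschitz_submanifold m S" and m: "1 \<le> m"
  obtains N where "N \<in> sets borel" "hausdorff_outer m N = 0"
    "\<And>x. x \<in> S \<Longrightarrow> x \<notin> N \<Longrightarrow> is_tangent_plane m S x (tangent_plane m S x)"
    "\<And>x v. x \<in> S \<Longrightarrow> x \<notin> N \<Longrightarrow> (\<lambda>k. real (Suc k) * infdist (x + v /\<^sub>R real (Suc k)) S) \<longlonglongrightarrow> norm (orej (tangent_plane m S x) v)"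
proof -
  have cS: "compact S" using S by (simp add: lipschitz_submanifold_def)
  have clS: "closed S" using cS by (rule compact_imp_closed)
  define good where "good x \<longleftrightarrow> is_tangent_plane m S x (tangent_plane m S x) \<and>
    (\<forall>v. (\<lambda>k. real (Suc k) * infdist (x + v /\<^sub>R real (Suc k)) S) \<longlonglongrightarrow> norm (orej (tangent_plane m S x) v))" for x
  define Q where "Q x0 r N \<longleftrightarrow> 0 < r \<and> N \<in> sets borel \<and> hausdorff_outer m N = 0 \<and> (\<forall>x\<in>S \<inter> ball x0 r. x \<notin> N \<longrightarrow> good x)" for x0 r N
  have loc: "\<exists>r N. Q x0 r N" if x0: "x0 \<in> S" for x0
  proof -
    obtain r P f L where r: "0 < r" and P: "subspace P" "dim P = m" and lip: "L-lipschitz_on P f"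
      and f: "\<And>u. u \<in> P \<Longrightarrow> f u \<in> orthogonal_comp P" and graph: "S \<inter> ball x0 r = {u + f u | u. u \<in> P} \<inter> ball x0 r"
      by (rule lipschitz_submanifoldE[OF S x0]) (rule that)
    define F where "F y = f (oproj P y)" for y
    have L: "0 \<le> L" using lip by (rule lipschitz_on_nonneg)
    have Flip: "norm (F x - F y) \<le> L * norm (oproj P (x - y))" for x y
      using lipschitz_on_normD[OF lip, of "oproj P x" "oproj P y"] P by (simp add: F_def oproj_diff)
    have "norm (F x - F y) \<le> L * norm (x - y)" for x y
      using Flip[of x y] mult_left_mono[OF norm_oproj_le[OF P(1), of "x - y"] L] by linarith
    then obtain N where N: "N \<in> null_sets lborel" "\<And>x. x \<notin> N \<Longrightarrow> F differentiable (at x)"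
      using lipschitz_AE_differentiable_vector[of F L] L by metis
    \<comment> \<open>The exact set of non-differentiability is invariant under translations normal
      to P, hence a cylinder; the null set N containing it need not be one.\<close>
    define M where "M = {x. \<not> F differentiable (at x)}"
    have "negligible M"
    proof (rule negligible_subset)
      show "negligible N" using N(1) by (auto simp: negligible_iff_null_sets null_sets_completionI)
      show "M \<subseteq> N" using N(2) by (auto simp: M_def)
    qed
    moreover have cyl: "y \<in> M" if "x \<in> M" "oproj P y = oproj P x" for x y
    proof -
      have "F differentiable (at x)" if d: "F differentiable (at y)"
      proof -
        obtain A where A: "(F has_derivative A) (at (x + (y - x)))" using d by (auto simp: differentiable_def)
        have "((\<lambda>z. F (z + (y - x))) has_derivative A) (at x)"
          by (rule has_derivative_shift[OF A])
        moreover have "F (z + (y - x)) = F z" for z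
          using \<open>oproj P y = oproj P x\<close> P by (simp add: F_def oproj_add oproj_diff)
        ultimately show ?thesis by (auto simp: differentiable_def)
      qed
      then show ?thesis using that by (auto simp: M_def)
    qed
    let ?A = "S \<inter> ball x0 r \<inter> M"
    have FP: "oproj P (f u) = 0" if "u \<in> P" for u
    proof (rule oproj_unique[OF P(1) subspace_0[OF P(1)]])
      fix v assume "v \<in> P"
      then show "(f u - 0) \<bullet> v = 0" using f[OF that] unfolding orthogonal_comp_def orthogonal_def by (auto simp: inner_commute)
    qed
    have rep: "y = oproj P y + F y" if y: "y \<in> S \<inter> ball x0 r" for y
    proof -
      obtain u where u: "u \<in> P" "y = u + f u" using y graph by blast
      then have "oproj P y = u" using FP[of u] P by (simp add: oproj_add oproj_id)
      then show ?thesis using u by (simp add: F_def)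
    qed
    have "hausdorff_outer m ?A = 0"
    proof (rule hausdorff_null_of_cylinder[OF P m \<open>negligible M\<close>, where A = ?A and K = "1 + L"])
      fix x y assume xy: "x \<in> ?A" "y \<in> ?A"
      have "x - y = oproj P (x - y) + (F x - F y)" using rep[of x] rep[of y] xy P by (simp add: oproj_diff algebra_simps)
      then have "norm (x - y) \<le> norm (oproj P (x - y)) + norm (F x - F y)" by (metis norm_triangle_ineq)
      then show "norm (x - y) \<le> (1 + L) * norm (oproj P (x - y))" using Flip[of x y] by (simp add: algebra_simps)
    qed (use L cyl in auto)
    then obtain N' where N': "N' \<in> sets borel" "?A \<subseteq> N'" "hausdorff_outer m N' = 0"
      using hausdorff_null_borel_hull[of m ?A] m by auto
    have "good x" if x: "x \<in> S \<inter> ball x0 r" "x \<notin> N'" for x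
    proof -
      have "F differentiable (at x)" using x N'(2) by (auto simp: M_def)
      then show ?thesis unfolding good_def F_def
        using graph_tangent_plane[OF clS _ _ P f graph, of x] x by blast
    qed
    then show ?thesis using r N' unfolding Q_def by blast
  qed
  then have "\<forall>x0\<in>S. \<exists>r. \<exists>N. Q x0 r N" by blast
  from bchoice[OF this] obtain r where "\<forall>x0\<in>S. \<exists>N. Q x0 (r x0) N" ..
  from bchoice[OF this] obtain N where "\<forall>x0\<in>S. Q x0 (r x0) (N x0)" ..
  then have rN: "\<And>x. x \<in> S \<Longrightarrow> 0 < r x" "\<And>x. x \<in> S \<Longrightarrow> N x \<in> sets borel" "\<And>x. x \<in> S \<Longrightarrow> hausdorff_outer m (N x) = 0"
    "\<And>x0 x. x0 \<in> S \<Longrightarrow> x \<in> S \<inter> ball x0 (r x0) \<Longrightarrow> x \<notin> N x0 \<Longrightarrow> good x" unfolding Q_def by blast+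
  have "S \<subseteq> (\<Union>x\<in>S. ball x (r x))" using rN(1) by force
  then obtain X where X: "X \<subseteq> S" "finite X" "S \<subseteq> (\<Union>x\<in>X. ball x (r x))" using compactE_image[OF cS, of S "\<lambda>x. ball x (r x)"] by auto
  show thesis
  proof (rule that[of "\<Union>x\<in>X. N x"])
    show "(\<Union>x\<in>X. N x) \<in> sets borel" using X rN(2) by (intro sets.finite_UN) auto
    have "hausdorff_outer m (\<Union>x\<in>Y. N x) = 0" if "finite Y" "Y \<subseteq> S" for Y
      using that
    proof (induction Y rule: finite_induct)
      case empty then show ?case using m by (simp add: hausdorff_outer_empty)
    next
      case (insert y Y)
      have "hausdorff_outer m (\<Union>x\<in>insert y Y. N x) \<le> hausdorff_outer m (N y) + hausdorff_outer m (\<Union>x\<in>Y. N x)"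
        using hausdorff_outer_Un_le[of m "N y" "\<Union>x\<in>Y. N x"] m by simp
      then show ?case using insert rN(3) by simp
    qed
    then show "hausdorff_outer m (\<Union>x\<in>X. N x) = 0" using X by blast
    have g: "good x" if x: "x \<in> S" "x \<notin> (\<Union>x\<in>X. N x)" for x
    proof -
      obtain x0 where "x0 \<in> X" "x \<in> ball x0 (r x0)" using X(3) x by blast
      then show ?thesis using rN(4)[of x0 x] X(1) x by blast
    qed
    show "is_tangent_plane m S x (tangent_plane m S x)" if "x \<in> S" "x \<notin> (\<Union>x\<in>X. N x)" for x using g[OF that] by (simp add: good_def)
    show "(\<lambda>k. real (Suc k) * infdist (x + v /\<^sub>R real (Suc k)) S) \<longlonglongrightarrow> norm (orej (tangent_plane m S x) v)"
      if "x \<in> S" "x \<notin> (\<Union>x\<in>X. N x)" for x v using g[OF that] by (simp add: good_def)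
  qed
qed

section \<open>Bounded energy implies decay of flatness\<close>

lemma norm_le_sum_orthonormal:
  fixes B :: "'a::euclidean_space set"
  assumes B: "orthonormal B" and p: "p \<in> span B"
  shows "norm p \<le> (\<Sum>b\<in>B. \<bar>p \<bullet> b\<bar>)"
proof -
  have fin: "finite B" using B by (simp add: orthonormal_def)
  obtain l where l: "p = (\<Sum>b\<in>B. l b *\<^sub>R b)" using p span_finite[OF fin] by auto
  have "p \<bullet> b = l b" if b: "b \<in> B" for b
  proof -
    have "p \<bullet> b = (\<Sum>b'\<in>B. if b = b' then l b' else 0)" unfolding l inner_sum_left
      using B b by (intro sum.cong) (auto simp: orthonormal_def)
    then show ?thesis using fin b by simp
  qed
  then have "p = (\<Sum>b\<in>B. (p \<bullet> b) *\<^sub>R b)" using l by simp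
  also have "norm \<dots> \<le> (\<Sum>b\<in>B. \<bar>p \<bullet> b\<bar>)"
    using B by (intro sum_norm_le) (simp add: orthonormal_def norm_eq_sqrt_inner)
  finally show ?thesis .
qed

text \<open>Finitely many graph patches suffice by compactness. Finiteness makes product measures
  and Tonelli's theorem available.\<close>

lemma lipschitz_submanifold_hausdorff_finite:
  fixes S :: "'a::euclidean_space set"
  assumes S: "lipschitz_submanifold m S" and m: "1 \<le> m"
  shows "hausdorff_outer m S < top"
proof -
  have cS: "compact S" using S by (simp add: lipschitz_submanifold_def)
  have "\<exists>r>0. hausdorff_outer m (S \<inter> ball x r) < top" if x: "x \<in> S" for x
  proof -
    obtain r P f L where r: "0 < r" and P: "subspace P" "dim P = m" and lip: "L-lipschitz_on P f"
      and f: "\<And>u. u \<in> P \<Longrightarrow> f u \<in> orthogonal_comp P" and graph: "S \<inter> ball x r = {u + f u | u. u \<in> P} \<inter> ball x r"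
      by (rule lipschitz_submanifoldE[OF S x]) (rule that)
    obtain B where B: "orthonormal B" "B \<subseteq> P" "card B = m" "span B = P" using orthonormal_basis_exists[OF P] .
    have L: "0 \<le> L" using lip by (rule lipschitz_on_nonneg)
    have fb: "f u \<bullet> b = 0" if "u \<in> P" "b \<in> B" for u b
      using f[OF that(1)] that(2) B(2) unfolding orthogonal_comp_def orthogonal_def by (auto simp: inner_commute)
    have "hausdorff_outer m (S \<inter> ball x r) < top"
    proof (rule hausdorff_outer_finite[OF _ B(1,3), where L = "1 + L"])
      show "bounded (S \<inter> ball x r)" by (rule bounded_subset[OF bounded_ball]) auto
      fix y z assume yz: "y \<in> S \<inter> ball x r" "z \<in> S \<inter> ball x r"
      obtain u where u: "u \<in> P" "y = u + f u" using yz graph by blast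
      obtain v where v: "v \<in> P" "z = v + f v" using yz graph by blast
      have "norm (y - z) \<le> norm (u - v) + norm (f u - f v)"
        using norm_triangle_ineq[of "u - v" "f u - f v"] u v by (simp add: algebra_simps)
      also have "\<dots> \<le> (1 + L) * norm (u - v)" using lipschitz_on_normD[OF lip u(1) v(1)] by (simp add: algebra_simps)
      also have "\<dots> \<le> (1 + L) * (\<Sum>b\<in>B. \<bar>(u - v) \<bullet> b\<bar>)"
        using norm_le_sum_orthonormal[OF B(1), of "u - v"] u v P B(4) L by (intro mult_left_mono) (auto simp: subspace_diff)
      also have "(\<Sum>b\<in>B. \<bar>(u - v) \<bullet> b\<bar>) = (\<Sum>b\<in>B. \<bar>(y - z) \<bullet> b\<bar>)"
        using u v fb by (intro sum.cong) (auto simp: inner_add_left inner_diff_left)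
      finally show "norm (y - z) \<le> (1 + L) * (\<Sum>b\<in>B. \<bar>(y - z) \<bullet> b\<bar>)" .
    qed (use m L in auto)
    then show ?thesis using r by blast
  qed
  then obtain r where r: "\<And>x. x \<in> S \<Longrightarrow> 0 < r x" "\<And>x. x \<in> S \<Longrightarrow> hausdorff_outer m (S \<inter> ball x (r x)) < top" by metis
  have "S \<subseteq> (\<Union>x\<in>S. ball x (r x))" using r(1) by force
  then obtain X where X: "X \<subseteq> S" "finite X" "S \<subseteq> (\<Union>x\<in>X. ball x (r x))" using compactE_image[OF cS, of S "\<lambda>x. ball x (r x)"] by auto
  have "hausdorff_outer m (\<Union>x\<in>Y. S \<inter> ball x (r x)) < top" if "finite Y" "Y \<subseteq> S" for Y
    using that
  proof (induction Y rule: finite_induct)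
    case empty then show ?case using m by (simp add: hausdorff_outer_empty)
  next
    case (insert y Y)
    have "hausdorff_outer m (\<Union>x\<in>insert y Y. S \<inter> ball x (r x)) \<le> hausdorff_outer m (S \<inter> ball y (r y)) + hausdorff_outer m (\<Union>x\<in>Y. S \<inter> ball x (r x))"
      using hausdorff_outer_Un_le[of m "S \<inter> ball y (r y)" "\<Union>x\<in>Y. S \<inter> ball x (r x)"] m by simp
    also have "\<dots> < top" using insert r(2) by (simp add: ennreal_add_less_top)
    finally show ?case .
  qed
  from this[OF X(2,1)] have "hausdorff_outer m (\<Union>x\<in>X. S \<inter> ball x (r x)) < top" .
  moreover have "S = (\<Union>x\<in>X. S \<inter> ball x (r x))" using X(3) by blast
  ultimately show ?thesis by metis
qed

lemma Hm_on_simps: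
  fixes S :: "'a::euclidean_space set"
  assumes S: "compact S" and m: "1 \<le> m"
  shows "space (Hm_on m S) = S" "\<And>X. X \<in> sets borel \<Longrightarrow> S \<inter> X \<in> sets (Hm_on m S)"
    "\<And>X. X \<in> sets borel \<Longrightarrow> emeasure (Hm_on m S) (S \<inter> X) = hausdorff_outer m (S \<inter> X)"
proof -
  have b: "S \<in> sets borel" using S by (simp add: borel_compact)
  show "space (Hm_on m S) = S" by (simp add: Hm_on_def space_restrict_space)
  show "S \<inter> X \<in> sets (Hm_on m S)" if "X \<in> sets borel" for X using that b by (auto simp: Hm_on_def sets_restrict_space)
  show "emeasure (Hm_on m S) (S \<inter> X) = hausdorff_outer m (S \<inter> X)" if "X \<in> sets borel" for X
    using that b m by (simp add: Hm_on_def emeasure_restrict_space emeasure_hausdorff)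
qed

lemma finite_measure_Hm_on:
  fixes S :: "'a::euclidean_space set"
  assumes "lipschitz_submanifold m S" "1 \<le> m"
  shows "finite_measure (Hm_on m S)"
proof (rule finite_measureI)
  have "compact S" using assms by (simp add: lipschitz_submanifold_def)
  from Hm_on_simps[OF this assms(2)] show "emeasure (Hm_on m S) (space (Hm_on m S)) \<noteq> \<infinity>"
    using lipschitz_submanifold_hausdorff_finite[OF assms] by (metis Int_UNIV_right infinity_ennreal_def less_irrefl space_in_borel space_borel)
qed

text \<open>Averaging over A. \<open>nn_integral\<close> is a supremum over simple functions below
  f, so comparison with a multiple of the indicator of A works for arbitrary f, including the
  suprema in the energies. The gap between E and F provides the strict contradiction.\<close>

lemma nn_integral_exists_le:
  assumes A: "A \<in> sets M" and a: "0 < a" "ennreal a \<le> emeasure M A" and E: "0 \<le> E" "E < F" and int: "(\<integral>\<^sup>+x. f x \<partial>M) \<le> ennreal E"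
  shows "\<exists>x\<in>A. f x \<le> ennreal (F / a)"
proof (rule ccontr)
  assume n: "\<not> ?thesis"
  have "ennreal F = ennreal (F / a) * ennreal a" using a E by (subst ennreal_mult[symmetric]) auto
  also have "\<dots> \<le> ennreal (F / a) * emeasure M A" by (intro mult_left_mono a) simp
  also have "\<dots> = (\<integral>\<^sup>+x. ennreal (F / a) * indicator A x \<partial>M)" using A by (simp add: nn_integral_cmult_indicator)
  also have "\<dots> \<le> (\<integral>\<^sup>+x. f x \<partial>M)" using n by (intro nn_integral_mono) (auto simp: indicator_def not_le less_imp_le)
  also have "\<dots> \<le> ennreal E" by (rule int)
  finally show False using E by simp
qed

section \<open>Tangent-point energies\<close>

lemma ennreal_powr_leD:
  assumes "ennreal (b powr p) \<le> ennreal t" "0 \<le> b" "0 < p" "0 \<le> t"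
  shows "b \<le> t powr (1 / p)"
proof -
  have "b powr p \<le> t" using assms by simp
  then have "(b powr p) powr (1 / p) \<le> t powr (1 / p)" using assms by (intro powr_mono2) auto
  then show ?thesis using assms by (simp add: powr_powr)
qed

lemma inv_Rtp_bound:
  fixes S :: "'a::euclidean_space set"
  assumes T: "subspace (tangent_plane m S x)" and b: "ennreal (inv_Rtp m S x z powr p) \<le> ennreal t" and p: "0 < p" and t: "0 \<le> t"
    and d: "norm (x - z) \<le> d"
  shows "norm (orej (tangent_plane m S x) (z - x)) \<le> d\<^sup>2 / 2 * t powr (1 / p)"
proof (cases "x = z")
  case True
  then show ?thesis using orej_0[OF T] by simp
next
  case False
  define c where "c = norm (orej (tangent_plane m S x) (z - x))"
  have eq: "inv_Rtp m S x z = 2 * c / (norm (x - z))\<^sup>2"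
    by (simp add: inv_Rtp_def infdist_translate_eq_orej[OF T] c_def)
  have "2 * c / (norm (x - z))\<^sup>2 \<le> t powr (1 / p)"
    using ennreal_powr_leD[OF b _ p t] unfolding eq by (simp add: c_def)
  then have "c \<le> (norm (x - z))\<^sup>2 / 2 * t powr (1 / p)" using False by (simp add: divide_le_eq mult.commute)
  also have "\<dots> \<le> d\<^sup>2 / 2 * t powr (1 / p)" using d by (intro mult_right_mono divide_right_mono power_mono) auto
  finally show ?thesis by (simp add: c_def)
qed

lemma powr_split_const:
  fixes A c s :: real
  assumes "0 \<le> A" "0 < c" "0 < s" "0 < p"
  shows "(A / (c * s powr e)) powr (1 / p) = (A / c) powr (1 / p) * s powr (- e / p)"
proof -
  have "A / (c * s powr e) = (A / c) * s powr (- e)" using assms by (simp add: powr_minus divide_inverse)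
  then have "(A / (c * s powr e)) powr (1 / p) = (A / c) powr (1 / p) * (s powr (- e)) powr (1 / p)"
    using assms by (simp only: powr_mult)
  then show ?thesis by (simp add: powr_powr)
qed

text \<open>Averaging over a ball of measure at least c1 s^m yields a point x at which 1/R is at
  most a constant times s^(-m/p) towards all of S. Since |x - z| is at most 21 s, the distance to
  the tangent plane is of order s^(2 - m/p).\<close>

lemma tpG_energy_flat:
  fixes S :: "'a::euclidean_space set"
  assumes m: "1 \<le> m" and S: "lipschitz_submanifold m S" and E: "0 < E" "tpG_energy m p S \<le> ennreal E" and p: "real m < p"
    and L: "1 \<le> L" and good: "mgood m L r S"
  defines "c1 \<equiv> hconst m / (L * m) ^ m"
  shows "mflat m (21\<^sup>2 * ((E + 1) / c1) powr (1 / p)) (1 - m / p) r S"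
  unfolding mflat_def
proof (intro ballI allI impI)
  fix y s assume y: "y \<in> S" and s: "0 < s \<and> s \<le> r"
  have cS: "compact S" using S by (simp add: lipschitz_submanifold_def)
  have p0: "0 < p" using p m by simp
  have c1: "0 < c1" using L m hconst_pos[of m] by (simp add: c1_def)
  obtain N where N: "N \<in> sets borel" "hausdorff_outer m N = 0"
    "\<And>x. x \<in> S \<Longrightarrow> x \<notin> N \<Longrightarrow> is_tangent_plane m S x (tangent_plane m S x)"
    by (rule lipschitz_submanifold_tangent_AE[OF S m]) (rule that)
  let ?A = "S \<inter> (cball y s - N)"
  note H = Hm_on_simps[OF cS m]
  have A: "?A \<in> sets (Hm_on m S)" using N by (intro H(2)) auto
  define \<mu> where "\<mu> = c1 * s powr m"
  have \<mu>0: "0 < \<mu>" using c1 s by (simp add: \<mu>_def)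
  have \<mu>: "ennreal \<mu> \<le> emeasure (Hm_on m S) ?A"
  proof -
    have "\<mu> = hconst m * (s / (L * m)) ^ m" using s by (simp add: \<mu>_def c1_def power_divide powr_realpow)
    then have "ennreal \<mu> \<le> hausdorff_outer m (S \<inter> cball y s)" using mgood_measure_ge[OF m good L y] s by simp
    also have "\<dots> \<le> hausdorff_outer m (?A \<union> N)" by (rule hausdorff_outer_mono) auto
    also have "\<dots> \<le> hausdorff_outer m ?A + hausdorff_outer m N" using m by (intro hausdorff_outer_Un_le) simp
    finally show ?thesis using N H(3)[of "cball y s - N"] by simp
  qed
  obtain x where x: "x \<in> ?A" "(SUP y\<in>S. ennreal (inv_Rtp m S x y powr p)) \<le> ennreal ((E + 1) / \<mu>)"
    using nn_integral_exists_le[OF A \<mu>0 \<mu> _ _ E(2)[unfolded tpG_energy_def], of "E + 1"] E(1) by auto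
  have tp: "is_tangent_plane m S x (tangent_plane m S x)" using N(3) x by blast
  let ?T = "tangent_plane m S x"
  have T: "subspace ?T" "dim ?T = m" using tp by (auto simp: is_tangent_plane_def)
  define h where "h = (21 * s)\<^sup>2 / 2 * ((E + 1) / \<mu>) powr (1 / p)"
  have xs: "norm (x - y) \<le> s" using x by (auto simp: dist_norm norm_minus_commute)
  have bd: "norm (orej ?T (z - x)) \<le> h" if z: "z \<in> S" "norm (z - y) \<le> 20 * s" for z
    unfolding h_def
  proof (rule inv_Rtp_bound[OF T(1) _ p0])
    show "ennreal (inv_Rtp m S x z powr p) \<le> ennreal ((E + 1) / \<mu>)" using x(2) z(1) by (meson SUP_upper order_trans)
    show "norm (x - z) \<le> 21 * s" using norm_triangle_ineq4[of "x - y" "z - y"] xs z by simp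
  qed (use E \<mu>0 in auto)
  \<comment> \<open>The factor 2 accounts for the change of base point from x to y.\<close>
  have hh: "2 * h = 21\<^sup>2 * ((E + 1) / c1) powr (1 / p) * s powr (1 + (1 - m / p))"
  proof -
    have "2 * h = 21\<^sup>2 * s\<^sup>2 * (((E + 1) / c1) powr (1 / p) * s powr (- m / p))"
      unfolding h_def \<mu>_def using powr_split_const[of "E + 1" c1 s p "real m"] E c1 s p0 by (simp add: power_mult_distrib)
    moreover have "s powr (1 + (1 - m / p)) = s\<^sup>2 * s powr (- m / p)"
    proof -
      have "1 + (1 - m / p) = 2 + - m / p" by simp
      then have "s powr (1 + (1 - m / p)) = s powr 2 * s powr (- m / p)" by (simp only: powr_add)
      then show ?thesis using s by (simp add: powr_numeral)
    qed
    ultimately show ?thesis by (simp add: mult_ac)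
  qed
  have "norm (orej ?T (z - y)) \<le> 21\<^sup>2 * ((E + 1) / c1) powr (1 / p) * s powr (1 + (1 - m / p))" if z: "z \<in> S" "norm (z - y) \<le> 20 * s" for z
  proof -
    have "norm (orej ?T (z - x) - orej ?T (y - x)) \<le> h + h"
      using bd[OF z] bd[OF y] s norm_triangle_ineq4[of "orej ?T (z - x)" "orej ?T (y - x)"] by simp
    then show ?thesis unfolding hh[symmetric] by (simp add: orej_diff[OF T(1), symmetric])
  qed
  then show "\<exists>P. subspace P \<and> dim P = m \<and> (\<forall>z\<in>S. norm (z - y) \<le> 20 * s \<longrightarrow>
      norm (orej P (z - y)) \<le> 21\<^sup>2 * ((E + 1) / c1) powr (1 / p) * s powr (1 + (1 - m / p)))" using T by blast
qed

text \<open>The map \<open>x \<mapsto> tangent_plane m S x\<close> is not known to be measurable, but the distance to the tangent plane is almost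
  everywhere a limit of the continuous functions \<open>k * infdist (x + (z - x) / k) S\<close>, so that Tonelli applies.\<close>

lemma tp_energy_swap:
  fixes S :: "'a::euclidean_space set"
  assumes m: "1 \<le> m" and S: "lipschitz_submanifold m S"
  obtains N g where "N \<in> sets borel" "hausdorff_outer m N = 0"
    "\<And>x. x \<in> S \<Longrightarrow> x \<notin> N \<Longrightarrow> is_tangent_plane m S x (tangent_plane m S x)"
    "\<And>x z. x \<in> S \<Longrightarrow> x \<notin> N \<Longrightarrow> g x z = ennreal (inv_Rtp m S x z powr p)"
    "tp_energy m p S = (\<integral>\<^sup>+x. (\<integral>\<^sup>+z. g x z \<partial>Hm_on m S) \<partial>Hm_on m S)"
proof -
  have cS: "compact S" using S by (simp add: lipschitz_submanifold_def)
  note H = Hm_on_simps[OF cS m]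
  obtain N where N: "N \<in> sets borel" "hausdorff_outer m N = 0"
    "\<And>x. x \<in> S \<Longrightarrow> x \<notin> N \<Longrightarrow> is_tangent_plane m S x (tangent_plane m S x)"
    "\<And>x v. x \<in> S \<Longrightarrow> x \<notin> N \<Longrightarrow> (\<lambda>k. real (Suc k) * infdist (x + v /\<^sub>R real (Suc k)) S) \<longlonglongrightarrow> norm (orej (tangent_plane m S x) v)"
    by (rule lipschitz_submanifold_tangent_AE[OF S m]) (rule that)
  let ?M = "Hm_on m S"
  define G where "G q = lim (\<lambda>k. real (Suc k) * infdist (fst q + (snd q - fst q) /\<^sub>R real (Suc k)) S)" for q :: "'a \<times> 'a"
  define g where "g x z = ennreal ((2 * G (x, z) / (norm (x - z))\<^sup>2) powr p)" for x z
  have Gm: "G \<in> borel_measurable (borel \<Otimes>\<^sub>M borel)"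
    unfolding G_def
  proof (rule borel_measurable_lim_metric)
    fix k
    have "continuous_on UNIV (\<lambda>q :: 'a \<times> 'a. real (Suc k) * infdist (fst q + (snd q - fst q) /\<^sub>R real (Suc k)) S)"
      by (intro continuous_intros)
    then show "(\<lambda>q :: 'a \<times> 'a. real (Suc k) * infdist (fst q + (snd q - fst q) /\<^sub>R real (Suc k)) S) \<in> borel_measurable (borel \<Otimes>\<^sub>M borel)"
      unfolding borel_prod by (rule borel_measurable_continuous_onI)
  qed
  have idm: "(\<lambda>x. x) \<in> measurable ?M borel" unfolding Hm_on_def by (rule measurable_restrict_space1) simp
  have [measurable]: "fst \<in> measurable (?M \<Otimes>\<^sub>M ?M) borel" "snd \<in> measurable (?M \<Otimes>\<^sub>M ?M) borel"
    using measurable_compose[OF measurable_fst idm] measurable_compose[OF measurable_snd idm] by auto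
  have "(\<lambda>q. (fst q, snd q)) \<in> measurable (?M \<Otimes>\<^sub>M ?M) (borel \<Otimes>\<^sub>M borel)" by measurable
  from measurable_compose[OF this Gm] have [measurable]: "G \<in> borel_measurable (?M \<Otimes>\<^sub>M ?M)" by simp
  have gm: "(\<lambda>q. g (fst q) (snd q)) \<in> borel_measurable (?M \<Otimes>\<^sub>M ?M)" unfolding g_def prod.collapse by measurable
  interpret finite_measure ?M by (rule finite_measure_Hm_on[OF S m])
  interpret pair_sigma_finite ?M ?M ..
  have geq: "g x z = ennreal (inv_Rtp m S x z powr p)" if x: "x \<in> S" "x \<notin> N" for x z
  proof -
    have T: "subspace (tangent_plane m S x)" using N(3)[OF x] by (simp add: is_tangent_plane_def)
    have "G (x, z) = norm (orej (tangent_plane m S x) (z - x))" unfolding G_def using N(4)[OF x, of "z - x"] by (simp add: limI)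
    then show ?thesis by (simp add: g_def inv_Rtp_def infdist_translate_eq_orej[OF T])
  qed
  have "S \<inter> N \<in> null_sets ?M"
  proof (rule null_setsI)
    have "hausdorff_outer m (S \<inter> N) \<le> hausdorff_outer m N" by (rule hausdorff_outer_mono) auto
    then show "emeasure ?M (S \<inter> N) = 0" using H(3)[OF N(1)] N(2) by simp
    show "S \<inter> N \<in> sets ?M" by (rule H(2)[OF N(1)])
  qed
  then have "AE x in ?M. x \<notin> S \<inter> N" by (rule AE_not_in)
  then have AEg: "AE x in ?M. ennreal (inv_Rtp m S x z powr p) = g x z" for z
    using AE_space[of ?M] by eventually_elim (simp add: H(1) geq)
  have "tp_energy m p S = (\<integral>\<^sup>+z. (\<integral>\<^sup>+x. g x z \<partial>?M) \<partial>?M)"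
    unfolding tp_energy_def by (intro nn_integral_cong nn_integral_cong_AE AEg)
  also have "\<dots> = (\<integral>\<^sup>+x. (\<integral>\<^sup>+z. g x z \<partial>?M) \<partial>?M)"
    using Fubini[OF gm] by simp
  finally have sw: "tp_energy m p S = (\<integral>\<^sup>+x. (\<integral>\<^sup>+z. g x z \<partial>?M) \<partial>?M)" .
  show thesis by (rule that[of N g, OF N(1) N(2) _ _ sw]) (erule (1) N(3), erule (1) geq)
qed

text \<open>Two averages: first x near y, then for each w in S a point z within \<eta> s of w at
  which the integrand is small. The plane error s^(2 - (2 m + a m)/p) and the displacement s^(1 + a)
  have the same order exactly for a = (p - 2 m) / (p + m), which is positive for p > 2 m.\<close>

lemma tp_energy_flat:
  fixes S :: "'a::euclidean_space set"
  assumes m: "1 \<le> m" and S: "lipschitz_submanifold m S" and E: "0 < E" "tp_energy m p S \<le> ennreal E" and p: "2 * real m < p"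
    and L: "1 \<le> L" and r1: "r \<le> 1" and good: "mgood m L r S"
  defines "c1 \<equiv> hconst m / (L * m) ^ m" and "a \<equiv> (p - 2 * m) / (p + m)"
  shows "mflat m (2 + 22\<^sup>2 * ((E + 2) / (c1 * c1)) powr (1 / p)) a r S"
  unfolding mflat_def
proof (intro ballI allI impI)
  fix y s assume y: "y \<in> S" and s: "0 < s \<and> s \<le> r"
  have cS: "compact S" using S by (simp add: lipschitz_submanifold_def)
  have p0: "0 < p" using p m by simp
  have a0: "0 < a" using p p0 by (simp add: a_def)
  have c1: "0 < c1" using L m hconst_pos[of m] by (simp add: c1_def)
  note H = Hm_on_simps[OF cS m]
  obtain N g where N: "N \<in> sets borel" "hausdorff_outer m N = 0"
    "\<And>x. x \<in> S \<Longrightarrow> x \<notin> N \<Longrightarrow> is_tangent_plane m S x (tangent_plane m S x)"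
    "\<And>x z. x \<in> S \<Longrightarrow> x \<notin> N \<Longrightarrow> g x z = ennreal (inv_Rtp m S x z powr p)"
    and sw: "tp_energy m p S = (\<integral>\<^sup>+x. (\<integral>\<^sup>+z. g x z \<partial>Hm_on m S) \<partial>Hm_on m S)"
    by (rule tp_energy_swap[OF m S, of p]) (rule that)
  have meas: "ennreal (c1 * t powr m) \<le> hausdorff_outer m (S \<inter> cball w t)" if "w \<in> S" "0 < t" "t \<le> r" for w t
  proof -
    have "c1 * t powr m = hconst m * (t / (L * m)) ^ m" using that by (simp add: c1_def power_divide powr_realpow)
    then show ?thesis using mgood_measure_ge[OF m good L that] by simp
  qed
  let ?A = "S \<inter> (cball y s - N)"
  have A: "?A \<in> sets (Hm_on m S)" using N by (intro H(2)) auto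
  define \<mu> where "\<mu> = c1 * s powr m"
  have \<mu>0: "0 < \<mu>" using c1 s by (simp add: \<mu>_def)
  have \<mu>: "ennreal \<mu> \<le> emeasure (Hm_on m S) ?A"
  proof -
    have "ennreal \<mu> \<le> hausdorff_outer m (S \<inter> cball y s)" using meas[OF y] s by (simp add: \<mu>_def)
    also have "\<dots> \<le> hausdorff_outer m (?A \<union> N)" by (rule hausdorff_outer_mono) auto
    also have "\<dots> \<le> hausdorff_outer m ?A + hausdorff_outer m N" using m by (intro hausdorff_outer_Un_le) simp
    finally show ?thesis using N H(3)[of "cball y s - N"] by simp
  qed
  obtain x where x: "x \<in> ?A" "(\<integral>\<^sup>+z. g x z \<partial>Hm_on m S) \<le> ennreal ((E + 1) / \<mu>)"
    using nn_integral_exists_le[OF A \<mu>0 \<mu> _ _ E(2)[unfolded sw], of "E + 1"] E(1) by auto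
  have tp: "is_tangent_plane m S x (tangent_plane m S x)" using N(3) x by blast
  let ?T = "tangent_plane m S x"
  have T: "subspace ?T" "dim ?T = m" using tp by (auto simp: is_tangent_plane_def)
  \<comment> \<open>As s is at most 1, so is \<eta>, and the smaller balls stay in the range of the
    measure bound.\<close>
  define \<eta> where "\<eta> = s powr a"
  have \<eta>: "0 < \<eta>" "\<eta> \<le> 1" using s r1 a0 by (auto simp: \<eta>_def intro!: powr_le1)
  have \<eta>s: "0 < \<eta> * s" "\<eta> * s \<le> s" using \<eta> s by (auto simp: mult_le_cancel_right1)
  define \<mu>1 where "\<mu>1 = c1 * (\<eta> * s) powr m"
  have \<mu>10: "0 < \<mu>1" unfolding \<mu>1_def using c1 \<eta>s by (intro mult_pos_pos) (auto simp: powr_gt_zero)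
  \<comment> \<open>E + 1 is the bound after the first average; the second one raises it to E +
    2.\<close>
  define t where "t = (E + 2) / \<mu> / \<mu>1"
  define h where "h = \<eta> * s + (22 * s)\<^sup>2 / 2 * t powr (1 / p)"
  have t0: "0 \<le> t" using E \<mu>0 \<mu>10 by (simp add: t_def)
  have xs: "norm (x - y) \<le> s" using x by (auto simp: dist_norm norm_minus_commute)
  have bd: "norm (orej ?T (w - x)) \<le> h" if w: "w \<in> S" "norm (w - y) \<le> 20 * s" for w
  proof -
    have W: "S \<inter> cball w (\<eta> * s) \<in> sets (Hm_on m S)" by (rule H(2)) auto
    have Wm: "ennreal \<mu>1 \<le> emeasure (Hm_on m S) (S \<inter> cball w (\<eta> * s))"
      using meas[OF w(1), of "\<eta> * s"] \<eta>s s H(3)[of "cball w (\<eta> * s)"] by (simp add: \<mu>1_def)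
    obtain z where z: "z \<in> S \<inter> cball w (\<eta> * s)" "g x z \<le> ennreal t"
      using nn_integral_exists_le[OF W \<mu>10 Wm _ _ x(2), of "(E + 2) / \<mu>"] E(1) \<mu>0 by (auto simp: t_def divide_strict_right_mono)
    have zw: "norm (w - z) \<le> \<eta> * s" using z by (auto simp: dist_norm)
    have "norm (orej ?T (z - x)) \<le> (22 * s)\<^sup>2 / 2 * t powr (1 / p)"
    proof (rule inv_Rtp_bound[OF T(1) _ p0 t0])
      show "ennreal (inv_Rtp m S x z powr p) \<le> ennreal t" using N(4)[of x z] x z by auto
      have "x - z = (x - y) - (w - y) + (w - z)" by simp
      then have "norm (x - z) \<le> norm ((x - y) - (w - y)) + norm (w - z)" by (metis norm_triangle_ineq)
      then show "norm (x - z) \<le> 22 * s"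
        using norm_triangle_ineq4[of "x - y" "w - y"] xs w zw \<eta>s by linarith
    qed
    moreover have "orej ?T (w - x) = orej ?T (w - z) + orej ?T (z - x)" by (simp add: orej_add[OF T(1), symmetric])
    moreover have "norm (orej ?T (w - z)) \<le> \<eta> * s" using norm_orej_le[OF T(1), of "w - z"] zw by linarith
    ultimately show ?thesis unfolding h_def using norm_triangle_ineq[of "orej ?T (w - z)" "orej ?T (z - x)"] by simp
  qed
  have "\<mu> * \<mu>1 = (c1 * c1) * s powr (2 * m + a * m)"
  proof -
    have e1: "(\<eta> * s) powr m = s powr (a * m) * s powr m"
      unfolding \<eta>_def using s by (simp add: powr_mult powr_powr)
    have e2: "s powr (2 * m + a * m) = s powr m * s powr m * s powr (a * m)"
      by (simp only: mult_2 of_nat_add powr_add)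
    show ?thesis unfolding \<mu>_def \<mu>1_def e1 e2 by (simp only: mult_ac)
  qed
  then have "t = (E + 2) / ((c1 * c1) * s powr (2 * m + a * m))" by (simp add: t_def)
  then have tp: "t powr (1 / p) = ((E + 2) / (c1 * c1)) powr (1 / p) * s powr (- (2 * m + a * m) / p)"
    using powr_split_const[of "E + 2" "c1 * c1" s p "2 * m + a * m"] E c1 s p0 by simp
  have ex: "2 + - (2 * m + a * m) / p = 1 + a"
  proof -
    have "a * (p + m) = p - 2 * m" using p0 m by (simp add: a_def)
    then show ?thesis using p0 by (simp add: field_simps)
  qed
  have hh: "2 * h = (2 + 22\<^sup>2 * ((E + 2) / (c1 * c1)) powr (1 / p)) * s powr (1 + a)"
  proof -
    have "s\<^sup>2 * s powr (- (2 * m + a * m) / p) = s powr (2 + - (2 * m + a * m) / p)"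
      using s by (simp only: powr_add) (simp add: powr_numeral)
    then have e1: "s\<^sup>2 * s powr (- (2 * m + a * m) / p) = s powr (1 + a)" by (simp only: ex)
    have e2: "\<eta> * s = s powr (1 + a)" using s by (simp add: \<eta>_def powr_add mult.commute)
    have "2 * h = 2 * (\<eta> * s) + 22\<^sup>2 * ((E + 2) / (c1 * c1)) powr (1 / p) * (s\<^sup>2 * s powr (- (2 * m + a * m) / p))"
      unfolding h_def tp by (simp add: power_mult_distrib)
    then show ?thesis unfolding e1 e2 by (simp only: distrib_right)
  qed
  have "norm (orej ?T (z - y)) \<le> 2 * h" if z: "z \<in> S" "norm (z - y) \<le> 20 * s" for z
  proof -
    have "norm (orej ?T (z - x) - orej ?T (y - x)) \<le> h + h"
      using bd[OF z] bd[OF y] s norm_triangle_ineq4[of "orej ?T (z - x)" "orej ?T (y - x)"] by simp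
    then show ?thesis by (simp add: orej_diff[OF T(1), symmetric])
  qed
  then show "\<exists>P. subspace P \<and> dim P = m \<and> (\<forall>z\<in>S. norm (z - y) \<le> 20 * s \<longrightarrow>
      norm (orej P (z - y)) \<le> (2 + 22\<^sup>2 * ((E + 2) / (c1 * c1)) powr (1 / p)) * s powr (1 + a))"
    using T unfolding hh by blast
qed

section \<open>Menger energies\<close>

lemma orthonormal_norm:
  fixes B :: "'a::euclidean_space set"
  shows "orthonormal B \<Longrightarrow> b \<in> B \<Longrightarrow> norm b = 1"
  by (simp add: orthonormal_def norm_eq_sqrt_inner)

text \<open>The volume is bounded below by base times height, through a family of points of the
  simplex that projects onto a box. Finiteness is shown as well because \<open>enn2real\<close> in
  \<open>menger_K\<close> would send an infinite value to 0.\<close>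

lemma simplex_hausdorff:
  fixes X :: "nat \<Rightarrow> 'a::euclidean_space"
  assumes m: "1 \<le> m" and en: "bij_betw en {..<m} B" and B: "orthonormal B" and \<sigma>: "0 < \<sigma>" and \<eta>: "2 * real m * \<eta> \<le> 1"
    and X: "\<And>i j. i < m \<Longrightarrow> j < m \<Longrightarrow> \<bar>(X (Suc i) - X 0) \<bullet> en j - (if i = j then \<sigma> else 0)\<bar> \<le> \<eta> * \<sigma>"
    and M: "1 \<le> M" "norm (X (Suc m) - X 0) \<le> M * \<sigma>"
  defines "U \<equiv> span ((\<lambda>i. X (Suc i) - X 0) ` {..<m})"
  defines "h \<equiv> norm (orej U (X (Suc m) - X 0))"
  assumes h: "0 < h"
  shows "ennreal (hconst (Suc m) * ((\<sigma> / (16 * (real m)\<^sup>2)) ^ m * (h / (16 * real m * M)))) \<le> hausdorff_outer (Suc m) (convex hull (X ` {..Suc m}))"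
    and "hausdorff_outer (Suc m) (convex hull (X ` {..Suc m})) < top"
proof -
  have fB: "finite B" using B by (simp add: orthonormal_def)
  have cB: "card B = m" using bij_betw_same_card[OF en] by simp
  define ix where "ix = inv_into {..<m} en"
  define p where "p e = X (Suc (ix e)) - X 0" for e
  have ixe: "ix (en i) = i" if "i < m" for i using en that by (simp add: ix_def bij_betw_def)
  have pen: "p (en i) = X (Suc i) - X 0" if "i < m" for i using ixe[OF that] by (simp add: p_def)
  have enB: "en ` {..<m} = B" using en by (simp add: bij_betw_def)
  have pB: "p ` B = (\<lambda>i. X (Suc i) - X 0) ` {..<m}"
    unfolding enB[symmetric] image_image by (rule image_cong) (auto simp: pen)
  have fr: "\<bar>p e' \<bullet> e - (if e = e' then \<sigma> else 0)\<bar> \<le> \<eta> * \<sigma>" if e: "e \<in> B" "e' \<in> B" for e e'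
  proof -
    obtain i j where ij: "i < m" "e' = en i" "j < m" "e = en j" using e enB by blast
    have "(e = e') = (i = j)" using ij en by (auto simp: bij_betw_def inj_on_def)
    then show ?thesis using X[OF ij(1,3)] ij pen[OF ij(1)] by simp
  qed
  have inj: "inj_on p B" and ind: "independent (p ` B)" using frame_independent[OF fB cB \<sigma> \<eta> fr] by auto
  have U: "subspace U" "dim U = m" unfolding U_def pB[symmetric]
    using dim_eq_card_independent[OF ind] card_image[OF inj] cB by (auto simp: dim_span)
  have pU: "p e \<in> U" if "e \<in> B" for e unfolding U_def pB[symmetric] using that by (intro span_base) auto
  have sumB: "(\<Sum>e\<in>B. f e) = (\<Sum>i<m. f (en i))" for f :: "'a \<Rightarrow> 'c::comm_monoid_add" by (rule sum.reindex_bij_betw[OF en, symmetric])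
  have coef: "\<exists>l. v = (\<Sum>e\<in>B. l e *\<^sub>R p e) \<and> (\<forall>e\<in>B. \<bar>l e\<bar> \<le> 2 * norm v / \<sigma>)" if v: "v \<in> U" for v
  proof -
    have "\<bar>v \<bullet> e\<bar> \<le> norm v" if "e \<in> B" for e
      using Cauchy_Schwarz_ineq2[of v e] orthonormal_norm[OF B that] by simp
    from frame_coeffs[OF U fB cB \<sigma> \<eta> fr pU v this] show ?thesis by metis
  qed
  define q where "q = X (Suc m) - X 0"
  obtain Bu where Bu: "orthonormal Bu" "Bu \<subseteq> U" "card Bu = m" "span Bu = U" using orthonormal_basis_exists[OF U] .
  have fBu: "finite Bu" using Bu by (simp add: orthonormal_def)
  define qh where "qh = orej U q /\<^sub>R h"
  have hq: "h = norm (orej U q)" by (simp add: h_def q_def)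
  have qho: "qh \<bullet> b = 0" "b \<bullet> qh = 0" if "b \<in> U" for b using orej_orth[OF U(1) that, of q] by (auto simp: qh_def inner_commute)
  have qh1: "qh \<bullet> qh = 1"
  proof -
    have "norm qh = 1" using h by (simp add: qh_def hq)
    then show ?thesis by (simp add: norm_eq_1)
  qed
  have qhBu: "qh \<notin> Bu" using qho[of qh] qh1 Bu(2) by auto
  let ?B = "insert qh Bu"
  have oB: "orthonormal ?B" using Bu(1,2) qho qh1 by (auto simp: orthonormal_def)
  have cB2: "card ?B = Suc m" using qhBu fBu Bu by simp
  \<comment> \<open>The base point with barycentric weights 1/2 at \<open>X 0\<close> and 1 / (2 m)
    at the other base vertices, so that each of these may vary by 1 / (4 m) and stay
    nonnegative.\<close>
  define c where "c = X 0 + (1 / (2 * m)) *\<^sub>R (\<Sum>e\<in>B. p e)"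
  define lb where "lb b = (if b = qh then h / (16 * real m * M) else \<sigma> / (16 * (real m)\<^sup>2))" for b
  let ?H = "convex hull (X ` {..Suc m})"
  have "ennreal (hconst (Suc m) * (\<Prod>b\<in>?B. lb b)) \<le> hausdorff_outer (Suc m) ?H"
  proof (rule hausdorff_outer_ge_box[OF _ oB cB2, of _ _ c])
    show "0 \<le> lb b" for b using h m M \<sigma> by (simp add: lb_def)
    fix t assume t: "\<And>b. b \<in> ?B \<Longrightarrow> 0 \<le> t b \<and> t b \<le> lb b"
    \<comment> \<open>The weight of the last vertex, read off from the prescribed height
      \<open>t qh\<close>.\<close>
    define \<mu> where "\<mu> = t qh / h"
    have \<mu>: "0 \<le> \<mu>" "\<mu> \<le> 1 / (16 * real m * M)" using t[of qh] h by (auto simp: \<mu>_def lb_def field_simps)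
    have mM: "1 \<le> m * M" using m M mult_mono[of 1 "real m" 1 M] by simp
    have \<mu>4: "\<mu> \<le> 1/4"
    proof -
      have "4 \<le> 16 * real m * M" using mM unfolding mult.assoc by linarith
      then have "1 / (16 * real m * M) \<le> 1 / 4" by (rule frac_le[rotated 3]) simp_all
      then show ?thesis using \<mu> by linarith
    qed
    define tb where "tb = (\<Sum>b\<in>Bu. t b *\<^sub>R b)"
    have tbU: "tb \<in> U" unfolding tb_def using Bu(2) U by (intro subspace_sum) (auto intro: subspace_scale)
    have ntb: "norm tb \<le> \<sigma> / (16 * m)"
    proof -
      have "norm tb \<le> (\<Sum>b\<in>Bu. \<sigma> / (16 * (real m)\<^sup>2))" unfolding tb_def
      proof (rule sum_norm_le)
        fix b assume b: "b \<in> Bu"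
        then have "norm b = 1" "b \<noteq> qh" using orthonormal_norm[OF Bu(1)] qhBu by auto
        then show "norm (t b *\<^sub>R b) \<le> \<sigma> / (16 * (real m)\<^sup>2)" using t[of b] b by (simp add: lb_def)
      qed
      also have "\<dots> = \<sigma> / (16 * m)" using Bu m by (simp add: power2_eq_square)
      finally show ?thesis .
    qed
    \<comment> \<open>Moving along q also shifts the point parallel to the base; this shift is
      subtracted from the prescribed base coordinates.\<close>
    define u where "u = tb - \<mu> *\<^sub>R oproj U q"
    have uU: "u \<in> U" using tbU U by (simp add: u_def subspace_diff subspace_scale)
    have nu: "norm u \<le> \<sigma> / (8 * m)"
    proof -
      have "norm (\<mu> *\<^sub>R oproj U q) \<le> 1 / (16 * real m * M) * (M * \<sigma>)"
        unfolding norm_scaleR using \<mu> norm_oproj_le[OF U(1), of q] M by (intro mult_mono) (auto simp: q_def)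
      also have "\<dots> = \<sigma> / (16 * m)" using M by simp
      finally show ?thesis unfolding u_def using norm_triangle_ineq4[of tb "\<mu> *\<^sub>R oproj U q"] ntb by (simp add: field_simps)
    qed
    obtain l where l: "u = (\<Sum>e\<in>B. l e *\<^sub>R p e)" "\<And>e. e \<in> B \<Longrightarrow> \<bar>l e\<bar> \<le> 2 * norm u / \<sigma>" using coef[OF uU] by blast
    have l4: "\<bar>l e\<bar> \<le> 1 / (4 * m)" if e: "e \<in> B" for e
    proof -
      have "2 * norm u / \<sigma> \<le> 2 * (\<sigma> / (8 * m)) / \<sigma>" using nu \<sigma> by (intro divide_right_mono mult_left_mono) auto
      also have "\<dots> = 1 / (4 * m)" using \<sigma> by simp
      finally show ?thesis using l(2)[OF e] by linarith
    qed
    define \<alpha> where "\<alpha> e = 1 / (2 * m) + l e" for e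
    have \<alpha>: "0 \<le> \<alpha> e" "\<alpha> e \<le> 3 / (4 * m)" if e: "e \<in> B" for e
    proof -
      have "1 / (2 * real m) = 2 / (4 * m)" "3 / (4 * real m) = 2 / (4 * m) + 1 / (4 * m)" "2 / (4 * real m) = 1 / (4 * m) + 1 / (4 * m)" "0 \<le> 1 / (4 * real m)"
        by (auto simp: add_divide_distrib[symmetric])
      then show "0 \<le> \<alpha> e" "\<alpha> e \<le> 3 / (4 * m)" using l4[OF e] unfolding \<alpha>_def by linarith+
    qed
    have S\<alpha>: "(\<Sum>e\<in>B. \<alpha> e) \<le> 3/4"
    proof -
      have "(\<Sum>e\<in>B. \<alpha> e) \<le> (\<Sum>e\<in>B. 3 / (4 * m))" by (intro sum_mono \<alpha>)
      also have "\<dots> = 3/4" using cB m by simp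
      finally show ?thesis .
    qed
    define x where "x = X 0 + (\<Sum>e\<in>B. \<alpha> e *\<^sub>R p e) + \<mu> *\<^sub>R q"
    have "x \<in> ?H"
    proof -
      \<comment> \<open>The base weights sum to at most 3/4 and \<open>\<mu>\<close> is at most 1/4,
        which leaves a nonnegative weight for \<open>X 0\<close>.\<close>
      define w where "w i = (if i = 0 then 1 - (\<Sum>e\<in>B. \<alpha> e) - \<mu> else if i = Suc m then \<mu> else \<alpha> (en (i - 1)))" for i
      have sp: "(\<Sum>i\<le>Suc m. f i) = f 0 + (\<Sum>i<m. f (Suc i)) + f (Suc m)" for f :: "nat \<Rightarrow> 'c::comm_monoid_add"
        by (simp add: sum.atMost_shift add.assoc)
      have "(\<Sum>i\<le>Suc m. w i *\<^sub>R X i) \<in> ?H"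
      proof (rule convex_sum)
        show "(\<Sum>i\<le>Suc m. w i) = 1" unfolding sp by (simp add: w_def sumB)
        show "0 \<le> w i" if "i \<in> {..Suc m}" for i
        proof -
          have "\<alpha> (en (i - 1)) \<ge> 0" if "i \<noteq> 0" "i \<noteq> Suc m" using \<alpha>(1)[of "en (i - 1)"] enB \<open>i \<in> _\<close> that by auto
          then show ?thesis using \<mu> \<mu>4 S\<alpha> by (auto simp: w_def)
        qed
        show "X i \<in> ?H" if "i \<in> {..Suc m}" for i using that by (intro hull_inc) auto
      qed (auto simp: convex_convex_hull)
      also have "(\<Sum>i\<le>Suc m. w i *\<^sub>R X i) = x"
      proof -
        have "(\<Sum>i<m. w (Suc i) *\<^sub>R X (Suc i)) = (\<Sum>i<m. \<alpha> (en i) *\<^sub>R (p (en i) + X 0))"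
          by (rule sum.cong) (auto simp: w_def pen)
        also have "\<dots> = (\<Sum>e\<in>B. \<alpha> e *\<^sub>R p e) + (\<Sum>e\<in>B. \<alpha> e) *\<^sub>R X 0"
          by (simp add: sumB scaleR_add_right sum.distrib scaleR_sum_left)
        finally show ?thesis unfolding sp by (simp add: w_def x_def q_def algebra_simps)
      qed
      finally show ?thesis .
    qed
    moreover have "(x - c) \<bullet> b = t b" if b: "b \<in> ?B" for b
    proof -
      have "x - c = u + \<mu> *\<^sub>R q"
        by (simp add: x_def c_def \<alpha>_def l(1) scaleR_add_left sum.distrib scaleR_sum_right)
      also have "\<dots> = tb + \<mu> *\<^sub>R orej U q" by (simp add: u_def orej_def algebra_simps)
      also have "\<mu> *\<^sub>R orej U q = t qh *\<^sub>R qh" using h by (simp add: qh_def \<mu>_def divide_inverse)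
      finally have xc: "x - c = tb + t qh *\<^sub>R qh" .
      show ?thesis
      proof (cases "b = qh")
        case True
        then show ?thesis unfolding xc using qho[OF tbU] qh1 by (simp add: inner_add_left)
      next
        case False
        then have b': "b \<in> Bu" using b by simp
        have "tb \<bullet> b = (\<Sum>b'\<in>Bu. if b = b' then t b' else 0)" unfolding tb_def inner_sum_left
          using Bu(1) b' by (intro sum.cong) (auto simp: orthonormal_def)
        also have "\<dots> = t b" using fBu b' by simp
        finally show ?thesis unfolding xc using qho[of b] b' Bu(2) by (auto simp: inner_add_left)
      qed
    qed
    ultimately show "\<exists>x\<in>?H. \<forall>b\<in>?B. (x - c) \<bullet> b = t b" by blast
  qed simp
  moreover have "(\<Prod>b\<in>?B. lb b) = (\<sigma> / (16 * (real m)\<^sup>2)) ^ m * (h / (16 * real m * M))"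
  proof -
    have "(\<Prod>b\<in>Bu. lb b) = (\<Prod>b\<in>Bu. \<sigma> / (16 * (real m)\<^sup>2))" using qhBu by (intro prod.cong) (auto simp: lb_def)
    then show ?thesis using fBu qhBu Bu(3) by (simp add: lb_def)
  qed
  ultimately show "ennreal (hconst (Suc m) * ((\<sigma> / (16 * (real m)\<^sup>2)) ^ m * (h / (16 * real m * M)))) \<le> hausdorff_outer (Suc m) ?H" by simp
  show "hausdorff_outer (Suc m) ?H < top"
  proof (rule hausdorff_outer_finite[OF _ oB cB2, where L = 1])
    show "bounded ?H" by (intro bounded_convex_hull finite_imp_bounded) auto
    \<comment> \<open>The simplex lies in an affine plane whose direction is spanned by the
      orthonormal set, so these coordinates control distances.\<close>
    have HV: "x - X 0 \<in> span ?B" if "x \<in> ?H" for x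
    proof -
      have "?H \<subseteq> {x. x - X 0 \<in> span ?B}"
      proof (rule hull_minimal)
        have UB: "U \<subseteq> span ?B" unfolding Bu(4)[symmetric] by (rule span_mono) auto
        have qB: "q \<in> span ?B"
        proof -
          have "q = oproj U q + h *\<^sub>R qh" using h by (simp add: qh_def orej_def)
          moreover have "oproj U q \<in> span ?B" using oproj_in[OF U(1)] UB by blast
          moreover have "h *\<^sub>R qh \<in> span ?B" by (intro span_scale span_base) auto
          ultimately show ?thesis by (metis span_add)
        qed
        have XB: "X (Suc i) - X 0 \<in> span ?B" if "i < m" for i
          using pU[of "en i"] enB pen[OF that] that UB by auto
        show "X ` {..Suc m} \<subseteq> {x. x - X 0 \<in> span ?B}"
        proof -
          have "X i - X 0 \<in> span ?B" if "i \<le> Suc m" for i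
          proof (cases i)
            case 0 then show ?thesis by (simp add: span_zero)
          next
            case (Suc j)
            then show ?thesis using qB XB[of j] that by (cases "j = m") (auto simp: q_def)
          qed
          then show ?thesis by auto
        qed
        have "{x. x - X 0 \<in> span ?B} = (+) (X 0) ` span ?B"
          by (auto simp: image_iff) (metis add_diff_cancel_left' diff_add_cancel add.commute)
        then show "convex {x. x - X 0 \<in> span ?B}" using convex_translation[OF subspace_imp_convex[OF subspace_span]] by metis
      qed
      then show ?thesis using that by blast
    qed
    fix x y assume "x \<in> ?H" "y \<in> ?H"
    then have "(x - X 0) - (y - X 0) \<in> span ?B" by (intro span_diff HV)
    then show "norm (x - y) \<le> 1 * (\<Sum>b\<in>?B. \<bar>(x - y) \<bullet> b\<bar>)" using norm_le_sum_orthonormal[OF oB, of "x - y"] by simp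
  qed auto
qed

text \<open>The vertices of a simplex spanned by a frame of \<open>S\<close> at \<open>y\<close> and an arbitrary further point are moved within balls of
  radius \<open>\<eta> s\<close> so that the curvature is controlled by the average of the integrand; \<open>\<eta> = \<eta>0 s\<^sup>a\<close> balances the error of
  this perturbation against the height of the simplex.\<close>

lemma menger_energy_flat:
  assumes m: "1 \<le> m" and l: "1 \<le> l" "l \<le> m + 2" and E: "0 < E" and p: "real (m * l) < p" and L: "1 \<le> L"
  obtains C where "0 \<le> C" "\<And>(S::'a::euclidean_space set) r. lipschitz_submanifold m S \<Longrightarrow> menger_energy m l p S \<le> ennreal E \<Longrightarrow>
     r \<le> 1 \<Longrightarrow> mgood m L r S \<Longrightarrow> mflat m C ((p - m * l) / (p + m * l)) r S"
proof -
  have p0: "0 < p" using p by (smt (verit) of_nat_0_le_iff)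
  \<comment> \<open>The solution of 2 - (1 + a) m l / p = 1 + a, where the left side is the exponent
    of the height bound and the right side that of the perturbation.\<close>
  define a where "a = (p - m * l) / (p + m * l)"
  have a0: "0 < a" using p p0 by (simp add: a_def add_pos_nonneg)
  define c1 where "c1 = hconst m / (L * m) ^ m"
  have c1: "0 < c1" using L m hconst_pos[of m] by (simp add: c1_def)
  \<comment> \<open>Small enough for the perturbed frame to remain independent: its relative error
    is 2 L \<eta>.\<close>
  define \<eta>0 where "\<eta>0 = 1 / (8 * m * L)"
  have mL: "1 \<le> m * L" using m L mult_mono[of 1 "real m" 1 L] by simp
  have \<eta>0: "0 < \<eta>0" "\<eta>0 \<le> 1" "4 * m * L * \<eta>0 \<le> 1" using mL m L by (auto simp: \<eta>0_def field_simps)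
  \<comment> \<open>The constant of \<open>simplex_hausdorff\<close> for \<sigma> = s / L and M = 22
    L, with the power of s and the height taken out.\<close>
  define c2 where "c2 = hconst (Suc m) * ((1 / L / (16 * (real m)\<^sup>2)) ^ m * (1 / (16 * real m * (22 * L))))"
  have c2: "0 < c2" using L m hconst_pos[of "Suc m"] by (simp add: c2_def)
  define A where "A = 42 ^ (m + 2) / c2 * ((E + 1) / (c1 * \<eta>0 ^ m) ^ l) powr (1 / p)"
  define C where "C = A + (2 + 88 * L * m) * \<eta>0"
  have A0: "0 \<le> A" using c2 by (simp add: A_def)
  have C0: "0 \<le> C" using A0 \<eta>0 L by (simp add: C_def)
  have "mflat m C a r S" if S: "lipschitz_submanifold m S" and en: "menger_energy m l p S \<le> ennreal E" and r1: "r \<le> 1" and good: "mgood m L r S"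
    for S :: "'a set" and r
    unfolding mflat_def
  proof (intro ballI allI impI)
    fix y s assume y: "y \<in> S" and s': "0 < s \<and> s \<le> r"
    then have s: "0 < s" "s \<le> r" "s \<le> 1" using r1 by auto
    have cS: "compact S" using S by (simp add: lipschitz_submanifold_def)
    note H = Hm_on_simps[OF cS m]
    let ?M = "Hm_on m S"
    obtain P0 B w where F: "subspace P0" "orthonormal B" "card B = m" "B \<subseteq> P0"
      "\<And>e. e \<in> B \<Longrightarrow> y + w e \<in> S" "\<And>e. e \<in> B \<Longrightarrow> oproj P0 (w e) = (s / L) *\<^sub>R e" "\<And>e. e \<in> B \<Longrightarrow> norm (w e) \<le> s"
      using mgood_frame[OF good L y] s by metis
    have fB: "finite B" using F(2) by (simp add: orthonormal_def)
    obtain ex where ex: "bij_betw ex {..<m} B" using ex_bij_betw_nat_finite[OF fB] F(3) by (auto simp: atLeast0LessThan)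
    have exim: "ex ` {..<m} = B" using ex by (simp add: bij_betw_def)
    have exB: "ex i \<in> B" if "i < m" for i using ex that by (auto simp: bij_betw_def)
    define \<sigma> where "\<sigma> = s / L"
    have \<sigma>: "0 < \<sigma>" "s = L * \<sigma>" using s L by (auto simp: \<sigma>_def)
    have we: "w (ex i) \<bullet> ex j = (if i = j then \<sigma> else 0)" if "i < m" "j < m" for i j
    proof -
      have "w (ex i) \<bullet> ex j = oproj P0 (w (ex i)) \<bullet> ex j" using F(1,4) exB[OF that(2)] by (subst oproj_inner) auto
      also have "\<dots> = \<sigma> * (ex i \<bullet> ex j)" using F(6)[OF exB[OF that(1)]] by (simp add: \<sigma>_def)
      also have "ex i \<bullet> ex j = (if i = j then 1 else 0)"
        using F(2) exB that ex by (auto simp: orthonormal_def bij_betw_def inj_on_def)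
      finally show ?thesis by simp
    qed
    \<comment> \<open>One plane must serve all \<zeta>, whereas the perturbed vertices and their
      span U depend on \<zeta>; so the plane of the unperturbed frame is used.\<close>
    define U0 where "U0 = span ((\<lambda>i. w (ex i)) ` {..<m})"
    have U0: "subspace U0" "dim U0 = m"
    proof -
      show "subspace U0" by (simp add: U0_def)
      have fr: "\<bar>w e' \<bullet> e - (if e = e' then \<sigma> else 0)\<bar> \<le> 0 * \<sigma>" if ee: "e \<in> B" "e' \<in> B" for e e'
      proof -
        obtain i j where "i < m" "e' = ex i" "j < m" "e = ex j" using exim ee by blast
        then show ?thesis using we[of i j] ex by (auto simp: bij_betw_def inj_on_def)
      qed
      have "inj_on w B" "independent (w ` B)" using frame_independent[OF fB F(3) \<sigma>(1) _ fr] by auto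
      moreover have "(\<lambda>i. w (ex i)) ` {..<m} = w ` B" using ex by (auto simp: bij_betw_def image_image[symmetric])
      ultimately show "dim U0 = m" unfolding U0_def using dim_eq_card_independent[of "w ` B"] card_image[of w B] F(3) by (simp add: dim_span)
    qed
    define \<eta> where "\<eta> = \<eta>0 * s powr a"
    have sa: "0 < s powr a" "s powr a \<le> 1" using s a0 by (auto intro!: powr_le1)
    have \<eta>: "0 < \<eta>" "\<eta> \<le> \<eta>0" "\<eta> \<le> 1"
    proof -
      show "0 < \<eta>" using \<eta>0 sa by (simp add: \<eta>_def)
      have "\<eta>0 * s powr a \<le> \<eta>0 * 1" using \<eta>0 sa by (intro mult_left_mono) auto
      then show "\<eta> \<le> \<eta>0" by (simp add: \<eta>_def)
      then show "\<eta> \<le> 1" using \<eta>0 by simp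
    qed
    have \<eta>s: "0 < \<eta> * s" "\<eta> * s \<le> s" using \<eta> s by (auto simp: mult_le_cancel_right1)
    have \<eta>sp: "\<eta> * s = \<eta>0 * s powr (1 + a)" using s by (simp add: \<eta>_def powr_add)
    define \<mu> where "\<mu> = c1 * (\<eta> * s) ^ m"
    have \<mu>0: "0 < \<mu>" using c1 \<eta>s by (simp add: \<mu>_def)
    have meas: "ennreal \<mu> \<le> emeasure ?M (S \<inter> cball v (\<eta> * s))" if "v \<in> S" for v
    proof -
      have "\<mu> = hconst m * ((\<eta> * s) / (L * m)) ^ m" by (simp add: \<mu>_def c1_def power_divide)
      then have "ennreal \<mu> \<le> hausdorff_outer m (S \<inter> cball v (\<eta> * s))"
        using mgood_measure_ge[OF m good L that \<eta>s(1)] \<eta>s s by simp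
      then show ?thesis using H(3)[of "cball v (\<eta> * s)"] by simp
    qed
    define t where "t = (E + 1) / \<mu> ^ l"
    have t0: "0 \<le> t" using E \<mu>0 by (simp add: t_def)
    have "norm (orej U0 (\<zeta> - y)) \<le> C * s powr (1 + a)" if \<zeta>: "\<zeta> \<in> S" "norm (\<zeta> - y) \<le> 20 * s" for \<zeta>
    proof -
      define z where "z i = (if i = 0 then y else if i = Suc m then \<zeta> else y + w (ex (i - 1)))" for i
      have zS: "z i \<in> S" if "i \<le> Suc m" for i using that y \<zeta> F(5) exB by (auto simp: z_def)
      have zy: "norm (z i - y) \<le> 20 * s" if "i \<le> Suc m" for i
      proof -
        have "norm (w (ex (i - 1))) \<le> s" if "i \<noteq> 0" "i \<noteq> Suc m" using that \<open>i \<le> Suc m\<close> F(7) exB by auto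
        then show ?thesis using \<zeta> s by (auto simp: z_def)
      qed
      \<comment> \<open>Only the first l vertices are perturbed; the supremum in the energy admits
        the remaining ones exactly as they are.\<close>
      let ?Q = "PiE {..<l} (\<lambda>i. S \<inter> cball (z i) (\<eta> * s))"
      interpret finite_measure ?M by (rule finite_measure_Hm_on[OF S m])
      interpret PS: product_sigma_finite "\<lambda>_. ?M" by standard
      have sets: "S \<inter> cball v (\<eta> * s) \<in> sets ?M" for v by (rule H(2)) auto
      have Q: "?Q \<in> sets (PiM {..<l} (\<lambda>_. ?M))" by (intro sets_PiM_I_finite sets) auto
      have "ennreal (\<mu> ^ l) = (\<Prod>i<l. ennreal \<mu>)" using \<mu>0 by (simp add: ennreal_power)
      also have "\<dots> \<le> (\<Prod>i<l. emeasure ?M (S \<inter> cball (z i) (\<eta> * s)))"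
        using l by (intro prod_mono_ennreal meas zS) auto
      also have "\<dots> = emeasure (PiM {..<l} (\<lambda>_. ?M)) ?Q" by (rule PS.emeasure_PiM[symmetric]) (auto intro: sets)
      finally have Qm: "ennreal (\<mu> ^ l) \<le> emeasure (PiM {..<l} (\<lambda>_. ?M)) ?Q" .
      have "0 < \<mu> ^ l" using \<mu>0 by simp
      from nn_integral_exists_le[OF Q this Qm _ _ en[unfolded menger_energy_def], of "E + 1"] E
      obtain xs where xs: "xs \<in> ?Q" and sup: "(SUP y\<in>{y. \<forall>i\<in>{l..m+1}. y i \<in> S}.
                 ennreal (menger_K m (\<lambda>i. if i < l then xs i else y i) powr p)) \<le> ennreal t"
        unfolding t_def by auto
      define X where "X i = (if i < l then xs i else z i)" for i
      have "z \<in> {y. \<forall>i\<in>{l..m+1}. y i \<in> S}" using zS by auto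
      from SUP_upper[OF this, of "\<lambda>y. ennreal (menger_K m (\<lambda>i. if i < l then xs i else y i) powr p)"] sup
      have K: "ennreal (menger_K m X powr p) \<le> ennreal t" unfolding X_def by (rule order_trans)
      have Xz: "norm (X i - z i) \<le> \<eta> * s" for i
      proof (cases "i < l")
        case True
        then have "xs i \<in> S \<inter> cball (z i) (\<eta> * s)" using xs by (auto simp: PiE_iff)
        then show ?thesis using True by (simp add: X_def dist_norm norm_minus_commute)
      qed (use \<eta>s in \<open>simp add: X_def\<close>)
      define d where "d i = X (Suc i) - X 0" for i
      have dz: "norm (d i - (z (Suc i) - y)) \<le> 2 * (\<eta> * s)" for i
      proof -
        have "d i - (z (Suc i) - y) = (X (Suc i) - z (Suc i)) - (X 0 - z 0)" by (simp add: d_def z_def)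
        then have "norm (d i - (z (Suc i) - y)) = norm ((X (Suc i) - z (Suc i)) - (X 0 - z 0))" by (rule arg_cong)
        then show ?thesis using norm_triangle_ineq4[of "X (Suc i) - z (Suc i)" "X 0 - z 0"] Xz[of "Suc i"] Xz[of 0] by linarith
      qed
      have zw: "z (Suc i) - y = w (ex i)" if "i < m" for i using that by (simp add: z_def)
      have fr: "\<bar>(X (Suc i) - X 0) \<bullet> ex j - (if i = j then \<sigma> else 0)\<bar> \<le> (2 * L * \<eta>) * \<sigma>" if ij: "i < m" "j < m" for i j
      proof -
        have n1: "norm (ex j) = 1" by (rule orthonormal_norm[OF F(2) exB[OF ij(2)]])
        have "(X (Suc i) - X 0) \<bullet> ex j - (if i = j then \<sigma> else 0) = (d i - w (ex i)) \<bullet> ex j"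
          using we[OF ij] by (simp add: d_def inner_diff_left)
        also have "\<bar>\<dots>\<bar> \<le> norm (d i - w (ex i)) * norm (ex j)" by (rule Cauchy_Schwarz_ineq2)
        also have "\<dots> \<le> 2 * (\<eta> * s)" using dz[of i] zw[OF ij(1)] n1 by simp
        finally show ?thesis using \<sigma>(2) by (simp add: mult_ac)
      qed
      have \<eta>': "2 * real m * (2 * L * \<eta>) \<le> 1"
      proof -
        have "4 * m * L * \<eta> \<le> 4 * m * L * \<eta>0" using \<eta> L by (intro mult_left_mono) auto
        then show ?thesis using \<eta>0(3) by (simp add: mult_ac)
      qed
      have q22: "norm (X (Suc m) - X 0) \<le> 22 * L * \<sigma>"
      proof -
        have "norm (d m) \<le> norm (d m - (z (Suc m) - y)) + norm (z (Suc m) - y)" using norm_triangle_ineq[of "d m - (z (Suc m) - y)" "z (Suc m) - y"] by simp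
        then have "norm (d m) \<le> 22 * s" using dz[of m] zy[of "Suc m"] \<eta>s by simp
        then show ?thesis using \<sigma>(2) by (simp add: d_def)
      qed
      define U where "U = span ((\<lambda>i. X (Suc i) - X 0) ` {..<m})"
      have U: "subspace U" by (simp add: U_def)
      define h where "h = norm (orej U (X (Suc m) - X 0))"
      have L22: "1 \<le> 22 * L" using L by simp
      \<comment> \<open>The volume bound c2 s^m h divided by (42 s)^(m + 2) is at most the
        curvature, so h is at most a constant times s^2 t^(1/p).\<close>
      have hA: "h \<le> A * s powr (1 + a)"
      proof (cases "0 < h")
        case True
        have sv: "ennreal (hconst (Suc m) * ((\<sigma> / (16 * (real m)\<^sup>2)) ^ m * (h / (16 * real m * (22 * L))))) \<le> hausdorff_outer (Suc m) (convex hull (X ` {..Suc m}))"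
          "hausdorff_outer (Suc m) (convex hull (X ` {..Suc m})) < top"
          using simplex_hausdorff[OF m ex F(2) \<sigma>(1) \<eta>' fr L22 q22] True by (simp_all only: h_def U_def)
        let ?H = "convex hull (X ` {..m + 1})"
        have bnd: "norm (X i - y) \<le> 21 * s" if "i \<le> m + 1" for i
          using norm_triangle_ineq[of "X i - z i" "z i - y"] Xz[of i] zy[of i] that \<eta>s by simp
        have dia: "diameter (X ` {..m+1}) \<le> 42 * s"
        proof (rule diameter_le)
          fix u v assume "u \<in> X ` {..m+1}" "v \<in> X ` {..m+1}"
          then obtain i j where "i \<le> m + 1" "j \<le> m + 1" "u = X i" "v = X j" by auto
          then show "norm (u - v) \<le> 42 * s" using norm_triangle_ineq4[of "X i - y" "X j - y"] bnd[of i] bnd[of j] by simp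
        qed (use s in auto)
        have dpos: "0 < diameter (X ` {..m+1})"
        proof -
          have "X (Suc m) \<noteq> X 0" using True orej_0[OF U] by (auto simp: h_def)
          then have "0 < dist (X (Suc m)) (X 0)" by simp
          also have "\<dots> \<le> diameter (X ` {..m+1})" by (rule diameter_bounded_bound) (auto intro: finite_imp_bounded)
          finally show ?thesis .
        qed
        have "c2 * s ^ m * h = hconst (Suc m) * ((\<sigma> / (16 * (real m)\<^sup>2)) ^ m * (h / (16 * real m * (22 * L))))"
        proof -
          have "\<sigma> / (16 * (real m)\<^sup>2) = (1 / L / (16 * (real m)\<^sup>2)) * s" by (simp add: \<sigma>_def)
          moreover have "h / (16 * real m * (22 * L)) = 1 / (16 * real m * (22 * L)) * h" by simp
          ultimately show ?thesis unfolding c2_def by (simp only: power_mult_distrib mult_ac)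
        qed
        then have "ennreal (c2 * s ^ m * h) \<le> hausdorff_outer (m + 1) ?H" using sv(1) by simp
        then have Hge: "c2 * s ^ m * h \<le> enn2real (hausdorff_outer (m + 1) ?H)"
          using sv(2) c2 s True by (metis Suc_eq_plus1 enn2real_mono enn2real_ennreal mult_nonneg_nonneg less_imp_le zero_le_power)
        have "c2 * s ^ m * h / (42 * s) ^ (m + 2) \<le> menger_K m X"
          unfolding menger_K_def using Hge dia dpos c2 s True by (intro frac_le power_mono) auto
        also have "menger_K m X \<le> t powr (1 / p)"
        proof (rule ennreal_powr_leD[OF K _ p0 t0])
          show "0 \<le> menger_K m X" unfolding menger_K_def using dpos by (intro divide_nonneg_nonneg) auto
        qed
        finally have "c2 * s ^ m * h \<le> t powr (1 / p) * (42 * s) ^ (m + 2)" using s by (simp add: pos_divide_le_eq)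
        also have "\<dots> = s ^ m * (42 ^ (m + 2) * s\<^sup>2 * t powr (1 / p))" by (simp add: power_mult_distrib power_add power2_eq_square)
        finally have "s ^ m * (c2 * h) \<le> s ^ m * (42 ^ (m + 2) * s\<^sup>2 * t powr (1 / p))" by (simp add: mult_ac)
        then have "c2 * h \<le> 42 ^ (m + 2) * s\<^sup>2 * t powr (1 / p)" using s by simp
        then have h1: "h \<le> 42 ^ (m + 2) / c2 * (s\<^sup>2 * t powr (1 / p))" using c2 by (simp add: field_simps)
        have "\<mu> ^ l = (c1 * \<eta>0 ^ m) ^ l * s powr ((1 + a) * (m * l))"
        proof -
          have "\<mu> = c1 * \<eta>0 ^ m * (s powr (1 + a)) ^ m" unfolding \<mu>_def \<eta>sp by (simp add: power_mult_distrib)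
          then have "\<mu> ^ l = (c1 * \<eta>0 ^ m) ^ l * ((s powr (1 + a)) ^ m) ^ l" by (simp only: power_mult_distrib)
          also have "((s powr (1 + a)) ^ m) ^ l = s powr ((1 + a) * (m * l))"
            using s by (simp add: power_mult[symmetric] powr_realpow[symmetric] powr_powr mult.assoc)
          finally show ?thesis .
        qed
        then have "t powr (1 / p) = ((E + 1) / (c1 * \<eta>0 ^ m) ^ l) powr (1 / p) * s powr (- ((1 + a) * (m * l)) / p)"
          unfolding t_def using powr_split_const[of "E + 1" "(c1 * \<eta>0 ^ m) ^ l" s p "(1 + a) * (m * l)"] E c1 \<eta>0 s p0 by simp
        moreover have "s\<^sup>2 * s powr (- ((1 + a) * (m * l)) / p) = s powr (1 + a)"
        proof -
          have e: "2 + - ((1 + a) * (m * l)) / p = 1 + a"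
          proof -
            have pos: "0 < p + m * l" using p0 by (simp add: add_pos_nonneg)
            then have "1 + a = 2 * p / (p + m * l)" by (simp add: a_def field_simps)
            then show ?thesis using p0 pos by (simp add: field_simps)
          qed
          have "s powr (2 + - ((1 + a) * (m * l)) / p) = s powr 2 * s powr (- ((1 + a) * (m * l)) / p)" by (rule powr_add)
          then show ?thesis using s unfolding e by (simp add: powr_numeral)
        qed
        ultimately have "s\<^sup>2 * t powr (1 / p) = ((E + 1) / (c1 * \<eta>0 ^ m) ^ l) powr (1 / p) * s powr (1 + a)"
          by (metis mult.left_commute)
        then show ?thesis using h1 by (simp add: A_def mult_ac)
      next
        case False
        then show ?thesis using A0 by (smt (verit) mult_nonneg_nonneg powr_ge_zero)
      qed
      define u where "u = oproj U (X (Suc m) - X 0)"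
      \<comment> \<open>Writing u in the perturbed frame and keeping the coefficients in the frame
        \<open>w\<close> moves it from U to U0, with an error of order \<eta> s.\<close>
      obtain v where v: "v \<in> U0" "norm (u - v) \<le> 88 * L * m * (\<eta> * s)"
      proof -
        have uU: "u \<in> U" using U by (simp add: u_def)
        have nu: "norm u \<le> 22 * L * \<sigma>" unfolding u_def using norm_oproj_le[OF U, of "X (Suc m) - X 0"] q22 by linarith
        have fr': "\<bar>d (inv_into {..<m} ex e') \<bullet> e - (if e = e' then \<sigma> else 0)\<bar> \<le> (2 * L * \<eta>) * \<sigma>" if ee: "e \<in> B" "e' \<in> B" for e e'
        proof -
          obtain i j where ij: "i < m" "e' = ex i" "j < m" "e = ex j" using exim ee by blast
          have "inv_into {..<m} ex e' = i" using ij ex by (simp add: bij_betw_def)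
          moreover have "(e = e') = (i = j)" using ij ex by (auto simp: bij_betw_def inj_on_def)
          ultimately show ?thesis using fr[OF ij(1,3)] ij by (simp add: d_def)
        qed
        let ?d = "\<lambda>e. d (inv_into {..<m} ex e)"
        have im: "?d ` B = (\<lambda>i. X (Suc i) - X 0) ` {..<m}"
        proof -
          have "?d ` ex ` {..<m} = (\<lambda>i. X (Suc i) - X 0) ` {..<m}"
            unfolding image_image using ex by (intro image_cong) (auto simp: bij_betw_def d_def)
          then show ?thesis using ex by (simp add: bij_betw_def)
        qed
        have ind: "inj_on ?d B" "independent (?d ` B)" using frame_independent[OF fB F(3) \<sigma>(1) \<eta>' fr'] by auto
        have dU: "dim U = m" unfolding U_def im[symmetric]
          using dim_eq_card_independent[OF ind(2)] card_image[OF ind(1)] F(3) by (simp add: dim_span)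
        have dB: "?d e \<in> U" if "e \<in> B" for e unfolding U_def im[symmetric] using that by (intro span_base) auto
        have ue: "\<bar>u \<bullet> e\<bar> \<le> norm u" if "e \<in> B" for e
          using Cauchy_Schwarz_ineq2[of u e] orthonormal_norm[OF F(2) that] by simp
        obtain c where c: "u = (\<Sum>e\<in>B. c e *\<^sub>R ?d e)" "\<And>e. e \<in> B \<Longrightarrow> \<bar>c e\<bar> \<le> 2 * norm u / \<sigma>"
          using frame_coeffs[OF U dU fB F(3) \<sigma>(1) \<eta>' fr' dB uU ue] by blast
        define v where "v = (\<Sum>e\<in>B. c e *\<^sub>R w e)"
        have "v \<in> U0" unfolding v_def
        proof (intro subspace_sum[OF U0(1)] subspace_scale[OF U0(1)])
          fix e assume "e \<in> B"
          then show "w e \<in> U0" using ex unfolding U0_def bij_betw_def by (intro span_base) auto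
        qed
        moreover have "norm (u - v) \<le> 88 * L * m * (\<eta> * s)"
        proof -
          have "u - v = (\<Sum>e\<in>B. c e *\<^sub>R (?d e - w e))" by (simp add: c(1) v_def scaleR_diff_right sum_subtractf)
          also have "norm \<dots> \<le> (\<Sum>e\<in>B. 44 * L * (2 * (\<eta> * s)))"
          proof (rule sum_norm_le)
            fix e assume e: "e \<in> B"
            obtain i where i: "i < m" "e = ex i" using exim e by blast
            have "inv_into {..<m} ex e = i" using i ex by (simp add: bij_betw_def)
            then have "norm (?d e - w e) \<le> 2 * (\<eta> * s)" using dz[of i] zw[OF i(1)] i by simp
            moreover have "\<bar>c e\<bar> \<le> 44 * L"
            proof -
              have "2 * norm u / \<sigma> \<le> 2 * (22 * L * \<sigma>) / \<sigma>" using nu \<sigma> by (intro divide_right_mono mult_left_mono) auto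
              then show ?thesis using c(2)[OF e] \<sigma> by simp
            qed
            ultimately show "norm (c e *\<^sub>R (?d e - w e)) \<le> 44 * L * (2 * (\<eta> * s))" unfolding norm_scaleR using L by (intro mult_mono) auto
          qed
          also have "\<dots> = 88 * L * m * (\<eta> * s)" using F(3) by simp
          finally show ?thesis .
        qed
        ultimately show thesis using that by blast
      qed
      have "norm (orej U0 (\<zeta> - y)) \<le> norm (\<zeta> - y - v)" by (rule norm_orej_le_dist[OF U0(1) v(1)])
      also have "\<zeta> - y - v = (orej U (X (Suc m) - X 0) + (u - v)) - (d m - (z (Suc m) - y))"
        by (simp add: orej_def u_def d_def z_def)
      also have "norm \<dots> \<le> norm (orej U (X (Suc m) - X 0) + (u - v)) + norm (d m - (z (Suc m) - y))" by (rule norm_triangle_ineq4)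
      also have "\<dots> \<le> h + 88 * L * m * (\<eta> * s) + 2 * (\<eta> * s)"
        using norm_triangle_ineq[of "orej U (X (Suc m) - X 0)" "u - v"] v(2) dz[of m] by (simp add: h_def)
      also have "\<dots> \<le> A * s powr (1 + a) + (2 + 88 * L * m) * (\<eta>0 * s powr (1 + a))"
        using hA unfolding \<eta>sp by (simp add: algebra_simps)
      also have "\<dots> = C * s powr (1 + a)" by (simp add: C_def algebra_simps)
      finally show ?thesis .
    qed
    then show "\<exists>P. subspace P \<and> dim P = m \<and> (\<forall>z\<in>S. norm (z - y) \<le> 20 * s \<longrightarrow> norm (orej P (z - y)) \<le> C * s powr (1 + a))"
      using U0 by blast
  qed
  then show thesis using that[OF C0] unfolding a_def by blast
qed

section \<open>Uniform graph scale and finiteness of isotopy types\<close>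

text \<open>The start of the iteration: L and r come from a finite cover by graph patches and depend
  on S.\<close>

lemma lipschitz_submanifold_mgood:
  fixes S :: "'a::euclidean_space set"
  assumes S: "lipschitz_submanifold m S"
  obtains L r where "1 \<le> L" "0 < r" "mgood m L r S"
proof -
  have cS: "compact S" using S by (simp add: lipschitz_submanifold_def)
  define G where "G y L r \<longleftrightarrow> (\<exists>P. subspace P \<and> dim P = m \<and>
     (\<forall>u\<in>P. norm u \<le> r \<longrightarrow> (\<exists>z\<in>S. oproj P (z - y) = u \<and> norm (z - y) \<le> L * norm u)))" for y L r
  define Q where "Q x \<rho> L r \<longleftrightarrow> 0 < \<rho> \<and> 1 \<le> L \<and> 0 < r \<and> (\<forall>y\<in>S \<inter> ball x \<rho>. G y L r)" for x \<rho> L r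
  have loc: "\<exists>\<rho> L r. Q x \<rho> L r" if x: "x \<in> S" for x
  proof -
    obtain r P f L where r: "0 < r" and P: "subspace P" "dim P = m" and lip: "L-lipschitz_on P f"
      and f: "\<And>u. u \<in> P \<Longrightarrow> f u \<in> orthogonal_comp P" and graph: "S \<inter> ball x r = {u + f u | u. u \<in> P} \<inter> ball x r"
      by (rule lipschitz_submanifoldE[OF S x]) (rule that)
    have L: "0 \<le> L" using lip by (rule lipschitz_on_nonneg)
    have FP: "oproj P (f u) = 0" if "u \<in> P" for u
    proof (rule oproj_unique[OF P(1) subspace_0[OF P(1)]])
      fix v assume "v \<in> P"
      then show "(f u - 0) \<bullet> v = 0" using f[OF that] unfolding orthogonal_comp_def orthogonal_def by (auto simp: inner_commute)
    qed
    \<comment> \<open>The radius keeps the covering point within r / 4 of y, hence inside the patch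
      where S is a graph.\<close>
    have "G y (1 + L) (r / (4 * (1 + L)))" if y: "y \<in> S \<inter> ball x (r/2)" for y
      unfolding G_def
    proof (intro exI[of _ P] conjI P ballI impI)
      fix u assume u: "u \<in> P" "norm u \<le> r / (4 * (1 + L))"
      have "y \<in> {u + f u | u. u \<in> P} \<inter> ball x r" unfolding graph[symmetric] using y r by auto
      then obtain v where v: "v \<in> P" "y = v + f v" by blast
      define z where "z = (v + u) + f (v + u)"
      have vu: "v + u \<in> P" using u v P by (simp add: subspace_add)
      have zy: "z - y = u + (f (v + u) - f v)" by (simp add: z_def v)
      have "norm (f (v + u) - f v) \<le> L * norm u" using lipschitz_on_normD[OF lip vu v(1)] by simp
      then have n: "norm (z - y) \<le> (1 + L) * norm u" unfolding zy
        using norm_triangle_ineq[of u "f (v + u) - f v"] by (simp add: algebra_simps)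
      also have "\<dots> \<le> (1 + L) * (r / (4 * (1 + L)))" using u L by (intro mult_left_mono) auto
      also have "\<dots> = r / 4" using L by (simp add: field_simps)
      finally have "dist y z \<le> r / 4" by (simp add: dist_norm norm_minus_commute)
      then have "z \<in> ball x r" using y r dist_triangle[of x z y] by auto
      then have "z \<in> S \<inter> ball x r" unfolding graph z_def using vu by blast
      moreover have "oproj P (z - y) = u" unfolding zy using u vu v P FP by (simp add: oproj_add oproj_diff oproj_id)
      ultimately show "\<exists>z\<in>S. oproj P (z - y) = u \<and> norm (z - y) \<le> (1 + L) * norm u" using n by blast
    qed
    then have "Q x (r/2) (1 + L) (r / (4 * (1 + L)))" using r L by (simp add: Q_def)
    then show ?thesis by blast
  qed
  then have "\<forall>x\<in>S. \<exists>t. Q x (fst t) (fst (snd t)) (snd (snd t))" by auto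
  from bchoice[OF this] obtain t where t: "\<forall>x\<in>S. Q x (fst (t x)) (fst (snd (t x))) (snd (snd (t x)))" ..
  define \<rho> where "\<rho> x = fst (t x)" for x
  define L where "L x = fst (snd (t x))" for x
  define r where "r x = snd (snd (t x))" for x
  have Q: "Q x (\<rho> x) (L x) (r x)" if "x \<in> S" for x using t that by (simp add: \<rho>_def L_def r_def)
  have "S \<subseteq> (\<Union>x\<in>S. ball x (\<rho> x))" using Q by (force simp: Q_def)
  then obtain X where X: "X \<subseteq> S" "finite X" "S \<subseteq> (\<Union>x\<in>X. ball x (\<rho> x))" using compactE_image[OF cS, of S "\<lambda>x. ball x (\<rho> x)"] by auto
  define L' where "L' = Max (insert 1 (L ` X))"
  define r' where "r' = Min (insert 1 (r ` X))"
  have L': "1 \<le> L'" "\<And>x. x \<in> X \<Longrightarrow> L x \<le> L'" using X by (auto simp: L'_def)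
  have r': "0 < r'" "\<And>x. x \<in> X \<Longrightarrow> r' \<le> r x" using X Q by (auto simp: r'_def Q_def subset_iff)
  have "mgood m L' r' S"
    unfolding mgood_def
  proof
    fix y assume y: "y \<in> S"
    then obtain x where x: "x \<in> X" "y \<in> ball x (\<rho> x)" using X by blast
    then have "G y (L x) (r x)" using Q[of x] X(1) y by (auto simp: Q_def)
    then obtain P where P: "subspace P" "dim P = m" "\<And>u. u \<in> P \<Longrightarrow> norm u \<le> r x \<Longrightarrow> \<exists>z\<in>S. oproj P (z - y) = u \<and> norm (z - y) \<le> L x * norm u"
      unfolding G_def by blast
    have "\<exists>z\<in>S. oproj P (z - y) = u \<and> norm (z - y) \<le> L' * norm u" if u: "u \<in> P" "norm u \<le> r'" for u
    proof -
      have "norm u \<le> r x" using u r'(2)[OF x(1)] by linarith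
      then obtain z where z: "z \<in> S" "oproj P (z - y) = u" "norm (z - y) \<le> L x * norm u" using P(3)[OF u(1)] by blast
      have "L x * norm u \<le> L' * norm u" using L'(2)[OF x(1)] by (intro mult_right_mono) auto
      with z(3) have "norm (z - y) \<le> L' * norm u" by (rule order_trans)
      then show ?thesis using z(1,2) by blast
    qed
    then show "\<exists>P. subspace P \<and> dim P = m \<and> (\<forall>u\<in>P. norm u \<le> r' \<longrightarrow> (\<exists>z\<in>S. oproj P (z - y) = u \<and> norm (z - y) \<le> L' * norm u))"
      using P(1,2) by blast
  qed
  then show thesis using that L'(1) r'(1) by blast
qed

text \<open>The exponent k is fixed before L, and only C depends on L: one decay rate serves both
  the first step, with its uncontrolled distortion, and the later ones with distortion 2.\<close>

lemma energy_flat: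
  assumes m: "1 \<le> m" and E: "0 < E" and ek: "valid_kind m ek" and p: "p0 m ek < p"
  obtains k where "0 < k" "\<And>L. 1 \<le> L \<Longrightarrow> \<exists>C\<ge>0. \<forall>(S::'a::euclidean_space set) r. lipschitz_submanifold m S \<longrightarrow> energy ek m p S \<le> ennreal E \<longrightarrow>
     r \<le> 1 \<longrightarrow> mgood m L r S \<longrightarrow> mflat m C k r S"
proof (cases ek)
  case (Menger l)
  have l: "1 \<le> l" "l \<le> m + 2" and pl: "real (m * l) < p" using ek p Menger by (auto simp: valid_kind_def p0_def)
  have "0 < (p - m * l) / (p + m * l)" using pl by (smt (verit) divide_pos_pos of_nat_0_le_iff of_nat_mult)
  moreover have "\<exists>C\<ge>0. \<forall>(S::'a set) r. lipschitz_submanifold m S \<longrightarrow> energy ek m p S \<le> ennreal E \<longrightarrow>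
     r \<le> 1 \<longrightarrow> mgood m L r S \<longrightarrow> mflat m C ((p - m * l) / (p + m * l)) r S" if L: "1 \<le> L" for L
  proof -
    obtain C where "0 \<le> C" "\<And>(S::'a set) r. lipschitz_submanifold m S \<Longrightarrow> menger_energy m l p S \<le> ennreal E \<Longrightarrow>
       r \<le> 1 \<Longrightarrow> mgood m L r S \<Longrightarrow> mflat m C ((p - m * l) / (p + m * l)) r S"
      using menger_energy_flat[OF m l E pl L] by metis
    then show ?thesis by (intro exI[of _ C]) (auto simp: energy_def Menger)
  qed
  ultimately show thesis by (rule that)
next
  case TangentPoint
  have p2: "2 * real m < p" using p TangentPoint by (simp add: p0_def)
  have "0 < (p - 2 * m) / (p + m)" using p2 m by simp
  moreover have "\<exists>C\<ge>0. \<forall>(S::'a set) r. lipschitz_submanifold m S \<longrightarrow> energy ek m p S \<le> ennreal E \<longrightarrow>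
     r \<le> 1 \<longrightarrow> mgood m L r S \<longrightarrow> mflat m C ((p - 2 * m) / (p + m)) r S" if L: "1 \<le> L" for L
    using tp_energy_flat[OF m _ E _ p2 L]
    by (intro exI[of _ "2 + 22\<^sup>2 * ((E + 2) / (hconst m / (L * m) ^ m * (hconst m / (L * m) ^ m))) powr (1 / p)"])
      (auto simp: energy_def TangentPoint)
  ultimately show thesis by (rule that)
next
  case TangentPointG
  have p1: "real m < p" using p TangentPointG by (simp add: p0_def)
  have "0 < 1 - m / p" using p1 m by simp
  moreover have "\<exists>C\<ge>0. \<forall>(S::'a set) r. lipschitz_submanifold m S \<longrightarrow> energy ek m p S \<le> ennreal E \<longrightarrow>
     r \<le> 1 \<longrightarrow> mgood m L r S \<longrightarrow> mflat m C (1 - m / p) r S" if L: "1 \<le> L" for L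
    using tpG_energy_flat[OF m _ E _ p1 L]
    by (intro exI[of _ "21\<^sup>2 * ((E + 1) / (hconst m / (L * m) ^ m)) powr (1 / p)"]) (auto simp: energy_def TangentPointG)
  ultimately show thesis by (rule that)
qed

lemma small_powr:
  fixes A e k :: real
  assumes "0 \<le> A" "0 < e" "0 < k"
  obtains R where "0 < R" "R \<le> 1" "\<And>r. 0 < r \<Longrightarrow> r \<le> R \<Longrightarrow> A * r powr k \<le> e"
proof (rule that[of "min 1 ((e / (A + 1)) powr (1 / k))"])
  show "0 < min 1 ((e / (A + 1)) powr (1 / k))" using assms by simp
  fix r assume r: "0 < r" "r \<le> min 1 ((e / (A + 1)) powr (1 / k))"
  have "r powr k \<le> ((e / (A + 1)) powr (1 / k)) powr k" using r assms by (intro powr_mono2) auto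
  also have "\<dots> = e / (A + 1)" using assms by (simp add: powr_powr)
  finally have "A * r powr k \<le> A * (e / (A + 1))" using assms by (intro mult_left_mono) auto
  also have "\<dots> \<le> e" using assms by (simp add: field_simps)
  finally show "A * r powr k \<le> e" .
qed simp

text \<open>The threshold R0 belongs to distortion 2 and is found before S is given. The threshold
  for the initial distortion of S is used for a single step; however small it is, repeated
  multiplication by 4 leads up to R0.\<close>

lemma energy_graphlike:
  assumes m: "1 \<le> m" and E: "0 < E" and ek: "valid_kind m ek" and p: "p0 m ek < p" and \<epsilon>: "0 < \<epsilon>"
  obtains a where "0 < a" "\<And>S::'a::euclidean_space set. lipschitz_submanifold m S \<Longrightarrow> energy ek m p S \<le> ennreal E \<Longrightarrow> graphlike m \<epsilon> a S"
proof -
  obtain k where k: "0 < k" and fl: "\<And>L. 1 \<le> L \<Longrightarrow> \<exists>C\<ge>0. \<forall>(S::'a set) r. lipschitz_submanifold m S \<longrightarrow> energy ek m p S \<le> ennreal E \<longrightarrow>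
     r \<le> 1 \<longrightarrow> mgood m L r S \<longrightarrow> mflat m C k r S"
    using energy_flat[OF m E ek p, where 'a = 'a] by metis
  define A where "A L = 1 + 6 * m * L + 6 * m * L / (1 - 2 powr (-k))" for L :: real
  have k1: "2 powr (-k) < (1::real)" using k by (simp add: powr_less_one)
  have A0: "0 \<le> A L" if "1 \<le> L" for L using that k1 by (simp add: A_def)
  have step: "\<exists>R>0. R \<le> 1 \<and> (\<forall>(S::'a set) r. lipschitz_submanifold m S \<longrightarrow> energy ek m p S \<le> ennreal E \<longrightarrow> 0 < r \<longrightarrow> r \<le> R \<longrightarrow> mgood m L r S \<longrightarrow>
      (\<forall>x\<in>S. \<exists>P. subspace P \<and> dim P = m \<and>
        (\<forall>y\<in>S. \<forall>z\<in>S. norm (y - x) \<le> 10 * r \<longrightarrow> norm (z - x) \<le> 10 * r \<longrightarrow> norm (orej P (z - y)) \<le> \<epsilon> * norm (z - y)) \<and>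
        (\<forall>u\<in>P. norm u \<le> 4 * r \<longrightarrow> (\<exists>z\<in>S. oproj P (z - x) = u \<and> norm (z - x) \<le> 2 * norm u))))" if L: "1 \<le> L" for L
  proof -
    obtain C where C: "0 \<le> C" "\<And>(S::'a set) r. lipschitz_submanifold m S \<Longrightarrow> energy ek m p S \<le> ennreal E \<Longrightarrow>
       r \<le> 1 \<Longrightarrow> mgood m L r S \<Longrightarrow> mflat m C k r S" using fl[OF L] by blast
    \<comment> \<open>Besides \<epsilon>, the bounds 1/10 and 1 / (2 m L^2 + 1) secure the covering
      part of \<open>graph_step\<close>.\<close>
    define e where "e = min \<epsilon> (min (1/10) (1 / (2 * m * L\<^sup>2 + 1)))"
    have mL: "0 \<le> 2 * m * L\<^sup>2" by simp
    have e: "0 < e" "e \<le> \<epsilon>" "e \<le> 1/10" "2 * m * L\<^sup>2 * e < 1"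
    proof -
      show "0 < e" "e \<le> \<epsilon>" "e \<le> 1/10" using \<epsilon> mL by (auto simp: e_def add_nonneg_pos)
      have "2 * m * L\<^sup>2 * e \<le> 2 * m * L\<^sup>2 * (1 / (2 * m * L\<^sup>2 + 1))" using mL by (intro mult_left_mono) (auto simp: e_def)
      also have "\<dots> < 1" using mL by (simp add: divide_less_eq add_nonneg_pos)
      finally show "2 * m * L\<^sup>2 * e < 1" .
    qed
    obtain R where R: "0 < R" "R \<le> 1" "\<And>r. 0 < r \<Longrightarrow> r \<le> R \<Longrightarrow> (A L * C) * r powr k \<le> e"
      using small_powr[of "A L * C" e k] A0[OF L] C e k by auto
    have "\<exists>P. subspace P \<and> dim P = m \<and>
        (\<forall>y\<in>S. \<forall>z\<in>S. norm (y - x) \<le> 10 * r \<longrightarrow> norm (z - x) \<le> 10 * r \<longrightarrow> norm (orej P (z - y)) \<le> \<epsilon> * norm (z - y)) \<and>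
        (\<forall>u\<in>P. norm u \<le> 4 * r \<longrightarrow> (\<exists>z\<in>S. oproj P (z - x) = u \<and> norm (z - x) \<le> 2 * norm u))"
      if S: "lipschitz_submanifold m S" "energy ek m p S \<le> ennreal E" and r: "0 < r" "r \<le> R" and g: "mgood m L r S" and x: "x \<in> S" for S :: "'a set" and r x
    proof -
      have cS: "compact S" using S by (simp add: lipschitz_submanifold_def)
      have mf: "mflat m C k r S" using C(2)[OF S _ g] r R by simp
      have ae: "(1 + 6 * m * L + 6 * m * L / (1 - 2 powr (-k))) * (C * r powr k) \<le> e" using R(3)[OF r] by (simp add: A_def mult.assoc)
      obtain P where P: "subspace P" "dim P = m"
        "\<And>y z. y \<in> S \<Longrightarrow> z \<in> S \<Longrightarrow> norm (y - x) \<le> 10 * r \<Longrightarrow> norm (z - x) \<le> 10 * r \<Longrightarrow> norm (orej P (z - y)) \<le> e * norm (z - y)"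
        "\<And>u. u \<in> P \<Longrightarrow> norm u \<le> 4 * r \<Longrightarrow> \<exists>z\<in>S. oproj P (z - x) = u \<and> norm (z - x) \<le> 2 * norm u"
        using graph_step[OF cS L k C(1) r(1) g mf ae e(3,4) x] by metis
      have "norm (orej P (z - y)) \<le> \<epsilon> * norm (z - y)" if "y \<in> S" "z \<in> S" "norm (y - x) \<le> 10 * r" "norm (z - x) \<le> 10 * r" for y z
      proof -
        have "e * norm (z - y) \<le> \<epsilon> * norm (z - y)" using e by (intro mult_right_mono) auto
        then show ?thesis using P(3)[OF that] by linarith
      qed
      then show ?thesis using P by blast
    qed
    then show ?thesis using R by blast
  qed
  obtain R0 where R0: "0 < R0" "R0 \<le> 1" and st2: "\<And>(S::'a set) r x. lipschitz_submanifold m S \<Longrightarrow> energy ek m p S \<le> ennreal E \<Longrightarrow> 0 < r \<Longrightarrow> r \<le> R0 \<Longrightarrow> mgood m 2 r S \<Longrightarrow> x \<in> S \<Longrightarrow>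
      \<exists>P. subspace P \<and> dim P = m \<and>
        (\<forall>y\<in>S. \<forall>z\<in>S. norm (y - x) \<le> 10 * r \<longrightarrow> norm (z - x) \<le> 10 * r \<longrightarrow> norm (orej P (z - y)) \<le> \<epsilon> * norm (z - y)) \<and>
        (\<forall>u\<in>P. norm u \<le> 4 * r \<longrightarrow> (\<exists>z\<in>S. oproj P (z - x) = u \<and> norm (z - x) \<le> 2 * norm u))"
    using step[of 2] by auto
  show thesis
  proof (rule that[of "3/10 * R0"])
    show "0 < 3/10 * R0" using R0 by simp
    fix S :: "'a set" assume S: "lipschitz_submanifold m S" "energy ek m p S \<le> ennreal E"
    obtain L1 r1 where L1: "1 \<le> L1" "0 < r1" "mgood m L1 r1 S" by (rule lipschitz_submanifold_mgood[OF S(1)])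
    obtain R1 where R1: "0 < R1" and st1: "\<And>(S::'a set) r x. lipschitz_submanifold m S \<Longrightarrow> energy ek m p S \<le> ennreal E \<Longrightarrow> 0 < r \<Longrightarrow> r \<le> R1 \<Longrightarrow> mgood m L1 r S \<Longrightarrow> x \<in> S \<Longrightarrow>
      \<exists>P. subspace P \<and> dim P = m \<and>
        (\<forall>y\<in>S. \<forall>z\<in>S. norm (y - x) \<le> 10 * r \<longrightarrow> norm (z - x) \<le> 10 * r \<longrightarrow> norm (orej P (z - y)) \<le> \<epsilon> * norm (z - y)) \<and>
        (\<forall>u\<in>P. norm u \<le> 4 * r \<longrightarrow> (\<exists>z\<in>S. oproj P (z - x) = u \<and> norm (z - x) \<le> 2 * norm u))"
      using step[OF L1(1)] by auto
    define r2 where "r2 = 4 * min r1 R1"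
    have r2: "0 < r2" using L1 R1 by (simp add: r2_def)
    have g2: "mgood m 2 r2 S"
      unfolding mgood_def
    proof
      fix y assume y: "y \<in> S"
      have "mgood m L1 (min r1 R1) S" using L1(3) by (rule mgood_mono) simp
      from st1[OF S _ _ this y] show "\<exists>P. subspace P \<and> dim P = m \<and> (\<forall>u\<in>P. norm u \<le> r2 \<longrightarrow> (\<exists>z\<in>S. oproj P (z - y) = u \<and> norm (z - y) \<le> 2 * norm u))"
        unfolding r2_def using L1 R1 by auto
    qed
    have up: "mgood m 2 (4 * r) S" if r: "0 < r" "r \<le> R0" "mgood m 2 r S" for r
      unfolding mgood_def using st2[OF S r] by blast
    \<comment> \<open>The truncation keeps the induction at scales to which the step
      applies.\<close>
    have "mgood m 2 (min (4 ^ n * r2) R0) S" for n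
    proof (induction n)
      case 0 then show ?case using g2 by (rule_tac mgood_mono) auto
    next
      case (Suc n)
      show ?case
      proof (cases "4 ^ n * r2 \<le> R0")
        case True
        then have "mgood m 2 (4 * (4 ^ n * r2)) S" using Suc r2 by (intro up) (auto simp: min_def split: if_splits)
        then show ?thesis by (rule mgood_mono) simp
      next
        case False
        then show ?thesis using Suc by (rule_tac mgood_mono[of m 2 R0]) (auto simp: min_def)
      qed
    qed
    moreover obtain n where "R0 / r2 < 4 ^ n" using real_arch_pow[of 4 "R0 / r2"] by auto
    then have "min (4 ^ n * r2) R0 = R0" using r2 by (simp add: field_simps)
    ultimately have g: "mgood m 2 R0 S" by metis
    show "graphlike m \<epsilon> (3/10 * R0) S"
      unfolding graphlike_def
    proof
      fix x assume x: "x \<in> S"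
      obtain P where P: "subspace P" "dim P = m"
        "\<And>y z. y \<in> S \<Longrightarrow> z \<in> S \<Longrightarrow> norm (y - x) \<le> 10 * R0 \<Longrightarrow> norm (z - x) \<le> 10 * R0 \<Longrightarrow> norm (orej P (z - y)) \<le> \<epsilon> * norm (z - y)"
        "\<And>u. u \<in> P \<Longrightarrow> norm u \<le> 4 * R0 \<Longrightarrow> \<exists>z\<in>S. oproj P (z - x) = u \<and> norm (z - x) \<le> 2 * norm u"
        using st2[OF S R0(1) order_refl g x] by blast
      have 1: "t \<le> 10 * R0" if "t \<le> 32 * (3/10 * R0)" for t using that R0 by linarith
      have 2: "t \<le> 4 * R0" if "t \<le> 10 * (3/10 * R0)" for t using that R0 by linarith
      show "\<exists>P. subspace P \<and> dim P = m \<and>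
       (\<forall>y\<in>S. \<forall>z\<in>S. norm (y - x) \<le> 32 * (3/10 * R0) \<longrightarrow> norm (z - x) \<le> 32 * (3/10 * R0) \<longrightarrow> norm (orej P (z - y)) \<le> \<epsilon> * norm (z - y)) \<and>
       (\<forall>u\<in>P. norm u \<le> 10 * (3/10 * R0) \<longrightarrow> (\<exists>z\<in>S. oproj P (z - x) = u \<and> norm (z - x) \<le> 2 * norm u))"
        using P 1 2 by (intro exI[of _ P]) blast
    qed
  qed
qed

section \<open>Translation to a fixed ball and finiteness of the signatures\<close>

lemma graphlike_translation:
  assumes "graphlike m \<epsilon> a S"
  shows "graphlike m \<epsilon> a ((\<lambda>x. x + c) ` S)"
  unfolding graphlike_def
proof (intro ballI)
  fix x' assume "x' \<in> (\<lambda>x. x + c) ` S"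
  then obtain x where x: "x \<in> S" "x' = x + c" by blast
  obtain P where P: "subspace P" "dim P = m"
    "\<forall>y\<in>S. \<forall>z\<in>S. norm (y - x) \<le> 32 * a \<longrightarrow> norm (z - x) \<le> 32 * a \<longrightarrow> norm (orej P (z - y)) \<le> \<epsilon> * norm (z - y)"
    "\<forall>u\<in>P. norm u \<le> 10 * a \<longrightarrow> (\<exists>z\<in>S. oproj P (z - x) = u \<and> norm (z - x) \<le> 2 * norm u)"
    using assms x unfolding graphlike_def by blast
  show "\<exists>P. subspace P \<and> dim P = m \<and>
     (\<forall>y\<in>(\<lambda>x. x + c) ` S. \<forall>z\<in>(\<lambda>x. x + c) ` S. norm (y - x') \<le> 32 * a \<longrightarrow> norm (z - x') \<le> 32 * a \<longrightarrow> norm (orej P (z - y)) \<le> \<epsilon> * norm (z - y)) \<and>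
     (\<forall>u\<in>P. norm u \<le> 10 * a \<longrightarrow> (\<exists>z\<in>(\<lambda>x. x + c) ` S. oproj P (z - x') = u \<and> norm (z - x') \<le> 2 * norm u))"
    using P by (intro exI[of _ P]) (simp add: x(2) bex_simps)
qed

theorem mainTheorem1:
  fixes m :: nat and E d p :: real and ek :: energy_kind
  assumes "1 \<le> m" and "m < CARD('n::finite)"
    and "E > 0" and "d > 0"
    and "valid_kind m ek" and "p > p0 m ek"
  shows "\<exists>K::nat. \<exists>S :: (real ^ 'n) set set.
           finite S \<and> card S \<le> K \<and> S \<subseteq> admissible_class ek m p E d \<and>
           (\<forall>\<Sigma>\<in>admissible_class ek m p E d. \<exists>\<Sigma>'\<in>S. ambient_isotopic \<Sigma> \<Sigma>')"
proof -
  let ?C = "admissible_class ek m p E d :: (real ^ 'n) set set"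
  obtain \<epsilon> :: real where \<epsilon>: "0 < \<epsilon>" and iso: "\<And>a M. 0 < a \<Longrightarrow> \<exists>\<delta>>0. \<forall>S1 S2::(real ^ 'n) set.
       graphlike m \<epsilon> a S1 \<longrightarrow> graphlike m \<epsilon> a S2 \<longrightarrow> S1 \<subseteq> cball 0 M \<longrightarrow>
       (\<forall>y\<in>S1. \<exists>p\<in>S2. norm (p - y) \<le> \<delta>) \<longrightarrow> (\<forall>y\<in>S2. \<exists>p\<in>S1. norm (p - y) \<le> \<delta>) \<longrightarrow> ambient_isotopic S1 S2"
    using close_graphlike_ambient_isotopic[of m, where 'a = "real ^ 'n"] by metis
  obtain a where a: "0 < a" and gr: "\<And>S::(real ^ 'n) set. lipschitz_submanifold m S \<Longrightarrow> energy ek m p S \<le> ennreal E \<Longrightarrow> graphlike m \<epsilon> a S"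
    using energy_graphlike[OF assms(1,3,5,6) \<epsilon>, where 'a = "real ^ 'n"] by metis
  obtain \<delta> where \<delta>: "0 < \<delta>" and iso': "\<And>S1 S2::(real ^ 'n) set. graphlike m \<epsilon> a S1 \<Longrightarrow> graphlike m \<epsilon> a S2 \<Longrightarrow> S1 \<subseteq> cball 0 d \<Longrightarrow>
       (\<forall>y\<in>S1. \<exists>p\<in>S2. norm (p - y) \<le> \<delta>) \<Longrightarrow> (\<forall>y\<in>S2. \<exists>p\<in>S1. norm (p - y) \<le> \<delta>) \<Longrightarrow> ambient_isotopic S1 S2"
    using iso[OF a, of d] by blast
  obtain K where K: "finite K" "cball (0::real ^ 'n) d \<subseteq> (\<Union>k\<in>K. ball k (\<delta>/2))"
    using compact_ball_cover[of "cball (0::real ^ 'n) d" "\<delta>/2"] \<delta> by auto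
  \<comment> \<open>A base point to be moved to the origin, since the class is not confined to a
    bounded region; for the empty set it is arbitrary.\<close>
  define b where "b S = (SOME x. x \<in> S)" for S :: "(real ^ 'n) set"
  define T where "T S = (\<lambda>x. x + - b S) ` S" for S :: "(real ^ 'n) set"
  \<comment> \<open>The balls met by the translated set. Equal signatures put two translated sets
    within \<delta> of each other, and there are at most 2^(card K) signatures.\<close>
  define sig where "sig S = {k \<in> K. \<exists>x\<in>T S. dist k x < \<delta>/2}" for S
  have TC: "graphlike m \<epsilon> a (T S)" "T S \<subseteq> cball 0 d" if S: "S \<in> ?C" for S
  proof -
    have l: "lipschitz_submanifold m S" "energy ek m p S \<le> ennreal E" "diameter S \<le> d" using S by (auto simp: admissible_class_def)
    show "graphlike m \<epsilon> a (T S)" unfolding T_def by (rule graphlike_translation[OF gr[OF l(1,2)]])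
    have bS: "bounded S" using l(1) by (auto simp: lipschitz_submanifold_def compact_imp_bounded)
    show "T S \<subseteq> cball 0 d"
    proof
      fix z assume "z \<in> T S"
      then obtain x where x: "x \<in> S" "z = x + - b S" by (auto simp: T_def)
      have "b S \<in> S" unfolding b_def by (rule someI[of "\<lambda>x. x \<in> S", OF x(1)])
      then have "dist x (b S) \<le> d" using diameter_bounded_bound[OF bS x(1)] l(3) by force
      then show "z \<in> cball 0 d" by (simp add: x(2) dist_norm norm_minus_commute)
    qed
  qed
  have near: "\<forall>y\<in>T S. \<exists>q\<in>T S'. norm (q - y) \<le> \<delta>" if S: "S \<in> ?C" and eq: "sig S = sig S'" for S S'
  proof
    fix y assume y: "y \<in> T S"
    then have "y \<in> (\<Union>k\<in>K. ball k (\<delta>/2))" using TC(2)[OF S] K(2) by blast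
    then obtain k where k: "k \<in> K" "dist k y < \<delta>/2" by auto
    then have "k \<in> sig S" using y by (auto simp: sig_def)
    then obtain q where q: "q \<in> T S'" "dist k q < \<delta>/2" unfolding eq by (auto simp: sig_def)
    have "dist q y \<le> dist k q + dist k y" by (rule dist_triangle3)
    then have "norm (q - y) \<le> \<delta>" using k q by (simp add: dist_norm)
    then show "\<exists>q\<in>T S'. norm (q - y) \<le> \<delta>" using q by blast
  qed
  have key: "ambient_isotopic S S'" if S: "S \<in> ?C" "S' \<in> ?C" "sig S = sig S'" for S S'
  proof -
    have 1: "ambient_isotopic (T S) (T S')"
      by (rule iso'[OF TC(1)[OF S(1)] TC(1)[OF S(2)] TC(2)[OF S(1)] near[OF S(1,3)] near[OF S(2) S(3)[symmetric]]])
    have "(\<lambda>x. x + b S) ` T S = S" by (simp add: T_def image_image)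
    then have 2: "ambient_isotopic S (T S)" using ambient_isotopic_translation[of "b S" "T S"] by simp
    have 3: "ambient_isotopic (T S') S'" unfolding T_def by (rule ambient_isotopic_translation)
    show ?thesis by (rule ambient_isotopic_trans[OF 2 ambient_isotopic_trans[OF 1 3]])
  qed
  \<comment> \<open>One member of the class for each signature that occurs, as the representatives
    themselves must be admissible.\<close>
  define rep where "rep v = (SOME S. S \<in> ?C \<and> sig S = v)" for v
  have rep: "rep (sig S) \<in> ?C \<and> sig (rep (sig S)) = sig S" if "S \<in> ?C" for S
    unfolding rep_def by (rule someI[of "\<lambda>S'. S' \<in> ?C \<and> sig S' = sig S" S]) (use that in simp)
  define R where "R = rep ` sig ` ?C"
  have "sig ` ?C \<subseteq> Pow K" by (auto simp: sig_def)
  then have "finite R" unfolding R_def using K(1) by (meson finite_Pow_iff finite_imageI finite_subset)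
  moreover have "R \<subseteq> ?C" using rep by (auto simp: R_def)
  moreover have "\<forall>\<Sigma>\<in>?C. \<exists>\<Sigma>'\<in>R. ambient_isotopic \<Sigma> \<Sigma>'"
  proof
    fix \<Sigma> assume S: "\<Sigma> \<in> ?C"
    have "rep (sig \<Sigma>) \<in> R" using S by (auto simp: R_def)
    moreover have "ambient_isotopic \<Sigma> (rep (sig \<Sigma>))" using rep[OF S] by (intro key[OF S]) auto
    ultimately show "\<exists>\<Sigma>'\<in>R. ambient_isotopic \<Sigma> \<Sigma>'" by blast
  qed
  ultimately show ?thesis by blast
qed

end
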